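(* Let $D\geqslant 10$, and let $x,y\geqslant 100$ be real numbers satisfying $$ y \geqslant \exp\left( \frac{60(D+1)}{\log 2}\cdot \frac{(\log \log x)^{2}}{\log \log \log x}\right). $$ Then $$ \left|N_a(x)-A\pi(x)\right|\leqslant \frac{\pi(x)}{(\log x)^D} $$ holds for all but $O_D\left(y/(\log x)^{D}\right)$ integers $a\in [-y,y]$.
   Context: For an integer $a$ and real $x$, $N_a(x)=\#\{p\leqslant x\colon a \text{ is a primitive root modulo } p\}$, where $p$ runs over primes (i.e. $p\nmid a$ and the residue class of $a$ generates the multiplicative group $(\mathbb{Z}/p\mathbb{Z})^\times$). $\pi(x)$ denotes the number of primes $p\leqslant x$. $A=\prod_{\ell}\left(1-\frac{1}{\ell(\ell-1)}\right)$ is Artin's constant, the product running over all primes $\ell$. The notation $O_D(V)$ denotes a quantity bounded in absolute value by $cV$ with $c>0$ a constant depending only on $D$. *)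

theory Defs
  imports "HOL-Analysis.Analysis" "HOL-Number_Theory.Number_Theory"
begin

definition is_primroot_mod :: "nat \<Rightarrow> int \<Rightarrow> bool" where
  "is_primroot_mod p a \<longleftrightarrow> residue_primroot p (nat (a mod int p))"

definition N_artin :: "int \<Rightarrow> real \<Rightarrow> nat" where
  "N_artin a x = card {p::nat. prime p \<and> real p \<le> x \<and> is_primroot_mod p a}"

definition prime_pi :: "real \<Rightarrow> nat" where
  "prime_pi x = card {p::nat. prime p \<and> real p \<le> x}"

definition artin_const :: real where
  "artin_const = lim (\<lambda>n. \<Prod>l\<in>{l::nat. prime l \<and> l \<le> n}. (1 - 1 / (real l * (real l - 1))))"

end

theory Submission
 imports Defs "HOL-Complex_Analysis.Complex_Analysis" "HOL-Probability.Probability" "HOL-Real_Asymp.Real_Asymp"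
begin

text \<open>
The main term follows from writing \<open>\<phi>(p-1)/(p-1)\<close> as a sum over the squarefree divisors of \<open>p-1\<close> and applying the
Siegel--Walfisz theorem modulo squarefree numbers. For the deviation, the indicator of primitive roots modulo \<open>p\<close> is expanded
in characters; as characters of different pairs \<open>(p,h)\<close> are almost orthogonal, a large sieve inequality bounds their sums on average.
For \<open>y < x^4\<close> one only averages over \<open>a = s r\<close> with a large factor \<open>r\<close> free of primes below \<open>z = (ln x)^20\<close>: a high
moment of the sum over \<open>r\<close> has few repeated products, which makes the large sieve efficient. The remaining \<open>a\<close> are nearly
\<open>z\<close>-smooth, and Rankin's method bounds their number; this is where the lower bound on \<open>y\<close> is needed.

The Siegel--Walfisz theorem is obtained without zero-free regions: the inequality of de la Vallee Poussin and Siegel's theorem give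
lower bounds \<open>L(s) \<ge> M^(-e)\<close> near \<open>Re s = 1\<close>, hence bounds for all derivatives of \<open>L'/L\<close> to the right of that line;
high logarithmic weights and Gaussian smoothing then turn these into bounds for sums over primes.
\<close>

subsection \<open>Residue characters\<close>

text \<open>Two obstacles shape the proof. Moduli as large as any fixed power of L = ln x must be
  treated without a zero-free region. On Re s = 1 + 1/L the k-th derivative of L'/L is trivially of
  order L^(k+1), whereas a lower bound L(s) >= M^(-e), M = q (2 + |Im s|), replaces this by M^e0
  with e0 as small as desired. Weighting by (ln n)^k therefore gains nearly L^k, while undoing the
  smoothing costs a power of L independent of k. Only squarefree moduli occur, so characters are
  products over distinct primes, and a real primitive one is determined by its set of primes;
  products of two distinct ones are then visibly nonprincipal, as Siegel's theorem demands. The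
  second obstacle is a short range of a. Distinct characters are orthogonal up to x^2 and there are
  up to x^2 of them, so the large sieve is efficient only for sums of length x^4. The k-th power of
  a sum of length N has this length once N^k >= x^4, at the price of the number of ways to write an
  integer as a product of k factors; for rough factors this number is at most x^(9/20).\<close>

definition dchar :: "nat => (nat => complex) => bool" where
 "dchar q \<xi> \<longleftrightarrow> q > 0 \<and> \<xi> 1 = 1 \<and> (\<forall>m n. \<xi> (m * n) = \<xi> m * \<xi> n) \<and>
   (\<forall>n. \<xi> (n + q) = \<xi> n) \<and> (\<forall>n. \<not> coprime n q \<longrightarrow> \<xi> n = 0)"

text \<open>Characters are functions on the naturals, and being nonprincipal refers to a modulus
  that may exceed the conductor. Products of characters to different moduli are then pointwise
  products to the modulus \<open>q * r\<close>.\<close>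

definition nonprincipal :: "nat => (nat => complex) => bool" where
 "nonprincipal q \<xi> \<longleftrightarrow> dchar q \<xi> \<and> (\<exists>a. coprime a q \<and> \<xi> a \<noteq> 1)"

lemma dcharD:
 assumes "dchar q \<xi>"
 shows "q > 0" "\<xi> 1 = 1" "\<xi> (m * n) = \<xi> m * \<xi> n" "\<xi> (n + q) = \<xi> n"
  "\<not> coprime n q ==> \<xi> n = 0"
 using assms unfolding dchar_def by auto

lemma nonprincipal_dchar: "nonprincipal q \<xi> ==> dchar q \<xi>"
 by (simp add: nonprincipal_def)

lemma periodic_mod:
 assumes "\<And>n. f (n + q) = f n"
 shows "f (n mod q) = f (n::nat)"
proof -
 have "f (m + k * q) = f m" for m k
 proof (induction k)
  case (Suc k)
  have "m + Suc k * q = (m + k * q) + q" by simp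
  then show ?case using Suc assms by metis
 qed simp
 from this[of "n mod q" "n div q"] show ?thesis by simp
qed

lemma dchar_mod: "dchar q \<xi> ==> \<xi> (n mod q) = \<xi> n"
 by (rule periodic_mod) (rule dcharD(4))

lemmas nat_cong_def = unique_euclidean_semiring_class.cong_def

lemma dchar_cong: "dchar q \<xi> ==> [m = n] (mod q) ==> \<xi> m = \<xi> n"
 by (metis dchar_mod nat_cong_def)

lemma dchar_power: "dchar q \<xi> ==> \<xi> (n ^ k) = \<xi> n ^ k"
 by (induction k) (use dcharD(2) in \<open>auto simp: dcharD(3)\<close>)

lemma dchar_norm_coprime:
 assumes "dchar q \<xi>" "coprime n q"
 shows "norm (\<xi> n) = 1"
proof -
 have "\<xi> n ^ totient q = \<xi> (n ^ totient q)" using assms by (simp add: dchar_power)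
 also have "... = \<xi> 1" by (rule dchar_cong[OF assms(1)]) (rule euler_theorem[OF assms(2)])
 finally have "norm (\<xi> n) ^ totient q = 1"
  by (metis assms(1) dcharD(2) norm_one norm_power)
 moreover have "totient q > 0" using dcharD(1)[OF assms(1)] by simp
 ultimately show ?thesis using power_eq_imp_eq_base[of "norm (\<xi> n)" "totient q" 1] by simp
qed

lemma dchar_norm_cases:
 assumes "dchar q \<xi>"
 shows "norm (\<xi> n) = 1 \<or> \<xi> n = 0"
 using dchar_norm_coprime[OF assms, of n] dcharD(5)[OF assms, of n] by blast

lemma dchar_norm_le: "dchar q \<xi> ==> norm (\<xi> n) <= 1"
 using dchar_norm_cases[of q \<xi> n] by auto

lemma nonprincipal_sum_period:
 assumes "nonprincipal q \<xi>"
 shows "(\<Sum>n<q. \<xi> n) = 0"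
proof -
 from assms obtain a where d: "dchar q \<xi>" and a: "coprime a q" "\<xi> a \<noteq> 1"
  by (auto simp: nonprincipal_def)
 have q: "q > 0" using dcharD(1)[OF d] .
 have inj: "inj_on (%n. (a * n) mod q) {..<q}"
 proof (rule inj_onI)
  fix m n assume mn: "m \<in> {..<q}" "n \<in> {..<q}" and "(a * m) mod q = (a * n) mod q"
  then have "[a * m = a * n] (mod q)" by (simp add: nat_cong_def)
  then have "[m = n] (mod q)" using a(1) by (simp add: cong_mult_lcancel_nat)
  then show "m = n" using mn by (simp add: nat_cong_def)
 qed
 moreover have "(%n. (a * n) mod q) ` {..<q} \<subseteq> {..<q}" using q by auto
 ultimately have "bij_betw (%n. (a * n) mod q) {..<q} {..<q}"
  by (simp add: bij_betw_def endo_inj_surj)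
 then have "(\<Sum>n<q. \<xi> n) = (\<Sum>n<q. \<xi> ((a * n) mod q))"
  by (rule sum.reindex_bij_betw[symmetric])
 also have "... = \<xi> a * (\<Sum>n<q. \<xi> n)"
  by (simp add: dchar_mod[OF d] dcharD(3)[OF d] sum_distrib_left)
 finally show ?thesis using a(2) by simp
qed

text \<open>Full periods contribute nothing, so fewer than q terms of size at most 1 remain. This
  trivial bound serves the continuation of L-functions and, with q <= x^2, the near orthogonality in
  the large sieve.\<close>

lemma periodic_sum_bound:
 fixes f :: "nat => complex"
 assumes per: "\<And>n. f (n + q) = f n" and zero: "(\<Sum>n<q. f n) = 0"
  and le: "\<And>n. norm (f n) <= 1" and q: "q > 0"
 shows "norm (\<Sum>n<N. f n) <= q"
proof (induction N rule: less_induct)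
 case (less N)
 show ?case
 proof (cases "N < q")
  case True
  have "norm (\<Sum>n<N. f n) <= (\<Sum>n<N. 1)" by (intro sum_norm_le le)
  also have "... <= q" using True by simp
  finally show ?thesis .
 next
  case False
  define N' where "N' = N - q"
  have N: "N = q + N'" using False by (simp add: N'_def)
  have "(\<Sum>n<N. f n) = (\<Sum>n<q. f n) + (\<Sum>n=q..<q+N'. f n)"
   unfolding N lessThan_atLeast0 by (rule sum.atLeastLessThan_concat[symmetric]) auto
  also have "(\<Sum>n=q..<q+N'. f n) = (\<Sum>n<N'. f n)"
   using sum.shift_bounds_nat_ivl[of f 0 q N'] per
   by (simp add: lessThan_atLeast0 add.commute)
  finally have "(\<Sum>n<N. f n) = (\<Sum>n<N'. f n)" using zero by simp
  moreover have "norm (\<Sum>n<N'. f n) <= q" using less.IH[of N'] N q by simp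
  ultimately show ?thesis by simp
 qed
qed

lemma periodic_sum_bound1:
 fixes f :: "nat => complex"
 assumes per: "\<And>n. f (n + q) = f n" and zero: "(\<Sum>n<q. f n) = 0"
  and le: "\<And>n. norm (f n) <= 1" and q: "q > 0"
 shows "norm (\<Sum>n=1..N. f n) <= q"
proof -
 have "norm (\<Sum>n<N. f (Suc n)) <= q"
 proof (rule periodic_sum_bound)
  show "f (Suc (n + q)) = f (Suc n)" for n using per[of "Suc n"] by simp
  have "f 0 + (\<Sum>n<q. f (Suc n)) = (\<Sum>n<q. f n) + f q"
   by (metis sum.lessThan_Suc sum.lessThan_Suc_shift)
  then show "(\<Sum>n<q. f (Suc n)) = 0" using zero per[of 0] by simp
 qed (use le q in auto)
 also have "(\<Sum>n<N. f (Suc n)) = (\<Sum>n=1..N. f n)"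
  by (rule sum.reindex_bij_witness[of _ "%n. n - 1" Suc]) auto
 finally show ?thesis .
qed

lemma nonprincipal_sum_bound:
 assumes "nonprincipal q \<xi>"
 shows "norm (\<Sum>n=1..N. \<xi> n) <= q"
 using assms nonprincipal_sum_period[OF assms]
 by (intro periodic_sum_bound1) (auto dest!: nonprincipal_dchar simp: dcharD dchar_norm_le)

lemma dchar_mult:
 assumes "dchar q \<xi>" "dchar r \<psi>"
 shows "dchar (q * r) (%n. \<xi> n * \<psi> n)"
proof -
 have "\<xi> (n + q * r) = \<xi> n" for n
  by (rule dchar_cong[OF assms(1)]) (simp add: nat_cong_def)
 moreover have "\<psi> (n + q * r) = \<psi> n" for n
  by (rule dchar_cong[OF assms(2)]) (simp add: nat_cong_def)
 ultimately show ?thesis using assms unfolding dchar_def by auto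
qed

lemma dchar_cnj: "dchar q \<xi> ==> dchar q (%n. cnj (\<xi> n))"
 unfolding dchar_def by auto

subsection \<open>Dirichlet series\<close>

text \<open>The index 0 is harmless: \<open>0 powr s\<close> is 0 for every s, so the coefficient
  \<open>a 0\<close> never enters.\<close>

definition dser :: "(nat => complex) => complex => complex" where
 "dser a s = (\<Sum>n. a n * of_nat n powr (-s))"

abbreviation zeta_dser :: "complex => complex" where "zeta_dser \<equiv> dser (%_. 1)"

text \<open>Absolute convergence for every real exponent above 1. The class is closed under
  multiplication by ln n, so derivatives of a Dirichlet series stay in it.\<close>

definition subpoly :: "(nat => complex) => bool" where
 "subpoly a \<longleftrightarrow> (\<forall>e>0. summable (%n. norm (a n) * real n powr (-1-e)))"

lemma norm_nat_powr: "norm (of_nat n powr s :: complex) = real n powr Re s"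
 by (cases "n = 0") (auto simp: norm_powr_real_powr)

lemma norm_dterm: "norm (a n * of_nat n powr (-s)) = norm (a n) * real n powr (- Re s)"
 by (simp add: norm_mult norm_nat_powr)

lemma subpoly_summable_norm:
 assumes "subpoly a" "Re s > 1"
 shows "summable (%n. norm (a n * of_nat n powr (-s)))"
proof -
 have "summable (%n. norm (a n) * real n powr (-1-(Re s - 1)))"
  using assms unfolding subpoly_def by (metis diff_gt_0_iff_gt)
 moreover have "-1 - (Re s - 1) = - Re s" by simp
 ultimately show ?thesis by (simp only: norm_dterm)
qed

lemma subpoly_summable:
 "subpoly a ==> Re s > 1 ==> summable (%n. a n * of_nat n powr (-s))"
 by (rule summable_norm_cancel) (rule subpoly_summable_norm)

lemma subpoly_bounded:
 assumes "\<And>n. norm (a n) <= C"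
 shows "subpoly a"
 unfolding subpoly_def
proof (intro allI impI)
 fix e :: real assume "e > 0"
 then have "summable (%n. real n powr (-1-e))" by (simp add: summable_real_powr_iff)
 then have "summable (%n. C * real n powr (-1-e))" by (rule summable_mult)
 then show "summable (%n. norm (a n) * real n powr (-1-e))"
  by (rule summable_comparison_test') (auto intro!: mult_right_mono assms)
qed

lemma subpoly_mono:
 assumes "subpoly b" "\<And>n. norm (a n) <= norm (b n)"
 shows "subpoly a"
 unfolding subpoly_def
proof (intro allI impI)
 fix e :: real assume "e > 0"
 then have "summable (%n. norm (b n) * real n powr (-1-e))" using assms by (simp add: subpoly_def)
 then show "summable (%n. norm (a n) * real n powr (-1-e))"
  by (rule summable_comparison_test') (auto intro!: mult_right_mono assms)
qed

lemma subpoly_ln: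
 assumes "subpoly a"
 shows "subpoly (%n. of_real (ln (real n)) * a n)"
 unfolding subpoly_def
proof (intro allI impI)
 fix e :: real assume e: "e > 0"
 then have "summable (%n. norm (a n) * real n powr (-1-e/2))"
  using assms unfolding subpoly_def by (metis half_gt_zero)
 then have "summable (%n. (2/e) * (norm (a n) * real n powr (-1-e/2)))" by (rule summable_mult)
 then show "summable (%n. norm (of_real (ln (real n)) * a n) * real n powr (-1-e))"
 proof (rule summable_comparison_test'[where N = 0])
  fix n :: nat
  show "norm (norm (of_real (ln (real n)) * a n) * real n powr (-1-e)) <= (2/e) * (norm (a n) * real n powr (-1-e/2))"
  proof (cases "n = 0")
   case False
   then have n: "real n >= 1" by simp
   have "\<bar>ln (real n)\<bar> <= real n powr (e/2) / (e/2)" using ln_powr_bound[OF n, of "e/2"] e n by simp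
   then have "\<bar>ln (real n)\<bar> * (norm (a n) * real n powr (-1-e)) <= real n powr (e/2) / (e/2) * (norm (a n) * real n powr (-1-e))"
    by (rule mult_right_mono) simp
   also have "... = (2/e) * (norm (a n) * (real n powr (e/2) * real n powr (-1-e)))" by simp
   also have "real n powr (e/2) * real n powr (-1-e) = real n powr (-1-e/2)"
    by (subst powr_add[symmetric]) (rule arg_cong[where f = "%z. real n powr z"], simp add: field_simps)
   finally show ?thesis by (simp add: norm_mult mult_ac)
  qed simp
 qed
qed

lemma subpoly_uminus: "subpoly a ==> subpoly (%n. - a n)"
 by (simp add: subpoly_def)

lemma dser_deriv:
 assumes a: "subpoly a" and s: "Re s > 1"
 shows "(dser a has_field_derivative dser (%n. - of_real (ln (real n)) * a n) s) (at s)"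
proof -
 define c where "c = (1 + Re s) / 2"
 have c: "c > 1" "c < Re s" using s by (auto simp: c_def)
 have sp: "subpoly (%n. - of_real (ln (real n)) * a n)"
  using subpoly_uminus[OF subpoly_ln[OF a]] by simp
 show ?thesis unfolding dser_def
 proof (rule has_field_derivative_series'(2)[of "{z. Re z > c}" _ _ s])
  show "convex {z. Re z > c}" by (rule convex_halfspace_Re_gt)
  show "((%s. a n * of_nat n powr - s) has_field_derivative - of_real (ln (real n)) * a n * of_nat n powr - z) (at z within {z. Re z > c})"
   for n z
  proof (cases "n = 0")
   case False
   have "((%s. of_nat n powr - s) has_field_derivative (- of_real (ln (real n))) * of_nat n powr - z) (at z within {z. Re z > c})"
    unfolding powr_def using False by (auto intro!: derivative_eq_intros)
   from DERIV_cmult[OF this, of "a n"] show ?thesis by (simp add: mult_ac)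
  qed simp
  show "uniformly_convergent_on {z. Re z > c} (%n z. \<Sum>i<n. - of_real (ln (real i)) * a i * of_nat i powr - z)"
  proof (rule Weierstrass_m_test')
   show "summable (%n. norm (- of_real (ln (real n)) * a n * of_nat n powr (- of_real c)))"
    using subpoly_summable_norm[OF sp, of "of_real c"] c by simp
   show "norm (- of_real (ln (real n)) * a n * of_nat n powr - z) <= norm (- of_real (ln (real n)) * a n * of_nat n powr (- of_real c))"
    if "z \<in> {z. Re z > c}" for n z
   proof (cases "n = 0")
    case False
    have "real n powr (- Re z) <= real n powr (- c)" using that False by (intro powr_mono) auto
    then show ?thesis by (simp add: norm_mult norm_nat_powr mult_left_mono)
   qed simp
  qed
  show "summable (%n. a n * of_nat n powr - s)" by (rule subpoly_summable[OF a s])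
  show "s \<in> interior {z. c < Re z}" using c open_halfspace_Re_gt[of c] by (simp add: interior_open)
 qed (use c in auto)
qed

lemma open_Re_gt: "open {s. Re s > c}" by (rule open_halfspace_Re_gt)

lemma dser_holomorphic:
 "subpoly a ==> dser a holomorphic_on {s. Re s > 1}"
 by (subst holomorphic_on_open[OF open_Re_gt]) (use dser_deriv in blast)

lemma subpoly_ln_power:
 assumes "subpoly a"
 shows "subpoly (%n. (- of_real (ln (real n))) ^ k * a n)"
proof (induction k)
 case (Suc k)
 show ?case using subpoly_uminus[OF subpoly_ln[OF Suc]] by (simp add: mult_ac)
qed (use assms in simp)

lemma dser_higher_deriv:
 assumes "subpoly a" "Re s > 1"
 shows "(deriv ^^ k) (dser a) s = dser (%n. (- of_real (ln (real n))) ^ k * a n) s"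
 using assms(2)
proof (induction k arbitrary: s)
 case (Suc k)
 have "(deriv ^^ Suc k) (dser a) s = deriv ((deriv ^^ k) (dser a)) s" by simp
 also have "... = deriv (dser (%n. (- of_real (ln (real n))) ^ k * a n)) s"
 proof (rule deriv_cong_ev)
  have "\<forall>\<^sub>F z in nhds s. z \<in> {z. Re z > 1}"
   using Suc.prems by (intro eventually_nhds_in_open open_Re_gt) auto
  then show "\<forall>\<^sub>F z in nhds s. (deriv ^^ k) (dser a) z = dser (%n. (- of_real (ln (real n))) ^ k * a n) z"
   by eventually_elim (use Suc.IH in simp)
 qed simp
 also have "... = dser (%n. - of_real (ln (real n)) * ((- of_real (ln (real n))) ^ k * a n)) s"
  by (rule DERIV_imp_deriv) (rule dser_deriv[OF subpoly_ln_power[OF assms(1)] Suc.prems])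
 finally show ?case by (simp add: mult_ac)
qed simp

lemma dser_eq_infsum:
 assumes "subpoly a" "Re s > 1"
 shows "((%n. a n * of_nat n powr (-s)) has_sum dser a s) {1..}"
proof -
 have "((%n. a n * of_nat n powr (-s)) has_sum dser a s) UNIV"
  unfolding dser_def
  by (rule norm_summable_imp_has_sum[OF subpoly_summable_norm[OF assms]])
    (use subpoly_summable[OF assms] in \<open>simp add: summable_sums\<close>)
 then show ?thesis
  by (subst (asm) has_sum_cong_neutral[where T = "{1..}" and g = "%n. a n * of_nat n powr (-s)"]) (auto simp: not_less_eq_eq Suc_le_eq)
qed

lemma dser_abs_summable_on:
 assumes "subpoly a" "Re s > 1"
 shows "(%n. norm (a n * of_nat n powr (-s))) summable_on {1..}"
proof -
 have "(%n. norm (a n * of_nat n powr (-s))) summable_on UNIV"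
  using subpoly_summable_norm[OF assms] by (simp add: summable_on_UNIV_nonneg_real_iff)
 then show ?thesis by (rule summable_on_subset) auto
qed

text \<open>Absolute convergence allows the double sum to be regrouped by the product; the bijection
  is (m, n) -> (m n, n), so the second variable becomes the divisor.\<close>

lemma dser_mult:
 assumes a: "subpoly a" and b: "subpoly b" and s: "Re s > 1"
  and c: "subpoly c" and conv: "\<And>n. n > 0 ==> c n = (\<Sum>d | d dvd n. a (n div d) * b d)"
 shows "dser a s * dser b s = dser c s"
proof -
 define A where "A = {1::nat..}"
 define u where "u = (%n. a n * of_nat n powr (-s))"
 define v where "v = (%n. b n * of_nat n powr (-s))"
 have dv: "Suc 0 <= n div d" "Suc 0 <= d" if "d dvd n" "Suc 0 <= n" for n d :: nat
  using that by (auto simp: Suc_le_eq div_greater_zero_iff dvd_imp_le dvd_pos_nat)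
 have S: "(%(m,n). u m * v n) summable_on A \<times> A"
 proof (rule abs_summable_summable)
  have "(%(m,n). norm (u m) * norm (v n)) summable_on A \<times> A"
  proof (rule summable_on_SigmaI)
   show "((%y. case (x, y) of (m, n) => norm (u m) * norm (v n)) has_sum (norm (u x) * infsum (%n. norm (v n)) A)) A" for x
    using dser_abs_summable_on[OF b s] unfolding v_def A_def by (auto intro!: has_sum_cmult_right)
   show "(%x. norm (u x) * infsum (%n. norm (v n)) A) summable_on A"
    using dser_abs_summable_on[OF a s] unfolding u_def A_def by (rule summable_on_cmult_left)
  qed auto
  then show "(%p. norm ((%(m,n). u m * v n) p)) summable_on A \<times> A"
   by (simp add: case_prod_unfold norm_mult)
 qed
 have eq1: "infsum (%(m,n). u m * v n) (A \<times> A) = infsum (%(m,d). u (m div d) * v d) (SIGMA n:A. {d. d dvd n})"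
  by (rule infsum_reindex_bij_witness[where j = "%(m,n). (m * n, n)" and i = "%(n,d). (n div d, d)"])
    (use dv in \<open>auto simp: A_def\<close>)
 have S2: "(%(m,d). u (m div d) * v d) summable_on (SIGMA n:A. {d. d dvd n})"
  by (rule iffD1[OF summable_on_reindex_bij_witness[where j = "%(m,n). (m * n, n)" and i = "%(n,d). (n div d, d)"] S])
    (use dv in \<open>auto simp: A_def\<close>)
 have "dser a s * dser b s = infsum u A * infsum v A"
  using dser_eq_infsum[OF a s] dser_eq_infsum[OF b s] by (simp add: u_def v_def A_def infsumI)
 also have "... = infsum (%m. infsum (%n. u m * v n) A) A"
  by (simp add: infsum_cmult_right' infsum_cmult_left')
 also have "... = infsum (%(m,n). u m * v n) (A \<times> A)"
  by (rule infsum_Sigma'_banach) (rule S)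
 also have "... = infsum (%(m,d). u (m div d) * v d) (SIGMA n:A. {d. d dvd n})" by (rule eq1)
 also have "... = infsum (%n. infsum (%d. u (n div d) * v d) {d. d dvd n}) A"
  by (rule infsum_Sigma'_banach[symmetric]) (rule S2)
 also have "... = infsum (%n. c n * of_nat n powr (-s)) A"
 proof (rule infsum_cong)
  fix n assume "n \<in> A"
  then have n: "n > 0" by (simp add: A_def Suc_le_eq)
  have "infsum (%d. u (n div d) * v d) {d. d dvd n} = (\<Sum>d | d dvd n. u (n div d) * v d)"
   using n by simp
  also have "... = (\<Sum>d | d dvd n. a (n div d) * b d * of_nat n powr (-s))"
  proof (rule sum.cong[OF refl])
   fix d assume d: "d \<in> {d. d dvd n}"
   have "(of_nat n :: complex) = of_nat (n div d) * of_nat d" using d by (metis of_nat_mult dvd_div_mult_self mem_Collect_eq)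
   then have "(of_nat n powr (-s) :: complex) = of_nat (n div d) powr (-s) * of_nat d powr (-s)"
    by (simp add: powr_times_real)
   then show "u (n div d) * v d = a (n div d) * b d * of_nat n powr (-s)" by (simp add: u_def v_def)
  qed
  also have "... = c n * of_nat n powr (-s)" using conv[OF n] by (simp add: sum_distrib_right)
  finally show "infsum (%d. u (n div d) * v d) {d. d dvd n} = c n * of_nat n powr (-s)" .
 qed
 also have "... = dser c s" using dser_eq_infsum[OF c s] by (simp add: A_def infsumI)
 finally show ?thesis .
qed

section \<open>Completely multiplicative functions and their logarithmic derivatives\<close>

definition cmult :: "(nat => complex) => bool" where
 "cmult f \<longleftrightarrow> f 1 = 1 \<and> (\<forall>m n. f (m * n) = f m * f n) \<and> (\<forall>n. norm (f n) = 1 \<or> f n = 0)"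

lemma dchar_cmult: "dchar q \<xi> ==> cmult \<xi>"
 unfolding cmult_def using dchar_norm_cases by (auto simp: dcharD(3) dest: dcharD(2))

lemma cmult_one: "cmult (%_. 1)" by (simp add: cmult_def)

lemma cmult_norm_le: "cmult f ==> norm (f n) <= 1"
 unfolding cmult_def by (metis norm_zero zero_le_one order_refl)

lemma cmult_subpoly: "cmult f ==> subpoly f"
 by (rule subpoly_bounded[of _ 1]) (rule cmult_norm_le)

lemma cmult_mangoldt_subpoly:
 assumes "cmult f"
 shows "subpoly (%n. f n * mangoldt n)"
proof (rule subpoly_mono[OF subpoly_ln[OF cmult_subpoly[OF cmult_one]]])
 fix n
 have "norm (f n) * mangoldt n <= 1 * ln (real n)" if "n > 0"
  using that by (intro mult_mono cmult_norm_le[OF assms] mangoldt_le mangoldt_nonneg) auto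
 then show "norm (f n * mangoldt n) <= norm (complex_of_real (ln (real n)) * 1)"
  by (cases "n = 0") (auto simp: norm_mult)
qed

text \<open>ln is the convolution of 1 and \<Lambda>; multiplying by a completely multiplicative f
  keeps this a convolution, of f and f \<Lambda>.\<close>

lemma cmult_log_deriv:
 assumes f: "cmult f" and s: "Re s > 1"
 shows "deriv (dser f) s = - dser (%n. f n * mangoldt n) s * dser f s"
proof -
 have "dser f s * dser (%n. f n * mangoldt n) s = dser (%n. of_real (ln (real n)) * f n) s"
 proof (rule dser_mult[OF cmult_subpoly[OF f] cmult_mangoldt_subpoly[OF f] s subpoly_ln[OF cmult_subpoly[OF f]]])
  fix n :: nat assume n: "n > 0"
  have "(\<Sum>d | d dvd n. f (n div d) * (f d * mangoldt d)) = (\<Sum>d | d dvd n. f n * mangoldt d)"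
  proof (rule sum.cong[OF refl])
   fix d assume "d \<in> {d. d dvd n}"
   then have "f n = f (n div d) * f d" using f unfolding cmult_def by (metis dvd_div_mult_self mem_Collect_eq)
   then show "f (n div d) * (f d * mangoldt d) = f n * mangoldt d" by simp
  qed
  also have "... = f n * of_real (ln (real n))"
   using mangoldt_sum[of n, where 'a = complex] n by (simp add: sum_distrib_left[symmetric])
  finally show "of_real (ln (real n)) * f n = (\<Sum>d | d dvd n. f (n div d) * (f d * mangoldt d))" by (simp add: mult.commute)
 qed
 moreover have "deriv (dser f) s = dser (%n. - of_real (ln (real n)) * f n) s"
  by (rule DERIV_imp_deriv) (rule dser_deriv[OF cmult_subpoly[OF f] s])
 moreover have "... = - dser (%n. of_real (ln (real n)) * f n) s"
  unfolding dser_def using subpoly_summable[OF subpoly_ln[OF cmult_subpoly[OF f]] s]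
  by (subst suminf_minus[symmetric]) auto
 ultimately show ?thesis by (simp add: mult.commute)
qed

section \<open>Elementary bounds for powers and for tails of power series in n\<close>

lemma powr_lipschitz:
 fixes s :: complex
 assumes "a > 0" "u >= a" "v >= a" "Re s >= -1"
 shows "norm (of_real u powr (-s) - of_real v powr (-s)) <= norm s * a powr (- Re s - 1) * \<bar>u - v\<bar>"
proof -
 define S where "S = {z. Im z = 0 \<and> Re z >= a}"
 have "norm (of_real u powr (-s) - of_real v powr (-s)) <= norm s * a powr (- Re s - 1) * norm (of_real u - of_real v :: complex)"
 proof (rule field_differentiable_bound[of S])
  show "convex S"
   unfolding S_def convex_def
  proof (auto)
   fix x y :: complex and p r :: real
   assume *: "a <= Re x" "a <= Re y" "0 <= p" "0 <= r" "p + r = 1"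
   have "a = p * a + r * a" using * by (metis distrib_right mult_1)
   also have "... <= p * Re x + r * Re y" using * by (intro add_mono mult_left_mono) auto
   finally show "a <= p * Re x + r * Re y" .
  qed
  fix z assume z: "z \<in> S"
  then have zr: "z = of_real (Re z)" "Re z >= a" by (auto simp: S_def complex_eq_iff)
  have "z \<notin> \<real>\<^sub>\<le>\<^sub>0" using zr assms(1) by (auto simp: complex_nonpos_Reals_iff)
  then show "((%z. z powr - s) has_field_derivative (- s * z powr (-s - 1))) (at z within S)"
   by (rule has_field_derivative_at_within[OF has_field_derivative_powr])
  have "norm (z powr (-s-1)) = Re z powr (- Re s - 1)"
   using z zr assms(1) by (subst norm_powr_real_powr) (auto simp: complex_is_Real_iff S_def)
  also have "... <= a powr (- Re s - 1)"
   using zr assms by (intro powr_mono2') auto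
  finally show "norm (- s * z powr (-s - 1)) <= norm s * a powr (- Re s - 1)"
   by (simp add: norm_mult mult_left_mono)
 qed (use assms in \<open>auto simp: S_def\<close>)
 also have "norm (of_real u - of_real v :: complex) = \<bar>u - v\<bar>"
  by (metis norm_of_real of_real_diff)
 finally show ?thesis .
qed

text \<open>The mean value theorem bounds each term by a difference of consecutive values of n^(-a)
  / a, and these telescope.\<close>

lemma powr_tail:
 fixes a :: real
 assumes a: "a > 0" and N: "N >= 1"
 shows "summable (%n. real (n + N + 1) powr (-1-a))"
  and "(\<Sum>n. real (n + N + 1) powr (-1-a)) <= real N powr (-a) / a"
proof -
 have "(%n. real (n + N) powr (-a)) \<longlonglongrightarrow> 0" using a by real_asymp
 from telescope_sums'[OF this]
 have T: "(%n. real (n + N) powr (-a) - real (Suc n + N) powr (-a)) sums (real N powr (-a))" by simp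
 have T2: "(%n. (real (n + N) powr (-a) - real (Suc n + N) powr (-a)) / a) sums (real N powr (-a) / a)"
  by (rule sums_divide[OF T])
 have e: "-1-a = -a-1" by simp
 have le: "real (n + N + 1) powr (-1-a) <= (real (n + N) powr (-a) - real (Suc n + N) powr (-a)) / a" for n
 proof -
  have "\<exists>z. real (n+N) < z \<and> z < real (n+N+1) \<and>
   real (n+N+1) powr (-a) - real (n+N) powr (-a) = (real (n+N+1) - real (n+N)) * (-a * z powr (-a-1))"
  proof (rule MVT2)
   fix x assume x: "real (n+N) <= x"
   have "x > 0" using x N by linarith
   then show "((%x. x powr (-a)) has_real_derivative (-a * x powr (-a-1))) (at x)"
    by (auto intro!: derivative_eq_intros)
  qed auto
  then obtain z where z: "real (n+N) < z" "z < real (n+N+1)"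
   "real (n+N+1) powr (-a) - real (n+N) powr (-a) = -a * z powr (-a-1)" by auto
  have "real (n+N+1) powr (-a-1) <= z powr (-a-1)" using z N a by (intro powr_mono2') auto
  then have "a * real (n+N+1) powr (-a-1) <= a * z powr (-a-1)" using a by (intro mult_left_mono) auto
  also have "... = real (n+N) powr (-a) - real (Suc n+N) powr (-a)" using z(3) by (simp add: add_ac)
  finally have "a * real (n+N+1) powr (-1-a) <= real (n+N) powr (-a) - real (Suc n+N) powr (-a)"
   by (simp only: e)
  then show ?thesis using a by (simp add: pos_le_divide_eq mult.commute)
 qed
 show S: "summable (%n. real (n + N + 1) powr (-1-a))"
  by (rule summable_comparison_test'[OF sums_summable[OF T2]]) (use le in auto)
 show "(\<Sum>n. real (n + N + 1) powr (-1-a)) <= real N powr (-a) / a"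
  using suminf_le[OF le S sums_summable[OF T2]] sums_unique[OF T2] by simp
qed

lemma powr_full_sum:
 fixes a :: real
 assumes a: "a > 0"
 shows "(\<Sum>n. real n powr (-1-a)) <= 1 + 1 / a"
proof -
 have S: "summable (%n. real n powr (-1-a))" using a by (simp add: summable_real_powr_iff)
 have "(\<Sum>n. real n powr (-1-a)) = (\<Sum>n. real (n + 2) powr (-1-a)) + (\<Sum>n<2. real n powr (-1-a))"
  by (rule suminf_split_initial_segment[OF S])
 also have "(\<Sum>n<2. real n powr (-1-a)) = 1" by (simp add: numeral_2_eq_2)
 also have "(\<Sum>n. real (n + 2) powr (-1-a)) <= 1 / a" using powr_tail(2)[OF a, of 1] by simp
 finally show ?thesis by simp
qed

lemma harmonic_le: "N >= 1 ==> (\<Sum>n=1..N. 1 / real n) <= 1 + ln (real N)"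
proof (induction N rule: nat_induct_at_least)
 case (Suc n)
 have "1 / real (Suc n) <= ln (real (Suc n)) - ln (real n)"
 proof -
  have "ln (real n / real (Suc n)) <= real n / real (Suc n) - 1"
   using Suc.hyps by (intro ln_le_minus_one) auto
  also have "... = - (1 / real (Suc n))" by (simp add: field_simps)
  finally show ?thesis using Suc.hyps by (simp add: ln_div)
 qed
 then show ?case using Suc.IH by simp
qed simp

subsection \<open>Series analytic in the right half plane\<close>

text \<open>Serves both continuations: the partially summed L-series and the zeta function with its
  pole removed have terms of this size. The factor \<open>norm s\<close> is locally bounded, which
  gives uniform convergence on closed discs; the explicit tail allows the series to be cut at a
  chosen N.\<close>

lemma halfplane_series:
 assumes hol: "\<And>n. f n holomorphic_on {s. Re s > 0}"
  and le: "\<And>n s. Re s > 0 ==> norm (f n s) <= K * norm s * real n powr (- Re s - 1)"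
  and K: "K >= 0"
 shows "(%s. \<Sum>n. f n s) holomorphic_on {s. Re s > 0}"
  and "Re s > 0 ==> summable (%n. f n s)"
  and "Re s > 0 ==> norm (\<Sum>n. f n s) <= K * norm s * (1 + 1 / Re s)"
  and "Re s > 0 ==> N >= 1 ==> norm ((\<Sum>n. f n s) - (\<Sum>n<Suc N. f n s)) <= K * norm s * (real N powr (- Re s) / Re s)"
proof -
 show "(%s. \<Sum>n. f n s) holomorphic_on {s. Re s > 0}"
 proof (rule holomorphic_uniform_sequence[of _ "%N s. \<Sum>n<N. f n s"])
  show "open {s. Re s > 0}" by (rule open_Re_gt)
  show "(%s. \<Sum>n<N. f n s) holomorphic_on {s. Re s > 0}" for N
   by (intro holomorphic_intros hol)
  fix x assume "x \<in> {s. Re s > 0}"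
  then have x: "Re x > 0" by simp
  have re: "Re z >= Re x / 2" "norm z <= norm x + Re x / 2" if "z \<in> cball x (Re x / 2)" for z
  proof -
   have "norm (x - z) <= Re x / 2" using that by (simp add: dist_norm)
   moreover have "\<bar>Re (x - z)\<bar> <= norm (x - z)" by (rule abs_Re_le_cmod)
   ultimately show "Re z >= Re x / 2" by simp
   have "norm z <= norm x + norm (x - z)" by (metis add.commute diff_diff_eq2 diff_add_cancel norm_minus_commute norm_triangle_sub)
   with \<open>norm (x - z) <= Re x / 2\<close> show "norm z <= norm x + Re x / 2" by simp
  qed
  have "uniform_limit (cball x (Re x / 2)) (%N s. \<Sum>n<N. f n s) (%s. \<Sum>n. f n s) sequentially"
  proof (rule Weierstrass_m_test)
   show "norm (f n z) <= K * (norm x + Re x / 2) * real n powr (-1 - Re x / 2)"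
    if z: "z \<in> cball x (Re x / 2)" for n z
   proof (cases "n = 0")
    case True
    then show ?thesis using le[of z 0] re[OF z] x by simp
   next
    case False
    have "norm (f n z) <= K * norm z * real n powr (- Re z - 1)"
     using re(1)[OF z] x by (intro le) auto
    also have "... <= K * (norm x + Re x / 2) * real n powr (-1 - Re x / 2)"
     using re[OF z] K x False by (intro mult_mono powr_mono) auto
    finally show ?thesis .
   qed
   show "summable (%n. K * (norm x + Re x / 2) * real n powr (-1 - Re x / 2))"
    using x by (intro summable_mult) (simp add: summable_real_powr_iff)
  qed
  then show "\<exists>d>0. cball x d \<subseteq> {s. 0 < Re s} \<and> uniform_limit (cball x d) (%N s. \<Sum>n<N. f n s) (%s. \<Sum>n. f n s) sequentially"
   using x re(1) by (intro exI[of _ "Re x / 2"]) fastforce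
 qed
 assume s: "Re s > 0"
 have S: "summable (%n. real n powr (-1 - Re s))" using s by (simp add: summable_real_powr_iff)
 have le': "norm (f n s) <= K * norm s * real n powr (-1 - Re s)" for n
 proof -
  have "- Re s - 1 = -1 - Re s" by simp
  then show ?thesis using le[OF s, of n] by (simp only:)
 qed
 have Sn: "summable (%n. norm (f n s))"
  by (rule summable_comparison_test'[OF summable_mult[OF S, of "K * norm s"]]) (use le' in auto)
 then show "summable (%n. f n s)" by (rule summable_norm_cancel)
 have "norm (\<Sum>n. f n s) <= (\<Sum>n. K * norm s * real n powr (-1 - Re s))"
  by (rule norm_suminf_le[OF le' summable_mult[OF S]])
 also have "... = K * norm s * (\<Sum>n. real n powr (-1 - Re s))" by (rule suminf_mult[OF S])
 also have "... <= K * norm s * (1 + 1 / Re s)"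
  using powr_full_sum[OF s] K by (intro mult_left_mono) auto
 finally show "norm (\<Sum>n. f n s) <= K * norm s * (1 + 1 / Re s)" .
 assume N: "N >= 1"
 have "(\<Sum>n. f n s) - (\<Sum>n<Suc N. f n s) = (\<Sum>n. f (n + Suc N) s)"
  using suminf_split_initial_segment[OF \<open>summable (%n. f n s)\<close>, of "Suc N"] by simp
 also have "norm ... <= (\<Sum>n. K * norm s * real (n + N + 1) powr (-1 - Re s))"
 proof (rule norm_suminf_le)
  show "norm (f (n + Suc N) s) <= K * norm s * real (n + N + 1) powr (-1 - Re s)" for n
   using le'[of "n + Suc N"] by simp
 qed (rule summable_mult[OF powr_tail(1)[OF s N]])
 also have "... = K * norm s * (\<Sum>n. real (n + N + 1) powr (-1 - Re s))"
  by (rule suminf_mult[OF powr_tail(1)[OF s N]])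
 also have "... <= K * norm s * (real N powr (- Re s) / Re s)"
  using powr_tail(2)[OF s N] K by (intro mult_left_mono) auto
 finally show "norm ((\<Sum>n. f n s) - (\<Sum>n<Suc N. f n s)) <= K * norm s * (real N powr (- Re s) / Re s)" .
qed

section \<open>Continuation of L-functions to Re s > 0 by partial summation\<close>

definition Lterm :: "(nat => complex) => nat => complex => complex" where
 "Lterm f n s = (\<Sum>k=1..n. f k) * (of_nat n powr (-s) - of_nat (Suc n) powr (-s))"

text \<open>Abel summation of the Dirichlet series of f. It converges for Re s > 0 as soon as the
  partial sums of f are bounded, and is then the continued L-function.\<close>

definition Lc :: "(nat => complex) => complex => complex" where
 "Lc f s = (\<Sum>n. Lterm f n s)"

lemma norm_Lterm:
 assumes "\<And>N. norm (\<Sum>k=1..N. f k) <= q" "Re s > 0"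
 shows "norm (Lterm f n s) <= q * norm s * real n powr (- Re s - 1)"
proof (cases "n = 0")
 case False
 have q: "q >= 0" using assms(1)[of 0] by simp
 have "norm (of_real (real n) powr (-s) - of_real (real (Suc n)) powr (-s)) <= norm s * real n powr (- Re s - 1) * \<bar>real n - real (Suc n)\<bar>"
  using False assms(2) by (intro powr_lipschitz) auto
 moreover have "\<bar>real n - real (Suc n)\<bar> = 1" by simp
 ultimately have "norm (of_nat n powr (-s) - of_nat (Suc n) powr (-s) :: complex) <= norm s * real n powr (- Re s - 1)"
  by (simp only: of_real_of_nat_eq mult_1_right)
 then have "norm (\<Sum>k=1..n. f k) * norm (of_nat n powr (-s) - of_nat (Suc n) powr (-s) :: complex) <= q * (norm s * real n powr (- Re s - 1))"
  using q by (intro mult_mono assms(1)) auto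
 then show ?thesis by (simp add: Lterm_def norm_mult del: of_nat_Suc)
qed (simp add: Lterm_def)

lemma Lterm_holomorphic: "Lterm f n holomorphic_on {s. Re s > 0}"
 unfolding Lterm_def by (intro holomorphic_intros)

context
 fixes f :: "nat => complex" and q :: real
 assumes f: "\<And>N. norm (\<Sum>k=1..N. f k) <= q"
begin

lemma q_nonneg: "q >= 0" using f[of 0] by simp

lemma Lc_holomorphic: "Lc f holomorphic_on {s. Re s > 0}"
 using halfplane_series(1)[of "Lterm f" q, OF Lterm_holomorphic norm_Lterm[OF f] q_nonneg]
 unfolding Lc_def by simp

lemma Lc_summable: "Re s > 0 ==> summable (%n. Lterm f n s)"
 using halfplane_series(2)[of "Lterm f" q, OF Lterm_holomorphic norm_Lterm[OF f] q_nonneg] by simp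

lemma Lc_norm: "Re s > 0 ==> norm (Lc f s) <= q * norm s * (1 + 1 / Re s)"
 using halfplane_series(3)[of "Lterm f" q, OF Lterm_holomorphic norm_Lterm[OF f] q_nonneg]
 unfolding Lc_def by simp

lemma Lc_tail: "Re s > 0 ==> N >= 1 ==> norm (Lc f s - (\<Sum>n<Suc N. Lterm f n s)) <= q * norm s * (real N powr (- Re s) / Re s)"
 using halfplane_series(4)[of "Lterm f" q, OF Lterm_holomorphic norm_Lterm[OF f] q_nonneg]
 unfolding Lc_def by simp

lemma Lterm_sum:
 "(\<Sum>n<Suc N. Lterm f n s) = (\<Sum>n=1..N. f n * of_nat n powr (-s)) - (\<Sum>n=1..N. f n) * of_nat (Suc N) powr (-s)"
proof (induction N)
 case (Suc N)
 have "(\<Sum>n<Suc (Suc N). Lterm f n s) = (\<Sum>n<Suc N. Lterm f n s) + Lterm f (Suc N) s" by simp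
 also have "... = (\<Sum>n=1..N. f n * of_nat n powr (-s)) - (\<Sum>n=1..N. f n) * of_nat (Suc N) powr (-s) + Lterm f (Suc N) s"
  by (simp only: Suc.IH)
 also have "... = (\<Sum>n=1..Suc N. f n * of_nat n powr (-s)) - (\<Sum>n=1..Suc N. f n) * of_nat (Suc (Suc N)) powr (-s)"
  by (simp add: Lterm_def algebra_simps del: of_nat_Suc)
 finally show ?case .
qed (simp add: Lterm_def)

lemma Lc_sums:
 assumes "Re s > 0"
 shows "(%N. \<Sum>n=1..N. f n * of_nat n powr (-s)) \<longlonglongrightarrow> Lc f s"
proof -
 have "(%N. \<Sum>n<Suc N. Lterm f n s) \<longlonglongrightarrow> Lc f s"
  using summable_LIMSEQ[OF Lc_summable[OF assms]] unfolding Lc_def by (rule LIMSEQ_Suc)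
 moreover have "(%N. (\<Sum>n=1..N. f n) * of_nat (Suc N) powr (-s)) \<longlonglongrightarrow> 0"
 proof (rule Lim_null_comparison)
  show "\<forall>\<^sub>F N in sequentially. norm ((\<Sum>n=1..N. f n) * of_nat (Suc N) powr (-s)) <= q * real (Suc N) powr (- Re s)"
   by (intro always_eventually allI) (unfold norm_mult norm_nat_powr uminus_complex.sel, intro mult_right_mono f, simp)
  show "(%N. q * real (Suc N) powr (- Re s)) \<longlonglongrightarrow> 0" using assms by real_asymp
 qed
 ultimately have "(%N. (\<Sum>n<Suc N. Lterm f n s) + (\<Sum>n=1..N. f n) * of_nat (Suc N) powr (-s)) \<longlonglongrightarrow> Lc f s + 0"
  by (rule tendsto_add)
 then show ?thesis unfolding Lterm_sum by simp
qed

lemma Lc_eq_dser: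
 assumes s: "Re s > 1" and sp: "subpoly f"
 shows "Lc f s = dser f s"
proof -
 have "(%N. \<Sum>n<Suc N. f n * of_nat n powr (-s)) \<longlonglongrightarrow> dser f s"
  using summable_LIMSEQ[OF subpoly_summable[OF sp s]] unfolding dser_def by (rule LIMSEQ_Suc)
 moreover have "(\<Sum>n<Suc N. f n * of_nat n powr (-s)) = (\<Sum>n=1..N. f n * of_nat n powr (-s))" for N
  by (induction N) auto
 ultimately show ?thesis using Lc_sums[of s] s LIMSEQ_unique by fastforce
qed

text \<open>The series is cut at N close to M = q (2 + |Im s|). The terms up to N are estimated
  trivially by 2 M^e (1 + ln N); beyond N the bounded partial sums give q |s| N^(-Re s), a constant
  times M^e. Any exponent of M that tends to 0 with e is good enough for the later
  arguments.\<close>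

lemma Lc_bound:
 assumes f1: "\<And>n. norm (f n) <= 1" and e: "0 < e" "e <= 1/4" and q: "q >= 1"
  and s: "1 - e <= Re s" "Re s <= 3"
 shows "norm (Lc f s) <= (7 + 4 / e) * (q * (2 + \<bar>Im s\<bar>)) powr (2 * e)"
proof -
 define M where "M = q * (2 + \<bar>Im s\<bar>)"
 have M: "M >= 2" unfolding M_def using mult_mono[of 1 q 2 "2 + \<bar>Im s\<bar>"] q by simp
 have qM: "q <= M" unfolding M_def using q mult_left_mono[of 1 "2 + \<bar>Im s\<bar>" q] by simp
 define N where "N = nat \<lceil>M\<rceil>"
 have N: "real N >= M" "real N <= 2 * M" "N >= 1" using M unfolding N_def by linarith+
 have ns: "norm s <= 3/2 * (2 + \<bar>Im s\<bar>)"
  using cmod_le[of s] s e by simp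
 have qs: "q * norm s <= 3/2 * M" using mult_left_mono[OF ns, of q] q unfolding M_def by (simp add: mult_ac)
 have Me: "M powr e >= 1" using M e by (simp add: ge_one_powr_ge_zero)
 have MeM: "M powr e * M powr e = M powr (2 * e)" by (simp add: powr_add[symmetric])
 have "(2 * M) powr e = 2 powr e * M powr e" using M by (simp add: powr_mult)
 moreover have "2 powr e * M powr e <= 2 powr 1 * M powr e" using e by (intro mult_right_mono powr_mono) auto
 ultimately have M2: "(2 * M) powr e <= 2 * M powr e" by simp
 have lnN: "1 + ln (real N) <= (1 + 2 / e) * M powr e"
 proof -
  have "ln (real N) <= ln (2 * M)" using N M by simp
  also have "... <= (2 * M) powr e / e" using M e by (intro ln_powr_bound) auto
  also have "... <= (2 * M powr e) / e" using M2 e by (intro divide_right_mono) auto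
  finally show ?thesis using Me by (simp add: algebra_simps)
 qed
 have small: "real N powr (- Re s) <= M powr (e - 1)"
 proof -
  have "real N powr (- Re s) <= real N powr (e - 1)" using s N by (intro powr_mono) auto
  also have "... <= M powr (e - 1)" using N M e by (intro powr_mono2') auto
  finally show ?thesis .
 qed
 have MM: "M * M powr (e - 1) = M powr e" using M by (simp add: powr_diff)
 have head1: "norm (\<Sum>n=1..N. f n * of_nat n powr (-s)) <= 2 * M powr e * ((1 + 2 / e) * M powr e)"
 proof -
  have "norm (\<Sum>n=1..N. f n * of_nat n powr (-s)) <= (\<Sum>n=1..N. 2 * M powr e * (1 / real n))"
  proof (rule sum_norm_le)
   fix n assume n: "n \<in> {1..N}"
   have "norm (f n * of_nat n powr (-s)) <= 1 * real n powr (- Re s)"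
    unfolding norm_dterm by (intro mult_right_mono f1) auto
   also have "... <= real n powr (e - 1)" using n s by (auto intro!: powr_mono)
   also have "... = real n powr e * (1 / real n)" using n by (simp add: powr_diff)
   also have "... <= (2 * M) powr e * (1 / real n)"
    using n N e M by (intro mult_right_mono powr_mono2) auto
   also have "... <= 2 * M powr e * (1 / real n)" using M2 by (intro mult_right_mono) auto
   finally show "norm (f n * of_nat n powr (-s)) <= 2 * M powr e * (1 / real n)" .
  qed
  also have "... = 2 * M powr e * (\<Sum>n=1..N. 1 / real n)" by (simp add: sum_distrib_left)
  also have "... <= 2 * M powr e * ((1 + 2 / e) * M powr e)"
   using harmonic_le[OF N(3)] lnN by (intro mult_left_mono) auto
  finally show ?thesis .
 qed
 have head2: "norm ((\<Sum>n=1..N. f n) * of_nat (Suc N) powr (-s)) <= M powr e"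
 proof -
  have "norm ((\<Sum>n=1..N. f n) * of_nat (Suc N) powr (-s)) <= q * real (Suc N) powr (- Re s)"
   by (simp only: norm_mult norm_nat_powr uminus_complex.sel) (intro mult_right_mono f powr_ge_zero)
  also have "... <= M * M powr (e - 1)"
  proof (intro mult_mono)
   have "real (Suc N) powr (- Re s) <= real N powr (- Re s)" using N s e by (intro powr_mono2') auto
   then show "real (Suc N) powr (- Re s) <= M powr (e - 1)" using small by simp
  qed (use qM M in auto)
  finally show ?thesis by (simp add: MM)
 qed
 have tail: "norm (Lc f s - (\<Sum>n<Suc N. Lterm f n s)) <= 3 * M powr e"
 proof -
  have "norm (Lc f s - (\<Sum>n<Suc N. Lterm f n s)) <= (q * norm s) * (real N powr (- Re s) / Re s)"
   using Lc_tail[of s N] s e N by simp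
  also have "... <= (3/2 * M) * (M powr (e - 1) * 2)"
  proof (rule mult_mono)
   have "real N powr (- Re s) / Re s <= real N powr (- Re s) / (1/2)"
    using s e by (intro divide_left_mono) auto
   then show "real N powr (- Re s) / Re s <= M powr (e - 1) * 2" using small by simp
  qed (use qs M s e in auto)
  also have "... = 3 * (M * M powr (e - 1))" by simp
  finally show ?thesis by (simp only: MM)
 qed
 have "norm (Lc f s) <= norm (Lc f s - (\<Sum>n<Suc N. Lterm f n s)) + norm (\<Sum>n<Suc N. Lterm f n s)"
  by (metis diff_add_cancel norm_triangle_ineq)
 also have "norm (\<Sum>n<Suc N. Lterm f n s) <= norm (\<Sum>n=1..N. f n * of_nat n powr (-s)) + norm ((\<Sum>n=1..N. f n) * of_nat (Suc N) powr (-s))"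
  unfolding Lterm_sum by (rule norm_triangle_ineq4)
 also have "norm (Lc f s - (\<Sum>n<Suc N. Lterm f n s)) + (norm (\<Sum>n=1..N. f n * of_nat n powr (-s)) + norm ((\<Sum>n=1..N. f n) * of_nat (Suc N) powr (-s)))
   <= 4 * M powr e + (2 + 4 / e) * M powr (2 * e)"
  using head1 head2 tail MeM by (simp add: algebra_simps)
 also have "... <= (7 + 4 / e) * M powr (2 * e)"
 proof -
  have "M powr e <= M powr (2 * e)" using M e by (intro powr_mono) auto
  then have "4 * M powr e <= 5 * M powr (2 * e)" using powr_ge_zero[of M "2 * e"] by linarith
  then show ?thesis by (simp add: algebra_simps)
 qed
 finally show ?thesis unfolding M_def by simp
qed

end

text \<open>The holomorphic part of the zeta function: on the half plane \<open>Re s > 1\<close> the sum of the terms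
 below is \<open>\<zeta>(s) - 1/(s-1)\<close>.\<close>

definition zeta_term :: "nat => complex => complex" where
 "zeta_term n s = (if n = 0 then 0 else of_nat n powr (-s) +
   (if s = 1 then - of_real (ln (real (Suc n)) - ln (real n))
   else (of_nat (Suc n) powr (1 - s) - of_nat n powr (1 - s)) / (s - 1)))"

definition zeta0 :: "complex => complex" where
 "zeta0 s = (\<Sum>n. zeta_term n s)"

text \<open>The numerator vanishes at s = 1, and the value prescribed there is its derivative, so
  the removable singularity is filled in by \<open>pole_lemma_open\<close>.\<close>

lemma zeta_term_holomorphic: "zeta_term n holomorphic_on {s. Re s > 0}"
proof (cases "n = 0")
 case True
 then show ?thesis by (simp add: zeta_term_def[abs_def])
next
 case False
 define f where "f = (%z. of_nat (Suc n) powr (1 - z) - of_nat n powr (1 - z) :: complex)"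
 have "f holomorphic_on {s. Re s > 0}" unfolding f_def by (intro holomorphic_intros)
 from pole_lemma_open[OF this open_Re_gt, of 1]
 have "(%z. of_nat n powr (-z) + (if z = 1 then deriv f 1 else (f z - f 1) / (z - 1))) holomorphic_on {s. Re s > 0}"
  by (intro holomorphic_intros)
 moreover have d: "deriv f 1 = - of_real (ln (real (Suc n)) - ln (real n))"
  unfolding f_def using False
  by (intro DERIV_imp_deriv) (auto intro!: derivative_eq_intros simp: powr_def simp del: of_nat_Suc)
 have f1: "f 1 = 0" using False unfolding f_def by (simp del: of_nat_Suc)
 have fz: "f z = of_nat (Suc n) powr (1 - z) - of_nat n powr (1 - z)" for z by (simp add: f_def)
 have "(%z. of_nat n powr (-z) + (if z = 1 then deriv f 1 else (f z - f 1) / (z - 1))) = zeta_term n"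
  by (rule ext) (use False in \<open>simp add: zeta_term_def d f1 fz del: of_nat_Suc\<close>)
 ultimately show ?thesis by simp
qed

lemma zeta_term_aux:
 assumes "n > 0" "Re s > 0" "s \<noteq> 1"
 shows "norm ((of_nat (Suc n) powr (1 - s) - of_nat n powr (1 - s)) / (1 - s)) <= real n powr (- Re s)"
  and "norm (zeta_term n s) <= norm s * real n powr (- Re s - 1)"
proof -
 define S where "S = {z. Im z = 0 \<and> Re z >= real n \<and> Re z <= real (Suc n)}"
 have cv: "convex S"
 proof -
  have "S = of_real ` {real n..real (Suc n)}"
   unfolding S_def by (auto simp: image_iff complex_eq_iff)
  then show ?thesis by (simp add: convex_linear_image bounded_linear.linear[OF bounded_linear_of_real])
 qed
 have zr: "z = of_real (Re z)" "Re z >= real n" "Re z > 0" "Re z <= real (Suc n)" "z \<notin> \<real>\<^sub>\<le>\<^sub>0" if "z \<in> S" for z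
  using that assms(1) by (auto simp: S_def complex_eq_iff complex_nonpos_Reals_iff)
 have d: "((%z. z powr (1 - s) / (1 - s)) has_field_derivative z powr (-s)) (at z within S)" if "z \<in> S" for z
  using zr(5)[OF that] assms(3)
  by (auto intro!: derivative_eq_intros has_field_derivative_at_within[OF has_field_derivative_powr])
 have "norm (of_nat (Suc n) powr (1 - s) / (1 - s) - of_nat n powr (1 - s) / (1 - s)) <= real n powr (- Re s) * norm (of_nat (Suc n) - of_nat n :: complex)"
 proof (rule field_differentiable_bound[OF cv d])
  fix z assume z: "z \<in> S"
  have "norm (z powr (-s)) = Re z powr (- Re s)"
   using zr[OF z] by (subst norm_powr_real_powr) (auto simp: complex_is_Real_iff complex_eq_iff)
  also have "... <= real n powr (- Re s)" using zr[OF z] assms by (intro powr_mono2') auto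
  finally show "norm (z powr (-s)) <= real n powr (- Re s)" .
 qed (auto simp: S_def)
 then show "norm ((of_nat (Suc n) powr (1 - s) - of_nat n powr (1 - s)) / (1 - s)) <= real n powr (- Re s)"
  by (simp add: diff_divide_distrib)
 \<comment> \<open>The term is minus the increment over [n, n+1] of z^(1-s)/(1-s) - z n^(-s), whose
   derivative z^(-s) - n^(-s) is small by \<open>powr_lipschitz\<close>.\<close>
 have "norm ((of_nat (Suc n) powr (1 - s) / (1 - s) - of_nat (Suc n) * of_nat n powr (-s)) - (of_nat n powr (1 - s) / (1 - s) - of_nat n * of_nat n powr (-s)))
   <= (norm s * real n powr (- Re s - 1)) * norm (of_nat (Suc n) - of_nat n :: complex)"
 proof (rule field_differentiable_bound[OF cv, where f = "%z. z powr (1 - s) / (1 - s) - z * of_nat n powr (-s)"])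
  fix z assume z: "z \<in> S"
  show "((%z. z powr (1 - s) / (1 - s) - z * of_nat n powr (-s)) has_field_derivative (z powr (-s) - of_nat n powr (-s))) (at z within S)"
   by (rule derivative_eq_intros d[OF z] refl | simp)+
  have "norm (of_real (Re z) powr (-s) - of_real (real n) powr (-s)) <= norm s * real n powr (- Re s - 1) * \<bar>Re z - real n\<bar>"
   using zr[OF z] assms by (intro powr_lipschitz) auto
  also have "... <= norm s * real n powr (- Re s - 1) * 1"
   using zr[OF z] by (intro mult_left_mono) auto
  finally show "norm (z powr (-s) - of_nat n powr (-s)) <= norm s * real n powr (- Re s - 1)"
   using zr(1)[OF z] by simp
 qed (auto simp: S_def)
 moreover have "norm ((of_nat (Suc n) powr (1 - s) / (1 - s) - of_nat (Suc n) * of_nat n powr (-s)) - (of_nat n powr (1 - s) / (1 - s) - of_nat n * of_nat n powr (-s))) = norm (zeta_term n s)"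
 proof -
  have "zeta_term n s = - ((of_nat (Suc n) powr (1 - s) / (1 - s) - of_nat (Suc n) * of_nat n powr (-s)) - (of_nat n powr (1 - s) / (1 - s) - of_nat n * of_nat n powr (-s)))"
   using assms by (simp add: zeta_term_def divide_simps) (simp add: algebra_simps)
  then show ?thesis by (simp only: norm_minus_cancel)
 qed
 ultimately show "norm (zeta_term n s) <= norm s * real n powr (- Re s - 1)" by simp
qed

lemma zeta_term_bound:
 assumes s: "Re s > 0"
 shows "norm (zeta_term n s) <= 1 * norm s * real n powr (- Re s - 1)"
proof (cases "n = 0 \<or> s \<noteq> 1")
 case True
 then show ?thesis using zeta_term_aux(2)[of n s] s by (cases "n = 0") (auto simp: zeta_term_def)
next
 case False
 then have n: "n > 0" and s1: "s = 1" by auto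
 have "ln (real (Suc n)) - ln (real n) = ln (1 + 1 / real n)"
 proof -
  have "1 + 1 / real n = real (Suc n) / real n" using n by (simp add: field_simps)
  then show ?thesis using n by (simp only: ln_div) simp
 qed
 moreover have "ln (1 + 1 / real n) <= 1 / real n" using n by (intro ln_add_one_self_le_self) auto
 moreover have "ln (1 + 1 / real n) >= 1 / real n - (1 / real n)\<^sup>2"
  using n by (intro ln_one_plus_pos_lower_bound) auto
 ultimately have "\<bar>1 / real n - (ln (real (Suc n)) - ln (real n))\<bar> <= (1 / real n)\<^sup>2" by simp
 moreover have "zeta_term n s = of_real (1 / real n - (ln (real (Suc n)) - ln (real n)))"
  using n s1 by (simp add: zeta_term_def powr_minus inverse_eq_divide)
 moreover have "(1 / real n)\<^sup>2 = real n powr (-2)" using n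
  by (simp add: powr_minus powr_numeral power_divide inverse_eq_divide)
 ultimately show ?thesis using s1 by (simp only: norm_of_real) simp
qed

lemma zeta0_holomorphic: "zeta0 holomorphic_on {s. Re s > 0}"
 using halfplane_series(1)[of zeta_term 1, OF zeta_term_holomorphic zeta_term_bound]
 unfolding zeta0_def by simp

lemma zeta0_norm: "Re s > 0 ==> norm (zeta0 s) <= norm s * (1 + 1 / Re s)"
 using halfplane_series(3)[of zeta_term 1, OF zeta_term_holomorphic zeta_term_bound]
 unfolding zeta0_def by simp

text \<open>\<open>zeta0_norm\<close> grows linearly in Im s, too much for the 3-4-1 inequality,
  where the bound has to be a small power. For Re s > 1 the terms up to N, with N about 2 + |Im s|,
  are at most 2/n, so only a logarithm is lost.\<close>

lemma zeta0_norm_log: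
 assumes s: "Re s > 1" "Re s <= 3"
 shows "norm (zeta0 s) <= 2 * ln (2 + \<bar>Im s\<bar>) + 8"
proof -
 define M where "M = 2 + \<bar>Im s\<bar>"
 define N where "N = nat \<lceil>M\<rceil>"
 have M: "M >= 2" by (simp add: M_def)
 have N: "real N >= M" "real N <= 2 * M" "N >= 1" using M unfolding N_def by linarith+
 have ns: "norm s <= 3/2 * M" using cmod_le[of s] s by (simp add: M_def)
 have s1: "s \<noteq> 1" using s by auto
 have "norm (zeta0 s - (\<Sum>n<Suc N. zeta_term n s)) <= 1 * norm s * (real N powr (- Re s) / Re s)"
  unfolding zeta0_def
  using halfplane_series(4)[of zeta_term 1, OF zeta_term_holomorphic zeta_term_bound, of s N] s N by simp
 also have "... <= (3/2 * M) * (1 / M)"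
 proof (subst mult_1, intro mult_mono ns)
  have "real N powr (- Re s) / Re s <= real N powr (- Re s) / 1" using s by (intro divide_left_mono) auto
  also have "... = real N powr (- Re s)" by simp
  also have "... <= real N powr (-1)" using s N by (intro powr_mono) auto
  also have "... = 1 / real N" using N by (simp add: powr_minus inverse_eq_divide)
  also have "... <= 1 / M" using N M by (intro divide_left_mono) auto
  finally show "real N powr (- Re s) / Re s <= 1 / M" .
 qed (use M s in auto)
 also have "... = 3/2" using M by simp
 finally have 1: "norm (zeta0 s - (\<Sum>n<Suc N. zeta_term n s)) <= 3/2" .
 have z0: "zeta_term 0 s = 0" by (simp add: zeta_term_def)
 have "(\<Sum>n<Suc K. zeta_term n s) = (\<Sum>n=1..K. zeta_term n s)" for K
  by (induction K) (simp_all add: z0)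
 then have "(\<Sum>n<Suc N. zeta_term n s) = (\<Sum>n=1..N. zeta_term n s)" .
 also have "norm ... <= (\<Sum>n=1..N. 2 * (1 / real n))"
 proof (rule sum_norm_le)
  fix n assume n: "n \<in> {1..N}"
  have "norm (zeta_term n s) <= norm (of_nat n powr (-s) :: complex) + norm ((of_nat (Suc n) powr (1 - s) - of_nat n powr (1 - s)) / (s - 1))"
   using n s1 by (simp add: zeta_term_def del: of_nat_Suc) (rule norm_triangle_ineq)
  also have "norm ((of_nat (Suc n) powr (1 - s) - of_nat n powr (1 - s)) / (s - 1)) = norm ((of_nat (Suc n) powr (1 - s) - of_nat n powr (1 - s)) / (1 - s))"
   by (simp add: norm_divide norm_minus_commute)
  also have "... <= real n powr (- Re s)" using n s s1 by (intro zeta_term_aux) auto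
  finally have "norm (zeta_term n s) <= 2 * real n powr (- Re s)" by (simp add: norm_nat_powr)
  also have "real n powr (- Re s) <= real n powr (-1)" using n s by (intro powr_mono) auto
  also have "... = 1 / real n" using n by (simp add: powr_minus inverse_eq_divide)
  finally show "norm (zeta_term n s) <= 2 * (1 / real n)" by simp
 qed
 also have "... = 2 * (\<Sum>n=1..N. 1 / real n)" by (simp only: sum_distrib_left)
 also have "... <= 2 * (1 + ln (real N))" using harmonic_le[OF N(3)] by simp
 also have "ln (real N) <= ln (2 * M)" using N M by simp
 also have "ln (2 * M) = ln 2 + ln M" using M by (simp add: ln_mult)
 finally have 2: "norm (\<Sum>n<Suc N. zeta_term n s) <= 2 * (1 + (ln 2 + ln M))" by simp
 have "norm (zeta0 s) <= norm (zeta0 s - (\<Sum>n<Suc N. zeta_term n s)) + norm (\<Sum>n<Suc N. zeta_term n s)"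
  by (metis diff_add_cancel norm_triangle_ineq)
 moreover have "ln 2 <= (1::real)" using ln_le_minus_one[of 2] by simp
 ultimately have "norm (zeta0 s) <= 2 * ln M + 8" using 1 2 by argo
 then show ?thesis by (simp only: M_def)
qed

lemma zeta_eq:
 assumes s: "Re s > 1"
 shows "zeta_dser s = 1 / (s - 1) + zeta0 s"
proof -
 have s1: "s \<noteq> 1" using s by auto
 have T1: "(%N. \<Sum>n<Suc N. 1 * of_nat n powr (-s)) \<longlonglongrightarrow> zeta_dser s"
  using summable_LIMSEQ[OF subpoly_summable[OF cmult_subpoly[OF cmult_one] s]] unfolding dser_def by (rule LIMSEQ_Suc)
 have T2: "(%N. \<Sum>n<Suc N. zeta_term n s) \<longlonglongrightarrow> zeta0 s"
 proof -
  have "summable (%n. zeta_term n s)"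
   using halfplane_series(2)[of zeta_term 1, OF zeta_term_holomorphic zeta_term_bound] s by simp
  then show ?thesis unfolding zeta0_def by (intro LIMSEQ_Suc summable_LIMSEQ)
 qed
 have T3: "(%N. (1 - of_nat (Suc N) powr (1 - s)) / (s - 1)) \<longlonglongrightarrow> (1 - 0) / (s - 1)"
 proof (intro tendsto_intros)
  show "(%N. of_nat (Suc N) powr (1 - s) :: complex) \<longlonglongrightarrow> 0"
  proof (rule Lim_null_comparison)
   show "\<forall>\<^sub>F N in sequentially. norm (of_nat (Suc N) powr (1 - s) :: complex) <= real (Suc N) powr (1 - Re s)"
    by (intro always_eventually allI) (simp only: norm_nat_powr minus_complex.simps one_complex.simps order_refl)
   show "(%N. real (Suc N) powr (1 - Re s)) \<longlonglongrightarrow> 0" using s by real_asymp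
  qed
 qed (use s1 in auto)
 have eq: "(\<Sum>n<Suc N. 1 * of_nat n powr (-s)) = (\<Sum>n<Suc N. zeta_term n s) + (1 - of_nat (Suc N) powr (1 - s)) / (s - 1)" for N
 proof (induction N)
  case 0
  then show ?case by (simp add: zeta_term_def)
 next
  case (Suc N)
  have "(\<Sum>n<Suc (Suc N). 1 * of_nat n powr (-s)) = (\<Sum>n<Suc N. zeta_term n s) + (1 - of_nat (Suc N) powr (1 - s)) / (s - 1) + of_nat (Suc N) powr (-s)"
   using Suc.IH by simp
  also have "... = (\<Sum>n<Suc N. zeta_term n s) + (zeta_term (Suc N) s + (1 - of_nat (Suc (Suc N)) powr (1 - s)) / (s - 1))"
   using s1 by (simp add: zeta_term_def divide_simps del: of_nat_Suc)
  finally show ?case by simp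
 qed
 have "zeta_dser s = zeta0 s + (1 - 0) / (s - 1)"
  by (rule LIMSEQ_unique[OF T1]) (subst eq, rule tendsto_add[OF T2 T3])
 then show ?thesis by simp
qed

text \<open>Purpose: the weights 1 / (ln n)^m are attached in this way to sums carrying the factor
  (ln n)^k, in order to return to sums over primes.\<close>

lemma abel_decreasing:
 fixes a :: "nat => complex" and b :: "nat => real"
 assumes A: "\<And>k. k <= N ==> norm (\<Sum>n=m..k. a n) <= Q"
  and dec: "\<And>n. m <= n ==> n < N ==> b (Suc n) <= b n"
  and nn: "\<And>n. m <= n ==> n <= N ==> 0 <= b n" and mN: "m <= N"
 shows "norm (\<Sum>n=m..N. a n * of_real (b n)) <= Q * b m"
proof -
 define S where "S = (%k. \<Sum>n=m..k. a n)"
 have eq: "(\<Sum>n=m..k. a n * of_real (b n)) = (\<Sum>n=m..<k. S n * of_real (b n - b (Suc n))) + S k * of_real (b k)"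
  if "m <= k" for k
  using that
 proof (induction k rule: dec_induct)
  case (step k)
  have "S (Suc k) = S k + a (Suc k)" using step.hyps by (simp add: S_def)
  then show ?case using step by (simp add: algebra_simps)
 qed (simp add: S_def)
 have Q: "0 <= Q" using A[OF mN] norm_ge_zero order_trans by blast
 have "norm (\<Sum>n=m..N. a n * of_real (b n)) <= norm (\<Sum>n=m..<N. S n * of_real (b n - b (Suc n))) + norm (S N * of_real (b N))"
  unfolding eq[OF mN] by (rule norm_triangle_ineq)
 also have "norm (\<Sum>n=m..<N. S n * of_real (b n - b (Suc n))) <= (\<Sum>n=m..<N. Q * (b n - b (Suc n)))"
 proof (rule sum_norm_le)
  fix n assume n: "n \<in> {m..<N}"
  then show "norm (S n * of_real (b n - b (Suc n))) <= Q * (b n - b (Suc n))"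
   unfolding norm_mult norm_of_real S_def using A[of n] dec[of n] Q by (auto intro!: mult_mono)
 qed
 also have "norm (S N * of_real (b N)) <= Q * b N"
  unfolding norm_mult norm_of_real S_def using A[of N] nn[of N] mN Q by (auto intro!: mult_mono)
 also have "(\<Sum>n=m..<N. Q * (b n - b (Suc n))) = Q * (b m - b N)"
  using mN by (simp add: sum_distrib_left[symmetric] sum_Suc_diff'[of m N "%n. - b n", simplified])
 finally show ?thesis by (simp add: algebra_simps)
qed

subsection \<open>Logarithms of L-functions\<close>

text \<open>The logarithm of the L-function. At n = 0 and n = 1 the von Mangoldt function vanishes,
  and so does the quotient.\<close>

definition logser :: "(nat => complex) => complex => complex" where
 "logser f = dser (%n. f n * of_real (mangoldt n / ln (real n)))"

lemma logcoeff_bounds: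
 "0 <= mangoldt n / ln (real n)" "mangoldt n / ln (real n) <= 1"
proof -
 have *: "mangoldt n <= ln (real n)" if "n > 0" using that by (rule mangoldt_le)
 show "0 <= mangoldt n / ln (real n)" by (cases "n = 0") (auto simp: mangoldt_nonneg)
 consider "n = 0" | "n = 1" | "n >= 2" by linarith
 then show "mangoldt n / ln (real n) <= 1"
  by cases (use * in \<open>auto simp: divide_le_eq_1\<close>)
qed

lemma logcoeff_norm:
 assumes "cmult f"
 shows "norm (f n * of_real (mangoldt n / ln (real n))) <= 1"
 unfolding norm_mult norm_of_real abs_of_nonneg[OF logcoeff_bounds(1)]
 using mult_mono[OF cmult_norm_le[OF assms, of n] logcoeff_bounds(2)[of n]] logcoeff_bounds[of n] by simp

lemma logser_subpoly: "cmult f ==> subpoly (%n. f n * of_real (mangoldt n / ln (real n)))"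
 by (rule subpoly_bounded[of _ 1]) (rule logcoeff_norm)

lemma logser_deriv:
 assumes f: "cmult f" and s: "Re s > 1"
 shows "(logser f has_field_derivative - dser (%n. f n * mangoldt n) s) (at s)"
proof -
 have eq: "- of_real (ln (real n)) * (f n * of_real (mangoldt n / ln (real n))) = - (f n * mangoldt n)" for n
 proof -
  consider "n = 0" | "n = 1" | "n >= 2" by linarith
  then show ?thesis by cases (auto simp: field_simps)
 qed
 have "- dser (%n. f n * mangoldt n) s = dser (%n. - (f n * mangoldt n)) s"
  unfolding dser_def using subpoly_summable[OF cmult_mangoldt_subpoly[OF f] s]
  by (subst suminf_minus[symmetric]) auto
 then show ?thesis unfolding logser_def
  using dser_deriv[OF logser_subpoly[OF f] s] by (simp only: eq)
qed

lemma dser_at_2: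
 assumes f: "cmult f"
 shows "norm (dser f 2 - 1) <= 3/4"
proof -
 have S: "summable (%n. f n * of_nat n powr (-2))"
  using subpoly_summable[OF cmult_subpoly[OF f], of 2] by simp
 have f1: "f 1 = 1" using f by (simp add: cmult_def)
 have "dser f 2 = (\<Sum>n. f (n + 3) * of_nat (n + 3) powr (-2)) + (\<Sum>n<3. f n * of_nat n powr (-2))"
  unfolding dser_def by (rule suminf_split_initial_segment[OF S])
 also have "(\<Sum>n<3. f n * of_nat n powr (-2)) = 1 + f 2 * of_nat 2 powr (-2)"
  using f1 by (simp add: eval_nat_numeral)
 finally have "dser f 2 - 1 = (\<Sum>n. f (n + 3) * of_nat (n + 3) powr (-2)) + f 2 * of_nat 2 powr (-2)" by simp
 then have "norm (dser f 2 - 1) <= norm (\<Sum>n. f (n + 3) * of_nat (n + 3) powr (-2)) + norm (f 2 * of_nat 2 powr (-2))"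
  by (metis norm_triangle_ineq)
 also have "norm (f 2 * of_nat 2 powr (-2)) <= 1 * (1/4)"
  unfolding norm_mult using cmult_norm_le[OF f, of 2]
  by (intro mult_mono) (auto simp: norm_nat_powr powr_minus)
 also have "norm (\<Sum>n. f (n + 3) * of_nat (n + 3) powr (-2)) <= (\<Sum>n. real (n + 2 + 1) powr (-1-1))"
 proof (rule norm_suminf_le)
  show "norm (f (n + 3) * of_nat (n + 3) powr (-2)) <= real (n + 2 + 1) powr (-1-1)" for n
  proof -
   have "norm (f (n + 3) * of_nat (n + 3) powr (-2)) = norm (f (n+3)) * real (n + 3) powr (-2)"
    by (simp only: norm_mult norm_nat_powr) simp
   also have "... <= 1 * real (n + 3) powr (-2)" by (intro mult_right_mono cmult_norm_le[OF f]) auto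
   finally show ?thesis by (simp add: add_ac)
  qed
 qed (rule powr_tail(1), auto)
 also have "... <= real 2 powr (-1) / 1" by (rule powr_tail(2)) auto
 also have "... = 1/2" by (simp add: powr_minus)
 finally show ?thesis by simp
qed

lemma logser_at_2:
 assumes f: "cmult f"
 shows "norm (logser f 2) <= 2"
proof -
 have "norm (logser f 2) <= (\<Sum>n. real n powr (-1-1))"
  unfolding logser_def dser_def
 proof (rule norm_suminf_le)
  show "norm (f n * of_real (mangoldt n / ln (real n)) * of_nat n powr - 2) <= real n powr (-1-1)" for n
   using mult_right_mono[OF logcoeff_norm[OF f, of n], of "real n powr (-2)"]
   unfolding norm_mult[of "f n * _"] by (simp add: norm_nat_powr)
 qed (simp add: summable_real_powr_iff)
 also have "... <= 1 + 1 / 1" by (rule powr_full_sum) simp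
 finally show ?thesis by simp
qed

text \<open>The product of \<open>dser f\<close> with exp(- \<open>logser f\<close>) has derivative
  0 and is a constant c on Re s > 1. Instead of letting s tend to infinity to see that c = 1, its
  value at s = 2 is bounded above and below; this affects constants only. The factor 40 covers
  (1/4)(1/9) and (7/4) 9.\<close>

lemma dser_exp_logser:
 assumes f: "cmult f"
 shows "\<exists>c. 1/40 <= norm c \<and> norm c <= 40 \<and> (\<forall>s. Re s > 1 \<longrightarrow> dser f s = c * exp (logser f s))"
proof -
 have "((%s. dser f s * exp (- logser f s)) has_field_derivative 0) (at s within {s. Re s > 1})"
  if "s \<in> {s. Re s > 1}" for s
 proof (rule has_field_derivative_at_within)
  have s: "Re s > 1" using that by simp
  have D: "(dser f has_field_derivative - dser (%n. f n * mangoldt n) s * dser f s) (at s)"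
   using dser_deriv[OF cmult_subpoly[OF f] s] cmult_log_deriv[OF f s] DERIV_imp_deriv by metis
  show "((%s. dser f s * exp (- logser f s)) has_field_derivative 0) (at s)"
   by (rule derivative_eq_intros D logser_deriv[OF f s] refl | simp)+
 qed
 from has_field_derivative_zero_constant[OF convex_halfspace_Re_gt this]
 obtain c where c: "\<And>s. Re s > 1 ==> dser f s * exp (- logser f s) = c" by auto
 have eq: "dser f s = c * exp (logser f s)" if "Re s > 1" for s
  using c[OF that] by (simp add: exp_minus field_simps)
 have "norm c = norm (dser f 2 * exp (- logser f 2))" using c[of 2] by simp
 then have "norm c = norm (dser f 2) * exp (- Re (logser f 2))" by (simp only: norm_mult norm_exp_eq_Re uminus_complex.sel)
 note nc = this
 have L: "1/4 <= norm (dser f 2)" "norm (dser f 2) <= 7/4"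
  using dser_at_2[OF f] norm_triangle_ineq2[of 1 "dser f 2"] norm_triangle_ineq2[of "dser f 2" 1]
  by (auto simp: norm_minus_commute)
 have "\<bar>Re (logser f 2)\<bar> <= 2" using logser_at_2[OF f] abs_Re_le_cmod order_trans by blast
 then have E: "exp (- Re (logser f 2)) <= exp 2" "exp (-2) <= exp (- Re (logser f 2))" by auto
 have e2: "exp 2 <= (9::real)"
 proof -
  have "exp (2::real) = exp 1 * exp 1" by (simp add: exp_add[symmetric])
  also have "... <= 3 * 3" using exp_le by (intro mult_mono) auto
  finally show ?thesis by simp
 qed
 then have "exp (-2) >= (1/9::real)" by (simp add: exp_minus field_simps)
 then have E1: "1/9 <= exp (- Re (logser f 2))" and E2: "exp (- Re (logser f 2)) <= 9"
  using order_trans[OF _ E(2)] order_trans[OF E(1) e2] by blast+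
 have "1/4 * (1/9) <= norm (dser f 2) * exp (- Re (logser f 2))"
  by (intro mult_mono L E1) auto
 moreover have "norm (dser f 2) * exp (- Re (logser f 2)) <= 7/4 * 9"
  by (intro mult_mono L E2) auto
 ultimately have "norm c >= 1/4 * (1/9)" "norm c <= 7/4 * 9" using nc by simp_all
 then show ?thesis using eq by (intro exI[of _ c]) auto
qed

lemma dser_nonzero: "cmult f ==> Re s > 1 ==> dser f s \<noteq> 0"
 using dser_exp_logser[of f] by fastforce

lemma logser_Re:
 assumes f: "cmult f" and s: "Re s > 1"
 defines "w \<equiv> %n. mangoldt n / ln (real n) * real n powr (- Re s)"
 shows "(%n. w n * Re (f n * of_nat n powr (- \<i> * of_real (Im s)))) sums Re (logser f s)"
proof -
 have "(%n. f n * of_real (mangoldt n / ln (real n)) * of_nat n powr (-s)) sums logser f s"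
  unfolding logser_def dser_def using subpoly_summable[OF logser_subpoly[OF f] s] by (rule summable_sums)
 then have "(%n. Re (f n * of_real (mangoldt n / ln (real n)) * of_nat n powr (-s))) sums Re (logser f s)"
  by (rule sums_Re)
 moreover have "Re (f n * of_real (mangoldt n / ln (real n)) * of_nat n powr (-s)) = w n * Re (f n * of_nat n powr (- \<i> * of_real (Im s)))" for n
 proof -
  have "-s = of_real (- Re s) + - \<i> * of_real (Im s)" by (simp add: complex_eq_iff)
  then have "of_nat n powr (-s) = (of_nat n powr of_real (- Re s)) * (of_nat n powr (- \<i> * of_real (Im s)) :: complex)"
   by (metis powr_add)
  also have "(of_nat n powr of_real (- Re s) :: complex) = of_real (real n powr (- Re s))"
   using powr_of_real[of "real n" "- Re s"] by simp
  finally have "f n * of_real (mangoldt n / ln (real n)) * of_nat n powr (-s) = of_real (w n) * (f n * of_nat n powr (- \<i> * of_real (Im s)))"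
   by (simp add: w_def)
  then show ?thesis by (metis Re_complex_of_real Im_complex_of_real mult_zero_left diff_zero times_complex.sel(1))
 qed
 ultimately show ?thesis by simp
qed

lemma unimodular_twist:
 assumes "cmult f"
 shows "norm (f n * of_nat n powr (- \<i> * of_real t)) = 1 \<or> f n * of_nat n powr (- \<i> * of_real t) = 0"
proof (cases "n = 0")
 case False
 then have "norm (of_nat n powr (- \<i> * of_real t) :: complex) = 1" by (simp add: norm_nat_powr)
 then show ?thesis using assms unfolding cmult_def norm_mult by auto
qed simp

lemma logser_weight_nonneg: "0 <= mangoldt n / ln (real n) * real n powr x"
 using logcoeff_bounds(1)[of n] by (intro mult_nonneg_nonneg) auto

text \<open>The real part of log zeta(Re s) + log L(s) is a sum of nonnegative terms because 1 + Re
  z >= 0 for |z| <= 1; 1600 = 40^2 collects the two constants of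
  \<open>dser_exp_logser\<close>.\<close>

lemma dser_lower_zeta:
 assumes f: "cmult f" and s: "Re s > 1"
 shows "norm (zeta_dser (of_real (Re s))) * norm (dser f s) >= 1/1600"
proof -
 obtain c where c: "1/40 <= norm c" "\<And>s. Re s > 1 ==> dser f s = c * exp (logser f s)"
  using dser_exp_logser[OF f] by blast
 obtain d where d: "1/40 <= norm d" "\<And>s. Re s > 1 ==> zeta_dser s = d * exp (logser (%_. 1) s)"
  using dser_exp_logser[OF cmult_one] by blast
 have s1: "Re (of_real (Re s)) > 1" using s by simp
 define w where "w = (%n. mangoldt n / ln (real n) * real n powr (- Re s))"
 have S: "(%n. w n * Re (1 * of_nat n powr (- \<i> * of_real 0)) + w n * Re (f n * of_nat n powr (- \<i> * of_real (Im s))))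
   sums (Re (logser (%_. 1) (of_real (Re s))) + Re (logser f s))"
  unfolding w_def using logser_Re[OF cmult_one s1] logser_Re[OF f s] by (intro sums_add) auto
 have P: "0 <= w n * Re (1 * of_nat n powr (- \<i> * of_real 0)) + w n * Re (f n * of_nat n powr (- \<i> * of_real (Im s)))" for n
 proof (cases "n = 0")
  case False
  define z where "z = f n * of_nat n powr (- \<i> * of_real (Im s))"
  have "norm z <= 1" using unimodular_twist[OF f, of n "Im s"] by (auto simp: z_def)
  then have "Re z >= -1" using abs_Re_le_cmod[of z] by linarith
  then have "w n * (1 + Re z) >= 0" using logser_weight_nonneg[of n] by (intro mult_nonneg_nonneg) (auto simp: w_def)
  then show ?thesis using False by (simp add: z_def algebra_simps)
 qed (simp add: w_def)
 have nn: "Re (logser (%_. 1) (of_real (Re s))) + Re (logser f s) >= 0"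
  by (rule sums_le[OF P sums_zero S])
 have "norm (zeta_dser (of_real (Re s))) * norm (dser f s) = (norm d * norm c) * exp (Re (logser (%_. 1) (of_real (Re s))) + Re (logser f s))"
  unfolding c(2)[OF s] d(2)[OF s1] by (simp add: norm_mult exp_add)
 also have "... >= (1/40 * (1/40)) * 1"
  using c(1) d(1) nn by (intro mult_mono) auto
 finally show ?thesis by simp
qed

text \<open>For z = f(n) n^(-it) = e^(iu) this is 3 + 4 cos u + cos 2u = 2 (1 + cos u)^2 >= 0. Since
  z^2 = f(n)^2 n^(-2it), the third factor belongs to f^2 at height 2 Im s. The 8 in 40^8 is 3 + 4 +
  1.\<close>

lemma three_four_one:
 assumes f: "cmult f" and s: "Re s > 1"
 shows "norm (zeta_dser (of_real (Re s))) ^ 3 * norm (dser f s) ^ 4 * norm (dser (%n. f n ^ 2) (s + \<i> * of_real (Im s))) >= 1 / 40 ^ 8"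
proof -
 have f2: "cmult (%n. f n ^ 2)" using f unfolding cmult_def
  by (auto simp: power_mult_distrib norm_power) (metis norm_zero power_one power_zero_numeral)
 obtain c where c: "1/40 <= norm c" "\<And>s. Re s > 1 ==> dser f s = c * exp (logser f s)"
  using dser_exp_logser[OF f] by blast
 obtain d where d: "1/40 <= norm d" "\<And>s. Re s > 1 ==> zeta_dser s = d * exp (logser (%_. 1) s)"
  using dser_exp_logser[OF cmult_one] by blast
 obtain e where e: "1/40 <= norm e" "\<And>s. Re s > 1 ==> dser (%n. f n ^ 2) s = e * exp (logser (%n. f n ^ 2) s)"
  using dser_exp_logser[OF f2] by blast
 define s2 where "s2 = s + \<i> * of_real (Im s)"
 have s1: "Re (of_real (Re s)) > 1" using s by simp
 have s2: "Re s2 > 1" using s by (simp add: s2_def)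
 define w where "w = (%n. mangoldt n / ln (real n) * real n powr (- Re s))"
 define z where "z = (%n. f n * of_nat n powr (- \<i> * of_real (Im s)))"
 have z2: "f n ^ 2 * of_nat n powr (- \<i> * of_real (Im s2)) = z n ^ 2" for n
 proof -
  have "- \<i> * of_real (Im s2) = - \<i> * of_real (Im s) + - \<i> * of_real (Im s)"
   by (simp add: s2_def complex_eq_iff)
  then have "of_nat n powr (- \<i> * of_real (Im s2)) = (of_nat n powr (- \<i> * of_real (Im s)))^2"
   by (simp only: powr_add power2_eq_square)
  then show ?thesis by (simp add: z_def power_mult_distrib)
 qed
 have A1: "(%n. w n * Re (1 * of_nat n powr (- \<i> * of_real 0))) sums Re (logser (%_. 1) (of_real (Re s)))"
  unfolding w_def using logser_Re[OF cmult_one s1] by simp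
 have A2: "(%n. w n * Re (z n)) sums Re (logser f s)"
  unfolding w_def z_def using logser_Re[OF f s] by simp
 have A3: "(%n. w n * Re (z n ^ 2)) sums Re (logser (%n. f n ^ 2) s2)"
  using logser_Re[OF f2 s2] unfolding z2 unfolding w_def by (simp add: s2_def)
 have S: "(%n. 3 * (w n * Re (1 * of_nat n powr (- \<i> * of_real 0))) + 4 * (w n * Re (z n)) + w n * Re (z n ^ 2))
   sums (3 * Re (logser (%_. 1) (of_real (Re s))) + 4 * Re (logser f s) + Re (logser (%n. f n ^ 2) s2))"
  by (intro sums_add sums_mult A1 A2 A3)
 have P: "0 <= 3 * (w n * Re (1 * of_nat n powr (- \<i> * of_real 0))) + 4 * (w n * Re (z n)) + w n * Re (z n ^ 2)" for n
 proof (cases "n = 0")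
  case False
  have "3 + 4 * Re (z n) + Re (z n ^ 2) >= 0"
   using unimodular_twist[OF f, of n "Im s"]
  proof
   assume "norm (f n * of_nat n powr (- \<i> * of_real (Im s))) = 1"
   then have "(Re (z n))^2 + (Im (z n))^2 = 1" by (simp add: z_def cmod_def)
   then have "3 + 4 * Re (z n) + Re (z n ^ 2) = 2 * (1 + Re (z n))^2"
    by (simp add: power2_eq_square algebra_simps)
   then show ?thesis by simp
  next
   assume "f n * of_nat n powr (- \<i> * of_real (Im s)) = 0"
   then have "z n = 0" by (simp only: z_def)
   then show ?thesis by simp
  qed
  then have "w n * (3 + 4 * Re (z n) + Re (z n ^ 2)) >= 0"
   using logser_weight_nonneg[of n] by (intro mult_nonneg_nonneg) (auto simp: w_def)
  then show ?thesis using False by (simp add: algebra_simps)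
 qed (simp add: w_def)
 have nn: "3 * Re (logser (%_. 1) (of_real (Re s))) + 4 * Re (logser f s) + Re (logser (%n. f n ^ 2) s2) >= 0"
  by (rule sums_le[OF P sums_zero S])
 have "norm (zeta_dser (of_real (Re s))) ^ 3 * norm (dser f s) ^ 4 * norm (dser (%n. f n ^ 2) s2)
   = (norm d ^ 3 * norm c ^ 4 * norm e) * exp (3 * Re (logser (%_. 1) (of_real (Re s))) + 4 * Re (logser f s) + Re (logser (%n. f n ^ 2) s2))"
  unfolding c(2)[OF s] d(2)[OF s1] e(2)[OF s2]
  by (simp add: norm_mult exp_add power_mult_distrib exp_of_nat_mult[symmetric])
 also have "... >= ((1/40)^3 * (1/40)^4 * (1/40)) * 1"
  using c(1) d(1) e(1) nn by (intro mult_mono power_mono) auto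
 also have "((1/40)^3 * (1/40)^4 * (1/40)) * 1 = (1 / 40 ^ 8 :: real)" by (simp add: power_divide)
 finally show ?thesis unfolding s2_def .
qed

lemma zeta_real_upper:
 assumes "1 < x" "x <= 3"
 shows "norm (zeta_dser (of_real x)) <= 9 / (x - 1)"
proof -
 have "zeta_dser (of_real x) = 1 / (of_real x - 1) + zeta0 (of_real x)" using assms by (intro zeta_eq) simp
 then have "norm (zeta_dser (of_real x)) <= norm (1 / (of_real x - 1 :: complex)) + norm (zeta0 (of_real x))"
  by (metis norm_triangle_ineq)
 also have "norm (1 / (of_real x - 1 :: complex)) = 1 / (x - 1)"
  using assms by (metis abs_of_pos diff_gt_0_iff_gt norm_divide norm_of_real norm_one of_real_1 of_real_diff)
 also have "norm (zeta0 (of_real x)) <= x * (1 + 1 / x)"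
  using zeta0_norm[of "of_real x"] assms by simp
 also have "x * (1 + 1 / x) = x + 1" using assms by (simp add: field_simps)
 also have "x + 1 <= 8 / (x - 1)"
 proof -
  have "(x + 1) * (x - 1) <= 4 * 2" using assms by (intro mult_mono) auto
  then show ?thesis using assms by (simp add: pos_le_divide_eq)
 qed
 finally show ?thesis by (simp add: add_divide_distrib[symmetric])
qed

lemma dser_lower_real:
 assumes f: "cmult f" and s: "1 < Re s" "Re s <= 3"
 shows "norm (dser f s) >= (Re s - 1) / 14400"
proof -
 have "1/1600 <= norm (zeta_dser (of_real (Re s))) * norm (dser f s)" by (rule dser_lower_zeta[OF f s(1)])
 also have "... <= 9 / (Re s - 1) * norm (dser f s)" by (intro mult_right_mono zeta_real_upper s) auto
 finally show ?thesis using s by (simp add: field_simps)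
qed

lemma dser_lower_four:
 assumes f: "cmult f" and s: "1 < Re s" "Re s <= 3"
  and K: "norm (dser (%n. f n ^ 2) (s + \<i> * of_real (Im s))) <= K" "K > 0"
 shows "norm (dser f s) ^ 4 >= (Re s - 1) ^ 3 / (40 ^ 8 * 729 * K)"
proof -
 have "1 / 40 ^ 8 <= norm (zeta_dser (of_real (Re s))) ^ 3 * norm (dser f s) ^ 4 * norm (dser (%n. f n ^ 2) (s + \<i> * of_real (Im s)))"
  by (rule three_four_one[OF f s(1)])
 also have "... <= (9 / (Re s - 1)) ^ 3 * norm (dser f s) ^ 4 * K"
  by (intro mult_mono power_mono zeta_real_upper s K(1)) (use s in auto)
 also have "... = 729 * K * norm (dser f s) ^ 4 / (Re s - 1) ^ 3" by (simp add: power_divide)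
 finally show ?thesis using s K(2) by (simp add: field_simps)
qed

subsection \<open>Nonvanishing at 1 for real characters\<close>

text \<open>Every divisor of p^k m is p^i d in exactly one way, with i <= k and d dividing
  m.\<close>

lemma divisor_sum_prime_power_mult:
 fixes g :: "nat => real"
 assumes p: "prime p" and m: "\<not> p dvd m" "m > 0" and g: "\<And>a b. g (a * b) = g a * g b" "g 1 = 1"
 shows "(\<Sum>d | d dvd p ^ k * m. g d) = (\<Sum>i\<le>k. g p ^ i) * (\<Sum>d | d dvd m. g d)"
proof -
 have gp: "g (p ^ i) = g p ^ i" for i by (induction i) (use g in auto)
 have bij: "bij_betw (%(i,d). p ^ i * d) ({..k} \<times> {d. d dvd m}) {d. d dvd p ^ k * m}"
 proof (rule bij_betw_imageI)
  show "inj_on (%(i,d). p ^ i * d) ({..k} \<times> {d. d dvd m})"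
  proof (rule inj_onI, clarsimp)
   fix i d j e assume *: "d dvd m" "e dvd m" "p ^ i * d = p ^ j * e"
   have nd: "\<not> p dvd d" "\<not> p dvd e" using * m(1) dvd_trans by blast+
   have "multiplicity p (p ^ i * d) = i" "multiplicity p (p ^ j * e) = j"
    using p nd by (auto intro!: multiplicity_eqI simp: prime_gt_0_nat)
   then have "i = j" using * by simp
   then show "i = j \<and> d = e" using * p by (simp add: prime_gt_0_nat)
  qed
  show "(%(i,d). p ^ i * d) ` ({..k} \<times> {d. d dvd m}) = {d. d dvd p ^ k * m}"
  proof (intro equalityI subsetI)
   fix x assume "x \<in> (%(i,d). p ^ i * d) ` ({..k} \<times> {d. d dvd m})"
   then show "x \<in> {d. d dvd p ^ k * m}" by (auto intro!: mult_dvd_mono le_imp_power_dvd)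
  next
   fix x assume "x \<in> {d. d dvd p ^ k * m}"
   then have "x dvd p ^ k * m" by simp
   then obtain b c where bc: "x = b * c" "b dvd p ^ k" "c dvd m" using division_decomp by blast
   obtain i where "i <= k" "b = p ^ i" using bc(2) p by (auto simp: divides_primepow_nat)
   then show "x \<in> (%(i,d). p ^ i * d) ` ({..k} \<times> {d. d dvd m})" using bc by force
  qed
 qed
 have "(\<Sum>d | d dvd p ^ k * m. g d) = (\<Sum>(i,d)\<in>{..k} \<times> {d. d dvd m}. g (p ^ i * d))"
  using sum.reindex_bij_betw[OF bij, of g] by (simp add: case_prod_unfold)
 also have "... = (\<Sum>(i,d)\<in>{..k} \<times> {d. d dvd m}. g p ^ i * g d)" by (simp add: g gp)
 also have "... = (\<Sum>i\<le>k. g p ^ i) * (\<Sum>d | d dvd m. g d)"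
  by (simp add: sum_product sum.cartesian_product)
 finally show ?thesis .
qed

context
 fixes g :: "nat => real"
 assumes gm: "\<And>a b. g (a * b) = g a * g b" and g1: "g 1 = 1" and gv: "\<And>n. g n \<in> {-1, 0, 1}"
begin

lemma geom_signed: "(\<Sum>i\<le>k. g p ^ i) >= (if even k then 1 else 0)"
proof -
 consider "g p = -1" | "g p = 0" | "g p = 1" using gv by blast
 then show ?thesis
 proof cases
  case 1
  have "(\<Sum>i\<le>k. (-1::real) ^ i) = (if even k then 1 else 0)" by (induction k) auto
  then show ?thesis using 1 by simp
 next
  case 2
  have "(\<Sum>i\<le>k. (0::real) ^ i) = 1" by (induction k) auto
  then show ?thesis using 2 by simp
 next
  case 3
  then show ?thesis by simp
 qed
qed

lemma prime_power_split:
 assumes "n \<noteq> 1" "n > (0::nat)"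
 obtains p k m where "prime p" "n = p ^ k * m" "\<not> p dvd m" "m > 0" "m < n"
proof -
 from assms obtain p where p: "prime p" "p dvd n" using prime_factor_nat by blast
 define k where "k = multiplicity p n"
 obtain m where m: "n = p ^ k * m" "\<not> p dvd m"
  unfolding k_def using multiplicity_decompose'[of n p] assms p by (metis not_prime_unit not_gr0)
 have m0: "m > 0" using m(1) assms by (cases "m = 0") auto
 have "k > 0" unfolding k_def using p assms by (simp add: prime_multiplicity_gt_zero_iff)
 then have "p ^ k > 1" using p by (metis one_less_power prime_gt_1_nat)
 then have "1 * m < p ^ k * m" using m0 by (intro mult_strict_right_mono) auto
 then have "m < n" using m(1) by simp
 with that p(1) m m0 show thesis by blast
qed

text \<open>One prime power is split off at a time. The local factors 1 + g p + ... + (g p)^k are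
  nonnegative, and at least 1 for even k, which is what squares need.\<close>

lemma divisor_sum_nonneg: "n > 0 ==> (\<Sum>d | d dvd n. g d) >= 0"
proof (induction n rule: less_induct)
 case (less n)
 show ?case
 proof (cases "n = 1")
  case False
  from prime_power_split[OF this less.prems] obtain p k m
   where p: "prime p" "n = p ^ k * m" "\<not> p dvd m" "m > 0" "m < n" by blast
  then have "(\<Sum>d | d dvd m. g d) >= 0" using less.IH by blast
  moreover have "(\<Sum>i\<le>k. g p ^ i) >= 0" using geom_signed[of k p] by (auto split: if_splits)
  ultimately show ?thesis
   unfolding p(2) divisor_sum_prime_power_mult[where g = g, OF p(1,3,4) gm g1] by (rule mult_nonneg_nonneg[rotated])
 qed (use g1 in simp)
qed

lemma divisor_sum_square: "a > 0 ==> (\<Sum>d | d dvd a ^ 2. g d) >= 1"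
proof (induction a rule: less_induct)
 case (less n)
 show ?case
 proof (cases "n = 1")
  case False
  from prime_power_split[OF this less.prems] obtain p k m
   where p: "prime p" "n = p ^ k * m" "\<not> p dvd m" "m > 0" "m < n" by blast
  then have IH: "(\<Sum>d | d dvd m ^ 2. g d) >= 1" using less.IH by blast
  have eq: "n ^ 2 = p ^ (2 * k) * m ^ 2" using p(2) by (simp add: power_mult_distrib power_mult[symmetric] mult.commute)
  have nd: "\<not> p dvd m ^ 2" using p(1,3) prime_dvd_power by blast
  have m2: "m ^ 2 > 0" using p(4) by simp
  have "(\<Sum>i\<le>2 * k. g p ^ i) >= 1" using geom_signed[of "2 * k" p] by simp
  then have "(\<Sum>i\<le>2 * k. g p ^ i) * (\<Sum>d | d dvd m ^ 2. g d) >= 1 * 1" using IH by (intro mult_mono) auto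
  then show ?thesis
   unfolding eq divisor_sum_prime_power_mult[where g = g, OF p(1) nd m2 gm g1] by simp
 qed (use g1 in simp)
qed

end

lemma real_values_trichotomy:
 assumes "dchar q \<xi>" "\<xi> n \<in> \<real>"
 shows "Re (\<xi> n) \<in> {-1, 0, 1}" "\<xi> n = of_real (Re (\<xi> n))"
proof -
 show eq: "\<xi> n = of_real (Re (\<xi> n))" using assms(2) by (simp add: complex_is_Real_iff complex_eq_iff)
 have "norm (\<xi> n) = \<bar>Re (\<xi> n)\<bar>" by (subst eq) (rule norm_of_real)
 then show "Re (\<xi> n) \<in> {-1, 0, 1}" using dchar_norm_cases[OF assms(1), of n] by auto
qed

lemma dser_of_real:
 assumes "subpoly (%n. of_real (k n))" "\<And>n. k n >= 0" "x > 1" "finite A"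
 obtains S where "dser (%n. of_real (k n)) (of_real x) = of_real S" "(\<Sum>n\<in>A. k n * real n powr (-x)) <= S"
proof -
 have eq: "of_real (k n) * of_nat n powr (- of_real x) = (of_real (k n * real n powr (-x)) :: complex)" for n
  using powr_of_real[of "real n" "-x"] by simp
 have "summable (%n. of_real (k n) * of_nat n powr (- of_real x) :: complex)"
  using assms by (intro subpoly_summable) auto
 then have S: "summable (%n. k n * real n powr (-x))" unfolding eq by (simp only: summable_complex_of_real)
 have "dser (%n. of_real (k n)) (of_real x) = of_real (\<Sum>n. k n * real n powr (-x))"
  unfolding dser_def eq by (rule suminf_of_real[OF S, symmetric])
 moreover have "(\<Sum>n\<in>A. k n * real n powr (-x)) <= (\<Sum>n. k n * real n powr (-x))"
  by (rule sum_le_suminf[OF S assms(4)]) (use assms(2) in simp)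
 ultimately show ?thesis by (rule that)
qed

lemma dser_shift: "dser (%n. a n * inverse (of_nat n)) s = dser a (s + 1)"
proof -
 have "a n * inverse (of_nat n) * of_nat n powr (-s) = a n * of_nat n powr (-(s + 1))" for n
  by (cases "n = 0") (simp_all add: powr_diff powr_minus field_simps flip: powr_add)
 then show ?thesis by (simp only: dser_def)
qed

text \<open>If \<open>L(1) = 0\<close>, then \<open>\<zeta>(s) L(s)\<close> is holomorphic for \<open>Re s > 0\<close>. Its Dirichlet coefficients are nonnegative
 and at least 1 at squares, so its Taylor series at 3, evaluated at 1/2, dominates the harmonic series.
 Everything is shifted by 1, so that the coefficients become bounded.\<close>

theorem L_one_nonzero:
 assumes np: "nonprincipal q \<xi>" and rl: "\<And>n. \<xi> n \<in> \<real>"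
 shows "Lc \<xi> 1 \<noteq> 0"
proof
 assume zero: "Lc \<xi> 1 = 0"
 note d = nonprincipal_dchar[OF np]
 note sb = nonprincipal_sum_bound[OF np]
 have sx: "subpoly \<xi>" by (rule cmult_subpoly[OF dchar_cmult[OF d]])
 define g where "g = (%n. Re (\<xi> n))"
 have xg: "\<xi> n = of_real (g n)" for n unfolding g_def by (rule real_values_trichotomy(2)[OF d rl])
 have gm: "g (a * b) = g a * g b" for a b
  using dcharD(3)[OF d, of a b] unfolding xg by (metis of_real_eq_iff of_real_mult)
 have g1: "g 1 = 1" using dcharD(2)[OF d] by (simp add: g_def)
 have gv: "g n \<in> {-1,0,1}" for n unfolding g_def by (rule real_values_trichotomy(1)[OF d rl])
 define r where "r = (%n. (\<Sum>d | d dvd n. g d) / real n)"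
 have r0: "r n >= 0" for n using divisor_sum_nonneg[OF gm g1 gv, of n] by (cases "n = 0") (auto simp: r_def)
 have bd: "subpoly f" if "\<And>n. norm (f n) <= 1" for f
  by (rule subpoly_mono[OF cmult_subpoly[OF cmult_one]]) (use that in simp)
 have r1: "r n <= 1" for n
 proof (cases "n = 0")
  case False
  have "(\<Sum>d | d dvd n. g d) <= (\<Sum>d | d dvd n. 1)"
  proof (rule sum_mono)
   show "g d <= 1" for d using gv[of d] by auto
  qed
  also have "card {d. d dvd n} <= card {1..n}" using False by (intro card_mono) (auto dest: dvd_imp_le intro: Suc_leI dvd_pos_nat)
  then have "(\<Sum>d | d dvd n. 1) <= real n" by simp
  finally show ?thesis using False by (simp add: r_def)
 qed (simp add: r_def)
 have sr: "subpoly (%n. of_real (r n))" by (rule bd) (use r0 r1 in simp)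
 \<comment> \<open>For Re s > 1 this equals zeta(s) L(s) - L(1)/(s - 1), so the assumption L(1) = 0
   identifies it with zeta(s) L(s).\<close>
 define H where "H = (%s. zeta0 s * Lc \<xi> s + (if s = 1 then deriv (Lc \<xi>) 1 else (Lc \<xi> s - Lc \<xi> 1) / (s - 1)))"
 have "(%s. if s = 1 then deriv (Lc \<xi>) 1 else (Lc \<xi> s - Lc \<xi> 1) / (s - 1)) holomorphic_on {s. Re s > 0}"
  by (rule pole_lemma_open[OF Lc_holomorphic[OF sb] open_Re_gt])
 then have H: "H holomorphic_on {s. Re s > 0}" unfolding H_def by (intro holomorphic_intros zeta0_holomorphic Lc_holomorphic[OF sb])
 define F where "F = (%s. H (s + 1))"
 have F: "F holomorphic_on {s. Re s > -1}"
  unfolding F_def by (rule holomorphic_on_compose_gen[of "%s. s + 1" _ H, unfolded o_def]) (auto intro!: holomorphic_intros H)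
 have FG: "F s = dser (%n. of_real (r n)) s" if s: "Re s > 1" for s
 proof -
  have n1: "norm (inverse (of_nat n :: complex)) <= 1" for n by (cases "n = 0") (auto simp: norm_inverse inverse_le_1_iff)
  have n2: "norm (\<xi> n * inverse (of_nat n)) <= 1" for n
   unfolding norm_mult using mult_mono[OF dchar_norm_le[OF d] n1] by simp
  have "dser (%n. 1 * inverse (of_nat n)) s * dser (%n. \<xi> n * inverse (of_nat n)) s = dser (%n. of_real (r n)) s"
  proof (rule dser_mult[OF bd bd s sr])
   fix n :: nat assume n: "n > 0"
   have "of_real (r n) = (\<Sum>d | d dvd n. \<xi> d * inverse (of_nat n))" by (simp add: r_def xg sum_divide_distrib divide_inverse sum_distrib_right)
   also have "... = (\<Sum>d | d dvd n. 1 * inverse (of_nat (n div d)) * (\<xi> d * inverse (of_nat d)))"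
   proof (rule sum.cong[OF refl])
    fix d assume "d \<in> {d. d dvd n}"
    then have "(of_nat n :: complex) = of_nat (n div d) * of_nat d" by (simp flip: of_nat_mult)
    then show "\<xi> d * inverse (of_nat n) = 1 * inverse (of_nat (n div d)) * (\<xi> d * inverse (of_nat d))" by (simp add: mult_ac)
   qed
   finally show "of_real (r n) = ..." .
  qed (use n1 n2 in auto)
  moreover have "s \<noteq> 0" using s by auto
  ultimately show ?thesis using zeta_eq[of "s + 1"] Lc_eq_dser[OF sb _ sx, of "s + 1"] s zero
   unfolding dser_shift by (simp add: F_def H_def algebra_simps)
 qed
 define t where "t = (%m n. ln (real n) ^ m * r n)"
 have Fd: "(deriv ^^ m) F 2 * (-1) ^ m = dser (%n. of_real (t m n)) 2" and st: "subpoly (%n. of_real (t m n))" for m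
 proof -
  have "(deriv ^^ m) F 2 = (deriv ^^ m) (dser (%n. of_real (r n))) 2"
   by (rule higher_deriv_transform_within_open[OF _ dser_holomorphic[OF sr] open_Re_gt[of 1]])
    (use F FG in \<open>auto elim!: holomorphic_on_subset\<close>)
  also have "... = dser (%n. (- of_real (ln (real n))) ^ m * of_real (r n)) 2" by (rule dser_higher_deriv[OF sr]) simp
  finally have e: "(deriv ^^ m) F 2 = dser (%n. (- of_real (ln (real n))) ^ m * of_real (r n)) 2" .
  have tm: "(- of_real (ln (real n))) ^ m * of_real (r n) = (-1) ^ m * (of_real (t m n) :: complex)" for n
   by (simp add: t_def power_minus[of "of_real (ln (real n))"])
  show st: "subpoly (%n. of_real (t m n))"
   by (rule subpoly_mono[OF subpoly_ln_power[OF sr, of m]]) (simp add: tm norm_mult norm_power)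
  have "dser (%n. (-1) ^ m * of_real (t m n)) 2 = (-1) ^ m * dser (%n. of_real (t m n)) 2"
   unfolding dser_def mult.assoc by (rule suminf_mult) (rule subpoly_summable[OF st], simp)
  then show "(deriv ^^ m) F 2 * (-1) ^ m = dser (%n. of_real (t m n)) 2"
   unfolding e tm by (simp add: mult_ac power_mult_distrib[symmetric])
 qed
 have t0: "t m n >= 0" for m n using r0[of n] unfolding t_def by (cases "n = 0") (auto intro!: mult_nonneg_nonneg zero_le_power)
 have "(%m. (deriv ^^ m) F 2 / fact m * (- 1/2 - 2) ^ m) sums F (- 1/2)"
 proof (rule holomorphic_power_series)
  show "F holomorphic_on ball 2 3"
  proof (rule holomorphic_on_subset[OF F], rule subsetI)
   fix z :: complex assume "z \<in> ball 2 3"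
   then have "\<bar>2 - Re z\<bar> < 3" using abs_Re_le_cmod[of "2 - z"] by (simp add: dist_norm)
   then show "z \<in> {s. Re s > -1}" by simp
  qed
 qed (simp add: dist_norm)
 moreover have "(deriv ^^ m) F 2 / fact m * (- 1/2 - 2) ^ m = ((deriv ^^ m) F 2 * (-1) ^ m) * of_real ((5/2) ^ m / fact m)" for m
 proof -
  have "(- 1/2 - 2 :: complex) ^ m = (-1) ^ m * (5/2) ^ m" by (simp add: power_mult_distrib[symmetric])
  then show ?thesis by simp
 qed
 ultimately have "(%m. dser (%n. of_real (t m n)) 2 * of_real ((5/2) ^ m / fact m)) sums F (- 1/2)" unfolding Fd by simp
 then have Fs: "(%m. Re (dser (%n. of_real (t m n)) 2 * of_real ((5/2) ^ m / fact m))) sums Re (F (- 1/2))" by (rule sums_Re)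
 have "(\<Sum>j=1..J. 1 / real j) <= Re (F (- 1/2))" for J
 proof -
  \<comment> \<open>The term n = j^2 of the expansion at 2, summed over m, is at least j^(-6) exp(u
    j) = 1/j: \<open>r\<close> at j^2 is at least j^(-2), the power n^(-2) is j^(-4), and 5/2 is the
    distance from 2 to -1/2. For each m only finitely many j are kept, so the order of summation
    causes no difficulty.\<close>
  define u where "u = (%j. 5/2 * ln (real (j\<^sup>2)))"
  have us: "(%m. \<Sum>j=1..J. inverse (fact m) *\<^sub>R u j ^ m * inverse (real j ^ 6)) sums (\<Sum>j=1..J. exp (u j) * inverse (real j ^ 6))"
   by (intro sums_sum sums_mult2 exp_converges)
  have le: "(\<Sum>j=1..J. inverse (fact m) *\<^sub>R u j ^ m * inverse (real j ^ 6)) <= Re (dser (%n. of_real (t m n)) 2 * of_real ((5/2) ^ m / fact m))" for m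
  proof -
   obtain S where S: "dser (%n. of_real (t m n)) (of_real 2) = of_real S" "(\<Sum>n\<in>(%j. j\<^sup>2) ` {1..J}. t m n * real n powr (-2)) <= S"
    by (rule dser_of_real[OF st t0, of 2 "(%j. j\<^sup>2) ` {1..J}"]) auto
   have "(\<Sum>j=1..J. ln (real (j\<^sup>2)) ^ m * inverse (real j ^ 6)) <= (\<Sum>j=1..J. t m (j\<^sup>2) * real (j\<^sup>2) powr (-2))"
   proof (rule sum_mono)
    fix j assume j: "j \<in> {1..J}"
    then have "1 / real (j\<^sup>2) <= r (j\<^sup>2)" unfolding r_def using divisor_sum_square[OF gm g1 gv, of j] by (intro divide_right_mono) auto
    then have "ln (real (j\<^sup>2)) ^ m * (1 / real (j\<^sup>2) * real (j\<^sup>2) powr (-2)) <= ln (real (j\<^sup>2)) ^ m * (r (j\<^sup>2) * real (j\<^sup>2) powr (-2))"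
     using j by (intro mult_left_mono mult_right_mono zero_le_power) auto
    moreover have "real (j\<^sup>2) powr (-2) = inverse (real j ^ 4)" using j by (simp add: powr_minus)
    then have "1 / real (j\<^sup>2) * real (j\<^sup>2) powr (-2) = inverse (real j ^ 6)" by (simp add: divide_inverse power_mult_distrib[symmetric] flip: power_add inverse_mult_distrib)
    ultimately show "ln (real (j\<^sup>2)) ^ m * inverse (real j ^ 6) <= t m (j\<^sup>2) * real (j\<^sup>2) powr (-2)" unfolding t_def by (simp only: mult.assoc)
   qed
   also have "... = (\<Sum>n\<in>(%j. j\<^sup>2) ` {1..J}. t m n * real n powr (-2))" by (subst sum.reindex) (auto simp: inj_on_def)
   also have "... <= S" by (rule S(2))
   finally have "(\<Sum>j=1..J. ln (real (j\<^sup>2)) ^ m * inverse (real j ^ 6)) * ((5/2) ^ m / fact m) <= S * ((5/2) ^ m / fact m)"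
    by (intro mult_right_mono) auto
   moreover have "Re (dser (%n. of_real (t m n)) 2 * of_real ((5/2) ^ m / fact m)) = S * ((5/2) ^ m / fact m)"
    using S(1) by (simp only: of_real_numeral of_real_mult[symmetric] Re_complex_of_real)
   moreover have "(\<Sum>j=1..J. inverse (fact m) *\<^sub>R u j ^ m * inverse (real j ^ 6)) = (\<Sum>j=1..J. ln (real (j\<^sup>2)) ^ m * inverse (real j ^ 6)) * ((5/2) ^ m / fact m)"
    unfolding sum_distrib_right u_def power_mult_distrib by (intro sum.cong refl) (simp only: real_scaleR_def divide_inverse mult_ac)
   ultimately show ?thesis by linarith
  qed
  have "(\<Sum>j=1..J. exp (u j) * inverse (real j ^ 6)) <= Re (F (- 1/2))" by (rule sums_le[OF le us Fs])
  moreover have "exp (u j) * inverse (real j ^ 6) = 1 / real j" if "j \<in> {1..J}" for j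
  proof -
   have "u j = real 5 * ln (real j)" using that by (simp add: u_def ln_realpow)
   then have "exp (u j) = exp (ln (real j)) ^ 5" by (simp only: exp_of_nat_mult)
   then have "exp (u j) = real j ^ 5" using that by simp
   moreover have "real j ^ 6 = real j ^ 5 * real j" using power_add[of "real j" 5 1] by simp
   moreover have "real j ^ 5 \<noteq> 0" using that by simp
   ultimately show ?thesis by (simp only: inverse_mult_distrib mult.assoc[symmetric] divide_inverse) simp
  qed
  ultimately show ?thesis by simp
 qed
 moreover have "(\<Sum>k\<le>J. 1 / real k) = (\<Sum>j=1..J. 1 / real j)" for J by (induction J) auto
 ultimately have "summable (%n. 1 / real n)"
  by (intro bounded_imp_summable[where B = "Re (F (- 1/2))"]) auto
 then show False using not_summable_harmonic[where 'a = real] by (simp add: inverse_eq_divide)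
qed

subsection \<open>Lower bounds for L-functions to the right of the line \<open>Re s = 1\<close>\<close>

lemma halfplane_deriv_bound:
 assumes hol: "g holomorphic_on {s. Re s > 0}" and e: "0 < e" "e <= 1/4"
  and B: "\<And>z. 1 - e <= Re z ==> Re z <= 3 ==> \<bar>Im z - t\<bar> <= 1 ==> norm (g z) <= B"
  and w: "1 <= Re w" "Re w <= 2" "\<bar>Im w - t\<bar> <= 1/2"
 shows "norm (deriv g w) <= B / e"
proof -
 have near: "1 - e <= Re z" "Re z <= 3" "\<bar>Im z - t\<bar> <= 1" if "norm (w - z) <= e" for z
 proof -
  have "\<bar>Re w - Re z\<bar> <= e" "\<bar>Im w - Im z\<bar> <= e"
   using that abs_Re_le_cmod[of "w - z"] abs_Im_le_cmod[of "w - z"] by simp_all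
  then show "1 - e <= Re z" "Re z <= 3" "\<bar>Im z - t\<bar> <= 1" using w e by linarith+
 qed
 have sub: "cball w e \<subseteq> {s. Re s > 0}"
  using near e by (force simp: dist_norm)
 have "norm ((deriv ^^ 1) g w) <= fact 1 * B / e ^ 1"
 proof (rule Cauchy_inequality)
  show "g holomorphic_on ball w e" using hol sub ball_subset_cball holomorphic_on_subset by blast
  show "continuous_on (cball w e) g"
   using hol sub holomorphic_on_imp_continuous_on continuous_on_subset by blast
  show "norm (g z) <= B" if "norm (w - z) = e" for z
   using near[of z] that by (intro B) auto
 qed (use e in auto)
 then show ?thesis by simp
qed

text \<open>Bounds for g slightly to the left of the line Re s = 1 turn, by Cauchy's inequality in
  discs of radius e, into a Lipschitz constant on a rectangle to its right.\<close>

lemma halfplane_lipschitz: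
 assumes hol: "g holomorphic_on {s. Re s > 0}" and e: "0 < e" "e <= 1/4"
  and B: "\<And>z. 1 - e <= Re z ==> Re z <= 3 ==> \<bar>Im z - t\<bar> <= 1 ==> norm (g z) <= B"
  and u: "1 <= Re u" "Re u <= 2" "\<bar>Im u - t\<bar> <= 1/2"
  and w: "1 <= Re w" "Re w <= 2" "\<bar>Im w - t\<bar> <= 1/2"
 shows "norm (g u - g w) <= B / e * norm (u - w)"
proof (rule field_differentiable_bound)
 define S where "S = {z. 1 <= Re z} \<inter> {z. Re z <= 2} \<inter> {z. t - 1/2 <= Im z} \<inter> {z. Im z <= t + 1/2}"
 show "convex S" unfolding S_def
  by (intro convex_Int convex_halfspace_Re_ge convex_halfspace_Re_le convex_halfspace_Im_ge convex_halfspace_Im_le)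
 show "(g has_field_derivative deriv g z) (at z within S)" if "z \<in> S" for z
 proof (rule has_field_derivative_at_within)
  have "Re z > 0" using that by (auto simp: S_def)
  then show "(g has_field_derivative deriv g z) (at z)"
   using hol open_Re_gt holomorphic_derivI by blast
 qed
 show "norm (deriv g z) <= B / e" if "z \<in> S" for z
 proof (rule halfplane_deriv_bound[OF hol e B])
  have "1 <= Re z" "Re z <= 2" "t - 1/2 <= Im z" "Im z <= t + 1/2" using that by (auto simp: S_def)
  then show "1 <= Re z" "Re z <= 2" "\<bar>Im z - t\<bar> <= 1/2" by linarith+
 qed
 have "t - 1/2 <= Im u" "Im u <= t + 1/2" "t - 1/2 <= Im w" "Im w <= t + 1/2" using u(3) w(3) by linarith+
 then show "u \<in> S" "w \<in> S" using u(1,2) w(1,2) unfolding S_def by blast+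
qed

text \<open>The constant of the 3-4-1 inequality after zeta(x)^3 has been bounded by (9 / (x -
  1))^3; 729 = 9^3.\<close>

definition c341 :: real where "c341 = 1 / (40 ^ 8 * 729)"

lemma c341: "0 < c341" "c341 <= 1" by (auto simp: c341_def)

text \<open>At distance at least \<tau> from the line Re s = 1, the 3-4-1 inequality gives |L|^4 >=
  c341 \<tau>^3 / K. Closer to the line the Lipschitz constant D = B / e loses at most D \<tau>. The
  value of \<tau> solves (2 D \<tau>)^4 = c341 \<tau>^3 / K, so the lower bound is twice the
  loss.\<close>

lemma L_lower_from_square:
 assumes f: "cmult f" and q: "\<And>N. norm (\<Sum>k=1..N. f k) <= q" and e: "0 < e" "e <= 1/4"
  and B: "\<And>z. 1 - e <= Re z ==> Re z <= 3 ==> \<bar>Im z - t\<bar> <= 1 ==> norm (Lc f z) <= B" "B >= 1"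
  and K: "\<And>x. 1 < x ==> x <= 2 ==> norm (dser (%n. f n ^ 2) (Complex x (2 * t))) <= K" "K >= 1"
  and x: "1 < x" "x <= 2"
 shows "norm (Lc f (Complex x t)) >= c341 / (16 * K * (B / e) ^ 3)"
proof -
 define D where "D = B / e"
 have D: "D >= 1" unfolding D_def using B e by (simp add: pos_le_divide_eq)
 define \<tau> where "\<tau> = c341 / (16 * K * D ^ 4)"
 have KD: "16 * K * D ^ 4 >= 1"
 proof -
  have "1 * 1 <= K * D ^ 4" using K D by (intro mult_mono one_le_power) auto
  then show ?thesis by simp
 qed
 have \<tau>: "\<tau> > 0" "\<tau> <= 1" using c341 KD K D unfolding \<tau>_def
  by (auto intro!: divide_pos_pos simp: divide_le_eq_1)
 have eqD: "c341 / (16 * K * (B / e) ^ 3) = D * \<tau>"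
  using D by (simp add: \<tau>_def D_def[symmetric] power_numeral_reduce)
 have big: "norm (Lc f (Complex y t)) >= 2 * D * \<tau>" if y: "1 + \<tau> <= y" "y <= 2" for y
 proof -
  have y1: "y > 1" using y \<tau> by simp
  have eqs: "Complex y t + \<i> * of_real (Im (Complex y t)) = Complex y (2 * t)" by (simp add: complex_eq_iff)
  have "(2 * D * \<tau>) ^ 4 = c341 * \<tau> ^ 3 / K"
   unfolding \<tau>_def using K D by (simp add: power_numeral_reduce field_simps)
  also have "... <= c341 * (y - 1) ^ 3 / K"
   using y \<tau> K c341 by (intro divide_right_mono mult_left_mono power_mono) auto
  also have "... = (Re (Complex y t) - 1) ^ 3 / (40 ^ 8 * 729 * K)" by (simp add: c341_def)
  also have "... <= norm (dser f (Complex y t)) ^ 4"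
   using K(1)[OF y1 y(2)] K(2) y y1 by (intro dser_lower_four[OF f]) (auto simp: eqs[simplified])
  also have "dser f (Complex y t) = Lc f (Complex y t)"
   using Lc_eq_dser[OF q _ cmult_subpoly[OF f], of "Complex y t"] y1 by simp
  finally have "(2 * D * \<tau>) ^ Suc 3 <= norm (Lc f (Complex y t)) ^ Suc 3" by simp
  then show ?thesis by (rule power_le_imp_le_base) simp
 qed
 show ?thesis
 proof (cases "1 + \<tau> <= x")
  case True
  have "D * \<tau> <= 2 * D * \<tau>" using D \<tau> by simp
  then show ?thesis using big[OF True x(2)] eqD by simp
 next
  case False
  have "norm (Lc f (Complex (1 + \<tau>) t) - Lc f (Complex x t)) <= B / e * norm (Complex (1 + \<tau>) t - Complex x t)"
   using \<tau> x by (intro halfplane_lipschitz[OF Lc_holomorphic[OF q] e B(1)]) auto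
  also have "norm (Complex (1 + \<tau>) t - Complex x t) = 1 + \<tau> - x"
  proof -
   have "Complex (1 + \<tau>) t - Complex x t = of_real (1 + \<tau> - x)" by (simp add: complex_eq_iff)
   then show ?thesis using False by (simp only: norm_of_real)
  qed
  also have "B / e * (1 + \<tau> - x) <= D * \<tau>" unfolding D_def[symmetric] using x D by (intro mult_left_mono) auto
  finally have "norm (Lc f (Complex (1 + \<tau>) t) - Lc f (Complex x t)) <= D * \<tau>" .
  moreover have "norm (Lc f (Complex (1 + \<tau>) t)) >= 2 * D * \<tau>" using \<tau> by (intro big) auto
  moreover have "norm (Lc f (Complex (1 + \<tau>) t)) <= norm (Lc f (Complex (1 + \<tau>) t) - Lc f (Complex x t)) + norm (Lc f (Complex x t))"
   by (metis diff_add_cancel norm_triangle_ineq)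
  ultimately show ?thesis using eqD by linarith
 qed
qed

text \<open>\<xi>^2 is here the indicator of coprimality to q. Subtracting its mean k = \<phi>(q)/q
  leaves a periodic function with bounded partial sums, and k zeta(s) contributes the pole term 1 /
  |Im s|.\<close>

lemma principal_dser_bound:
 assumes d: "dchar q \<xi>" and sq: "\<And>n. coprime n q ==> \<xi> n ^ 2 = 1"
  and s: "1 < Re s" "Re s <= 3" "Im s \<noteq> 0" and e: "0 < e" "e <= 1/4"
 shows "norm (dser (%n. \<xi> n ^ 2) s) <= (7 + 4 / e) * (real q * (2 + \<bar>Im s\<bar>)) powr (2 * e) + 1 / \<bar>Im s\<bar> + 2 * ln (2 + \<bar>Im s\<bar>) + 8"
proof -
 have q: "q > 0" using dcharD(1)[OF d] .
 define f where "f = (%n. \<xi> n ^ 2)"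
 define k where "k = real (card {n\<in>{..<q}. coprime n q}) / real q"
 define g where "g = (%n. f n - of_real k)"
 have f: "f n = of_real (if coprime n q then 1 else 0)" for n
  using sq[of n] dcharD(5)[OF d, of n] by (auto simp: f_def)
 have "card {n\<in>{..<q}. coprime n q} <= card {..<q}" by (rule card_mono) auto
 then have k: "0 <= k" "k <= 1" using q by (auto simp: k_def)
 have gper: "g (n + q) = g n" for n using dcharD(4)[OF d, of n] by (simp add: g_def f_def)
 have "(\<Sum>n<q. f n) = of_real (\<Sum>n<q. if coprime n q then 1 else 0)" unfolding f by simp
 also have "(\<Sum>n<q. if coprime n q then 1 else 0) = real (card {n\<in>{..<q}. coprime n q})"
  by (simp add: sum.If_cases Int_def)
 finally have "(\<Sum>n<q. f n) = of_real (real q * k)" using q by (simp add: k_def)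
 then have gzero: "(\<Sum>n<q. g n) = 0" by (simp add: g_def sum_subtractf)
 have gle: "norm (g n) <= 1" for n
 proof -
  have "g n = of_real ((if coprime n q then 1 else 0) - k)" by (simp add: g_def f)
  then have "norm (g n) = \<bar>(if coprime n q then 1 else 0) - k\<bar>" by (metis norm_of_real)
  then show ?thesis using k by auto
 qed
 have gsum: "norm (\<Sum>n=1..N. g n) <= real q" for N by (rule periodic_sum_bound1[OF gper gzero gle q])
 have gsp: "subpoly g" by (rule subpoly_bounded[OF gle])
 have "dser f s = dser g s + of_real k * zeta_dser s"
 proof -
  have S1: "summable (%n. g n * of_nat n powr (-s))" by (rule subpoly_summable[OF gsp s(1)])
  have S2: "summable (%n. 1 * of_nat n powr (-s) :: complex)" by (rule subpoly_summable[OF cmult_subpoly[OF cmult_one] s(1)])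
  have "dser f s = (\<Sum>n. g n * of_nat n powr (-s) + of_real k * (1 * of_nat n powr (-s)))"
   unfolding dser_def by (simp add: g_def algebra_simps)
  also have "... = dser g s + (\<Sum>n. of_real k * (1 * of_nat n powr (-s)))"
   unfolding dser_def by (rule suminf_add[symmetric, OF S1 summable_mult[OF S2]])
  also have "(\<Sum>n. of_real k * (1 * of_nat n powr (-s))) = of_real k * zeta_dser s"
   unfolding dser_def by (rule suminf_mult[OF S2])
  finally show ?thesis .
 qed
 also have "dser g s = Lc g s" by (rule Lc_eq_dser[symmetric, OF gsum s(1) gsp])
 finally have "norm (dser f s) <= norm (Lc g s) + norm (of_real k * zeta_dser s)" by (metis norm_triangle_ineq)
 also have "norm (Lc g s) <= (7 + 4 / e) * (real q * (2 + \<bar>Im s\<bar>)) powr (2 * e)"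
  using q s e by (intro Lc_bound[OF gsum gle e]) auto
 also have "norm (of_real k * zeta_dser s) <= 1 * norm (zeta_dser s)"
  unfolding norm_mult norm_of_real using k by (intro mult_right_mono) auto
 also have "norm (zeta_dser s) <= norm (1 / (s - 1)) + norm (zeta0 s)"
  unfolding zeta_eq[OF s(1)] by (rule norm_triangle_ineq)
 also have "norm (1 / (s - 1)) <= 1 / \<bar>Im s\<bar>"
  using abs_Im_le_cmod[of "s - 1"] s(3) by (simp add: norm_divide frac_le)
 also have "norm (zeta0 s) <= 2 * ln (2 + \<bar>Im s\<bar>) + 8" by (rule zeta0_norm_log[OF s(1,2)])
 finally show ?thesis unfolding f_def by simp
qed

subsection \<open>Siegel's theorem\<close>

lemma sum_in_nonneg_Reals:
 "(\<And>i. i \<in> A ==> f i \<in> \<real>\<^sub>\<ge>\<^sub>0) ==> sum f A \<in> (\<real>\<^sub>\<ge>\<^sub>0 :: complex set)"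
 by (induction A rule: infinite_finite_induct) (auto intro: nonneg_Reals_add_I)

lemma dser_real_nonneg:
 assumes "subpoly (%n. of_real (k n))" "\<And>n. k n >= 0" "x > 1"
 shows "dser (%n. of_real (k n)) (of_real x) \<in> \<real>\<^sub>\<ge>\<^sub>0"
proof (rule dser_of_real[OF assms finite.emptyI])
 fix S assume S: "dser (%n. of_real (k n)) (of_real x) = of_real S" "(\<Sum>n\<in>{}. k n * real n powr (-x)) <= S"
 have "S >= 0" using S(2) by simp
 then show ?thesis unfolding S(1) nonneg_Reals_of_real_iff .
qed

text \<open>Each derivative brings down a factor -ln n, and (-1)^m makes the coefficients
  nonnegative again.\<close>

lemma dser_derivs_sign:
 assumes sp: "subpoly (%n. of_real (k n))" and k: "\<And>n. k n >= 0"
 shows "(-1) ^ m * (deriv ^^ m) (dser (%n. of_real (k n))) 2 \<in> \<real>\<^sub>\<ge>\<^sub>0"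
proof -
 have sp2: "subpoly (%n. (- of_real (ln (real n))) ^ m * of_real (k n))" by (rule subpoly_ln_power[OF sp])
 have "(-1) ^ m * (deriv ^^ m) (dser (%n. of_real (k n))) 2 = (-1) ^ m * dser (%n. (- of_real (ln (real n))) ^ m * of_real (k n)) 2"
  using dser_higher_deriv[OF sp, of 2 m] by simp
 also have "... = (\<Sum>n. (-1) ^ m * ((- of_real (ln (real n))) ^ m * of_real (k n) * of_nat n powr (-2)))"
  unfolding dser_def by (rule suminf_mult[symmetric]) (rule subpoly_summable[OF sp2], simp)
 also have "... = dser (%n. of_real (ln (real n) ^ m * k n)) 2"
 proof -
  have E: "(-1) ^ m * ((- of_real (ln (real n))) ^ m * of_real (k n) * of_nat n powr (-2)) = of_real (ln (real n) ^ m * k n) * (of_nat n powr (-2) :: complex)" for n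
  proof -
   have "(-1) ^ m * (- of_real (ln (real n))) ^ m = (of_real (ln (real n)) ^ m :: complex)"
    by (simp add: power_mult_distrib[symmetric])
   then show ?thesis by (simp only: mult.assoc[symmetric] of_real_mult of_real_power)
  qed
  show ?thesis unfolding dser_def by (simp only: E)
 qed
 also have "... \<in> \<real>\<^sub>\<ge>\<^sub>0"
 proof -
  have "subpoly (%n. of_real (ln (real n) ^ m * k n))"
   by (rule subpoly_mono[OF sp2]) (simp add: norm_mult norm_power)
  moreover have "ln (real n) ^ m * k n >= 0" for n
   using k[of n] by (cases "n = 0") (auto intro!: mult_nonneg_nonneg zero_le_power)
  ultimately show ?thesis using dser_real_nonneg[of "%n. ln (real n) ^ m * k n" 2] by simp
 qed
 finally show ?thesis .
qed

lemma higher_deriv_reciprocal: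
 "Re s > 1 ==> (deriv ^^ m) (%s. 1 / (s - 1)) s = (-1) ^ m * fact m / (s - 1) ^ Suc m"
proof (induction m arbitrary: s)
 case (Suc m)
 have s1: "s - 1 \<noteq> 0" using Suc.prems by auto
 have "(deriv ^^ Suc m) (%s. 1 / (s - 1)) s = deriv ((deriv ^^ m) (%s. 1 / (s - 1))) s" by simp
 also have "... = deriv (%s. (-1) ^ m * fact m / (s - 1) ^ Suc m) s"
 proof (rule deriv_cong_ev)
  have "\<forall>\<^sub>F z in nhds s. z \<in> {z. Re z > 1}"
   using Suc.prems by (intro eventually_nhds_in_open open_Re_gt) auto
  then show "\<forall>\<^sub>F z in nhds s. (deriv ^^ m) (%s. 1 / (s - 1)) z = (-1) ^ m * fact m / (z - 1) ^ Suc m"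
   by eventually_elim (use Suc.IH in simp)
 qed simp
 also have "... = (-1) ^ Suc m * fact (Suc m) / (s - 1) ^ Suc (Suc m)"
 proof (rule DERIV_imp_deriv)
  have D: "((%s. (s - 1) ^ Suc m) has_field_derivative of_nat (Suc m) * (s - 1) ^ m) (at s)"
   by (auto intro!: derivative_eq_intros simp del: power_Suc)
  have "((%s. (-1) ^ m * fact m / (s - 1) ^ Suc m) has_field_derivative
    (0 * (s - 1) ^ Suc m - (-1) ^ m * fact m * (of_nat (Suc m) * (s - 1) ^ m)) / ((s - 1) ^ Suc m * (s - 1) ^ Suc m)) (at s)"
   by (rule DERIV_divide[OF DERIV_const D]) (use s1 in simp)
  moreover have "(0 * (s - 1) ^ Suc m - (-1) ^ m * fact m * (of_nat (Suc m) * (s - 1) ^ m)) / ((s - 1) ^ Suc m * (s - 1) ^ Suc m)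
    = (-1) ^ Suc m * fact (Suc m) / (s - 1) ^ Suc (Suc m)"
  proof -
   have gen: "(0 * u ^ Suc m - a * (c * u ^ m)) / (u ^ Suc m * u ^ Suc m) = - (a * c) / u ^ Suc (Suc m)"
    if "u \<noteq> 0" for u a c :: complex
    using that by (simp add: field_simps)
   have "- ((-1) ^ m * fact m * of_nat (Suc m)) = ((-1) ^ Suc m * fact (Suc m) :: complex)" by (simp add: algebra_simps)
   then show ?thesis unfolding gen[OF s1] by (simp only:)
  qed
  ultimately show "((%s. (-1) ^ m * fact m / (s - 1) ^ Suc m) has_field_derivative (-1) ^ Suc m * fact (Suc m) / (s - 1) ^ Suc (Suc m)) (at s)"
   by (simp only:)
 qed
 finally show ?case .
qed simp

text \<open>From G' = -G K and Leibniz, a derivative of G at 2 is a combination of products of lower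
  derivatives of G with derivatives of K, all of alternating sign. The signs come from the
  nonnegative coefficients of the logarithmic derivative, so the coefficients of a product of up to
  four L-functions never have to be written down.\<close>

lemma higher_deriv_sign_of_log_deriv:
 assumes G: "G holomorphic_on {s. Re s > 1}" and sp: "subpoly (%n. of_real (k n))" and k: "\<And>n. k n >= 0"
  and ld: "\<And>s. Re s > 1 ==> deriv G s = - (G s * dser (%n. of_real (k n)) s)" and G2: "G 2 \<in> \<real>\<^sub>\<ge>\<^sub>0"
 shows "(-1) ^ m * (deriv ^^ m) G 2 \<in> \<real>\<^sub>\<ge>\<^sub>0"
proof (induction m rule: less_induct)
 case (less m)
 show ?case
 proof (cases m)
  case (Suc l)
  define K where "K = dser (%n. of_real (k n))"
  have K: "K holomorphic_on {s. Re s > 1}" unfolding K_def by (rule dser_holomorphic[OF sp])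
  have GK: "(%s. G s * K s) holomorphic_on {s. Re s > 1}" by (intro holomorphic_intros G K)
  have "(deriv ^^ m) G 2 = (deriv ^^ l) (deriv G) 2" unfolding Suc by (simp add: funpow_swap1)
  also have "... = (deriv ^^ l) (%s. - (G s * K s)) 2"
   by (rule higher_deriv_transform_within_open[OF _ _ open_Re_gt[of 1]])
     (use holomorphic_deriv[OF G open_Re_gt] holomorphic_on_minus[OF GK] ld in \<open>auto simp: K_def\<close>)
  also have "... = - (deriv ^^ l) (%s. G s * K s) 2"
   by (rule higher_deriv_uminus[OF GK open_Re_gt]) simp
  also have "(deriv ^^ l) (%s. G s * K s) 2 = (\<Sum>i=0..l. of_nat (l choose i) * (deriv ^^ i) G 2 * (deriv ^^ (l - i)) K 2)"
   by (rule higher_deriv_mult[OF G K open_Re_gt]) simp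
  finally have "(-1) ^ m * (deriv ^^ m) G 2 = (-1) ^ l * (\<Sum>i=0..l. of_nat (l choose i) * (deriv ^^ i) G 2 * (deriv ^^ (l - i)) K 2)"
   by (simp add: Suc)
  also have "... = (\<Sum>i=0..l. of_nat (l choose i) * (((-1) ^ i * (deriv ^^ i) G 2) * ((-1) ^ (l - i) * (deriv ^^ (l - i)) K 2)))"
   unfolding sum_distrib_left
  proof (rule sum.cong[OF refl])
   fix i assume "i \<in> {0..l}"
   then have "(-1) ^ l = ((-1) ^ i * (-1) ^ (l - i) :: complex)" by (simp add: power_add[symmetric])
   then show "(-1) ^ l * (of_nat (l choose i) * (deriv ^^ i) G 2 * (deriv ^^ (l - i)) K 2) = of_nat (l choose i) * (((-1) ^ i * (deriv ^^ i) G 2) * ((-1) ^ (l - i) * (deriv ^^ (l - i)) K 2))"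
    by (simp only: mult_ac)
  qed
  also have "... \<in> \<real>\<^sub>\<ge>\<^sub>0"
  proof (rule sum_in_nonneg_Reals)
   fix i assume "i \<in> {0..l}"
   then have 1: "(-1) ^ i * (deriv ^^ i) G 2 \<in> \<real>\<^sub>\<ge>\<^sub>0" using less.IH[of i] Suc by simp
   have 2: "(-1) ^ (l - i) * (deriv ^^ (l - i)) K 2 \<in> \<real>\<^sub>\<ge>\<^sub>0" unfolding K_def by (rule dser_derivs_sign[OF sp k])
   have 3: "(of_nat (l choose i) :: complex) \<in> \<real>\<^sub>\<ge>\<^sub>0" by (simp add: complex_nonneg_Reals_iff)
   show "of_nat (l choose i) * (((-1) ^ i * (deriv ^^ i) G 2) * ((-1) ^ (l - i) * (deriv ^^ (l - i)) K 2)) \<in> \<real>\<^sub>\<ge>\<^sub>0"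
    by (rule nonneg_Reals_mult_I[OF 3 nonneg_Reals_mult_I[OF 1 2]])
  qed
  finally show ?thesis .
 qed (use G2 in simp)
qed

text \<open>Estermann's proof of Siegel's theorem. The function zeta P - \<rho>/(s - 1) is
  holomorphic in the disc around 2 reaching to 2/3, and its Taylor coefficients are, up to sign, b m
  - \<rho> with b m >= 0 and b 0 >= 1/256. Its real part at \<beta> is at most \<rho>/(1 - \<beta>)
  because P(\<beta>) >= 0. If \<rho> were too small, the contribution of b 0 alone would exceed
  this.\<close>

lemma estermann:
 assumes P: "P holomorphic_on {s. Re s > 0}" and B: "\<And>z. norm (2 - z) <= 4/3 ==> norm (P z) <= B" "B >= 1"
  and sp: "subpoly (%n. of_real (k n))" and k: "\<And>n. k n >= 0"
  and ld: "\<And>s. Re s > 1 ==> deriv (%s. zeta_dser s * P s) s = - (zeta_dser s * P s * dser (%n. of_real (k n)) s)"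
  and G2: "zeta_dser 2 * P 2 = of_real g" "g >= 1/256"
  and lam: "P 1 = of_real \<rho>" and \<beta>: "9/10 < \<beta>" "\<beta> < 1" and p: "P (of_real \<beta>) = of_real p" "p >= 0"
 shows "\<rho> >= (1 - \<beta>) / 1024 * (50000 * B) powr (- 6 * (1 - \<beta>))"
proof -
 define H where "H = (%s. zeta0 s * P s + (if s = 1 then deriv P 1 else (P s - P 1) / (s - 1)))"
 define G where "G = (%s. zeta_dser s * P s)"
 have "(%s. if s = 1 then deriv P 1 else (P s - P 1) / (s - 1)) holomorphic_on {s. Re s > 0}"
  by (rule pole_lemma_open[OF P open_Re_gt])
 then have H: "H holomorphic_on {s. Re s > 0}" unfolding H_def by (intro holomorphic_intros zeta0_holomorphic P)
 have near: "Re z >= 2/3" "norm z <= 10/3" if "norm (2 - z) <= 4/3" for z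
 proof -
  have "\<bar>2 - Re z\<bar> <= 4/3" using abs_Re_le_cmod[of "2 - z"] that by simp
  then show "Re z >= 2/3" by linarith
  have "norm z <= norm (2::complex) + norm (2 - z)" by (metis norm_minus_commute norm_triangle_sub add.commute)
  then show "norm z <= 10/3" using that by simp
 qed
 have sub: "cball 2 (4/3) \<subseteq> {s. Re s > 0}" using near by (force simp: dist_norm)
 \<comment> \<open>15 = 9 + 6: on the circle zeta0 is at most 9, and the difference quotient is at
   most 2 B / (1/3).\<close>
 have Hb: "norm ((deriv ^^ m) H 2) <= fact m * (15 * B) / (4/3) ^ m" for m
 proof (rule Cauchy_inequality)
  show "H holomorphic_on ball 2 (4/3)" using H sub ball_subset_cball holomorphic_on_subset by blast
  show "continuous_on (cball 2 (4/3)) H" using H sub holomorphic_on_imp_continuous_on continuous_on_subset by blast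
  fix z :: complex assume z: "norm (2 - z) = 4/3"
  have "norm (2 - z) <= norm (z - 1) + 1" using norm_triangle_ineq[of "1 - z" 1] by (simp add: norm_minus_commute)
  then have z1: "norm (z - 1) >= 1/3" using z by simp
  then have zn1: "z \<noteq> 1" by auto
  have "norm (zeta0 z) <= norm z * (1 + 1 / Re z)" using near(1)[of z] z by (intro zeta0_norm) simp
  also have "... <= 10/3 * (1 + 1 / (2/3))"
   using near[of z] z by (intro mult_mono add_mono divide_left_mono) auto
  finally have "norm (zeta0 z) <= 9" by simp
  then have "norm (zeta0 z * P z) <= 9 * B" unfolding norm_mult using B(1)[of z] z by (intro mult_mono) auto
  moreover have "norm ((P z - P 1) / (z - 1)) <= (B + B) / (1/3)"
   unfolding norm_divide
  proof (rule frac_le)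
   have "norm (P z - P 1) <= norm (P z) + norm (P 1)" by (rule norm_triangle_ineq4)
   then show "norm (P z - P 1) <= B + B" using B(1)[of z] B(1)[of 1] z by simp
  qed (use B z1 in auto)
  ultimately have "norm (zeta0 z * P z) + norm ((P z - P 1) / (z - 1)) <= 15 * B" by simp
  then show "norm (H z) <= 15 * B" unfolding H_def using zn1
   norm_triangle_ineq[of "zeta0 z * P z" "(P z - P 1) / (z - 1)"] by simp
 qed simp
 have Ghol: "G holomorphic_on {s. Re s > 1}" unfolding G_def
  using P by (intro holomorphic_intros dser_holomorphic cmult_subpoly cmult_one) (auto elim!: holomorphic_on_subset)
 define b where "b = (%m. Re ((-1) ^ m * (deriv ^^ m) G 2) / fact m)"
 have Gsign: "(-1) ^ m * (deriv ^^ m) G 2 \<in> \<real>\<^sub>\<ge>\<^sub>0" for m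
  using G2 ld by (intro higher_deriv_sign_of_log_deriv[OF Ghol sp k]) (auto simp: G_def)
 have bnn: "b m >= 0" for m
 proof -
  have "Re ((-1) ^ m * (deriv ^^ m) G 2) >= 0" using Gsign[of m] by (simp only: complex_nonneg_Reals_iff)
  then show ?thesis unfolding b_def by (intro divide_nonneg_nonneg) auto
 qed
 have b0: "b 0 >= 1/256" using G2 by (simp add: b_def G_def)
 define h where "h = (%m. (-1) ^ m * ((deriv ^^ m) H 2 / fact m))"
 have Hder: "(deriv ^^ m) H 2 = (deriv ^^ m) G 2 - of_real \<rho> * ((-1) ^ m * fact m)" for m
 proof -
  have rec: "(%s. 1 / (s - 1) :: complex) holomorphic_on {s. Re s > 1}" by (intro holomorphic_intros) auto
  have rec2: "(%s. of_real \<rho> * (1 / (s - 1)) :: complex) holomorphic_on {s. Re s > 1}" by (intro holomorphic_intros rec)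
  have "(deriv ^^ m) H 2 = (deriv ^^ m) (%s. G s - of_real \<rho> * (1 / (s - 1))) 2"
  proof (rule higher_deriv_transform_within_open[OF _ _ open_Re_gt[of 1]])
   show "H holomorphic_on {s. Re s > 1}" by (rule holomorphic_on_subset[OF H]) auto
   show "(%s. G s - of_real \<rho> * (1 / (s - 1))) holomorphic_on {s. Re s > 1}" by (intro holomorphic_intros Ghol rec)
   fix z :: complex assume z: "z \<in> {s. Re s > 1}"
   then have "z \<noteq> 1" by auto
   then show "H z = G z - of_real \<rho> * (1 / (z - 1))"
    using z zeta_eq[of z] by (simp add: H_def G_def lam algebra_simps diff_divide_distrib)
  qed simp
  also have "... = (deriv ^^ m) G 2 - (deriv ^^ m) (%s. of_real \<rho> * (1 / (s - 1))) 2"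
   by (rule higher_deriv_diff[OF Ghol rec2 open_Re_gt]) simp
  also have "(deriv ^^ m) (%s. of_real \<rho> * (1 / (s - 1))) 2 = of_real \<rho> * (deriv ^^ m) (%s. 1 / (s - 1)) (2::complex)"
   by (rule higher_deriv_cmult[OF rec _ open_Re_gt]) simp
  also have "(deriv ^^ m) (%s. 1 / (s - 1)) (2::complex) = (-1) ^ m * fact m" using higher_deriv_reciprocal[of 2 m] by simp
  finally show ?thesis .
 qed
 have hre: "Re (h m) = b m - \<rho>" for m
 proof -
  have "h m = ((-1) ^ m * (deriv ^^ m) G 2) / fact m - of_real \<rho>"
   unfolding h_def Hder by (simp add: field_simps power_mult_distrib[symmetric])
  moreover have "Re (((-1) ^ m * (deriv ^^ m) G 2) / fact m) = b m" unfolding b_def by (metis Re_divide_of_real of_real_fact)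
  ultimately show ?thesis by simp
 qed
 have hnorm: "norm (h m) <= 15 * B * (3/4) ^ m" for m
 proof -
  have "norm (h m) = norm ((deriv ^^ m) H 2) / fact m" by (simp add: h_def norm_mult norm_power norm_divide)
  also have "... <= (fact m * (15 * B) / (4/3) ^ m) / fact m" by (intro divide_right_mono Hb) simp
  also have "... = 15 * B * (3/4) ^ m" by (simp add: power_divide)
  finally show ?thesis .
 qed
 define x where "x = 2 - \<beta>"
 have x: "1 < x" "x < 11/10" "x - 1 = 1 - \<beta>" using \<beta> by (auto simp: x_def)
 have "(%m. (deriv ^^ m) H 2 / fact m * (of_real \<beta> - 2) ^ m) sums H (of_real \<beta>)"
 proof (rule holomorphic_power_series)
  show "H holomorphic_on ball 2 (4/3)" using H sub ball_subset_cball holomorphic_on_subset by blast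
  have "dist 2 (of_real \<beta> :: complex) = \<bar>2 - \<beta>\<bar>" by (metis dist_of_real of_real_numeral dist_real_def)
  then show "of_real \<beta> \<in> ball (2::complex) (4/3)" using \<beta> by simp
 qed
 moreover have "(deriv ^^ m) H 2 / fact m * (of_real \<beta> - 2) ^ m = h m * of_real (x ^ m)" for m
 proof -
  have "(of_real \<beta> - 2 :: complex) = -1 * of_real x" by (simp add: x_def)
  then have "(of_real \<beta> - 2 :: complex) ^ m = (-1) ^ m * of_real x ^ m" by (simp only: power_mult_distrib)
  then show ?thesis by (simp add: h_def)
 qed
 ultimately have "(%m. h m * of_real (x ^ m)) sums H (of_real \<beta>)" by simp
 then have "(%m. Re (h m * of_real (x ^ m))) sums Re (H (of_real \<beta>))" by (rule sums_Re)
 then have Hs: "(%m. (b m - \<rho>) * x ^ m) sums Re (H (of_real \<beta>))"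
  by (simp only: times_complex.sel Re_complex_of_real Im_complex_of_real mult_zero_right diff_zero hre)
 \<comment> \<open>1/(1 - \<beta>) >= 10 outweighs Re zeta0(\<beta>) <= 2, so the terms containing p
   >= 0 are in total not positive.\<close>
 have Hup: "Re (H (of_real \<beta>)) <= \<rho> / (1 - \<beta>)"
 proof -
  have "norm (zeta0 (of_real \<beta>)) <= \<beta> * (1 + 1 / \<beta>)" using zeta0_norm[of "of_real \<beta>"] \<beta> by simp
  also have "... = \<beta> + 1" using \<beta> by (simp add: field_simps)
  finally have z2: "Re (zeta0 (of_real \<beta>)) <= 2" using \<beta> complex_Re_le_cmod[of "zeta0 (of_real \<beta>)"] by linarith
  have inv: "1 / (1 - \<beta>) >= 10" using \<beta> by (simp add: pos_le_divide_eq)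
  have b1: "(of_real \<beta> :: complex) \<noteq> 1" using \<beta> by (metis less_irrefl of_real_1 of_real_eq_iff)
  have "H (of_real \<beta>) = of_real p * zeta0 (of_real \<beta>) + of_real ((p - \<rho>) / (\<beta> - 1))"
   using b1 by (simp add: H_def p lam mult.commute)
  then have "Re (H (of_real \<beta>)) = p * Re (zeta0 (of_real \<beta>)) + (p - \<rho>) / (\<beta> - 1)" by simp
  also have "(p - \<rho>) / (\<beta> - 1) = \<rho> / (1 - \<beta>) - p * (1 / (1 - \<beta>))"
  proof -
   have "(p - \<rho>) / (\<beta> - 1) = - (p - \<rho>) / (1 - \<beta>)" by (metis minus_diff_eq minus_divide_divide)
   then show ?thesis by (simp add: diff_divide_distrib)
  qed
  also have "p * Re (zeta0 (of_real \<beta>)) + (\<rho> / (1 - \<beta>) - p * (1 / (1 - \<beta>))) <= \<rho> / (1 - \<beta>)"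
   using mult_left_mono[OF z2 p(2)] mult_left_mono[OF inv p(2)] p(2) by linarith
  finally show ?thesis .
 qed
 \<comment> \<open>The tail decays like (3/4)^m (11/10)^m = (33/40)^m, and 33/40 <= exp(-7/40). As 6
   times 7/40 exceeds 1, this many terms bring the tail below 1/512, half of the lower bound for b
   0.\<close>
 define m0 where "m0 = nat \<lceil>6 * ln (50000 * B)\<rceil> + 1"
 have lnB: "ln (50000 * B) > 0" using B by simp
 have m0: "m0 >= 1" "real m0 >= 6 * ln (50000 * B)" "real m0 <= 6 * ln (50000 * B) + 2"
  using lnB unfolding m0_def by linarith+
 define y where "y = (33/40 :: real)"
 have tail_le: "\<bar>(b m - \<rho>) * x ^ m\<bar> <= 15 * B * y ^ m" for m
 proof -
  have "\<bar>b m - \<rho>\<bar> <= 15 * B * (3/4) ^ m" using hnorm[of m] hre[of m] abs_Re_le_cmod[of "h m"] by simp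
  then have "\<bar>b m - \<rho>\<bar> * x ^ m <= (15 * B * (3/4) ^ m) * (11/10) ^ m"
   using x by (intro mult_mono power_mono) auto
  also have "... = 15 * B * y ^ m" by (simp add: y_def power_mult_distrib[symmetric])
  finally show ?thesis using x by (simp add: abs_mult)
 qed
 have ysum: "(%i. 15 * B * y ^ (i + m0)) sums (15 * B * (y ^ m0 * (40/7)))"
 proof -
  have "(%i. y ^ i) sums (1 / (1 - y))" by (rule geometric_sums) (simp add: y_def)
  from sums_mult[OF this, of "15 * B * y ^ m0"] show ?thesis by (simp add: y_def power_add mult_ac)
 qed
 have split: "Re (H (of_real \<beta>)) = (\<Sum>i. (b (i + m0) - \<rho>) * x ^ (i + m0)) + (\<Sum>m<m0. (b m - \<rho>) * x ^ m)"
  using suminf_split_initial_segment[OF sums_summable[OF Hs], of m0] sums_unique[OF Hs] by simp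
 have tail: "(\<Sum>i. (b (i + m0) - \<rho>) * x ^ (i + m0)) >= - (15 * B * (y ^ m0 * (40/7)))"
 proof -
  have "norm (\<Sum>i. (b (i + m0) - \<rho>) * x ^ (i + m0)) <= (\<Sum>i. 15 * B * y ^ (i + m0))"
   using tail_le by (intro norm_suminf_le sums_summable[OF ysum]) auto
  then show ?thesis using sums_unique[OF ysum] by simp
 qed
 have ysmall: "15 * B * (y ^ m0 * (40/7)) <= 1/512"
 proof -
  have "y <= exp (-(7/40))" using exp_ge_add_one_self[of "-(7/40)"] by (simp add: y_def)
  then have "y ^ m0 <= exp (-(7/40)) ^ m0" by (intro power_mono) (auto simp: y_def)
  also have "... = exp (- (7/40) * real m0)" by (simp add: exp_of_nat_mult[symmetric] mult.commute)
  also have "... <= exp (- ln (50000 * B))"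
  proof -
   have "7/40 * real m0 >= 7/40 * (6 * ln (50000 * B))" using m0 by (intro mult_left_mono) auto
   then show ?thesis using lnB by simp
  qed
  also have "... = 1 / (50000 * B)" using B by (simp add: exp_minus inverse_eq_divide)
  finally have "15 * B * (y ^ m0 * (40/7)) <= 15 * B * (1 / (50000 * B) * (40/7))" using B by (intro mult_left_mono mult_right_mono) auto
  also have "... <= 1/512" using B by simp
  finally show ?thesis .
 qed
 have head: "(\<Sum>m<m0. (b m - \<rho>) * x ^ m) >= 1/256 - \<rho> * ((x ^ m0 - 1) / (x - 1))"
 proof -
  have "(\<Sum>m<m0. (b m - \<rho>) * x ^ m) = (\<Sum>m<m0. b m * x ^ m) - \<rho> * (\<Sum>m<m0. x ^ m)"
   by (simp add: left_diff_distrib sum_subtractf sum_distrib_left)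
  moreover have "(\<Sum>m<m0. x ^ m) = (x ^ m0 - 1) / (x - 1)" using x by (intro geometric_sum) auto
  moreover have "b 0 * x ^ 0 <= (\<Sum>m<m0. b m * x ^ m)"
   using m0 bnn x by (intro member_le_sum) auto
  ultimately show ?thesis using b0 by simp
 qed
 have "1/512 <= \<rho> / (1 - \<beta>) * x ^ m0"
 proof -
  have "1/256 - \<rho> * ((x ^ m0 - 1) / (x - 1)) - 1/512 <= \<rho> / (1 - \<beta>)"
   using Hup split tail ysmall head by linarith
  moreover have "\<rho> * ((x ^ m0 - 1) / (x - 1)) = \<rho> / (1 - \<beta>) * x ^ m0 - \<rho> / (1 - \<beta>)"
   using x by (simp add: right_diff_distrib diff_divide_distrib)
  ultimately show ?thesis by linarith
 qed
 then have l1: "\<rho> >= (1 - \<beta>) / 512 / x ^ m0" using \<beta> x by (simp add: field_simps)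
 have "x ^ m0 <= exp (1 - \<beta>) ^ m0" using x exp_ge_add_one_self[of "1 - \<beta>"] by (intro power_mono) auto
 also have "... = exp ((1 - \<beta>) * real m0)" by (simp add: exp_of_nat_mult[symmetric] mult.commute)
 also have "... <= exp ((1 - \<beta>) * (6 * ln (50000 * B) + 2))" using m0 \<beta> by (auto intro!: mult_left_mono)
 also have "... = exp (6 * (1 - \<beta>) * ln (50000 * B)) * exp (2 * (1 - \<beta>))" by (simp add: exp_add[symmetric] algebra_simps)
 also have "exp (6 * (1 - \<beta>) * ln (50000 * B)) = (50000 * B) powr (6 * (1 - \<beta>))" using B by (simp add: powr_def)
 also have "(50000 * B) powr (6 * (1 - \<beta>)) * exp (2 * (1 - \<beta>)) <= (50000 * B) powr (6 * (1 - \<beta>)) * 2"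
 proof (intro mult_left_mono)
  have "1/2 <= 1 + - (2 * (1 - \<beta>))" using \<beta> by simp
  then have "exp (- (2 * (1 - \<beta>))) >= 1/2" using exp_ge_add_one_self order_trans by blast
  then have "exp (2 * (1 - \<beta>)) * (1/2) <= exp (2 * (1 - \<beta>)) * exp (- (2 * (1 - \<beta>)))" by (intro mult_left_mono) auto
  also have "... = 1" by (rule exp_minus_inverse)
  finally show "exp (2 * (1 - \<beta>)) <= 2" by simp
 qed simp
 finally have "x ^ m0 <= (50000 * B) powr (6 * (1 - \<beta>)) * 2" .
 then have "(1 - \<beta>) / 512 / ((50000 * B) powr (6 * (1 - \<beta>)) * 2) <= (1 - \<beta>) / 512 / x ^ m0"
  using \<beta> x B by (intro divide_left_mono mult_pos_pos) auto
 also have "(1 - \<beta>) / 512 / ((50000 * B) powr (6 * (1 - \<beta>)) * 2) = (1 - \<beta>) / 1024 * (50000 * B) powr (- 6 * (1 - \<beta>))"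
 proof -
  have "- 6 * (1 - \<beta>) = - (6 * (1 - \<beta>))" by simp
  then show ?thesis by (simp only: powr_minus_divide) simp
 qed
 finally show ?thesis using l1 by (rule order_trans)
qed

lemma dser_add:
 assumes "subpoly a" "subpoly b" "Re s > 1"
 shows "dser (%n. a n + b n) s = dser a s + dser b s"
 unfolding dser_def distrib_right
 by (rule suminf_add[symmetric]) (use assms subpoly_summable in auto)

lemma subpoly_add:
 assumes "subpoly a" "subpoly b"
 shows "subpoly (%n. a n + b n)"
 unfolding subpoly_def
proof (intro allI impI)
 fix e :: real assume "e > 0"
 then have "summable (%n. norm (a n) * real n powr (-1-e) + norm (b n) * real n powr (-1-e))"
  using assms by (intro summable_add) (auto simp: subpoly_def)
 then show "summable (%n. norm (a n + b n) * real n powr (-1-e))"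
 proof (rule summable_comparison_test')
  fix n
  have "norm (a n + b n) * real n powr (-1-e) <= (norm (a n) + norm (b n)) * real n powr (-1-e)"
   by (intro mult_right_mono norm_triangle_ineq) auto
  then show "norm (norm (a n + b n) * real n powr (-1-e)) <= norm (a n) * real n powr (-1-e) + norm (b n) * real n powr (-1-e)"
   by (simp add: distrib_right)
 qed
qed

lemma zeta_log_deriv:
 assumes "Re s > 1"
 shows "(zeta_dser has_field_derivative - (zeta_dser s * dser (%n. mangoldt n) s)) (at s)"
 using dser_deriv[OF cmult_subpoly[OF cmult_one] assms] cmult_log_deriv[OF cmult_one assms]
 by (simp add: DERIV_imp_deriv mult.commute)

lemma Lc_log_deriv:
 assumes q: "\<And>N. norm (\<Sum>k=1..N. f k) <= q" and f: "cmult f" and s: "Re s > 1"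
 shows "(Lc f has_field_derivative - (Lc f s * dser (%n. f n * mangoldt n) s)) (at s)"
proof (rule has_field_derivative_transform_within_open[OF _ open_Re_gt[of 1]])
 have "(dser f has_field_derivative - (dser f s * dser (%n. f n * mangoldt n) s)) (at s)"
  using dser_deriv[OF cmult_subpoly[OF f] s] cmult_log_deriv[OF f s]
  by (simp add: DERIV_imp_deriv mult.commute)
 then show "(dser f has_field_derivative - (Lc f s * dser (%n. f n * mangoldt n) s)) (at s)"
  using Lc_eq_dser[OF q s cmult_subpoly[OF f]] by simp
 show "dser f z = Lc f z" if "z \<in> {s. Re s > 1}" for z
  using Lc_eq_dser[OF q _ cmult_subpoly[OF f], of z] that by simp
qed (use s in simp)

lemma log_deriv_mult:
 assumes "(F has_field_derivative - (F s * dser a s)) (at s)" "(G has_field_derivative - (G s * dser b s)) (at s)"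
  "subpoly a" "subpoly b" "Re s > 1"
 shows "((%s. F s * G s) has_field_derivative - (F s * G s * dser (%n. a n + b n) s)) (at s)"
proof -
 have "((%s. F s * G s) has_field_derivative (- (F s * dser a s) * G s + - (G s * dser b s) * F s)) (at s)"
  by (rule DERIV_mult[OF assms(1,2)])
 moreover have "- (F s * dser a s) * G s + - (G s * dser b s) * F s = - (F s * G s * dser (%n. a n + b n) s)"
  unfolding dser_add[OF assms(3-5)] by (simp add: algebra_simps)
 ultimately show ?thesis by (simp only:)
qed

lemma Lc_crude_bound:
 assumes "nonprincipal q \<xi>" "norm (2 - z) <= 4/3"
 shows "norm (Lc \<xi> z) <= 9 * real q"
proof -
 have "\<bar>2 - Re z\<bar> <= 4/3" using abs_Re_le_cmod[of "2 - z"] assms(2) by simp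
 then have re: "Re z >= 2/3" by linarith
 have "norm z <= norm (2::complex) + norm (2 - z)" by (metis norm_minus_commute norm_triangle_sub add.commute)
 then have nz: "norm z <= 10/3" using assms(2) by simp
 have "norm (Lc \<xi> z) <= real q * norm z * (1 + 1 / Re z)"
  using re by (intro Lc_norm nonprincipal_sum_bound[OF assms(1)]) auto
 also have "... <= real q * (10/3) * (1 + 1 / (2/3))"
  using re nz by (intro mult_mono add_mono divide_left_mono) auto
 finally show ?thesis by simp
qed

lemma Lc_real:
 assumes np: "nonprincipal q \<xi>" and rl: "\<And>n. \<xi> n \<in> \<real>" and x: "x > 0"
 shows "Lc \<xi> (of_real x) = of_real (Re (Lc \<xi> (of_real x)))"
proof -
 have "Lc \<xi> (of_real x) \<in> \<real>"
 proof (rule Lim_in_closed_set[OF closed_complex_Reals _ _ Lc_sums[OF nonprincipal_sum_bound[OF np]]])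
  have "of_nat n powr (- of_real x) = (of_real (real n powr (-x)) :: complex)" for n
   using powr_of_real[of "real n" "-x"] by simp
  then show "\<forall>\<^sub>F N in sequentially. (\<Sum>n=1..N. \<xi> n * of_nat n powr - of_real x) \<in> \<real>"
   using rl by (intro always_eventually allI sum_in_Reals Reals_mult) auto
 qed (use x in auto)
 then show ?thesis by (simp add: complex_is_Real_iff complex_eq_iff)
qed

lemma L_two_lower:
 assumes "nonprincipal q \<xi>"
 shows "Re (Lc \<xi> 2) >= 1/4"
proof -
 note c = dchar_cmult[OF nonprincipal_dchar[OF assms]]
 have "\<bar>Re (dser \<xi> 2 - 1)\<bar> <= 3/4" using dser_at_2[OF c] abs_Re_le_cmod order_trans by blast
 then have "Re (dser \<xi> 2) >= 1/4" unfolding minus_complex.sel one_complex.sel by linarith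
 then show ?thesis using Lc_eq_dser[OF nonprincipal_sum_bound[OF assms] _ cmult_subpoly[OF c], of 2] by simp
qed

lemma zeta_two: "zeta_dser 2 = of_real (Re (zeta_dser 2))" "Re (zeta_dser 2) >= 1/4"
proof -
 have "subpoly (%n. of_real ((%_::nat. 1) n))" using cmult_subpoly[OF cmult_one] by simp
 from dser_real_nonneg[OF this, of 2] have "zeta_dser 2 \<in> \<real>\<^sub>\<ge>\<^sub>0" by simp
 then show "zeta_dser 2 = of_real (Re (zeta_dser 2))"
  by (simp add: complex_nonneg_Reals_iff complex_eq_iff)
 have "\<bar>Re (zeta_dser 2 - 1)\<bar> <= 3/4" using dser_at_2[OF cmult_one] abs_Re_le_cmod order_trans by blast
 then show "Re (zeta_dser 2) >= 1/4" unfolding minus_complex.sel one_complex.sel by linarith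
qed

lemma mangoldt_subpoly: "subpoly (%n. mangoldt n)"
 using cmult_mangoldt_subpoly[OF cmult_one] by simp

text \<open>Here P is L itself. L has no zero between 1 - \<eta> and 1, none at 1 and none beyond,
  and it is positive at 2; by the intermediate value theorem it is positive at \<beta> = 1 -
  \<eta>/2, as \<open>estermann\<close> asks.\<close>

lemma siegel_no_zero:
 assumes np: "nonprincipal q \<xi>" and rl: "\<And>n. \<xi> n \<in> \<real>" and \<eta>: "0 < \<eta>" "\<eta> <= 1/10"
  and nz: "\<And>\<beta>. 1 - \<eta> < \<beta> ==> \<beta> < 1 ==> Lc \<xi> (of_real \<beta>) \<noteq> 0"
 shows "norm (Lc \<xi> 1) >= \<eta> / 2048 * (450000 * real q) powr (- 3 * \<eta>)"
proof -
 note d = nonprincipal_dchar[OF np]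
 note c = dchar_cmult[OF d]
 note sb = nonprincipal_sum_bound[OF np]
 have q: "real q >= 1" using dcharD(1)[OF d] by simp
 define g where "g = (%n. Re (\<xi> n))"
 have xg: "\<xi> n = of_real (g n)" for n unfolding g_def by (rule real_values_trichotomy(2)[OF d rl])
 have gv: "g n \<in> {-1,0,1}" for n unfolding g_def by (rule real_values_trichotomy(1)[OF d rl])
 define \<beta> where "\<beta> = 1 - \<eta> / 2"
 have \<beta>: "1 - \<eta> < \<beta>" "\<beta> < 1" "9/10 < \<beta>" using \<eta> by (auto simp: \<beta>_def)
 note re = Lc_real[OF np rl]
 have pos: "Re (Lc \<xi> (of_real \<beta>)) > 0"
 proof (rule ccontr)
  assume "\<not> Re (Lc \<xi> (of_real \<beta>)) > 0"
  moreover have "continuous_on {\<beta>..2} (%x. Re (Lc \<xi> (of_real x)))"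
  proof (intro continuous_intros continuous_on_compose2[OF holomorphic_on_imp_continuous_on[OF Lc_holomorphic[OF sb]]])
   show "of_real ` {\<beta>..2} \<subseteq> {s::complex. 0 < Re s}" using \<beta> by auto
  qed
  moreover have "Re (Lc \<xi> (of_real 2)) >= 0" using L_two_lower[OF np] by simp
  ultimately obtain x where x: "\<beta> <= x" "x <= 2" "Re (Lc \<xi> (of_real x)) = 0"
   using IVT'[of "%x. Re (Lc \<xi> (of_real x))" \<beta> 0 2] \<beta> by auto
  have zero: "Lc \<xi> (of_real x) = 0" using re[of x] x \<beta> by simp
  consider "x < 1" | "x = 1" | "x > 1" by linarith
  then show False
  proof cases
   case 1
   then show False using nz[of x] zero x \<beta> by simp
  next
   case 2
   then show False using L_one_nonzero[OF np rl] zero by simp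
  next
   case 3
   then show False using Lc_eq_dser[OF sb _ cmult_subpoly[OF c], of "of_real x"] dser_nonzero[OF c, of "of_real x"] zero by simp
  qed
 qed
 define k where "k = (%n. mangoldt n * (1 + g n))"
 have keq: "(%n. complex_of_real (k n)) = (%n. mangoldt n + \<xi> n * mangoldt n)"
  by (simp add: k_def fun_eq_iff xg algebra_simps)
 have kn: "k n >= 0" for n using gv[of n] unfolding k_def by (intro mult_nonneg_nonneg mangoldt_nonneg) auto
 have ksp: "subpoly (%n. of_real (k n))" unfolding keq by (intro subpoly_add mangoldt_subpoly cmult_mangoldt_subpoly[OF c])
 have "Re (Lc \<xi> (of_real 1)) >= (1 - \<beta>) / 1024 * (50000 * (9 * real q)) powr (- 6 * (1 - \<beta>))"
 proof (rule estermann[where P = "Lc \<xi>" and k = k and p = "Re (Lc \<xi> (of_real \<beta>))" and g = "Re (zeta_dser 2) * Re (Lc \<xi> 2)"])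
  show "Lc \<xi> holomorphic_on {s. 0 < Re s}" by (rule Lc_holomorphic[OF sb])
  show "norm (Lc \<xi> z) <= 9 * real q" if "norm (2 - z) <= 4/3" for z by (rule Lc_crude_bound[OF np that])
  show "1 <= 9 * real q" using q by simp
  show "deriv (%s. zeta_dser s * Lc \<xi> s) s = - (zeta_dser s * Lc \<xi> s * dser (%n. complex_of_real (k n)) s)" if "Re s > 1" for s
   unfolding keq
   by (rule DERIV_imp_deriv[OF log_deriv_mult[OF zeta_log_deriv[OF that] Lc_log_deriv[OF sb c that] mangoldt_subpoly cmult_mangoldt_subpoly[OF c] that]])
  show "zeta_dser 2 * Lc \<xi> 2 = of_real (Re (zeta_dser 2) * Re (Lc \<xi> 2))"
   using zeta_two(1) re[of 2] by simp
  have "1/4 * (1/4) <= Re (zeta_dser 2) * Re (Lc \<xi> 2)"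
   by (intro mult_mono zeta_two(2) L_two_lower[OF np]) (use zeta_two(2) in auto)
  then show "1/256 <= Re (zeta_dser 2) * Re (Lc \<xi> 2)" by simp
  show "Lc \<xi> 1 = of_real (Re (Lc \<xi> (of_real 1)))" using re[of 1] by simp
  show "Lc \<xi> (of_real \<beta>) = of_real (Re (Lc \<xi> (of_real \<beta>)))" using re[of \<beta>] \<beta> by simp
 qed (use ksp kn \<beta> pos in auto)
 then have "Re (Lc \<xi> 1) >= \<eta> / 2048 * (450000 * real q) powr (- 3 * \<eta>)" by (simp add: \<beta>_def)
 then show ?thesis using complex_Re_le_cmod[of "Lc \<xi> 1"] by linarith
qed

text \<open>Here P is the product of the three L-functions and vanishes at the given zero, so
  \<open>estermann\<close> applies with p = 0. The logarithmic derivative of zeta P has, up to sign,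
  the coefficients \<Lambda>(n) (1 + \<xi>1(n)) (1 + \<xi>(n)) >= 0.\<close>

lemma siegel_zero:
 assumes np1: "nonprincipal q1 \<xi>1" and rl1: "\<And>n. \<xi>1 n \<in> \<real>" and np: "nonprincipal q \<xi>" and rl: "\<And>n. \<xi> n \<in> \<real>"
  and np12: "nonprincipal (q1 * q) (%n. \<xi>1 n * \<xi> n)"
  and \<beta>: "9/10 < \<beta>" "\<beta> < 1" and zero: "Lc \<xi>1 (of_real \<beta>) = 0"
 shows "norm (Lc \<xi>1 1) * (norm (Lc \<xi> 1) * norm (Lc (%n. \<xi>1 n * \<xi> n) 1)) >= (1 - \<beta>) / 1024 * (50000 * (729 * (real q1 * real q)\<^sup>2)) powr (- 6 * (1 - \<beta>))"
proof -
 define \<psi> where "\<psi> = (%n. \<xi>1 n * \<xi> n)"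
 have np12': "nonprincipal (q1 * q) \<psi>" using np12 by (simp add: \<psi>_def)
 have rl12: "\<psi> n \<in> \<real>" for n using rl1 rl by (simp add: \<psi>_def)
 note c1 = dchar_cmult[OF nonprincipal_dchar[OF np1]] and c = dchar_cmult[OF nonprincipal_dchar[OF np]]
  and c12 = dchar_cmult[OF nonprincipal_dchar[OF np12']]
 note s1 = nonprincipal_sum_bound[OF np1] and s = nonprincipal_sum_bound[OF np] and s12 = nonprincipal_sum_bound[OF np12']
 note r1 = Lc_real[OF np1 rl1] and r = Lc_real[OF np rl] and r12 = Lc_real[OF np12' rl12]
 have q: "real q1 >= 1" "real q >= 1" using dcharD(1) nonprincipal_dchar np1 np by (metis Suc_leI One_nat_def of_nat_1 of_nat_le_iff)+
 define P where "P = (%s. Lc \<xi>1 s * (Lc \<xi> s * Lc \<psi> s))"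
 define k where "k = (%n. mangoldt n * ((1 + Re (\<xi>1 n)) * (1 + Re (\<xi> n))))"
 have eq1: "\<xi>1 n = of_real (Re (\<xi>1 n))" and eq: "\<xi> n = of_real (Re (\<xi> n))" for n
  by (rule real_values_trichotomy(2)[OF nonprincipal_dchar[OF np1] rl1], rule real_values_trichotomy(2)[OF nonprincipal_dchar[OF np] rl])
 have keq: "(%n. complex_of_real (k n)) = (%n. mangoldt n + (\<xi>1 n * mangoldt n + (\<xi> n * mangoldt n + \<psi> n * mangoldt n)))"
 proof
  fix n
  have "complex_of_real (k n) = mangoldt n * ((1 + of_real (Re (\<xi>1 n))) * (1 + of_real (Re (\<xi> n))))" by (simp add: k_def)
  also have "... = mangoldt n * ((1 + \<xi>1 n) * (1 + \<xi> n))" by (simp only: eq1[symmetric] eq[symmetric])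
  finally show "complex_of_real (k n) = mangoldt n + (\<xi>1 n * mangoldt n + (\<xi> n * mangoldt n + \<psi> n * mangoldt n))"
   by (simp add: \<psi>_def algebra_simps)
 qed
 have kn: "k n >= 0" for n
  using real_values_trichotomy(1)[OF nonprincipal_dchar[OF np1] rl1, of n] real_values_trichotomy(1)[OF nonprincipal_dchar[OF np] rl, of n]
  unfolding k_def by (intro mult_nonneg_nonneg mangoldt_nonneg) auto
 note sps = mangoldt_subpoly cmult_mangoldt_subpoly[OF c1] cmult_mangoldt_subpoly[OF c] cmult_mangoldt_subpoly[OF c12]
 have ksp: "subpoly (%n. of_real (k n))" unfolding keq by (intro subpoly_add sps)
 define G where "G = Re (zeta_dser 2) * (Re (Lc \<xi>1 2) * (Re (Lc \<xi> 2) * Re (Lc \<psi> 2)))"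
 define \<rho> where "\<rho> = Re (Lc \<xi>1 1) * (Re (Lc \<xi> 1) * Re (Lc \<psi> 1))"
 have "\<rho> >= (1 - \<beta>) / 1024 * (50000 * (729 * (real q1 * real q)\<^sup>2)) powr (- 6 * (1 - \<beta>))"
 proof (rule estermann[where P = P and k = k and p = 0 and g = G])
  show "P holomorphic_on {s. 0 < Re s}" unfolding P_def by (intro holomorphic_intros Lc_holomorphic[OF s1] Lc_holomorphic[OF s] Lc_holomorphic[OF s12])
  show "norm (P z) <= 729 * (real q1 * real q)\<^sup>2" if "norm (2 - z) <= 4/3" for z
  proof -
   have "norm (P z) <= (9 * real q1) * ((9 * real q) * (9 * real (q1 * q)))"
    unfolding P_def norm_mult by (intro mult_mono Lc_crude_bound[OF np1 that] Lc_crude_bound[OF np that] Lc_crude_bound[OF np12' that]) auto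
   then show ?thesis by (simp add: power2_eq_square mult_ac)
  qed
  have "1 * 1 <= real q1 * real q" using q by (intro mult_mono) auto
  then have "1 <= (real q1 * real q)\<^sup>2" by (simp add: one_le_power)
  then show "1 <= 729 * (real q1 * real q)\<^sup>2" by simp
  show "deriv (%s. zeta_dser s * P s) z = - (zeta_dser z * P z * dser (%n. complex_of_real (k n)) z)" if z: "Re z > 1" for z
   unfolding keq P_def
   by (rule DERIV_imp_deriv) (intro log_deriv_mult zeta_log_deriv Lc_log_deriv[OF s1] Lc_log_deriv[OF s] Lc_log_deriv[OF s12] c1 c c12 sps subpoly_add z)
  show "zeta_dser 2 * P 2 = of_real G"
   unfolding P_def G_def using zeta_two(1) r1[of 2] r[of 2] r12[of 2] by simp
  have "1/4 * (1/4 * (1/4 * (1/4))) <= G" unfolding G_def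
   by (intro mult_mono zeta_two(2) L_two_lower[OF np] L_two_lower[OF np1] L_two_lower[OF np12'])
    (use zeta_two(2) L_two_lower[OF np] L_two_lower[OF np1] L_two_lower[OF np12'] in auto)
  then show "1/256 <= G" by simp
  show "P 1 = of_real \<rho>" unfolding P_def \<rho>_def using r1[of 1] r[of 1] r12[of 1] by simp
  show "P (of_real \<beta>) = of_real 0" unfolding P_def using zero by simp
 qed (use ksp kn \<beta> in auto)
 also have "\<rho> <= norm (of_real \<rho> :: complex)" by simp
 also have "(of_real \<rho> :: complex) = Lc \<xi>1 1 * (Lc \<xi> 1 * Lc \<psi> 1)" unfolding \<rho>_def using r1[of 1] r[of 1] r12[of 1] by simp
 finally show ?thesis by (simp only: norm_mult \<psi>_def)
qed

text \<open>Nonprincipal products of distinct members are what distinct real primitive characters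
  provide in the usual formulation of Siegel's theorem.\<close>

definition siegel_family :: "(nat \<times> (nat => complex)) set => bool" where
 "siegel_family R \<longleftrightarrow> (\<forall>(q,\<xi>)\<in>R. nonprincipal q \<xi> \<and> (\<forall>n. \<xi> n \<in> \<real>)) \<and>
   (\<forall>(q,\<xi>)\<in>R. \<forall>(r,\<psi>)\<in>R. (q,\<xi>) \<noteq> (r,\<psi>) \<longrightarrow> nonprincipal (q * r) (%n. \<xi> n * \<psi> n))"

text \<open>If no member has a real zero within \<eta> of 1, \<open>siegel_no_zero\<close> settles
  everything. Otherwise one member with such a zero \<beta> is fixed once and for all, and
  \<open>siegel_zero\<close> compares every other member with it; c then depends on this unknown
  member, which is the source of ineffectivity.\<close>

theorem siegel:
 assumes R: "siegel_family R" and e: "0 < e" "e <= 1"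
 shows "\<exists>c>0. c <= 1 \<and> (\<forall>(q,\<xi>)\<in>R. norm (Lc \<xi> 1) >= c * real q powr (-e))"
proof -
 \<comment> \<open>In the second case q is lost with exponent 12 (1 - \<beta>) <= 12 \<eta> = e/2 in
   the lower bound and with e/4 in the upper bound for the product character, which leaves e/4 to
   spare.\<close>
 define \<eta> where "\<eta> = e / 24"
 have \<eta>: "0 < \<eta>" "\<eta> <= 1/10" using e by (auto simp: \<eta>_def)
 have np: "nonprincipal q \<xi>" "\<xi> n \<in> \<real>" if "(q,\<xi>) \<in> R" for q \<xi> n using R that by (auto simp: siegel_family_def)
 have q1: "real q >= 1" if "(q,\<xi>) \<in> R" for q \<xi> using dcharD(1)[OF nonprincipal_dchar[OF np(1)[OF that]]] by simp
 show ?thesis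
 proof (cases "\<exists>q \<xi> \<beta>. (q,\<xi>) \<in> R \<and> 1 - \<eta> < \<beta> \<and> \<beta> < 1 \<and> Lc \<xi> (of_real \<beta>) = 0")
  case False
  define c where "c = \<eta> / 2048 * 450000 powr (- 3 * \<eta>)"
  have c0: "c > 0" using \<eta> by (simp add: c_def)
  have "450000 powr (- 3 * \<eta>) <= 450000 powr (0::real)" using \<eta> by (intro powr_mono) auto
  then have c1: "c <= \<eta> / 2048 * 1" unfolding c_def using \<eta> by (intro mult_left_mono) auto
  have "norm (Lc \<xi> 1) >= c * real q powr (-e)" if m: "(q,\<xi>) \<in> R" for q \<xi>
  proof -
   have "c * real q powr (-e) <= c * real q powr (- 3 * \<eta>)"
    using c0 q1[OF m] \<eta> by (intro mult_left_mono powr_mono) (auto simp: \<eta>_def)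
   also have "... = \<eta> / 2048 * (450000 * real q) powr (- 3 * \<eta>)"
    unfolding c_def using q1[OF m] by (subst powr_mult) auto
   also have "... <= norm (Lc \<xi> 1)"
    by (rule siegel_no_zero[OF np[OF m] \<eta>]) (use False m in blast)
   finally show ?thesis .
  qed
  then show ?thesis using c0 c1 \<eta> by (intro exI[of _ c]) auto
 next
  case True
  then obtain r \<psi> \<beta> where m1: "(r,\<psi>) \<in> R" and \<beta>: "1 - \<eta> < \<beta>" "\<beta> < 1" and zero: "Lc \<psi> (of_real \<beta>) = 0" by blast
  have r1: "real r >= 1" by (rule q1[OF m1])
  define e' where "e' = e / 8"
  have e': "0 < e'" "e' <= 1/4" using e by (auto simp: e'_def)
  define A where "A = (1 - \<beta>) / 1024 * (50000 * (729 * (real r)\<^sup>2)) powr (- 6 * (1 - \<beta>))"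
  define E where "E = (7 + 4 / e') * (2 * real r) powr (2 * e')"
  have A0: "A > 0" using \<beta> r1 by (simp add: A_def)
  have E0: "E > 0" using e' r1 by (simp add: E_def add_pos_pos)
  define c where "c = min 1 (min (A / (9 * real r * E)) (norm (Lc \<psi> 1)))"
  have c0: "c > 0" using A0 E0 r1 L_one_nonzero[OF np[OF m1]] by (simp add: c_def)
  have "norm (Lc \<xi> 1) >= c * real q powr (-e)" if m: "(q,\<xi>) \<in> R" for q \<xi>
  proof (cases "(q,\<xi>) = (r,\<psi>)")
   case True
   have "real q powr (-e) <= real q powr 0" using q1[OF m] e by (intro powr_mono) auto
   then have "c * real q powr (-e) <= norm (Lc \<psi> 1) * 1" using c0 q1[OF m] by (intro mult_mono) (auto simp: c_def)
   then show ?thesis using True by simp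
  next
   case False
   have np12: "nonprincipal (r * q) (%n. \<psi> n * \<xi> n)" using R m1 m False unfolding siegel_family_def by fast
   define L where "L = norm (Lc \<xi> 1)"
   define L12 where "L12 = norm (Lc (%n. \<psi> n * \<xi> n) 1)"
   have qp: "real q >= 1" by (rule q1[OF m])
   have low: "(1 - \<beta>) / 1024 * (50000 * (729 * (real r * real q)\<^sup>2)) powr (- 6 * (1 - \<beta>)) <= norm (Lc \<psi> 1) * (L * L12)"
    unfolding L_def L12_def using \<beta> \<eta> by (intro siegel_zero[OF np[OF m1] np[OF m] np12 _ _ zero]) auto
   have "50000 * (729 * (real r * real q)\<^sup>2) = (50000 * (729 * (real r)\<^sup>2)) * (real q)\<^sup>2" by (simp add: power_mult_distrib)
   then have "(50000 * (729 * (real r * real q)\<^sup>2)) powr (- 6 * (1 - \<beta>)) = (50000 * (729 * (real r)\<^sup>2)) powr (- 6 * (1 - \<beta>)) * ((real q)\<^sup>2) powr (- 6 * (1 - \<beta>))"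
    using r1 qp by (simp only:) (subst powr_mult, auto)
   moreover have "((real q)\<^sup>2) powr (- 6 * (1 - \<beta>)) = real q powr (- 12 * (1 - \<beta>))"
   proof -
    have "(real q)\<^sup>2 = real q powr 2" using qp by (simp add: powr_numeral)
    moreover have "2 * (- 6 * (1 - \<beta>)) = - 12 * (1 - \<beta>)" by simp
    ultimately show ?thesis by (simp only: powr_powr)
   qed
   ultimately have eqA: "(1 - \<beta>) / 1024 * (50000 * (729 * (real r * real q)\<^sup>2)) powr (- 6 * (1 - \<beta>)) = A * real q powr (- 12 * (1 - \<beta>))"
    by (simp add: A_def)
   have "A * real q powr (- (e / 2)) <= A * real q powr (- 12 * (1 - \<beta>))"
    using A0 qp \<beta> by (intro mult_left_mono powr_mono) (auto simp: \<eta>_def)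
   also have "... <= norm (Lc \<psi> 1) * (L * L12)" using low eqA by simp
   also have "... <= (9 * real r) * (L * (E * real q powr (e / 4)))"
   proof (intro mult_mono)
    show "norm (Lc \<psi> 1) <= 9 * real r" by (rule Lc_crude_bound[OF np(1)[OF m1]]) simp
    have "L12 <= (7 + 4 / e') * (real (r * q) * (2 + \<bar>Im 1\<bar>)) powr (2 * e')"
     unfolding L12_def using e' r1 qp dchar_norm_le[OF nonprincipal_dchar[OF np12]] mult_mono[OF r1 qp]
     by (intro Lc_bound[OF nonprincipal_sum_bound[OF np12]]) auto
    also have "real (r * q) * (2 + \<bar>Im 1\<bar>) = (2 * real r) * real q" by simp
    also have "((2 * real r) * real q) powr (2 * e') = (2 * real r) powr (2 * e') * real q powr (2 * e')"
     using r1 qp by (simp only: powr_mult)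
    finally show "L12 <= E * real q powr (e / 4)" by (simp add: E_def e'_def mult.assoc)
   qed (auto simp: L_def L12_def)
   finally have "A * real q powr (- (e / 2)) <= (9 * real r * E) * (L * real q powr (e / 4))" by (simp add: mult_ac)
   then have "A / (9 * real r * E) * real q powr (- (e / 2)) <= L * real q powr (e / 4)"
    using E0 r1 by (simp add: field_simps)
   then have "A / (9 * real r * E) * real q powr (- (e / 2)) * real q powr (- (e / 4)) <= L * real q powr (e / 4) * real q powr (- (e / 4))"
    by (intro mult_right_mono) auto
   also have "L * real q powr (e / 4) * real q powr (- (e / 4)) = L" using qp by (simp add: mult.assoc powr_add[symmetric])
   finally have *: "A / (9 * real r * E) * real q powr (- (3 * e / 4)) <= L" by (simp add: mult.assoc powr_add[symmetric])
   have "c * real q powr (-e) <= A / (9 * real r * E) * real q powr (- (3 * e / 4))"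
    using qp e A0 E0 r1 by (intro mult_mono powr_mono) (auto simp: c_def)
   then show ?thesis using * unfolding L_def by simp
  qed
  then show ?thesis using c0 by (intro exI[of _ c]) (auto simp: c_def)
 qed
qed

subsection \<open>Uniform bounds for reciprocals and logarithmic derivatives\<close>

text \<open>For a character with principal square the 3-4-1 inequality meets the pole of zeta; such
  members of F must lie in a family R covered by Siegel's theorem.\<close>

definition siegel_class :: "(nat \<times> (nat => complex)) set => (nat \<times> (nat => complex)) set => bool" where
 "siegel_class F R \<longleftrightarrow> siegel_family R \<and>
   (\<forall>(q,\<xi>)\<in>F. nonprincipal q \<xi> \<and> (nonprincipal q (%n. \<xi> n ^ 2) \<or> (q,\<xi>) \<in> R))"

lemma L_strip_bound:
 assumes np: "nonprincipal q \<xi>" and e: "0 < e" "e <= 1/4" and z: "1 - e <= Re z" "Re z <= 3"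
  and t: "2 + \<bar>Im z\<bar> <= 2 * (2 + \<bar>t\<bar>)"
 shows "norm (Lc \<xi> z) <= 2 * (7 + 4 / e) * (real q * (2 + \<bar>t\<bar>)) powr (2 * e)"
proof -
 have q: "real q >= 1" using dcharD(1)[OF nonprincipal_dchar[OF np]] by simp
 have "norm (Lc \<xi> z) <= (7 + 4 / e) * (real q * (2 + \<bar>Im z\<bar>)) powr (2 * e)"
  by (rule Lc_bound[OF nonprincipal_sum_bound[OF np] dchar_norm_le[OF nonprincipal_dchar[OF np]] e q z])
 also have "... <= (7 + 4 / e) * (2 * (real q * (2 + \<bar>t\<bar>)) powr (2 * e))"
 proof (intro mult_left_mono)
  have "(real q * (2 + \<bar>Im z\<bar>)) powr (2 * e) <= (2 * (real q * (2 + \<bar>t\<bar>))) powr (2 * e)"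
   using q e mult_left_mono[OF t, of "real q"] by (intro powr_mono2) auto
  also have "... = 2 powr (2 * e) * (real q * (2 + \<bar>t\<bar>)) powr (2 * e)"
   using q by (simp only: powr_mult)
  also have "... <= 2 powr 1 * (real q * (2 + \<bar>t\<bar>)) powr (2 * e)"
   using e by (intro mult_right_mono powr_mono) auto
  finally show "(real q * (2 + \<bar>Im z\<bar>)) powr (2 * e) <= 2 * (real q * (2 + \<bar>t\<bar>)) powr (2 * e)" by simp
 qed (use e in auto)
 finally show ?thesis by (simp only: mult_ac)
qed

text \<open>If \<xi>^2 is nonprincipal, the 3-4-1 inequality is enough. Otherwise there are three
  regions. Near s = 1 the bound L(1) >= \<delta> from Siegel's theorem spreads by the Lipschitz
  bound. For Re s - 1 >= \<delta>/(4D) the comparison with zeta is enough. In the remaining region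
  |Im s| >= \<delta>/(4D), and the pole of zeta in the 3-4-1 inequality costs only a factor of order
  D/\<delta>.\<close>

theorem L_reciprocal_bound:
 assumes cl: "siegel_class F R" and e0: "e0 > 0"
 shows "\<exists>C>0. \<forall>(q,\<xi>)\<in>F. \<forall>s. 1 < Re s \<longrightarrow> Re s <= 2 \<longrightarrow>
      norm (Lc \<xi> s) >= C * (real q * (2 + \<bar>Im s\<bar>)) powr (- e0)"
proof -
 \<comment> \<open>The final bound is \<delta>/D^4 up to constants, with \<delta> of size M^(-e) and
   D of size M^(2e), hence M^(-9e).\<close>
 define e where "e = min (1/4) (e0 / 10)"
 have e: "0 < e" "e <= 1/4" "10 * e <= e0" using e0 by (auto simp: e_def)
 obtain c where c: "0 < c" "c <= 1" "\<And>q \<xi>. (q,\<xi>) \<in> R ==> norm (Lc \<xi> 1) >= c * real q powr (-e)"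
  using siegel[of R e] cl e unfolding siegel_class_def by fastforce
 define A where "A = 2 * (7 + 4 / e) / e"
 have A: "A >= 1"
 proof -
  have "4 / e >= 0" using e by simp
  then have "2 * (7 + 4 / e) >= e" using e by (simp only: distrib_left)
  then show ?thesis using e by (simp add: A_def pos_le_divide_eq)
 qed
 \<comment> \<open>57600 is four times 14400; it comes from the region Re s - 1 >= \<delta>/(4D) and
   dominates the constants of the other regions.\<close>
 define C where "C = c341 * c / (57600 * A ^ 4)"
 have C0: "C > 0" using c341 c A by (simp add: C_def)
 have "norm (Lc \<xi> s) >= C * (real q * (2 + \<bar>Im s\<bar>)) powr (- e0)"
  if F: "(q,\<xi>) \<in> F" and s: "1 < Re s" "Re s <= 2" for q \<xi> s
 proof -
  define t where "t = Im s"
  define M where "M = real q * (2 + \<bar>t\<bar>)"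
  have np: "nonprincipal q \<xi>" and alt: "nonprincipal q (%n. \<xi> n ^ 2) \<or> (q,\<xi>) \<in> R"
   using cl F unfolding siegel_class_def by auto
  note d = nonprincipal_dchar[OF np]
  note cm = dchar_cmult[OF d]
  note sb = nonprincipal_sum_bound[OF np]
  have q: "real q >= 1" using dcharD(1)[OF d] by simp
  have M: "M >= 2" unfolding M_def using mult_mono[of 1 "real q" 2 "2 + \<bar>t\<bar>"] q by simp
  have qM: "real q <= M" unfolding M_def using q mult_left_mono[of 1 "2 + \<bar>t\<bar>" "real q"] by simp
  have tM: "2 + \<bar>t\<bar> <= M" unfolding M_def using mult_right_mono[of 1 "real q" "2 + \<bar>t\<bar>"] q by simp
  define B where "B = 2 * (7 + 4 / e) * M powr (2 * e)"
  define D where "D = B / e"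
  have DA: "D = A * M powr (2 * e)" by (simp add: D_def B_def A_def)
  have Mp: "M powr (2 * e) >= 1" using M e by (simp add: ge_one_powr_ge_zero)
  have D1: "D >= 1" unfolding DA using mult_mono[OF A Mp] A by simp
  have B1: "B >= 1"
  proof -
   have "1 * 1 <= 2 * (7 + 4 / e) * M powr (2 * e)" using e Mp by (intro mult_mono) auto
   then show ?thesis by (simp add: B_def)
  qed
  have BD: "B <= D" unfolding D_def using B1 e by (simp add: pos_le_divide_eq)
  have Bnd: "norm (Lc \<xi> z) <= B" if "1 - e <= Re z" "Re z <= 3" "2 + \<bar>Im z\<bar> <= 2 * (2 + \<bar>t\<bar>)" for z
   unfolding B_def M_def by (rule L_strip_bound[OF np e(1,2) that])
  have Bnd_t: "norm (Lc \<xi> z) <= B" if "1 - e <= Re z" "Re z <= 3" "\<bar>Im z - t\<bar> <= 1" for z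
   using that by (intro Bnd) auto
  have sE: "s = Complex (Re s) t" by (simp add: t_def complex_eq_iff)
  define \<delta> where "\<delta> = c * M powr (- e)"
  have \<delta>: "\<delta> > 0" "\<delta> <= 1"
  proof -
   show "\<delta> > 0" using c M by (simp add: \<delta>_def)
   have "M powr (-e) <= M powr 0" using M e by (intro powr_mono) auto
   then have "c * M powr (-e) <= 1 * 1" using c M by (intro mult_mono) auto
   then show "\<delta> <= 1" by (simp add: \<delta>_def)
  qed
  have D41: "D ^ 4 >= D" using self_le_power[OF D1, of 4] by simp
  have goal_le: "C * (real q * (2 + \<bar>Im s\<bar>)) powr (- e0) <= c341 * \<delta> / (57600 * D ^ 4)"
  proof -
   have "c341 * \<delta> / (57600 * D ^ 4) = C * (M powr (-e) / (M powr (2 * e)) ^ 4)"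
    by (simp add: C_def \<delta>_def DA power_mult_distrib)
   also have "(M powr (2 * e)) ^ 4 = M powr (8 * e)"
    using M by (simp add: powr_realpow[symmetric] powr_powr)
   also have "M powr (-e) / M powr (8 * e) = M powr (- 9 * e)" using M by (simp add: powr_diff[symmetric])
   finally have "c341 * \<delta> / (57600 * D ^ 4) = C * M powr (- 9 * e)" .
   moreover have "C * M powr (- e0) <= C * M powr (- 9 * e)" using C0 M e by (intro mult_left_mono powr_mono) auto
   ultimately show ?thesis by (simp add: M_def t_def)
  qed
  have "norm (Lc \<xi> s) >= c341 * \<delta> / (57600 * D ^ 4)"
  proof (cases "nonprincipal q (%n. \<xi> n ^ 2)")
   case True
   have K: "norm (dser (%n. \<xi> n ^ 2) (Complex x (2 * t))) <= B" if "1 < x" "x <= 2" for x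
   proof -
    have "dser (%n. \<xi> n ^ 2) (Complex x (2 * t)) = Lc (%n. \<xi> n ^ 2) (Complex x (2 * t))"
     using Lc_eq_dser[OF nonprincipal_sum_bound[OF True] _ cmult_subpoly[OF dchar_cmult[OF nonprincipal_dchar[OF True]]], of "Complex x (2 * t)"] that by simp
    also have "norm ... <= B" unfolding B_def M_def using that e by (intro L_strip_bound[OF True e(1,2)]) auto
    finally show ?thesis .
   qed
   have "norm (Lc \<xi> (Complex (Re s) t)) >= c341 / (16 * B * (B / e) ^ 3)"
    by (rule L_lower_from_square[OF cm sb e(1,2) Bnd_t B1 K B1 s])
   moreover have "c341 * \<delta> / (57600 * D ^ 4) <= c341 / (16 * B * (B / e) ^ 3)"
   proof (rule frac_le)
    show "c341 * \<delta> <= c341" using \<delta> c341 by simp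
    have "16 * B * D ^ 3 <= 57600 * (D * D ^ 3)" using BD D1 B1 by (simp add: mult_right_mono mult.assoc[symmetric])
    then show "16 * B * (B / e) ^ 3 <= 57600 * D ^ 4" unfolding D_def[symmetric] by (simp add: power_numeral_reduce)
   qed (use c341 B1 e in auto)
   ultimately show ?thesis using sE by simp
  next
   case False
   then have R: "(q,\<xi>) \<in> R" using alt by simp
   have rl: "\<xi> n \<in> \<real>" for n using cl R unfolding siegel_class_def siegel_family_def by auto
   have sq: "\<xi> n ^ 2 = 1" if "coprime n q" for n
   proof -
    have "norm (\<xi> n) = 1" by (rule dchar_norm_coprime[OF d that])
    then have "Re (\<xi> n) \<noteq> 0" using real_values_trichotomy(2)[OF d rl, of n] by (metis norm_zero of_real_0 zero_neq_one)
    then have "Re (\<xi> n) = 1 \<or> Re (\<xi> n) = -1" using real_values_trichotomy(1)[OF d rl, of n] by auto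
    then show ?thesis using real_values_trichotomy(2)[OF d rl, of n] by (metis of_real_1 of_real_minus power2_minus power_one)
   qed
   have L1: "norm (Lc \<xi> 1) >= \<delta>"
   proof -
    have "M powr (-e) <= real q powr (-e)" using q qM e by (intro powr_mono2') auto
    then have "\<delta> <= c * real q powr (-e)" unfolding \<delta>_def using c by (intro mult_left_mono) auto
    then show ?thesis using c(3)[OF R] by simp
   qed
   have small: "c341 * \<delta> / (57600 * D ^ 4) <= x" if "x >= \<delta> / (57600 * D)" for x
   proof -
    have "c341 * \<delta> / (57600 * D ^ 4) <= \<delta> / (57600 * D)"
     using c341 \<delta> D1 D41 by (intro frac_le) auto
    then show ?thesis using that by simp
   qed
   show ?thesis
   proof (cases "norm (s - 1) <= \<delta> / (2 * D)")
    case True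
    have "\<delta> / (2 * D) <= 1 / (2 * 1)" using \<delta> D1 by (intro frac_le) auto
    then have "\<bar>t\<bar> <= 1/2" using True abs_Im_le_cmod[of "s - 1"] by (simp add: t_def)
    then have "norm (Lc \<xi> 1 - Lc \<xi> s) <= B / e * norm (1 - s)"
     using s by (intro halfplane_lipschitz[OF Lc_holomorphic[OF sb] e(1,2), of 0] Bnd) (auto simp: t_def)
    also have "... <= D * (\<delta> / (2 * D))" unfolding D_def[symmetric] using True D1 by (intro mult_left_mono) (auto simp: norm_minus_commute)
    also have "... = \<delta> / 2" using D1 by simp
    finally have "norm (Lc \<xi> 1 - Lc \<xi> s) <= \<delta> / 2" .
    moreover have "norm (Lc \<xi> 1) <= norm (Lc \<xi> 1 - Lc \<xi> s) + norm (Lc \<xi> s)" by (metis diff_add_cancel norm_triangle_ineq)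
    ultimately have "norm (Lc \<xi> s) >= \<delta> / 2" using L1 by linarith
    moreover have "\<delta> / (57600 * D) <= \<delta> / 2" using \<delta> D1 by (intro divide_left_mono) auto
    ultimately show ?thesis by (intro small) simp
   next
    case far: False
    show ?thesis
    proof (cases "Re s - 1 >= \<delta> / (4 * D)")
     case True
     have "norm (dser \<xi> s) >= (Re s - 1) / 14400" using s by (intro dser_lower_real[OF cm]) auto
     moreover have "dser \<xi> s = Lc \<xi> s" by (rule Lc_eq_dser[OF sb s(1) cmult_subpoly[OF cm], symmetric])
     moreover have "\<delta> / (57600 * D) = \<delta> / (4 * D) / 14400" by simp
     ultimately show ?thesis using True by (intro small) simp
    next
     case False
     have "norm (s - 1) <= \<bar>Re s - 1\<bar> + \<bar>t\<bar>" using cmod_le[of "s - 1"] by (simp add: t_def)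
     then have t: "\<bar>t\<bar> >= \<delta> / (4 * D)"
     proof -
      have "\<delta> / (2 * D) = \<delta> / (4 * D) + \<delta> / (4 * D)" by simp
      then show ?thesis using far False s \<open>norm (s - 1) <= \<bar>Re s - 1\<bar> + \<bar>t\<bar>\<close> by linarith
     qed
     have td: "\<delta> / (4 * D) > 0" using \<delta> D1 by simp
     then have t0: "t \<noteq> 0" using t by auto
     \<comment> \<open>The four terms of \<open>principal_dser_bound\<close> are at most D,
       2D/\<delta>, 2D and 8D; with D <= D/\<delta> they add up to 13 D/\<delta>.\<close>
     define K where "K = 13 * D / \<delta>"
     have D\<delta>: "D <= D / \<delta>" using \<delta> D1 by (simp add: pos_le_divide_eq mult_left_le)
     have K1: "K >= 1" using D\<delta> D1 by (simp add: K_def)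
     have K: "norm (dser (%n. \<xi> n ^ 2) (Complex x (2 * t))) <= K" if x: "1 < x" "x <= 2" for x
     proof -
      have "norm (dser (%n. \<xi> n ^ 2) (Complex x (2 * t))) <= (7 + 4 / e) * (real q * (2 + \<bar>Im (Complex x (2 * t))\<bar>)) powr (2 * e) + 1 / \<bar>Im (Complex x (2 * t))\<bar> + 2 * ln (2 + \<bar>Im (Complex x (2 * t))\<bar>) + 8"
       using x t0 e by (intro principal_dser_bound[OF d sq]) auto
      also have "... = (7 + 4 / e) * (real q * (2 + 2 * \<bar>t\<bar>)) powr (2 * e) + 1 / (2 * \<bar>t\<bar>) + 2 * ln (2 + 2 * \<bar>t\<bar>) + 8" by (simp add: abs_mult)
      also have "... <= D + 2 * D / \<delta> + 2 * D + 8 * D"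
      proof (intro add_mono)
       have p2: "(2 * M) powr (2 * e) <= 2 * M powr (2 * e)"
       proof -
        have "(2 * M) powr (2 * e) = 2 powr (2 * e) * M powr (2 * e)" using M by (simp only: powr_mult)
        also have "... <= 2 powr 1 * M powr (2 * e)" using e by (intro mult_right_mono powr_mono) auto
        finally show ?thesis by simp
       qed
       have "(real q * (2 + 2 * \<bar>t\<bar>)) powr (2 * e) <= (2 * M) powr (2 * e)"
        unfolding M_def using q e by (intro powr_mono2) (auto simp: algebra_simps)
       then have "(real q * (2 + 2 * \<bar>t\<bar>)) powr (2 * e) <= 2 * M powr (2 * e)" using p2 by simp
       then have "(7 + 4 / e) * (real q * (2 + 2 * \<bar>t\<bar>)) powr (2 * e) <= (7 + 4 / e) * (2 * M powr (2 * e))"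
        using e by (intro mult_left_mono) auto
       also have "... = B" by (simp add: B_def)
       finally show "(7 + 4 / e) * (real q * (2 + 2 * \<bar>t\<bar>)) powr (2 * e) <= D" using BD by simp
       have "1 / (2 * \<bar>t\<bar>) <= 1 / (2 * (\<delta> / (4 * D)))" using t td by (intro frac_le) auto
       then show "1 / (2 * \<bar>t\<bar>) <= 2 * D / \<delta>" by simp
       have "ln (2 + 2 * \<bar>t\<bar>) <= (2 + 2 * \<bar>t\<bar>) powr (2 * e) / (2 * e)" using e by (intro ln_powr_bound) auto
       also have "... <= (2 * M) powr (2 * e) / (2 * e)" using e tM by (intro divide_right_mono powr_mono2) auto
       also have "... <= (2 * M powr (2 * e)) / (2 * e)" using e p2 by (intro divide_right_mono) auto
       also have "... = (1 / e) * M powr (2 * e)" by simp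
       also have "... <= A * M powr (2 * e)"
       proof (intro mult_right_mono)
        have "1 <= 2 * (7 + 4 / e)" using e by (simp add: pos_le_divide_eq add_nonneg_nonneg)
        then show "1 / e <= A" unfolding A_def using e by (intro divide_right_mono) auto
       qed simp
       finally show "2 * ln (2 + 2 * \<bar>t\<bar>) <= 2 * D" by (simp add: DA)
       show "8 <= 8 * D" using D1 by simp
      qed
      also have "... <= K"
      proof -
       have "13 * D / \<delta> = 11 * (D / \<delta>) + 2 * D / \<delta>" by (simp add: add_divide_distrib[symmetric])
       then show ?thesis unfolding K_def using D\<delta> by linarith
      qed
      finally show ?thesis .
     qed
     have "norm (Lc \<xi> (Complex (Re s) t)) >= c341 / (16 * K * (B / e) ^ 3)"
      by (rule L_lower_from_square[OF cm sb e(1,2) Bnd_t B1 K K1 s])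
     moreover have "c341 / (16 * K * (B / e) ^ 3) = c341 * \<delta> / (208 * D ^ 4)"
      unfolding D_def[symmetric] K_def using D1 \<delta> by (simp add: power_numeral_reduce)
     moreover have "c341 * \<delta> / (57600 * D ^ 4) <= c341 * \<delta> / (208 * D ^ 4)"
      using c341 \<delta> D1 by (intro divide_left_mono) auto
     ultimately show ?thesis using sE by simp
    qed
   qed
  qed
  then show ?thesis using goal_le by linarith
 qed
 then show ?thesis using C0 by (intro exI[of _ C]) auto
qed

text \<open>The disc around \<open>s\<close> of radius \<open>\<gamma> M^(-3 e)\<close> is free of zeros by the lower bound at \<open>s\<close> and the derivative
 bound, so the derivatives of the logarithmic derivative at \<open>s\<close> are controlled by Cauchy's inequality.\<close>

theorem log_deriv_bound:
 assumes cl: "siegel_class F R" and e0: "e0 > 0"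
 shows "\<exists>C>0. \<forall>(q,\<xi>)\<in>F. \<forall>s. 1 < Re s \<longrightarrow> Re s <= 2 \<longrightarrow>
      norm (dser (%n. (- of_real (ln (real n))) ^ k * (\<xi> n * mangoldt n)) s) <= C * (real q * (2 + \<bar>Im s\<bar>)) powr e0"
proof -
 \<comment> \<open>L'/L is of size M^(3e) on a disc of radius of order M^(-3e), so the k-th
   derivative costs M^((3 + 3k) e).\<close>
 define e where "e = min (1/4) (e0 / (10 * real (k + 1)))"
 have e: "0 < e" "e <= 1/4" unfolding e_def by (simp add: e0, rule min.cobounded1)
 have "e <= e0 / (10 * real (k + 1))" by (simp add: e_def)
 then have e2: "(3 + 3 * real k) * e <= e0" using e0 by (simp add: field_simps)
 obtain c where c: "0 < c" "\<And>q \<xi> s. (q,\<xi>) \<in> F ==> 1 < Re s ==> Re s <= 2 ==> norm (Lc \<xi> s) >= c * (real q * (2 + \<bar>Im s\<bar>)) powr (- e)"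
  using L_reciprocal_bound[OF cl e(1)] by fast
 define A where "A = 2 * (7 + 4 / e) / e"
 have A: "A > 0" using e by (simp add: A_def add_pos_pos)
 define \<gamma> where "\<gamma> = min (e / 2) (c / (4 * A))"
 have \<gamma>: "\<gamma> > 0" "\<gamma> <= e / 2" "\<gamma> <= c / (4 * A)" using e c A by (auto simp: \<gamma>_def)
 define C where "C = fact k * (4 * A / c) / \<gamma> ^ k"
 have C0: "C > 0" using A c \<gamma> by (simp add: C_def)
 have "norm (dser (%n. (- of_real (ln (real n))) ^ k * (\<xi> n * mangoldt n)) s) <= C * (real q * (2 + \<bar>Im s\<bar>)) powr e0"
  if F: "(q,\<xi>) \<in> F" and s: "1 < Re s" "Re s <= 2" for q \<xi> s
 proof -
  define t where "t = Im s"
  define M where "M = real q * (2 + \<bar>t\<bar>)"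
  have np: "nonprincipal q \<xi>" using cl F unfolding siegel_class_def by auto
  note d = nonprincipal_dchar[OF np]
  note cm = dchar_cmult[OF d]
  note sb = nonprincipal_sum_bound[OF np]
  have q: "real q >= 1" using dcharD(1)[OF d] by simp
  have M: "M >= 2" unfolding M_def using mult_mono[of 1 "real q" 2 "2 + \<bar>t\<bar>"] q by simp
  have Lhol: "Lc \<xi> holomorphic_on {s. Re s > 0}" by (rule Lc_holomorphic[OF sb])
  define B where "B = 2 * (7 + 4 / e) * M powr (2 * e)"
  have BA: "B / e = A * M powr (2 * e)" by (simp add: B_def A_def)
  have Bnd_t: "norm (Lc \<xi> z) <= B" if "1 - e <= Re z" "Re z <= 3" "\<bar>Im z - t\<bar> <= 1" for z
   unfolding B_def M_def using that by (intro L_strip_bound[OF np e]) auto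
  define r where "r = \<gamma> * M powr (- 3 * e)"
  have r: "r > 0" "r <= e / 2"
  proof -
   show "r > 0" using \<gamma> M by (simp add: r_def)
   have "M powr (- 3 * e) <= M powr 0" using M e by (intro powr_mono) auto
   then have "\<gamma> * M powr (- 3 * e) <= (e / 2) * 1" using \<gamma> M by (intro mult_mono) auto
   then show "r <= e / 2" by (simp add: r_def)
  qed
  have near: "Re s - e / 2 <= Re z" "Re z <= Re s + e / 2" "\<bar>Im z - t\<bar> <= e / 2" if "norm (s - z) <= r" for z
  proof -
   have "\<bar>Re s - Re z\<bar> <= e / 2" "\<bar>t - Im z\<bar> <= e / 2"
    using that r abs_Re_le_cmod[of "s - z"] abs_Im_le_cmod[of "s - z"] by (auto simp: t_def)
   then show "Re s - e / 2 <= Re z" "Re z <= Re s + e / 2" "\<bar>Im z - t\<bar> <= e / 2" by linarith+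
  qed
  have db: "norm (deriv (Lc \<xi>) z) <= 2 * (A * M powr (2 * e))" if z: "norm (s - z) <= r" for z
  proof -
   have cb: "1 - e <= Re w" "Re w <= 3" "\<bar>Im w - t\<bar> <= 1" if "norm (z - w) <= e / 2" for w
   proof -
    have "\<bar>Re z - Re w\<bar> <= e / 2" "\<bar>Im z - Im w\<bar> <= e / 2"
     using that abs_Re_le_cmod[of "z - w"] abs_Im_le_cmod[of "z - w"] by auto
    then show "1 - e <= Re w" "Re w <= 3" "\<bar>Im w - t\<bar> <= 1" using near[OF z] s e by linarith+
   qed
   have sub: "cball z (e / 2) \<subseteq> {s. Re s > 0}" using cb e by (force simp: dist_norm)
   have "norm ((deriv ^^ 1) (Lc \<xi>) z) <= fact 1 * B / (e / 2) ^ 1"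
   proof (rule Cauchy_inequality)
    show "Lc \<xi> holomorphic_on ball z (e / 2)" using Lhol sub ball_subset_cball holomorphic_on_subset by blast
    show "continuous_on (cball z (e / 2)) (Lc \<xi>)" using Lhol sub holomorphic_on_imp_continuous_on continuous_on_subset by blast
    show "norm (Lc \<xi> w) <= B" if "norm (z - w) = e / 2" for w using cb[of w] that by (intro Bnd_t) auto
   qed (use e in auto)
   moreover have "B / (e / 2) = 2 * (B / e)" by simp
   ultimately show ?thesis unfolding BA by simp
  qed
  have sub: "cball s r \<subseteq> {s. Re s > 0}" using near s e by (force simp: dist_norm)
  have Ls: "norm (Lc \<xi> s) >= c * M powr (-e)" unfolding M_def t_def by (rule c(2)[OF F s])
  have low: "norm (Lc \<xi> z) >= c / 2 * M powr (-e)" if z: "norm (s - z) <= r" for z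
  proof -
   have "norm (Lc \<xi> s - Lc \<xi> z) <= 2 * (A * M powr (2 * e)) * norm (s - z)"
   proof (rule field_differentiable_bound[OF convex_cball[of s r]])
    fix w assume w: "w \<in> cball s r"
    then have "Re w > 0" using sub by auto
    then have "(Lc \<xi> has_field_derivative deriv (Lc \<xi>) w) (at w)" using Lhol open_Re_gt holomorphic_derivI by blast
    then show "(Lc \<xi> has_field_derivative deriv (Lc \<xi>) w) (at w within cball s r)" by (rule has_field_derivative_at_within)
    show "norm (deriv (Lc \<xi>) w) <= 2 * (A * M powr (2 * e))" using w by (intro db) (simp add: dist_norm)
   qed (use z r in \<open>auto simp: dist_norm\<close>)
   also have "... <= 2 * (A * M powr (2 * e)) * r" using z A by (intro mult_left_mono) auto
   also have "... = 2 * A * \<gamma> * (M powr (2 * e) * M powr (- 3 * e))" by (simp add: r_def)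
   also have "M powr (2 * e) * M powr (- 3 * e) = M powr (-e)" by (simp add: powr_add[symmetric])
   also have "2 * A * \<gamma> * M powr (-e) <= 2 * A * (c / (4 * A)) * M powr (-e) "
    using \<gamma> A by (intro mult_right_mono mult_left_mono) auto
   finally have "norm (Lc \<xi> s - Lc \<xi> z) <= c / 2 * M powr (-e)" using A by simp
   moreover have "norm (Lc \<xi> s) <= norm (Lc \<xi> s - Lc \<xi> z) + norm (Lc \<xi> z)" by (metis diff_add_cancel norm_triangle_ineq)
   ultimately show ?thesis using Ls by linarith
  qed
  have nz: "Lc \<xi> z \<noteq> 0" if "norm (s - z) <= r" for z
  proof -
   have "0 < c / 2 * M powr (-e)" using c M by simp
   then show ?thesis using low[OF that] by auto
  qed
  define g where "g = (%z. - deriv (Lc \<xi>) z / Lc \<xi> z)"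
  have dhol: "deriv (Lc \<xi>) holomorphic_on {s. Re s > 0}" by (rule holomorphic_deriv[OF Lhol open_Re_gt])
  have dc: "deriv (Lc \<xi>) holomorphic_on cball s r" "Lc \<xi> holomorphic_on cball s r"
   using dhol Lhol sub holomorphic_on_subset by blast+
  have ghol: "g holomorphic_on cball s r" unfolding g_def
   using nz by (intro holomorphic_intros dc) (auto simp: dist_norm)
  have "norm ((deriv ^^ k) g s) <= fact k * (4 * A / c * M powr (3 * e)) / r ^ k"
  proof (rule Cauchy_inequality)
   show "g holomorphic_on ball s r" using ghol ball_subset_cball holomorphic_on_subset by blast
   show "continuous_on (cball s r) g" by (rule holomorphic_on_imp_continuous_on[OF ghol])
   fix z assume "norm (s - z) = r"
   then have z: "norm (s - z) <= r" by simp
   have "norm (g z) <= 2 * (A * M powr (2 * e)) / (c / 2 * M powr (-e))"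
    unfolding g_def norm_divide norm_minus_cancel using db[OF z] low[OF z] c M A by (intro frac_le) auto
   also have "... = 4 * A / c * (M powr (2 * e) / M powr (-e))" by simp
   also have "M powr (2 * e) / M powr (-e) = M powr (3 * e)" by (simp add: powr_diff[symmetric])
   finally show "norm (g z) <= 4 * A / c * M powr (3 * e)" .
  qed (rule r)
  also have "... = C * (M powr (3 * e) / (M powr (- 3 * e)) ^ k)"
   by (simp add: C_def r_def power_mult_distrib)
  also have "M powr (3 * e) / (M powr (- 3 * e)) ^ k = M powr ((3 + 3 * real k) * e)"
  proof -
   have "(M powr (- 3 * e)) ^ k = M powr (- 3 * e * real k)" using M by (simp add: powr_realpow[symmetric] powr_powr)
   then show ?thesis by (simp add: powr_diff[symmetric] algebra_simps)
  qed
  also have "C * M powr ((3 + 3 * real k) * e) <= C * M powr e0"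
   using C0 M e2 by (intro mult_left_mono powr_mono) auto
  finally have "norm ((deriv ^^ k) g s) <= C * M powr e0" .
  moreover have "(deriv ^^ k) g s = (deriv ^^ k) (dser (%n. \<xi> n * mangoldt n)) s"
  proof (rule higher_deriv_transform_within_open[where S = "ball s r \<inter> {z. Re z > 1}"])
   show "g holomorphic_on ball s r \<inter> {z. Re z > 1}"
    by (rule holomorphic_on_subset[OF ghol]) auto
   show "dser (%n. \<xi> n * mangoldt n) holomorphic_on ball s r \<inter> {z. Re z > 1}"
    by (rule holomorphic_on_subset[OF dser_holomorphic[OF cmult_mangoldt_subpoly[OF cm]]]) auto
   show "open (ball s r \<inter> {z. Re z > 1})" by (intro open_Int open_ball open_Re_gt)
   show "s \<in> ball s r \<inter> {z. Re z > 1}" using r s by simp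
   fix z assume z: "z \<in> ball s r \<inter> {z. Re z > 1}"
   then have "deriv (Lc \<xi>) z = - (Lc \<xi> z * dser (%n. \<xi> n * mangoldt n) z)"
    by (intro DERIV_imp_deriv Lc_log_deriv[OF sb cm]) auto
   moreover have "Lc \<xi> z \<noteq> 0" using z by (intro nz) (simp add: dist_norm)
   ultimately show "g z = dser (%n. \<xi> n * mangoldt n) z" by (simp add: g_def)
  qed
  ultimately show ?thesis using dser_higher_deriv[OF cmult_mangoldt_subpoly[OF cm] s(1), of k] by (simp add: M_def t_def)
 qed
 then show ?thesis using C0 by (intro exI[of _ C]) auto
qed

subsection \<open>Gaussian smoothing of summatory functions\<close>

abbreviation "Gauss \<equiv> std_normal_distribution"

lemma gauss_char: "(CLINT z|Gauss. iexp (u * z)) = of_real (exp (- (u\<^sup>2) / 2))"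
 using char_std_normal_distribution unfolding char_def by (metis (no_types, lifting))

lemma gauss_integral:
 fixes f :: "real => 'a::{banach, second_countable_topology}"
 assumes "f \<in> borel_measurable borel"
 shows "integrable Gauss f \<longleftrightarrow> integrable lborel (%z. std_normal_density z *\<^sub>R f z)"
  and "integral\<^sup>L Gauss f = (\<integral>z. std_normal_density z *\<^sub>R f z \<partial>lborel)"
 using assms by (auto simp: integrable_density integral_density)

lemma norm_integral_le:
 fixes f :: "'b => 'a::{banach, second_countable_topology}"
 assumes g: "integrable M g" and le: "AE x in M. norm (f x) <= g x"
 shows "norm (integral\<^sup>L M f) <= integral\<^sup>L M g"
proof (cases "integrable M f")
 case True
 have "norm (integral\<^sup>L M f) <= (\<integral>x. norm (f x) \<partial>M)" by (rule integral_norm_bound)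
 also have "... <= integral\<^sup>L M g" by (rule integral_mono_AE) (use True g le in auto)
 finally show ?thesis .
next
 case False
 have "0 <= integral\<^sup>L M g"
  by (rule integral_nonneg_AE) (use le in \<open>auto elim!: eventually_mono intro: order_trans[OF norm_ge_zero]\<close>)
 then show ?thesis using False by (simp add: not_integrable_integral_eq)
qed

lemma gauss_exp:
 fixes c :: real
 shows "integrable Gauss (%z. exp (c * z))" "(\<integral>z. exp (c * z) \<partial>Gauss) = exp (c\<^sup>2 / 2)"
proof -
 have eq: "std_normal_density z *\<^sub>R exp (c * z) = exp (c\<^sup>2 / 2) * normal_density c 1 z" for z
 proof -
  have "exp (- z\<^sup>2 / 2) * exp (c * z) = exp (c\<^sup>2 / 2) * exp (- (z - c)\<^sup>2 / 2)"
   by (simp add: exp_add[symmetric] power2_eq_square field_simps)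
  then show ?thesis by (simp add: normal_density_def)
 qed
 have m: "(%z. exp (c * z)) \<in> borel_measurable borel" by measurable
 show "integrable Gauss (%z. exp (c * z))" unfolding gauss_integral(1)[OF m] eq by simp
 show "(\<integral>z. exp (c * z) \<partial>Gauss) = exp (c\<^sup>2 / 2)" unfolding gauss_integral(2)[OF m] eq by simp
qed

text \<open>Bound for the mean of exp(5 |z|) under the normal law; 25/2 is 5^2 / 2.\<close>

definition K5 :: real where "K5 = 2 * exp (25/2)"

lemma gauss_exp_abs:
 shows "integrable Gauss (%z. exp (5 * \<bar>z\<bar>))" "(\<integral>z. exp (5 * \<bar>z\<bar>) \<partial>Gauss) <= K5"
proof -
 have I: "integrable Gauss (%z. exp (5 * z) + exp ((-5) * z))" by (intro Bochner_Integration.integrable_add gauss_exp)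
 have le: "exp (5 * \<bar>z\<bar>) <= exp (5 * z) + exp ((-5) * z)" for z :: real by (cases "z >= 0") auto
 show J: "integrable Gauss (%z. exp (5 * \<bar>z\<bar>))"
  by (rule Bochner_Integration.integrable_bound[OF I]) (use le in \<open>auto intro!: AE_I2 order_trans[OF le]\<close>)
 have "(\<integral>z. exp (5 * \<bar>z\<bar>) \<partial>Gauss) <= (\<integral>z. exp (5 * z) + exp ((-5) * z) \<partial>Gauss)"
  by (rule integral_mono[OF J I]) (rule le)
 also have "... = K5" by (subst Bochner_Integration.integral_add) (auto simp: gauss_exp[of 5, simplified] gauss_exp[of "-5", simplified] gauss_exp K5_def)
 finally show "(\<integral>z. exp (5 * \<bar>z\<bar>) \<partial>Gauss) <= K5" .
qed

lemma prob_space_Gauss: "prob_space Gauss" by (rule prob_space_normal_density) simp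

text \<open>A Gaussian window of width w around v on the logarithmic scale. It takes the part of
  Perron's kernel, with absolute convergence.\<close>

definition smooth :: "(nat => complex) => real => real => real => complex" where
 "smooth a \<sigma> w v = (\<Sum>n. a n * of_real (real n powr (-\<sigma>) * exp (- ((v - ln (real n)) / w)\<^sup>2 / 2)))"

lemma subpoly_summable_real:
 assumes "subpoly a" "\<sigma> > 1"
 shows "summable (%n. norm (a n) * real n powr (-\<sigma>))"
 using subpoly_summable_norm[OF assms(1), of "of_real \<sigma>"] assms(2) by (simp add: norm_dterm)

lemma Gauss_UNIV: "measure Gauss UNIV = 1"
 using prob_space.prob_space[OF prob_space_Gauss] by simp

lemma nat_le_nat_floor_iff: "n > 0 ==> n <= nat \<lfloor>y :: real\<rfloor> \<longleftrightarrow> real n <= y"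
 using le_nat_floor[of n y] by linarith

text \<open>The window is the characteristic function of a normal variable z at (v - ln n)/w.
  Summing over n inside the mean turns \<open>smooth\<close> into an average of the Dirichlet series
  on the line Re s = \<sigma> at the heights z/w.\<close>

lemma smooth_bound:
 assumes sp: "subpoly a" and \<sigma>: "\<sigma> > 1" and w: "w > 0"
  and Bd: "\<And>t. norm (dser a (Complex \<sigma> t)) <= Bd t" and I: "integrable Gauss (%z. Bd (z / w))"
  and E: "(\<integral>z. Bd (z / w) \<partial>Gauss) <= E0"
 shows "norm (smooth a \<sigma> w v) <= E0"
proof -
 interpret prob_space Gauss by (rule prob_space_Gauss)
 define f where "f = (%n z. a n * of_real (real n powr (-\<sigma>)) * iexp (((v - ln (real n)) / w) * z))"
 have fm: "(%z. f n z) \<in> borel_measurable borel" for n unfolding f_def by measurable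
 have fn: "norm (f n z) = norm (a n) * real n powr (-\<sigma>)" for n z
  by (simp add: f_def norm_mult)
 have fI: "integrable Gauss (f n)" for n
  by (rule integrable_const_bound[where B = "norm (a n) * real n powr (-\<sigma>)"]) (use fn fm[of n] in auto)
 have fsum: "f n z = iexp (v * z / w) * (a n * of_nat n powr (- Complex \<sigma> (z / w)))" for n z
 proof (cases "n = 0")
  case False
  have "of_nat n powr (- Complex \<sigma> (z / w)) = exp (- Complex \<sigma> (z / w) * of_real (ln (real n)))"
   using False by (simp add: powr_def)
  also have "- Complex \<sigma> (z / w) * of_real (ln (real n)) = of_real (- \<sigma> * ln (real n)) + \<i> * of_real (- (z / w) * ln (real n))"
   by (simp add: complex_eq_iff)
  also have "exp ... = of_real (exp (- \<sigma> * ln (real n))) * iexp (- (z / w) * ln (real n))"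
   by (simp only: exp_add exp_of_real)
  also have "exp (- \<sigma> * ln (real n)) = real n powr (-\<sigma>)" using False by (simp add: powr_def)
  finally have p: "of_nat n powr (- Complex \<sigma> (z / w)) = of_real (real n powr (-\<sigma>)) * iexp (- (z / w) * ln (real n))" .
  have "iexp (v * z / w) * iexp (- (z / w) * ln (real n)) = iexp (((v - ln (real n)) / w) * z)"
   unfolding exp_add[symmetric] by (rule arg_cong[where f = exp]) (use w in \<open>simp add: field_simps\<close>)
  then show ?thesis unfolding f_def p by (simp add: mult_ac)
 qed (simp add: f_def)
 have "smooth a \<sigma> w v = (\<Sum>n. integral\<^sup>L Gauss (f n))"
 proof -
  have "integral\<^sup>L Gauss (f n) = a n * of_real (real n powr (-\<sigma>) * exp (- ((v - ln (real n)) / w)\<^sup>2 / 2))" for n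
   unfolding f_def integral_mult_right_zero gauss_char by (simp only: of_real_mult mult.assoc)
  then show ?thesis unfolding smooth_def by (simp only:)
 qed
 also have "... = (\<integral>z. (\<Sum>n. f n z) \<partial>Gauss)"
 proof (rule integral_suminf[symmetric, OF fI])
  show "AE z in Gauss. summable (%n. norm (f n z))" unfolding fn using subpoly_summable_real[OF sp \<sigma>] by simp
  show "summable (%n. \<integral>z. norm (f n z) \<partial>Gauss)" unfolding fn using subpoly_summable_real[OF sp \<sigma>] by (simp add: Gauss_UNIV)
 qed
 also have "... = (\<integral>z. iexp (v * z / w) * dser a (Complex \<sigma> (z / w)) \<partial>Gauss)"
  unfolding fsum dser_def
  by (rule Bochner_Integration.integral_cong[OF refl]) (rule suminf_mult, rule subpoly_summable[OF sp], use \<sigma> in simp)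
 finally have eq: "smooth a \<sigma> w v = (\<integral>z. iexp (v * z / w) * dser a (Complex \<sigma> (z / w)) \<partial>Gauss)" .
 have "norm (smooth a \<sigma> w v) <= (\<integral>z. Bd (z / w) \<partial>Gauss)"
  unfolding eq by (rule norm_integral_le[OF I]) (use Bd in \<open>auto simp: norm_mult\<close>)
 then show ?thesis using E by simp
qed

lemma integral_exp_Iic:
 fixes c \<sigma> :: real
 assumes "\<sigma> > 0"
 shows "integrable lborel (%v. indicator {..c} v * exp (\<sigma> * v))" "(\<integral>v. indicator {..c} v * exp (\<sigma> * v) \<partial>lborel) = exp (\<sigma> * c) / \<sigma>"
proof -
 interpret E: prob_space "density lborel (exponential_density \<sigma>)" by (rule prob_space_exponential_density[OF assms])
 have m: "exponential_density \<sigma> \<in> borel_measurable borel" by measurable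
 have nn: "AE x in lborel. 0 <= exponential_density \<sigma> x" using assms by (auto intro!: AE_I2 exponential_density_nonneg)
 have I1: "integrable lborel (exponential_density \<sigma>)"
  using integrable_density[of "%_. 1::real" lborel "exponential_density \<sigma>"] m nn E.integrable_const[of "1::real"] by simp
 have I2: "integral\<^sup>L lborel (exponential_density \<sigma>) = 1"
  using integral_density[of "%_. 1::real" lborel "exponential_density \<sigma>"] m nn E.prob_space by simp
 define f where "f = (%v. indicator {..c} v * exp (\<sigma> * v))"
 have eq: "f (c + (-1) * r) = exp (\<sigma> * c) / \<sigma> * exponential_density \<sigma> r" for r
  using assms by (auto simp: f_def exponential_density_def indicator_def exp_diff exp_minus algebra_simps divide_simps exp_add[symmetric])
 have "integrable lborel (%r. f (c + (-1) * r))" unfolding eq using I1 by simp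
 then show "integrable lborel (%v. indicator {..c} v * exp (\<sigma> * v))"
  using lborel_integrable_real_affine_iff[of "-1" f c] by (simp add: f_def)
 have "integral\<^sup>L lborel f = \<bar>-1\<bar> *\<^sub>R (\<integral>r. f (c + (-1) * r) \<partial>lborel)" by (rule lborel_integral_real_affine) simp
 also have "... = exp (\<sigma> * c) / \<sigma>" unfolding eq using I2 by simp
 finally show "(\<integral>v. indicator {..c} v * exp (\<sigma> * v) \<partial>lborel) = exp (\<sigma> * c) / \<sigma>" by (simp add: f_def)
qed

definition summatory :: "(nat => complex) => real => complex" where
 "summatory a u = (\<Sum>n=1..nat \<lfloor>u\<rfloor>. a n)"

text \<open>Substituting v = ln n + w z for each n identifies the integral of \<open>smooth\<close>
  against e^(\<sigma> v) over v <= ln x with w sqrt(2 pi) times the normal mean of e^(\<sigma> w z)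
  A(x e^(-w z)), where A is the summatory function. A uniform bound for \<open>smooth\<close> thus
  controls a smoothed version of A.\<close>

lemma smoothed_summatory:
 assumes sp: "subpoly a" and \<sigma>: "\<sigma> > 1" and w: "w > 0" and x: "x > 0"
  and E0: "\<And>v. norm (smooth a \<sigma> w v) <= E0"
 shows "norm (\<integral>z. of_real (exp (\<sigma> * w * z)) * summatory a (x * exp (- w * z)) \<partial>Gauss) <= E0 * x powr \<sigma> / w"
proof -
 interpret prob_space Gauss by (rule prob_space_Gauss)
 have E0n: "E0 >= 0" using E0[of 0] norm_ge_zero order_trans by blast
 define J where "J = (%n z. indicator {z. ln (real n) + w * z <= ln x} z * exp (\<sigma> * w * z))"
 \<comment> \<open>The index 0 is suppressed: \<open>summatory\<close> starts at 1, and ln 0 is only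
   a default value, so the indicator in \<open>J\<close> means nothing there.\<close>
 define f where "f = (%n z. (if n = 0 then 0 else a n) * of_real (J n z))"
 have Jm: "J n \<in> borel_measurable borel" for n unfolding J_def by measurable
 have Jb: "0 <= J n z" "J n z <= x powr \<sigma> * real n powr (-\<sigma>)" if "n \<noteq> 0" for n z
 proof -
  show "0 <= J n z" by (simp add: J_def)
  have "exp (\<sigma> * w * z) <= x powr \<sigma> * real n powr (-\<sigma>)" if *: "ln (real n) + w * z <= ln x"
  proof -
   have "\<sigma> * (w * z) <= \<sigma> * (ln x - ln (real n))" using * \<sigma> by (intro mult_left_mono) auto
   then have "exp (\<sigma> * w * z) <= exp (\<sigma> * ln x + - \<sigma> * ln (real n))" by (simp add: algebra_simps)
   also have "... = x powr \<sigma> * real n powr (-\<sigma>)" using x \<open>n \<noteq> 0\<close> by (simp only: exp_add) (simp add: powr_def)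
   finally show ?thesis .
  qed
  then show "J n z <= x powr \<sigma> * real n powr (-\<sigma>)" by (auto simp: J_def indicator_def)
 qed
 have fb: "norm (f n z) <= x powr \<sigma> * (norm (a n) * real n powr (-\<sigma>))" for n z
 proof (cases "n = 0")
  case False
  then show ?thesis using mult_left_mono[OF Jb(2)[OF False, of z], of "norm (a n)"] Jb(1)[OF False, of z]
   by (simp add: f_def norm_mult mult_ac)
 qed (simp add: f_def)
 have fm: "f n \<in> borel_measurable borel" for n unfolding f_def using Jm[of n] by measurable
 have fI: "integrable Gauss (f n)" for n
  by (rule integrable_const_bound[OF AE_I2[OF fb]]) (use fm[of n] in simp)
 have S0: "summable (%n. x powr \<sigma> * (norm (a n) * real n powr (-\<sigma>)))" by (intro summable_mult subpoly_summable_real[OF sp \<sigma>])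
 have fS: "(\<Sum>n. f n z) = of_real (exp (\<sigma> * w * z)) * summatory a (x * exp (- w * z))" for z
 proof -
  have iff: "ln (real n) + w * z <= ln x \<longleftrightarrow> n <= nat \<lfloor>x * exp (- w * z)\<rfloor>" if "n \<noteq> 0" for n
  proof -
   have "ln (real n) + w * z <= ln x \<longleftrightarrow> ln (real n) <= ln (x * exp (- w * z))" using x by (simp add: ln_mult) linarith
   also have "... \<longleftrightarrow> real n <= x * exp (- w * z)" using that x by simp
   also have "... \<longleftrightarrow> n <= nat \<lfloor>x * exp (- w * z)\<rfloor>" using nat_le_nat_floor_iff[of n] that by simp
   finally show ?thesis .
  qed
  have "(\<Sum>n. f n z) = (\<Sum>n\<in>{1..nat \<lfloor>x * exp (- w * z)\<rfloor>}. f n z)"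
  proof (rule suminf_finite)
   fix n assume "n \<notin> {1..nat \<lfloor>x * exp (- w * z)\<rfloor>}"
   then show "f n z = 0" using iff[of n] by (cases "n = 0") (auto simp: f_def J_def)
  qed simp
  also have "... = (\<Sum>n\<in>{1..nat \<lfloor>x * exp (- w * z)\<rfloor>}. of_real (exp (\<sigma> * w * z)) * a n)"
  proof (rule sum.cong[OF refl])
   fix n assume "n \<in> {1..nat \<lfloor>x * exp (- w * z)\<rfloor>}"
   then show "f n z = of_real (exp (\<sigma> * w * z)) * a n" using iff[of n] by (auto simp: f_def J_def)
  qed
  finally show ?thesis by (simp add: summatory_def sum_distrib_left)
 qed
 define k where "k = (%n v. exp (- ((v - ln (real n)) / w)\<^sup>2 / 2))"
 define g where "g = (%n v. (a n * of_real (real n powr (-\<sigma>) * k n v)) * of_real (indicator {..ln x} v * exp (\<sigma> * v)))"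
 have k1: "0 <= k n v" "k n v <= 1" for n v by (auto simp: k_def)
 have km: "k n \<in> borel_measurable borel" for n unfolding k_def by measurable
 have gb: "norm (g n v) <= norm (a n) * real n powr (-\<sigma>) * (indicator {..ln x} v * exp (\<sigma> * v))" for n v
 proof -
  have "norm (g n v) = norm (a n) * real n powr (-\<sigma>) * (indicator {..ln x} v * exp (\<sigma> * v)) * k n v"
   using k1[of n v] by (simp add: g_def norm_mult mult_ac)
  also have "... <= norm (a n) * real n powr (-\<sigma>) * (indicator {..ln x} v * exp (\<sigma> * v)) * 1"
   by (intro mult_left_mono k1) auto
  finally show ?thesis by simp
 qed
 note X = integral_exp_Iic[of \<sigma> "ln x"]
 have gm: "g n \<in> borel_measurable borel" for n unfolding g_def using km[of n] by measurable
 have gI: "integrable lborel (g n)" for n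
  by (rule Bochner_Integration.integrable_bound[OF integrable_mult_right[OF X(1), of "norm (a n) * real n powr (-\<sigma>)"]])
    (use gm[of n] gb[of n] \<sigma> in \<open>auto intro!: AE_I2 order_trans[OF gb]\<close>)
 have fg: "integral\<^sup>L Gauss (f n) = of_real (1 / (w * sqrt (2 * pi))) * integral\<^sup>L lborel (g n)" for n
 proof (cases "n = 0")
  case False
  have "integral\<^sup>L lborel (g n) = \<bar>w\<bar> *\<^sub>R (\<integral>z. g n (ln (real n) + w * z) \<partial>lborel)"
   by (rule lborel_integral_real_affine) (use w in simp)
  also have "(\<integral>z. g n (ln (real n) + w * z) \<partial>lborel) = (\<integral>z. of_real (sqrt (2 * pi)) * (std_normal_density z *\<^sub>R f n z) \<partial>lborel)"
  proof (rule Bochner_Integration.integral_cong[OF refl])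
   fix z
   have E1: "real n powr (-\<sigma>) * exp (\<sigma> * (ln (real n) + w * z)) = exp (\<sigma> * w * z)"
    using False by (simp add: powr_def exp_add[symmetric] algebra_simps)
   have E2: "k n (ln (real n) + w * z) = sqrt (2 * pi) * std_normal_density z"
    using w by (simp add: k_def normal_density_def)
   have E3: "indicator {..ln x} (ln (real n) + w * z) = (indicator {z. ln (real n) + w * z <= ln x} z :: real)"
    by (simp add: indicator_def)
   have "real n powr (-\<sigma>) * k n (ln (real n) + w * z) * (indicator {..ln x} (ln (real n) + w * z) * exp (\<sigma> * (ln (real n) + w * z)))
     = k n (ln (real n) + w * z) * (indicator {..ln x} (ln (real n) + w * z) * (real n powr (-\<sigma>) * exp (\<sigma> * (ln (real n) + w * z))))"
    by (simp only: mult_ac)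
   also have "... = sqrt (2 * pi) * std_normal_density z * J n z" unfolding E1 E2 E3 J_def ..
   finally have E4: "real n powr (-\<sigma>) * k n (ln (real n) + w * z) * (indicator {..ln x} (ln (real n) + w * z) * exp (\<sigma> * (ln (real n) + w * z)))
     = sqrt (2 * pi) * std_normal_density z * J n z" .
   have "g n (ln (real n) + w * z) = a n * of_real (sqrt (2 * pi) * std_normal_density z * J n z)"
    unfolding g_def E4[symmetric] by (simp only: of_real_mult mult.assoc)
   then show "g n (ln (real n) + w * z) = of_real (sqrt (2 * pi)) * (std_normal_density z *\<^sub>R f n z)"
    using False by (simp add: f_def scaleR_conv_of_real)
  qed
  also have "... = of_real (sqrt (2 * pi)) * integral\<^sup>L Gauss (f n)"
   unfolding integral_mult_right_zero gauss_integral(2)[OF fm] ..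
  finally show ?thesis using w by (simp add: scaleR_conv_of_real)
 qed (simp add: f_def g_def)
 have "(\<integral>z. of_real (exp (\<sigma> * w * z)) * summatory a (x * exp (- w * z)) \<partial>Gauss) = (\<integral>z. (\<Sum>n. f n z) \<partial>Gauss)"
  by (simp only: fS)
 also have "... = (\<Sum>n. integral\<^sup>L Gauss (f n))"
 proof (rule integral_suminf[OF fI])
  show "AE z in Gauss. summable (%n. norm (f n z))"
   by (rule AE_I2) (rule summable_comparison_test'[OF S0], use fb in auto)
  show "summable (%n. \<integral>z. norm (f n z) \<partial>Gauss)"
  proof (rule summable_comparison_test'[OF S0])
   fix n
   have "(\<integral>z. norm (f n z) \<partial>Gauss) <= (\<integral>z. x powr \<sigma> * (norm (a n) * real n powr (-\<sigma>)) \<partial>Gauss)"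
    by (intro integral_mono integrable_norm fI fb) auto
   then show "norm (\<integral>z. norm (f n z) \<partial>Gauss) <= x powr \<sigma> * (norm (a n) * real n powr (-\<sigma>))" by (simp add: Gauss_UNIV)
  qed
 qed
 also have "... = of_real (1 / (w * sqrt (2 * pi))) * (\<Sum>n. integral\<^sup>L lborel (g n))"
 proof -
  have "summable (%n. integral\<^sup>L lborel (g n))"
  proof (rule summable_comparison_test'[OF summable_mult2[OF subpoly_summable_real[OF sp \<sigma>], of "exp (\<sigma> * ln x) / \<sigma>"]])
   fix n
   have "norm (integral\<^sup>L lborel (g n)) <= (\<integral>v. norm (a n) * real n powr (-\<sigma>) * (indicator {..ln x} v * exp (\<sigma> * v)) \<partial>lborel)"
    by (rule norm_integral_le) (use X(1) \<sigma> gb in auto)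
   then show "norm (integral\<^sup>L lborel (g n)) <= norm (a n) * real n powr (-\<sigma>) * (exp (\<sigma> * ln x) / \<sigma>)" using X(2) \<sigma> by simp
  qed
  then show ?thesis unfolding fg by (rule suminf_mult)
 qed
 also have "(\<Sum>n. integral\<^sup>L lborel (g n)) = (\<integral>v. (\<Sum>n. g n v) \<partial>lborel)"
 proof (rule integral_suminf[symmetric, OF gI])
  show "AE v in lborel. summable (%n. norm (g n v))"
   by (rule AE_I2) (rule summable_comparison_test'[OF summable_mult2[OF subpoly_summable_real[OF sp \<sigma>]]], use gb in auto)
  show "summable (%n. \<integral>v. norm (g n v) \<partial>lborel)"
  proof (rule summable_comparison_test'[OF summable_mult2[OF subpoly_summable_real[OF sp \<sigma>], of "exp (\<sigma> * ln x) / \<sigma>"]])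
   fix n
   have "(\<integral>v. norm (g n v) \<partial>lborel) <= (\<integral>v. norm (a n) * real n powr (-\<sigma>) * (indicator {..ln x} v * exp (\<sigma> * v)) \<partial>lborel)"
    using X(1) \<sigma> by (intro integral_mono integrable_norm gI gb) auto
   then show "norm (\<integral>v. norm (g n v) \<partial>lborel) <= norm (a n) * real n powr (-\<sigma>) * (exp (\<sigma> * ln x) / \<sigma>)" using X(2) \<sigma> by simp
  qed
 qed
 also have "(\<integral>v. (\<Sum>n. g n v) \<partial>lborel) = (\<integral>v. smooth a \<sigma> w v * of_real (indicator {..ln x} v * exp (\<sigma> * v)) \<partial>lborel)"
 proof (rule Bochner_Integration.integral_cong[OF refl])
  fix v
  have "summable (%n. a n * of_real (real n powr (-\<sigma>) * k n v))"
  proof (rule summable_comparison_test'[OF subpoly_summable_real[OF sp \<sigma>]])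
   fix n
   have "norm (a n) * real n powr (-\<sigma>) * k n v <= norm (a n) * real n powr (-\<sigma>) * 1" by (intro mult_left_mono k1) auto
   then show "norm (a n * of_real (real n powr (-\<sigma>) * k n v)) <= norm (a n) * real n powr (-\<sigma>)"
    using k1[of n v] by (simp add: norm_mult)
  qed
  then show "(\<Sum>n. g n v) = smooth a \<sigma> w v * of_real (indicator {..ln x} v * exp (\<sigma> * v))"
   unfolding g_def smooth_def k_def by (rule suminf_mult2[symmetric])
 qed
 finally have eq: "(\<integral>z. of_real (exp (\<sigma> * w * z)) * summatory a (x * exp (- w * z)) \<partial>Gauss) = of_real (1 / (w * sqrt (2 * pi))) * (\<integral>v. smooth a \<sigma> w v * of_real (indicator {..ln x} v * exp (\<sigma> * v)) \<partial>lborel)" .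
 have "norm (\<integral>v. smooth a \<sigma> w v * of_real (indicator {..ln x} v * exp (\<sigma> * v)) \<partial>lborel) <= (\<integral>v. E0 * (indicator {..ln x} v * exp (\<sigma> * v)) \<partial>lborel)"
 proof (rule norm_integral_le)
  show "integrable lborel (%v. E0 * (indicator {..ln x} v * exp (\<sigma> * v)))" using X(1) \<sigma> by simp
  show "AE v in lborel. norm (smooth a \<sigma> w v * of_real (indicator {..ln x} v * exp (\<sigma> * v))) <= E0 * (indicator {..ln x} v * exp (\<sigma> * v))"
  proof (rule AE_I2)
   fix v
   have "norm (smooth a \<sigma> w v) * (indicator {..ln x} v * exp (\<sigma> * v)) <= E0 * (indicator {..ln x} v * exp (\<sigma> * v))"
    by (intro mult_right_mono E0) auto
   then show "norm (smooth a \<sigma> w v * of_real (indicator {..ln x} v * exp (\<sigma> * v))) <= E0 * (indicator {..ln x} v * exp (\<sigma> * v))"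
    by (simp add: norm_mult)
  qed
 qed
 also have "... = E0 * (x powr \<sigma> / \<sigma>)" using X(2) \<sigma> x by (simp add: powr_def)
 finally have b1: "norm (\<integral>v. smooth a \<sigma> w v * of_real (indicator {..ln x} v * exp (\<sigma> * v)) \<partial>lborel) <= E0 * (x powr \<sigma> / \<sigma>)" .
 have "1 <= sqrt (2 * pi)" using pi_ge_two by simp
 then have s1: "1 / (w * sqrt (2 * pi)) <= 1 / w" using w by (intro divide_left_mono) auto
 have "norm (\<integral>z. of_real (exp (\<sigma> * w * z)) * summatory a (x * exp (- w * z)) \<partial>Gauss) <= (1 / w) * (E0 * (x powr \<sigma> / \<sigma>))"
  unfolding eq norm_mult norm_of_real using s1 b1 w by (intro mult_mono) auto
 also have "... <= (1 / w) * (E0 * (x powr \<sigma> / 1))"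
  using w E0n \<sigma> by (intro mult_left_mono divide_left_mono) auto
 finally show ?thesis by simp
qed

lemma gauss_exp_abs':
 fixes c :: real
 shows "integrable Gauss (%z. exp (c * \<bar>z\<bar>))" "(\<integral>z. exp (c * \<bar>z\<bar>) \<partial>Gauss) <= 2 * exp (c\<^sup>2 / 2)"
proof -
 have I: "integrable Gauss (%z. exp (c * z) + exp ((-c) * z))" by (intro Bochner_Integration.integrable_add gauss_exp)
 have le: "exp (c * \<bar>z\<bar>) <= exp (c * z) + exp ((-c) * z)" for z :: real by (cases "z >= 0") auto
 show J: "integrable Gauss (%z. exp (c * \<bar>z\<bar>))"
  by (rule Bochner_Integration.integrable_bound[OF I]) (use le in \<open>auto intro!: AE_I2 order_trans[OF le]\<close>)
 have "(\<integral>z. exp (c * \<bar>z\<bar>) \<partial>Gauss) <= (\<integral>z. exp (c * z) + exp ((-c) * z) \<partial>Gauss)"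
  by (rule integral_mono[OF J I]) (rule le)
 also have "... = exp (c\<^sup>2 / 2) + exp ((-c)\<^sup>2 / 2)"
  unfolding gauss_exp(2)[symmetric] by (intro Bochner_Integration.integral_add gauss_exp)
 finally show "(\<integral>z. exp (c * \<bar>z\<bar>) \<partial>Gauss) <= 2 * exp (c\<^sup>2 / 2)" by simp
qed

lemma summatory_diff:
 assumes a: "\<And>n. n > 0 ==> norm (a n) <= ln (real n) ^ m" and uv: "0 <= u" "u <= v" "1 <= v"
 shows "norm (summatory a v - summatory a u) <= (v - u + 1) * ln v ^ m"
proof -
 define i j where "i = nat \<lfloor>u\<rfloor>" and "j = nat \<lfloor>v\<rfloor>"
 have ij: "i <= j" "real j <= v" "real i >= u - 1" using uv unfolding i_def j_def by linarith+
 have "{1..j} = {1..i} \<union> {Suc i..j}" "{1..i} \<inter> {Suc i..j} = {}" using ij by auto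
 then have "summatory a v - summatory a u = (\<Sum>n=Suc i..j. a n)"
  unfolding summatory_def i_def[symmetric] j_def[symmetric] by (simp add: sum.union_disjoint)
 also have "norm ... <= (\<Sum>n=Suc i..j. ln v ^ m)"
 proof (rule sum_norm_le)
  fix n assume n: "n \<in> {Suc i..j}"
  have "norm (a n) <= ln (real n) ^ m" using n by (intro a) auto
  also have "... <= ln v ^ m" using n ij by (intro power_mono) (auto simp: ln_ge_zero)
  finally show "norm (a n) <= ln v ^ m" .
 qed
 also have "... = real (j - i) * ln v ^ m" using ij by simp
 also have "... <= (v - u + 1) * ln v ^ m" using ij uv by (intro mult_right_mono) (auto simp: of_nat_diff)
 finally show ?thesis .
qed

text \<open>Moving x by the factor e^(-w z) changes the range by about x w |z| integers. All
  dependence on z, including that of the logarithms, is put into one exponential, which is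
  integrable against the normal density.\<close>

lemma summatory_perturb:
 assumes a: "\<And>n. n > 0 ==> norm (a n) <= ln (real n) ^ m" and x: "x >= exp 1" and w: "0 < w" "w <= 1"
 shows "norm (summatory a (x * exp (- w * z)) - summatory a x) <= (x * w + 1) * ln x ^ m * exp ((real m + 2) * \<bar>z\<bar>)"
proof -
 define y where "y = x * exp (- w * z)"
 define u v where "u = min x y" and "v = max x y"
 have x1: "x >= 1" using x exp_ge_add_one_self[of 1] by linarith
 have y: "y > 0" using x1 by (simp add: y_def)
 have L: "ln x >= 1" using x x1 by (simp add: ln_ge_iff)
 have "norm (summatory a y - summatory a x) = norm (summatory a v - summatory a u)"
  by (cases "x <= y") (auto simp: u_def v_def norm_minus_commute)
 also have "... <= (v - u + 1) * ln v ^ m"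
  by (rule summatory_diff[OF a]) (use x1 y in \<open>auto simp: u_def v_def\<close>)
 also have "... <= ((x * w + 1) * exp (2 * \<bar>z\<bar>)) * (ln x * exp \<bar>z\<bar>) ^ m"
 proof (intro mult_mono power_mono)
  have wz: "\<bar>w * z\<bar> <= \<bar>z\<bar>" using w by (simp add: abs_mult mult_left_le_one_le)
  have "\<bar>exp (- w * z) - 1\<bar> <= \<bar>w * z\<bar> * exp \<bar>w * z\<bar>"
  proof (cases "w * z >= 0")
   case True
   have "1 - exp (- (w * z)) <= w * z" using exp_ge_add_one_self[of "- (w * z)"] by linarith
   also have "... <= (w * z) * exp (w * z)" using mult_left_mono[of 1 "exp (w * z)" "w * z"] True by simp
   finally show ?thesis using True by simp
  next
   case False
   define b where "b = - (w * z)"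
   have b: "b > 0" using False by (simp add: b_def)
   have "exp b * (1 - b) <= exp b * exp (- b)" using exp_ge_add_one_self[of "-b"] by (intro mult_left_mono) auto
   then have "exp b - 1 <= b * exp b" by (simp add: exp_minus_inverse algebra_simps)
   then show ?thesis using b by (simp add: b_def abs_if)
  qed
  also have "... <= (w * exp \<bar>z\<bar>) * exp \<bar>z\<bar>"
  proof (intro mult_mono)
   have "\<bar>z\<bar> <= exp \<bar>z\<bar>" using exp_ge_add_one_self[of "\<bar>z\<bar>"] by linarith
   then show "\<bar>w * z\<bar> <= w * exp \<bar>z\<bar>" using w by (simp add: abs_mult)
  qed (use wz w in auto)
  also have "... = w * exp (2 * \<bar>z\<bar>)" by (simp add: exp_add[symmetric])
  finally have "x * \<bar>exp (- w * z) - 1\<bar> <= x * (w * exp (2 * \<bar>z\<bar>))" using x1 by (intro mult_left_mono) auto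
  moreover have "v - u = x * \<bar>exp (- w * z) - 1\<bar>"
  proof -
   have "v - u = \<bar>y - x\<bar>" by (auto simp: u_def v_def)
   also have "y - x = x * (exp (- w * z) - 1)" by (simp add: y_def algebra_simps)
   finally show ?thesis using x1 by (simp add: abs_mult)
  qed
  moreover have "1 <= exp (2 * \<bar>z\<bar>)" by simp
  ultimately have "v - u + 1 <= x * (w * exp (2 * \<bar>z\<bar>)) + exp (2 * \<bar>z\<bar>)" by linarith
  then show "v - u + 1 <= (x * w + 1) * exp (2 * \<bar>z\<bar>)" by (simp add: algebra_simps)
  have "v <= x * exp \<bar>z\<bar>"
  proof -
   have "- w * z <= \<bar>z\<bar>" using wz by linarith
   then have "y <= x * exp \<bar>z\<bar>" unfolding y_def using x1 by (intro mult_left_mono) auto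
   moreover have "x * 1 <= x * exp \<bar>z\<bar>" using x1 by (intro mult_left_mono) auto
   ultimately show ?thesis by (simp add: v_def)
  qed
  moreover have "v > 0" using x1 by (simp add: v_def)
  ultimately have "ln v <= ln (x * exp \<bar>z\<bar>)" using x1 by simp
  also have "... = ln x + \<bar>z\<bar>" using x1 by (simp add: ln_mult)
  also have "... <= ln x * (1 + \<bar>z\<bar>)" using L mult_right_mono[OF L, of "\<bar>z\<bar>"] by (simp add: algebra_simps)
  also have "... <= ln x * exp \<bar>z\<bar>" using L by (intro mult_left_mono exp_ge_add_one_self) auto
  finally show "ln v <= ln x * exp \<bar>z\<bar>" .
  show "0 <= ln v" using x1 by (auto simp: v_def)
 qed (use x1 w L in \<open>auto simp: v_def intro!: zero_le_power\<close>)
 also have "... = (x * w + 1) * ln x ^ m * (exp (2 * \<bar>z\<bar>) * exp \<bar>z\<bar> ^ m)" by (simp add: power_mult_distrib)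
 also have "exp (2 * \<bar>z\<bar>) * exp \<bar>z\<bar> ^ m = exp ((real m + 2) * \<bar>z\<bar>)"
  by (simp add: exp_of_nat_mult[symmetric] exp_add[symmetric] algebra_simps)
 finally show ?thesis by (simp add: y_def)
qed

lemma summatory_measurable: "(%z. summatory a (x * exp (- w * z))) \<in> borel_measurable borel"
proof -
 have "(%z. \<lfloor>x * exp (- w * z)\<rfloor>) \<in> measurable borel (count_space UNIV)"
  by measurable
 from measurable_compose[OF this, of "%k. \<Sum>n=1..nat k. a n" borel] show ?thesis
  unfolding summatory_def by simp
qed

lemma summatory_bound:
 assumes sp: "subpoly a" and a: "\<And>n. n > 0 ==> norm (a n) <= ln (real n) ^ m"
  and \<sigma>: "1 < \<sigma>" "\<sigma> <= 2" and w: "0 < w" "w <= 1" and x: "x >= exp 1"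
  and E0: "\<And>v. norm (smooth a \<sigma> w v) <= E0"
 shows "norm (summatory a x) <= E0 * x powr \<sigma> / w + 2 * exp ((real m + 4)\<^sup>2 / 2) * (x * w + 1) * ln x ^ m"
proof -
 have x0: "x > 0" using x exp_gt_zero[of "1::real"] by linarith
 define g where "g = (%z. of_real (exp (\<sigma> * w * z)) * (summatory a (x * exp (- w * z)) - summatory a x))"
 define Q where "Q = (x * w + 1) * ln x ^ m"
 have le: "norm (g z) <= Q * exp ((real m + 4) * \<bar>z\<bar>)" for z
 proof -
  have "\<sigma> * w * z <= 2 * \<bar>z\<bar>"
  proof -
   have "\<sigma> * w * z <= \<bar>\<sigma> * w * z\<bar>" by simp
   also have "... = \<sigma> * w * \<bar>z\<bar>" using \<sigma> w by (simp add: abs_mult)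
   also have "... <= (2 * 1) * \<bar>z\<bar>" using \<sigma> w by (intro mult_right_mono mult_mono) auto
   finally show ?thesis by simp
  qed
  then have "norm (g z) <= exp (2 * \<bar>z\<bar>) * (Q * exp ((real m + 2) * \<bar>z\<bar>))"
   unfolding g_def norm_mult norm_of_real Q_def
   using summatory_perturb[OF a x w, of z] by (intro mult_mono) auto
  also have "... = Q * exp ((real m + 4) * \<bar>z\<bar>)" by (simp add: mult_exp_exp algebra_simps)
  finally show ?thesis .
 qed
 have gm: "g \<in> borel_measurable borel" unfolding g_def using summatory_measurable[of a x w] by measurable
 have bI: "integrable Gauss (%z. Q * exp ((real m + 4) * \<bar>z\<bar>))" using gauss_exp_abs'(1) by simp
 have gI: "integrable Gauss g"
  by (rule Bochner_Integration.integrable_bound[OF bI]) (use gm le in \<open>auto intro!: AE_I2 order_trans[OF le]\<close>)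
 have gint: "norm (integral\<^sup>L Gauss g) <= Q * (2 * exp ((real m + 4)\<^sup>2 / 2))"
 proof -
  have "norm (integral\<^sup>L Gauss g) <= (\<integral>z. Q * exp ((real m + 4) * \<bar>z\<bar>) \<partial>Gauss)"
   by (rule norm_integral_le[OF bI]) (use le in simp)
  also have "... = Q * (\<integral>z. exp ((real m + 4) * \<bar>z\<bar>) \<partial>Gauss)" by simp
  also have "... <= Q * (2 * exp ((real m + 4)\<^sup>2 / 2))"
  proof (intro mult_left_mono gauss_exp_abs')
   have "ln x >= 0" using x exp_ge_add_one_self[of 1] by (intro ln_ge_zero) linarith
   then show "0 <= Q" using x0 w by (simp add: Q_def)
  qed
  finally show ?thesis .
 qed
 have I2: "integrable Gauss (%z. complex_of_real (exp (\<sigma> * w * z)) * summatory a x)"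
  using gauss_exp(1)[of "\<sigma> * w"] by (intro integrable_mult_left integrable_of_real) simp
 have "(\<integral>z. of_real (exp (\<sigma> * w * z)) * summatory a (x * exp (- w * z)) \<partial>Gauss) = (\<integral>z. g z + of_real (exp (\<sigma> * w * z)) * summatory a x \<partial>Gauss)"
  by (rule Bochner_Integration.integral_cong) (auto simp: g_def algebra_simps)
 also have "... = integral\<^sup>L Gauss g + (\<integral>z. of_real (exp (\<sigma> * w * z)) * summatory a x \<partial>Gauss)"
  by (rule Bochner_Integration.integral_add[OF gI I2])
 also have "(\<integral>z. of_real (exp (\<sigma> * w * z)) * summatory a x \<partial>Gauss) = of_real (exp ((\<sigma> * w)\<^sup>2 / 2)) * summatory a x"
  unfolding integral_mult_left_zero by (simp only: integral_complex_of_real gauss_exp(2))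
 finally have eq: "of_real (exp ((\<sigma> * w)\<^sup>2 / 2)) * summatory a x = (\<integral>z. of_real (exp (\<sigma> * w * z)) * summatory a (x * exp (- w * z)) \<partial>Gauss) - integral\<^sup>L Gauss g"
  by simp
 have "1 * norm (summatory a x) <= exp ((\<sigma> * w)\<^sup>2 / 2) * norm (summatory a x)"
  by (intro mult_right_mono) auto
 also have "... = norm (of_real (exp ((\<sigma> * w)\<^sup>2 / 2)) * summatory a x)" by (simp add: norm_mult)
 also have "... <= norm (\<integral>z. of_real (exp (\<sigma> * w * z)) * summatory a (x * exp (- w * z)) \<partial>Gauss) + norm (integral\<^sup>L Gauss g)"
  unfolding eq by (rule norm_triangle_ineq4)
 also have "... <= E0 * x powr \<sigma> / w + Q * (2 * exp ((real m + 4)\<^sup>2 / 2))"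
  by (intro add_mono smoothed_summatory[OF sp \<sigma>(1) w(1) x0 E0] gint)
 finally show ?thesis by (simp add: Q_def mult_ac)
qed

subsection \<open>The Siegel--Walfisz theorem\<close>

text \<open>An explicit constant trades powers of ln x for x^(1/4) at every x >= 1 and not just
  eventually.\<close>

lemma ln_powr_le:
 fixes c x :: real
 assumes "c > 0" "x >= 1"
 shows "ln x powr c <= (4 * c) powr c * x powr (1/4)"
proof (cases "x = 1")
 case False
 have "ln x <= x powr (1 / (4 * c)) / (1 / (4 * c))" using assms by (intro ln_powr_bound) auto
 then have "ln x <= (4 * c) * x powr (1 / (4 * c))" by (simp add: mult.commute)
 then have "ln x powr c <= ((4 * c) * x powr (1 / (4 * c))) powr c" using assms by (intro powr_mono2) auto
 also have "... = (4 * c) powr c * x powr (1/4)" using assms by (simp add: powr_mult powr_powr)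
 finally show ?thesis .
qed simp

text \<open>A proper prime power p^j <= x has p <= sqrt x and j <= 2 ln x, the latter because ln 2
  >= 1/2. The added 1's count the exponent 0 and the base 0 in the enclosing rectangle.\<close>

lemma card_prime_powers_le:
 assumes "x >= 1"
 shows "real (card {n. primepow n \<and> \<not> prime n \<and> n <= nat \<lfloor>x :: real\<rfloor>}) <= (sqrt x + 1) * (2 * ln x + 1)"
proof -
 define P where "P = nat \<lfloor>sqrt x\<rfloor>"
 define J where "J = nat \<lfloor>2 * ln x\<rfloor>"
 have sub: "{n. primepow n \<and> \<not> prime n \<and> n <= nat \<lfloor>x\<rfloor>} \<subseteq> (%(p,j). p ^ j) ` ({..P} \<times> {..J})"
 proof
  fix n assume "n \<in> {n. primepow n \<and> \<not> prime n \<and> n <= nat \<lfloor>x\<rfloor>}"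
  then have n: "primepow n" "\<not> prime n" "n <= nat \<lfloor>x\<rfloor>" by auto
  then have nx: "real n <= x" using assms by linarith
  obtain p k where pk: "prime p" "k > 0" "n = p ^ k" using n(1) unfolding primepow_def by blast
  have k2: "k >= 2" using pk n(2) by (cases "k = 1") auto
  have p2: "p >= 2" using pk(1) by (rule prime_ge_2_nat)
  have "p ^ 2 <= n" unfolding pk(3) using k2 p2 by (intro power_increasing) auto
  then have "(real p)\<^sup>2 <= x" using nx by (metis of_nat_le_iff of_nat_power order_trans)
  then have "real p <= sqrt x" by (rule real_le_rsqrt)
  then have pP: "p <= P" unfolding P_def by (rule le_nat_floor)
  have "(2::real) ^ k <= real p ^ k" using p2 by (intro power_mono) auto
  then have "(2::real) ^ k <= x" using nx pk(3) by simp
  then have "real k * ln 2 <= ln x" using assms by (simp add: ln_realpow[symmetric])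
  moreover have "ln 2 >= (1/2::real)" using ln2_ge_two_thirds by simp
  then have "real k * (1/2) <= real k * ln 2" by (intro mult_left_mono) auto
  ultimately have "real k <= 2 * ln x" by simp
  then have "k <= J" unfolding J_def by (rule le_nat_floor)
  then show "n \<in> (%(p,j). p ^ j) ` ({..P} \<times> {..J})" using pP pk(3) by force
 qed
 have "card {n. primepow n \<and> \<not> prime n \<and> n <= nat \<lfloor>x\<rfloor>} <= card ((%(p,j). p ^ j) ` ({..P} \<times> {..J}))"
  by (rule card_mono[OF _ sub]) simp
 also have "... <= card ({..P} \<times> {..J})" by (rule card_image_le) simp
 also have "... = (P + 1) * (J + 1)" by simp
 finally have "real (card {n. primepow n \<and> \<not> prime n \<and> n <= nat \<lfloor>x\<rfloor>}) <= real ((P + 1) * (J + 1))" by (simp only: of_nat_le_iff)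
 also have "... = (real P + 1) * (real J + 1)" by (simp add: algebra_simps)
 also have "... <= (sqrt x + 1) * (2 * ln x + 1)"
 proof (intro mult_mono add_mono)
  show "real P <= sqrt x" unfolding P_def using assms by (intro of_nat_floor) simp
  show "real J <= 2 * ln x" unfolding J_def using assms by (intro of_nat_floor) simp
 qed (use assms in auto)
 finally show ?thesis .
qed

abbreviation primes_le :: "real => nat set" where "primes_le x \<equiv> {p. prime p \<and> real p <= x}"

text \<open>With width w = L^(-B), unsmoothing saves L^(-B) over the trivial bound x L^m for the
  weighted sum. The k-th derivative on Re s = 1 + 1/L contributes x L / w = x L^(1+B) up to a
  constant, with an exponent that does not depend on k; after division by the weights this is small
  as well.\<close>

theorem siegel_walfisz:
 assumes cl: "siegel_class F R" and B: "B >= 1"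
 shows "\<exists>C>0. \<forall>x\<ge>3. \<forall>(q,\<xi>)\<in>F. real q <= ln x powr B \<longrightarrow>
      norm (\<Sum>p | prime p \<and> real p <= x. \<xi> p) <= C * x / ln x powr B"
proof -
 define k where "k = nat \<lceil>2 * B\<rceil>"
 have k: "real k >= 2 * B" unfolding k_def by linarith
 define m where "m = k + 1"
 \<comment> \<open>Modulus and height enter together through q / w <= L^(2B); raised to the power
   \<delta> = 1/(2B) this costs one factor L.\<close>
 define \<delta> where "\<delta> = 1 / (2 * B)"
 have \<delta>: "\<delta> > 0" "\<delta> <= 1" using B by (auto simp: \<delta>_def)
 obtain C where C: "C > 0" "\<And>q \<xi> s. (q,\<xi>) \<in> F ==> 1 < Re s ==> Re s <= 2 ==>
   norm (dser (%n. (- of_real (ln (real n))) ^ k * (\<xi> n * mangoldt n)) s) <= C * (real q * (2 + \<bar>Im s\<bar>)) powr \<delta>"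
  using log_deriv_bound[OF cl \<delta>(1), of k] by fast
 define K where "K = 2 * exp ((real m + 4)\<^sup>2 / 2)"
 define M1 where "M1 = (4 * B) powr B"
 define C1 where "C1 = 2 * C * K5 * 3 + K * (1 + M1) + 3 ^ m"
 define C2 where "C2 = (4 * (B + 1)) powr (B + 1)"
 define C3 where "C3 = 2 * C1 * 2 ^ m * 2 + 9 * C2"
 have C1pos: "C1 > 0" using C unfolding C1_def K_def K5_def M1_def by (intro add_nonneg_pos add_nonneg_nonneg mult_nonneg_nonneg) auto
 have C3pos: "C3 > 0" unfolding C3_def C2_def using C1pos B by (intro add_pos_nonneg) auto
 have main: "norm (\<Sum>p | prime p \<and> real p <= x. \<xi> p) <= C3 * x / ln x powr B"
  if x3: "x >= 3" and F: "(q,\<xi>) \<in> F" and qB: "real q <= ln x powr B" for x q \<xi>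
 proof -
  define L where "L = ln x"
  have xe: "x >= exp 1" using x3 exp_le by linarith
  have L1: "L >= 1" using xe x3 by (simp add: L_def ln_ge_iff)
  have np: "nonprincipal q \<xi>" using cl F unfolding siegel_class_def by auto
  note d = nonprincipal_dchar[OF np]
  note cm = dchar_cmult[OF d]
  have q1: "real q >= 1" using dcharD(1)[OF d] by simp
  define a where "a = (%n. (- of_real (ln (real n))) ^ k * (\<xi> n * mangoldt n))"
  have asp: "subpoly a" unfolding a_def by (rule subpoly_ln_power[OF cmult_mangoldt_subpoly[OF cm]])
  have an: "norm (a n) <= ln (real n) ^ m" if "n > 0" for n
  proof -
   have "norm (a n) = ln (real n) ^ k * (norm (\<xi> n) * mangoldt n)"
    using that by (simp add: a_def norm_mult norm_power)
   also have "... <= ln (real n) ^ k * (1 * ln (real n))"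
    using that by (intro mult_left_mono mult_mono dchar_norm_le[OF d] mangoldt_le mangoldt_nonneg) auto
   finally show ?thesis by (simp add: m_def mult.commute)
  qed
  define w where "w = L powr (-B)"
  have w: "w > 0" "w <= 1"
  proof -
   show "w > 0" using L1 by (simp add: w_def)
   have "L powr (-B) <= L powr 0" using L1 B by (intro powr_mono) auto
   then show "w <= 1" using L1 by (simp add: w_def)
  qed
  \<comment> \<open>Chosen so that x^\<sigma> = e x.\<close>
  define \<sigma> where "\<sigma> = 1 + 1 / L"
  have \<sigma>: "1 < \<sigma>" "\<sigma> <= 2" using L1 by (auto simp: \<sigma>_def divide_le_eq_1)
  define Q where "Q = 2 * C * (real q / w) powr \<delta>"
  have Qn: "Q >= 0" using C by (simp add: Q_def)
  have sm: "norm (smooth a \<sigma> w v) <= Q * K5" for v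
  proof (rule smooth_bound[OF asp \<sigma>(1) w(1), where Bd = "%t. Q * exp (5 * \<bar>w * t\<bar>)"])
   fix t
   have "norm (dser a (Complex \<sigma> t)) <= C * (real q * (2 + \<bar>t\<bar>)) powr \<delta>"
    using C(2)[OF F, of "Complex \<sigma> t"] \<sigma> by (simp add: a_def)
   also have "(real q * (2 + \<bar>t\<bar>)) powr \<delta> <= ((real q / w) * (2 + \<bar>w * t\<bar>)) powr \<delta>"
   proof (intro powr_mono2)
    have "w * (2 + \<bar>t\<bar>) <= 2 + \<bar>w * t\<bar>" using w by (simp add: abs_mult distrib_left)
    then have "2 + \<bar>t\<bar> <= (2 + \<bar>w * t\<bar>) / w" using w by (simp add: pos_le_divide_eq mult.commute)
    from mult_left_mono[OF this, of "real q"] show "real q * (2 + \<bar>t\<bar>) <= (real q / w) * (2 + \<bar>w * t\<bar>)" by simp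
   qed (use \<delta> in auto)
   also have "((real q / w) * (2 + \<bar>w * t\<bar>)) powr \<delta> = (real q / w) powr \<delta> * (2 + \<bar>w * t\<bar>) powr \<delta>" by (simp only: powr_mult)
   also have "... <= (real q / w) powr \<delta> * (2 * exp (5 * \<bar>w * t\<bar>))"
   proof (intro mult_left_mono)
    have "(2 + \<bar>w * t\<bar>) powr \<delta> <= (2 + \<bar>w * t\<bar>) powr 1" using \<delta> by (intro powr_mono) auto
    also have "... = 2 + \<bar>w * t\<bar>" by simp
    also have "... <= 2 * (1 + 5 * \<bar>w * t\<bar>)" by simp
    also have "... <= 2 * exp (5 * \<bar>w * t\<bar>)" by (intro mult_left_mono exp_ge_add_one_self) auto
    finally show "(2 + \<bar>w * t\<bar>) powr \<delta> <= 2 * exp (5 * \<bar>w * t\<bar>)" .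
   qed auto
   finally show "norm (dser a (Complex \<sigma> t)) <= Q * exp (5 * \<bar>w * t\<bar>)"
    using C(1) by (simp add: Q_def mult_ac)
  next
   show "integrable Gauss (%z. Q * exp (5 * \<bar>w * (z / w)\<bar>))" using w gauss_exp_abs by simp
   show "(\<integral>z. Q * exp (5 * \<bar>w * (z / w)\<bar>) \<partial>Gauss) <= Q * K5"
    using w gauss_exp_abs(2) Qn by (simp add: mult_left_mono)
  qed
  have QL: "Q <= 2 * C * L"
  proof -
   have "real q / w <= L powr B / L powr (-B)" unfolding w_def using qB L1 by (intro divide_right_mono) (auto simp: L_def)
   also have "... = L powr (2 * B)" by (simp add: powr_diff[symmetric])
   finally have "(real q / w) powr \<delta> <= (L powr (2 * B)) powr \<delta>" using w \<delta> by (intro powr_mono2) auto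
   also have "... = L" using L1 B by (simp add: powr_powr \<delta>_def)
   finally show ?thesis unfolding Q_def using C by simp
  qed
  have LB: "L powr B >= 1" using L1 B by (simp add: ge_one_powr_ge_zero)
  have LM: "L powr B <= M1 * x"
  proof -
   have "L powr B <= M1 * x powr (1/4)" unfolding L_def M1_def using B x3 by (intro ln_powr_le) auto
   also have "... <= M1 * x powr 1" using x3 by (intro mult_left_mono powr_mono) (auto simp: M1_def)
   finally show ?thesis using x3 by simp
  qed
  text \<open>The exponent \<open>m = k + 1\<close> exceeds \<open>2 B\<close>, so that after removing the weight both error terms are \<open>x L^(-B)\<close>.\<close>
  have Lm: "L * L powr B <= L ^ m * w"
  proof -
   have "L * L powr B = L powr (1 + B)" using L1 by (simp add: powr_add)
   also have "... <= L powr (real m - B)" using k L1 by (intro powr_mono) (auto simp: m_def)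
   also have "... = L ^ m * w" using L1 by (simp add: w_def powr_diff powr_minus powr_realpow divide_inverse)
   finally show ?thesis .
  qed
  have summ: "norm (summatory a u) <= C1 * x * (L ^ m * w)" if u: "0 <= u" "u <= x" for u
  proof (cases "u >= exp 1")
   case True
   have u1: "u >= 1" using True exp_ge_add_one_self[of 1] by linarith
   have lnu: "0 <= ln u" "ln u <= L" using u u1 by (auto simp: L_def)
   have "norm (summatory a u) <= (Q * K5) * u powr \<sigma> / w + 2 * exp ((real m + 4)\<^sup>2 / 2) * (u * w + 1) * ln u ^ m"
    by (rule summatory_bound[OF asp an \<sigma> w True sm])
   also have "... <= (2 * C * L * K5) * (3 * x) / w + K * (x * w + 1) * L ^ m"
   proof (intro add_mono divide_right_mono mult_mono power_mono)
    have "u powr \<sigma> <= x powr \<sigma>" using u \<sigma> by (intro powr_mono2) auto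
    also have "... = x * x powr (1 / L)" unfolding \<sigma>_def using x3 by (simp add: powr_add)
    also have "x powr (1 / L) = exp 1" using x3 L1 by (simp add: powr_def L_def)
    also have "x * exp 1 <= x * 3" using x3 exp_le by (intro mult_left_mono) auto
    finally show "u powr \<sigma> <= 3 * x" by simp
   qed (use QL Qn C L1 u w lnu x3 in \<open>auto simp: K_def K5_def intro!: add_nonneg_nonneg\<close>)
   also have "(2 * C * L * K5) * (3 * x) / w = (2 * C * K5 * 3) * x * (L * L powr B)"
    using w by (simp add: w_def powr_minus field_simps)
   also have "... <= (2 * C * K5 * 3) * x * (L ^ m * w)"
    using Lm C x3 by (intro mult_left_mono) (auto simp: K5_def)
   also have "K * (x * w + 1) * L ^ m <= K * (x * w + M1 * x * w) * L ^ m"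
   proof (intro mult_left_mono mult_right_mono add_left_mono)
    have "1 = L powr B * w" using L1 by (simp add: w_def powr_minus)
    also have "... <= M1 * x * w" using LM w by (intro mult_right_mono) auto
    finally show "1 <= M1 * x * w" .
   qed (use L1 in \<open>auto simp: K_def\<close>)
   also have "K * (x * w + M1 * x * w) * L ^ m = (K * (1 + M1)) * x * (L ^ m * w)" by (simp add: algebra_simps)
   finally have "norm (summatory a u) <= (2 * C * K5 * 3 + K * (1 + M1)) * x * (L ^ m * w)" by (simp add: algebra_simps)
   also have "... <= C1 * x * (L ^ m * w)" unfolding C1_def using x3 L1 w by (intro mult_right_mono) auto
   finally show ?thesis .
  next
   case False
   have "norm (summatory a u) <= 3 ^ m * 3"
   proof -
    have "norm (summatory a (max 1 u) - summatory a 0) <= (max 1 u - 0 + 1) * ln (max 1 u) ^ m"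
     by (rule summatory_diff[OF an]) (use u in auto)
    moreover have "summatory a 0 = 0" by (simp add: summatory_def)
    moreover have "norm (summatory a u) <= norm (summatory a (max 1 u))"
     by (cases "u >= 1") (auto simp: summatory_def max_def)
    moreover have "(max 1 u - 0 + 1) * ln (max 1 u) ^ m <= (3 + 1) * 1 ^ m"
    proof (intro mult_mono power_mono add_mono)
     show "max 1 u - 0 <= 3" using False exp_le by simp
     have "ln (max 1 u) <= ln (exp 1)" using False exp_ge_add_one_self[of 1] by (subst ln_le_cancel_iff) (auto simp: max_def)
     then show "ln (max 1 u) <= 1" by simp
    qed auto
    moreover have "(3::real) ^ m >= 3 ^ 1" by (rule power_increasing) (auto simp: m_def)
    ultimately show ?thesis by simp
   qed
   also have "... <= C1 * x * (L ^ m * w)"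
   proof -
    have "1 * 1 <= L * L powr B" using L1 LB by (intro mult_mono) auto
    then have "1 <= L ^ m * w" using Lm by simp
    moreover have "3 ^ m <= C1" unfolding C1_def using C by (simp add: K_def K5_def M1_def)
    ultimately have "(3 ^ m * 3) * 1 <= (C1 * x) * (L ^ m * w)" using x3 C1pos by (intro mult_mono) auto
    then show ?thesis by simp
   qed
   finally show ?thesis .
  qed
  \<comment> \<open>The range up to sqrt x is discarded at a cost of about sqrt x. Above it ln n
    lies between L/2 and L, so dividing by (ln n)^m instead of L^m loses only 2^m.\<close>
  define N0 where "N0 = Suc (nat \<lfloor>sqrt x\<rfloor>)"
  define N where "N = nat \<lfloor>x\<rfloor>"
  have sx: "sqrt x >= 1" "sqrt x <= x"
   using x3 self_le_power[of x 2] by (auto intro!: real_le_lsqrt)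
  have NN: "real N0 > sqrt x" "real N <= x" "real N0 <= sqrt x + 1" unfolding N0_def N_def using sx x3 by linarith+
  \<comment> \<open>Of the m = k + 1 logarithms, k undo the derivative, and the last one turns
    \<Lambda>(n) into \<Lambda>(n) / ln n, which is 1 at primes.\<close>
  define b where "b = (%n. 1 / ln (real n) ^ m)"
  have lnN0: "ln (real n) >= L / 2" if "n >= N0" for n
  proof -
   have "sqrt x < real n" using NN(1) that by linarith
   moreover have "sqrt x > 0" using sx by linarith
   ultimately have "ln (sqrt x) <= ln (real n)" by (subst ln_le_cancel_iff) linarith+
   then show ?thesis using x3 by (simp add: L_def ln_sqrt)
  qed
  have part: "norm (\<Sum>n=N0..j. a n) <= 2 * (C1 * x * (L ^ m * w))" if "j <= N" for j
  proof (cases "N0 <= j")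
   case True
   have e1: "summatory a (real j) = (\<Sum>n=1..j. a n)" "summatory a (real (N0 - 1)) = (\<Sum>n=1..N0-1. a n)" by (auto simp: summatory_def)
   have "{1..j} = {1..N0-1} \<union> {N0..j}" "{1..N0-1} \<inter> {N0..j} = {}" using True by (auto simp: N0_def)
   then have "(\<Sum>n=N0..j. a n) = summatory a (real j) - summatory a (real (N0 - 1))" unfolding e1 by (simp add: sum.union_disjoint)
   also have "norm ... <= norm (summatory a (real j)) + norm (summatory a (real (N0 - 1)))" by (rule norm_triangle_ineq4)
   also have "... <= C1 * x * (L ^ m * w) + C1 * x * (L ^ m * w)"
   proof (intro add_mono summ)
    show "real j <= x" using that NN by linarith
    show "real (N0 - 1) <= x" using True that NN by linarith
   qed auto
   finally show ?thesis by (simp only: mult_2)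
  next
   case False
   then show ?thesis using C1pos x3 L1 w by simp
  qed
  have wsum: "norm (\<Sum>n=N0..N. a n * of_real (b n)) <= 2 * C1 * 2 ^ m * x * w"
  proof (cases "N0 <= N")
   case True
   have "norm (\<Sum>n=N0..N. a n * of_real (b n)) <= 2 * (C1 * x * (L ^ m * w)) * b N0"
   proof (rule abel_decreasing[OF part])
    show "b (Suc n) <= b n" if "N0 <= n" "n < N" for n
    proof -
     have "ln (real n) > 0" using lnN0[OF that(1)] L1 by linarith
     moreover have "ln (real n) <= ln (real (Suc n))" using that by (cases "n = 0") (auto simp: N0_def)
     ultimately show ?thesis unfolding b_def by (intro divide_left_mono power_mono mult_pos_pos zero_less_power) linarith+
    qed
    show "0 <= b n" if "N0 <= n" for n
     using lnN0[OF that] L1 unfolding b_def by (intro divide_nonneg_nonneg zero_le_power) auto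
   qed (use True in auto)
   also have "b N0 <= 1 / (L / 2) ^ m"
    unfolding b_def using lnN0[of N0] L1 by (intro divide_left_mono power_mono mult_pos_pos zero_less_power) auto
   also have "2 * (C1 * x * (L ^ m * w)) * (1 / (L / 2) ^ m) = 2 * C1 * 2 ^ m * x * w"
    using L1 by (simp add: power_divide)
   finally show ?thesis using C1pos x3 L1 w by (simp add: mult_left_mono)
  next
   case False
   then show ?thesis using C1pos x3 w by simp
  qed
  define c where "c = (%n. \<xi> n * of_real (mangoldt n / ln (real n)))"
  have ab: "a n * of_real (b n) = (-1) ^ k * c n" if "n >= N0" for n
  proof -
   have l: "ln (real n) > 0" using lnN0[OF that] L1 by linarith
   have "(- of_real (ln (real n))) ^ k = (-1) ^ k * (of_real (ln (real n) ^ k) :: complex)" by (simp add: power_minus[of "of_real (ln (real n))"])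
   then have "a n * of_real (b n) = (-1) ^ k * (\<xi> n * of_real (mangoldt n) * of_real (ln (real n) ^ k * b n))"
    by (simp add: a_def mult_ac)
   also have "ln (real n) ^ k * b n = 1 / ln (real n)" using l by (simp add: b_def m_def)
   finally show ?thesis by (simp add: c_def mult_ac divide_inverse)
  qed
  have csum: "norm (\<Sum>n=N0..N. c n) <= 2 * C1 * 2 ^ m * x * w"
  proof -
   have "(\<Sum>n=N0..N. a n * of_real (b n)) = (-1) ^ k * (\<Sum>n=N0..N. c n)"
    unfolding sum_distrib_left by (rule sum.cong[OF refl]) (use ab in auto)
   then show ?thesis using wsum by (simp add: norm_mult norm_power)
  qed
  define P where "P = (primes_le x)"
  have Psub: "P \<subseteq> {1..N}" unfolding P_def N_def using prime_gt_0_nat by (auto simp: Suc_le_eq le_nat_floor)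
  have finP: "finite P" using Psub finite_subset by blast
  define P2 where "P2 = {n. primepow n \<and> \<not> prime n \<and> n <= N}"
  have finP2: "finite P2" unfolding P2_def by (rule finite_subset[of _ "{..N}"]) auto
  have cP: "c p = \<xi> p" if "p \<in> P" for p
   using that prime_gt_1_nat[of p] by (simp add: c_def P_def)
  have c0: "c n = 0" if "\<not> primepow n" for n using that by (simp add: c_def mangoldt_def)
  have c1: "norm (c n) <= 1" for n unfolding c_def by (rule logcoeff_norm[OF cm])
  have split: "(\<Sum>p\<in>P. \<xi> p) = (\<Sum>n=N0..N. c n) + (\<Sum>p\<in>P \<inter> {..<N0}. c p) - (\<Sum>n\<in>P2 \<inter> {N0..}. c n)"
  proof -
   have "(\<Sum>n=N0..N. c n) = (\<Sum>n\<in>(P \<inter> {N0..}) \<union> (P2 \<inter> {N0..}). c n)"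
   proof (rule sum.mono_neutral_right)
    show "\<forall>i\<in>{N0..N} - ((P \<inter> {N0..}) \<union> (P2 \<inter> {N0..})). c i = 0"
    proof
     fix i assume i: "i \<in> {N0..N} - ((P \<inter> {N0..}) \<union> (P2 \<inter> {N0..}))"
     then have "real i <= x" using NN by auto
     then have "\<not> primepow i" using i by (auto simp: P_def P2_def)
     then show "c i = 0" by (rule c0)
    qed
   qed (use Psub in \<open>auto simp: P2_def\<close>)
   also have "... = (\<Sum>n\<in>P \<inter> {N0..}. c n) + (\<Sum>n\<in>P2 \<inter> {N0..}. c n)"
    by (rule sum.union_disjoint) (use finP finP2 in \<open>auto simp: P_def P2_def\<close>)
   finally have e1: "(\<Sum>n=N0..N. c n) = (\<Sum>n\<in>P \<inter> {N0..}. c n) + (\<Sum>n\<in>P2 \<inter> {N0..}. c n)" .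
   have e2: "(\<Sum>p\<in>P. \<xi> p) = (\<Sum>p\<in>P. c p)" by (rule sum.cong) (use cP in auto)
   have "(\<Sum>p\<in>P. c p) = (\<Sum>p\<in>(P \<inter> {N0..}) \<union> (P \<inter> {..<N0}). c p)" by (rule sum.cong) auto
   also have "(\<Sum>p\<in>(P \<inter> {N0..}) \<union> (P \<inter> {..<N0}). c p) = (\<Sum>p\<in>P \<inter> {N0..}. c p) + (\<Sum>p\<in>P \<inter> {..<N0}. c p)"
    by (rule sum.union_disjoint) (use finP in auto)
   finally show ?thesis using e1 e2 by simp
  qed
  have s1: "norm (\<Sum>p\<in>P \<inter> {..<N0}. c p) <= sqrt x + 1"
  proof -
   have "norm (\<Sum>p\<in>P \<inter> {..<N0}. c p) <= (\<Sum>p\<in>P \<inter> {..<N0}. 1)" by (intro sum_norm_le c1)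
   also have "... = real (card (P \<inter> {..<N0}))" by simp
   also have "... <= real (card {1..<N0})" using Psub by (intro of_nat_mono card_mono) auto
   also have "... <= sqrt x + 1" using NN by simp
   finally show ?thesis .
  qed
  have s2: "norm (\<Sum>n\<in>P2 \<inter> {N0..}. c n) <= (sqrt x + 1) * (2 * L + 1)"
  proof -
   have "norm (\<Sum>n\<in>P2 \<inter> {N0..}. c n) <= (\<Sum>n\<in>P2 \<inter> {N0..}. 1)" by (intro sum_norm_le c1)
   also have "... = real (card (P2 \<inter> {N0..}))" by simp
   also have "... <= real (card P2)" using finP2 by (intro of_nat_mono card_mono) auto
   also have "... <= (sqrt x + 1) * (2 * L + 1)" unfolding P2_def N_def L_def using x3 by (intro card_prime_powers_le) auto
   finally show ?thesis .
  qed
  have "norm (\<Sum>p\<in>P. \<xi> p) <= norm ((\<Sum>n=N0..N. c n) + (\<Sum>p\<in>P \<inter> {..<N0}. c p)) + norm (\<Sum>n\<in>P2 \<inter> {N0..}. c n)"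
   unfolding split by (rule norm_triangle_ineq4)
  also have "norm ((\<Sum>n=N0..N. c n) + (\<Sum>p\<in>P \<inter> {..<N0}. c p)) <= norm (\<Sum>n=N0..N. c n) + norm (\<Sum>p\<in>P \<inter> {..<N0}. c p)"
   by (rule norm_triangle_ineq)
  also have "norm (\<Sum>n=N0..N. c n) + norm (\<Sum>p\<in>P \<inter> {..<N0}. c p) + norm (\<Sum>n\<in>P2 \<inter> {N0..}. c n)
    <= 2 * C1 * 2 ^ m * x * w + (sqrt x + 1) + (sqrt x + 1) * (2 * L + 1)"
   by (intro add_mono csum s1 s2)
  also have "2 * C1 * 2 ^ m * x * w + (sqrt x + 1) + (sqrt x + 1) * (2 * L + 1) <= 2 * C1 * 2 ^ m * x * w + 8 * (sqrt x * L)"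
  proof -
   have "(sqrt x + 1) * (2 * L + 2) <= (2 * sqrt x) * (4 * L)" using sx L1 by (intro mult_mono) auto
   then show ?thesis by (simp add: algebra_simps)
  qed
  also have "sqrt x * L <= C2 * x * w"
  proof -
   have "L powr (B + 1) <= C2 * x powr (1/4)" unfolding L_def C2_def using B x3 by (intro ln_powr_le) auto
   also have "... <= C2 * x powr (1/2)" using x3 by (intro mult_left_mono powr_mono) (auto simp: C2_def)
   also have "x powr (1/2) = sqrt x" using x3 by (simp add: powr_half_sqrt)
   finally have "sqrt x * L powr (B + 1) <= sqrt x * (C2 * sqrt x)" using sx by (intro mult_left_mono) auto
   also have "... = C2 * x" using x3 by (simp add: mult_ac)
   finally have "sqrt x * L powr (B + 1) * w <= C2 * x * w" using w by (intro mult_right_mono) auto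
   moreover have "L powr (B + 1) * w = L" using L1 by (simp add: w_def powr_add[symmetric])
   ultimately show ?thesis by (simp add: mult.assoc)
  qed
  also have "2 * C1 * 2 ^ m * x * w + 8 * (C2 * x * w) <= C3 * x * w"
  proof -
   have "0 <= C2" by (simp add: C2_def)
   then have "2 * C1 * 2 ^ m + 8 * C2 <= C3" unfolding C3_def using C1pos by simp
   then have "(2 * C1 * 2 ^ m + 8 * C2) * (x * w) <= C3 * (x * w)" using x3 w by (intro mult_right_mono) auto
   then show ?thesis by (simp add: algebra_simps)
  qed
  finally have "norm (\<Sum>p\<in>P. \<xi> p) <= C3 * x * w" by simp
  then show ?thesis using L1 by (simp add: P_def w_def L_def powr_minus divide_inverse)
 qed
 show ?thesis using main C3pos by (intro exI[of _ C3]) auto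
qed

subsection \<open>Roots of unity and characters to prime moduli\<close>

definition root1 :: "nat => nat => complex" where
 "root1 m k = cis (2 * pi * real k / real m)"

lemma root1_add: "root1 m (a + b) = root1 m a * root1 m b"
 by (simp add: root1_def cis_mult distrib_left add_divide_distrib)

lemma root1_0 [simp]: "root1 m 0 = 1" by (simp add: root1_def)

lemma root1_norm [simp]: "norm (root1 m k) = 1" by (simp add: root1_def)

lemma root1_mult: "root1 m (a * b) = root1 m a ^ b"
 by (induction b) (auto simp: root1_add)

lemma root1_eq_1_iff:
 assumes "m > 0"
 shows "root1 m k = 1 \<longleftrightarrow> m dvd k"
proof
 assume "m dvd k"
 then obtain j where "k = m * j" by blast
 then have "2 * pi * real k / real m = 2 * pi * real j" using assms by simp
 then show "root1 m k = 1" by (simp add: root1_def cis_multiple_2pi)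
next
 assume "root1 m k = 1"
 then have "cos (2 * pi * real k / real m) = 1" by (simp add: root1_def complex_eq_iff)
 then obtain n :: int where "2 * pi * real k / real m = of_int n * 2 * pi" by (auto simp: cos_one_2pi_int)
 then have "real k = of_int n * real m" using assms by (simp add: field_simps)
 then have "int k = n * int m" by (metis of_int_eq_iff of_int_mult of_int_of_nat_eq)
 then show "m dvd k" by (metis dvd_triv_right int_dvd_int_iff)
qed

lemma root1_period: "m > 0 ==> root1 m (m * j) = 1"
 using root1_eq_1_iff by simp

lemma root1_mod: "m > 0 ==> root1 m (k mod m) = root1 m k"
 by (metis mult_div_mod_eq root1_add root1_period mult_1)

lemma root1_cong:
 assumes "m > 0" "[a = b] (mod m)"
 shows "root1 m a = root1 m b"
 using assms root1_mod[of m] by (metis nat_cong_def)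

lemma root1_sum:
 assumes "m > 0"
 shows "(\<Sum>h<m. root1 m (h * k)) = (if m dvd k then of_nat m else 0)"
proof (cases "m dvd k")
 case True
 then have "root1 m k = 1" using assms by (simp add: root1_eq_1_iff)
 then have "root1 m (h * k) = 1" for h using root1_mult[of m k h] by (simp add: mult.commute)
 then show ?thesis using True by simp
next
 case False
 then have k1: "root1 m k \<noteq> 1" using assms by (simp add: root1_eq_1_iff)
 have "(\<Sum>h<m. root1 m (h * k)) = (\<Sum>h<m. root1 m k ^ h)" by (simp add: root1_mult[symmetric] mult.commute)
 also have "... = (root1 m k ^ m - 1) / (root1 m k - 1)" by (rule geometric_sum[OF k1])
 also have "root1 m k ^ m = 1" using root1_mult[of m k m] root1_period[OF assms, of k] by (simp add: mult.commute)
 finally show ?thesis using False by simp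
qed

section \<open>Characters modulo a prime through discrete logarithms\<close>

definition pgen :: "nat => nat" where "pgen p = (SOME g. residue_primroot p g)"

definition pind :: "nat => nat => nat" where "pind p n = (LEAST i. [pgen p ^ i = n] (mod p))"

text \<open>For h = 0, ..., p - 2 these are all the characters modulo p. Multiples of p are treated
  separately, because the \<open>LEAST\<close> in \<open>pind\<close> has no witness there.\<close>

definition pchar :: "nat => nat => nat => complex" where
 "pchar p h n = (if p dvd n then 0 else root1 (p - 1) (h * pind p n))"

lemma pgen: "prime p ==> residue_primroot p (pgen p)"
 unfolding pgen_def by (rule someI_ex) (rule prime_primitive_root_exists[OF prime_gt_1_nat])

lemma pgen_coprime: "prime p ==> coprime p (pgen p)"
 using pgen by (simp add: residue_primroot_def)

lemma pgen_ord: "prime p ==> ord p (pgen p) = p - 1"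
 using pgen by (simp add: residue_primroot_def totient_prime)

lemma prime_not_dvd_coprime: "prime p ==> \<not> p dvd n \<longleftrightarrow> coprime n (p::nat)"
 by (metis coprime_commute prime_imp_coprime coprime_absorb_left not_prime_unit)

lemma pind:
 assumes "prime p" "\<not> p dvd n"
 shows "[pgen p ^ pind p n = n] (mod p)"
proof -
 have p1: "p > 1" using assms(1) by (rule prime_gt_1_nat)
 have "coprime n p" using assms prime_not_dvd_coprime by blast
 then have "coprime (n mod p) p" using p1 by (simp add: coprime_mod_left_iff)
 moreover have "n mod p > 0" using assms(2) by (simp add: mod_greater_zero_iff_not_dvd)
 ultimately have "n mod p \<in> totatives p" using p1 by (simp add: totatives_def less_imp_le)
 then have "n mod p \<in> (%i. pgen p ^ i mod p) ` {..<totient p}"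
  using residue_primroot_is_generator[OF p1 pgen[OF assms(1)]] by (simp add: bij_betw_def)
 then obtain i where "n mod p = pgen p ^ i mod p" by auto
 then have "[pgen p ^ i = n] (mod p)" by (simp add: nat_cong_def)
 then show ?thesis unfolding pind_def by (rule LeastI)
qed

lemma pgen_power_cong_iff:
 assumes "prime p"
 shows "[pgen p ^ i = pgen p ^ j] (mod p) \<longleftrightarrow> [i = j] (mod (p - 1))"
 using order_divides_expdiff[OF pgen_coprime[OF assms], of i j] pgen_ord[OF assms] by simp

lemma pind_cong:
 assumes "prime p" "[pgen p ^ i = n] (mod p)"
 shows "[pind p n = i] (mod (p - 1))"
proof -
 have "\<not> p dvd n"
 proof
  assume "p dvd n"
  then have "p dvd pgen p ^ i" using assms(2) cong_dvd_iff by blast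
  then have "p dvd pgen p" using assms(1) prime_dvd_power by blast
  then show False using pgen_coprime[OF assms(1)] assms(1) by (metis coprime_absorb_left not_prime_unit)
 qed
 then have "[pgen p ^ pind p n = pgen p ^ i] (mod p)"
  using pind[OF assms(1)] assms(2) cong_sym cong_trans by blast
 then show ?thesis using pgen_power_cong_iff[OF assms(1)] by blast
qed

lemma pchar_gen:
 assumes "prime p" "[pgen p ^ i = n] (mod p)" "\<not> p dvd n"
 shows "pchar p h n = root1 (p - 1) (h * i)"
proof -
 have "[h * pind p n = h * i] (mod (p - 1))" using pind_cong[OF assms(1,2)] by (rule cong_scalar_left)
 then show ?thesis using assms prime_gt_1_nat[OF assms(1)] root1_cong by (simp add: pchar_def)
qed

lemma pchar_dchar:
 assumes p: "prime p"
 shows "dchar p (pchar p h)"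
 unfolding dchar_def
proof (intro conjI allI impI)
 show "p > 0" using p by (rule prime_gt_0_nat)
 have "\<not> p dvd 1" using p not_prime_unit by auto
 then show "pchar p h 1 = 1" using pchar_gen[OF p, of 0 1 h] by simp
 show "pchar p h (m * n) = pchar p h m * pchar p h n" for m n
 proof (cases "p dvd m \<or> p dvd n")
  case True
  then show ?thesis by (auto simp: pchar_def)
 next
  case False
  then have mn: "\<not> p dvd m * n" using p prime_dvd_mult_iff by blast
  have "[pgen p ^ (pind p m + pind p n) = m * n] (mod p)"
   unfolding power_add using False by (intro cong_mult pind[OF p]) auto
  then have "pchar p h (m * n) = root1 (p - 1) (h * (pind p m + pind p n))" by (rule pchar_gen[OF p _ mn])
  then show ?thesis using False by (simp add: pchar_def distrib_left root1_add)
 qed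
 show "pchar p h (n + p) = pchar p h n" for n
  by (simp add: pchar_def pind_def nat_cong_def)
 show "pchar p h n = 0" if "\<not> coprime n p" for n
  using that prime_not_dvd_coprime[OF p] by (auto simp: pchar_def)
qed

lemma pgen_not_dvd: "prime p ==> \<not> p dvd pgen p"
 using pgen_coprime by (metis coprime_absorb_left not_prime_unit)

lemma pchar_at_gen: "prime p ==> [a = pgen p] (mod p) ==> pchar p h a = root1 (p - 1) h"
 using pchar_gen[of p 1 "pgen p" h] dchar_cong[OF pchar_dchar, of p a "pgen p" h] pgen_not_dvd by simp

lemma pchar_at_one: "prime p ==> [a = 1] (mod p) ==> pchar p h a = 1"
 using dchar_cong[OF pchar_dchar, of p a 1 h] dcharD(2)[OF pchar_dchar, of p h] by simp

lemma pchar_0: "pchar p 0 n = (if p dvd n then 0 else 1)"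
 by (simp add: pchar_def)

lemma pchar_orthogonality:
 assumes p: "prime p"
 shows "(\<Sum>h<p-1. pchar p h n) = (if [n = 1] (mod p) then of_nat (p - 1) else 0)"
proof (cases "p dvd n")
 case True
 then have "\<not> [n = 1] (mod p)" using cong_dvd_iff[of n 1 p] p not_prime_unit by auto
 then show ?thesis using True by (simp add: pchar_def)
next
 case False
 have p1: "p - 1 > 0" using prime_gt_1_nat[OF p] by simp
 have "(\<Sum>h<p-1. pchar p h n) = (if (p - 1) dvd pind p n then of_nat (p - 1) else 0)"
  using False root1_sum[OF p1, of "pind p n"] by (simp add: pchar_def)
 moreover have "(p - 1) dvd pind p n \<longleftrightarrow> [n = 1] (mod p)"
 proof -
  have "(p - 1) dvd pind p n \<longleftrightarrow> [pind p n = 0] (mod (p - 1))" by (simp add: cong_0_iff)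
  also have "... \<longleftrightarrow> [pgen p ^ pind p n = pgen p ^ 0] (mod p)" using pgen_power_cong_iff[OF p] by blast
  also have "... \<longleftrightarrow> [n = 1] (mod p)" using pind[OF p False] cong_sym cong_trans by (metis power_0)
  finally show ?thesis .
 qed
 ultimately show ?thesis by simp
qed

text \<open>An integer that is a primitive root modulo one prime and 1 modulo the others sees a
  single component of a product character; evaluating there shows such products to be
  nonprincipal.\<close>

lemma crt_prime:
 assumes T: "finite T" "\<And>l. l \<in> T ==> prime (l::nat)" and l: "l \<in> T"
 obtains a where "[a = pgen l] (mod l)" "\<And>r. r \<in> T ==> r \<noteq> l ==> [a = 1] (mod r)" "\<And>r. r \<in> T ==> coprime a r"
proof -
 have "coprime l (\<Prod>(T - {l}))"
  using T l by (intro prod_coprime_right) (auto intro: primes_coprime)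
 from binary_chinese_remainder_nat[OF this, of "pgen l" 1] obtain a
  where a: "[a = pgen l] (mod l)" "[a = 1] (mod \<Prod>(T - {l}))" by blast
 have r: "[a = 1] (mod r)" if "r \<in> T" "r \<noteq> l" for r
  by (rule cong_dvd_modulus_nat[OF a(2)]) (use that T in \<open>auto intro!: dvd_prodI\<close>)
 have cop: "coprime a r" if "r \<in> T" for r
 proof (cases "r = l")
  case True
  have "coprime (pgen l) l" using pgen_coprime[OF T(2)[OF l]] by (simp add: coprime_commute)
  then show ?thesis using True a(1) cong_imp_coprime cong_sym by blast
 next
  case False
  then show ?thesis using r[OF that] cong_imp_coprime[of 1 a r] cong_sym by auto
 qed
 show thesis by (rule that[OF a(1) r cop])
qed

section \<open>Characters to squarefree moduli as products over primes\<close>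

definition mchar :: "nat set => (nat => nat) => nat => complex" where
 "mchar S h n = (\<Prod>l\<in>S. pchar l (h l) n)"

lemma mchar_dchar:
 assumes "finite S" "\<And>l. l \<in> S ==> prime l"
 shows "dchar (\<Prod>S) (mchar S h)"
 using assms
proof (induction S rule: finite_induct)
 case empty
 show ?case by (simp add: dchar_def mchar_def)
next
 case (insert l S)
 then have "dchar (l * \<Prod>S) (%n. pchar l (h l) n * mchar S h n)" by (intro dchar_mult pchar_dchar) auto
 then show ?case using insert by (simp add: mchar_def[abs_def])
qed

lemma mchar_crt:
 assumes "finite S" "\<And>l. l \<in> S ==> prime l" "l \<in> S" "[a = pgen l] (mod l)" "\<And>r. r \<in> S ==> r \<noteq> l ==> [a = 1] (mod r)"
 shows "mchar S h a = root1 (l - 1) (h l)"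
proof -
 have "mchar S h a = pchar l (h l) a * (\<Prod>r\<in>S-{l}. pchar r (h r) a)"
  unfolding mchar_def by (rule prod.remove[OF assms(1,3)])
 also have "(\<Prod>r\<in>S-{l}. pchar r (h r) a) = 1"
  by (rule prod.neutral) (use assms pchar_at_one in auto)
 finally show ?thesis using pchar_at_gen[OF assms(2)[OF assms(3)] assms(4)] by simp
qed

lemma mchar_nonprincipal:
 assumes S: "finite S" "\<And>l. l \<in> S ==> prime l" and l: "l \<in> S" "\<not> (l - 1) dvd h l"
 shows "nonprincipal (\<Prod>S) (mchar S h)"
proof -
 obtain a where a: "[a = pgen l] (mod l)" "\<And>r. r \<in> S ==> r \<noteq> l ==> [a = 1] (mod r)" "\<And>r. r \<in> S ==> coprime a r"
  using crt_prime[OF S l(1)] by blast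
 have "mchar S h a = root1 (l - 1) (h l)" by (rule mchar_crt[OF S l(1) a(1,2)])
 moreover have "l - 1 > 0" using S(2)[OF l(1)] prime_gt_1_nat by fastforce
 ultimately have "mchar S h a \<noteq> 1" using l(2) root1_eq_1_iff by simp
 then show ?thesis unfolding nonprincipal_def using mchar_dchar[OF S] prod_coprime_right[of S a "%x. x"] a(3) by auto
qed

lemma mchar_power2: "mchar S h n ^ 2 = mchar S (%l. 2 * h l) n"
 unfolding mchar_def prod_power_distrib
proof (rule prod.cong[OF refl])
 fix l
 have "root1 (l - 1) (h l * pind l n) ^ 2 = root1 (l - 1) (2 * h l * pind l n)"
  by (simp add: root1_mult[symmetric] mult_ac)
 then show "pchar l (h l) n ^ 2 = pchar l (2 * h l) n" by (simp add: pchar_def)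
qed

lemma mchar_orthogonality:
 assumes "finite S" "\<And>l. l \<in> S ==> prime l"
 shows "(\<Sum>h\<in>PiE S (%l. {..<l-1}). mchar S h n) = (if \<forall>l\<in>S. [n = 1] (mod l) then of_nat (\<Prod>l\<in>S. l - 1) else 0)"
proof -
 have "(\<Sum>h\<in>PiE S (%l. {..<l-1}). mchar S h n) = (\<Prod>l\<in>S. \<Sum>k<l-1. pchar l k n)"
  unfolding mchar_def using assms(1) by (intro prod_sum_PiE[symmetric]) auto
 also have "... = (\<Prod>l\<in>S. if [n = 1] (mod l) then of_nat (l - 1) else 0)"
  by (rule prod.cong[OF refl]) (use assms pchar_orthogonality in auto)
 also have "... = (if \<forall>l\<in>S. [n = 1] (mod l) then of_nat (\<Prod>l\<in>S. l - 1) else 0)"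
 proof (cases "\<forall>l\<in>S. [n = 1] (mod l)")
  case True
  then show ?thesis by (simp del: of_nat_diff)
 next
  case False
  then have "(\<Prod>l\<in>S. if [n = 1] (mod l) then of_nat (l - 1) else (0::complex)) = 0"
   using assms(1) by (intro prod_zero) auto
  then show ?thesis using False by auto
 qed
 finally show ?thesis .
qed

subsection \<open>Primes congruent to 1 to squarefree moduli\<close>

text \<open>Encodes the squarefree positive integers: S stands for the product of its elements, the
  empty set for 1. Subsets are divisors, and sums over squarefree divisors become sums over
  \<open>Pow\<close>.\<close>

definition prime_sets :: "nat set set" where
 "prime_sets = {S. finite S \<and> (\<forall>l\<in>S. prime l)}"

lemma prime_setsD: "S \<in> prime_sets ==> finite S" "S \<in> prime_sets ==> l \<in> S ==> prime l"
 by (auto simp: prime_sets_def)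

lemma prime_sets_subset: "S \<in> prime_sets ==> T \<subseteq> S ==> T \<in> prime_sets"
 by (auto simp: prime_sets_def finite_subset)

lemma prime_factors_prime_set:
 assumes "S \<in> prime_sets"
 shows "prime_factors (\<Prod>S) = S"
proof -
 have "prime_factors (\<Prod>S) = (\<Union>l\<in>S. prime_factors l)"
  using prime_setsD[OF assms] by (subst prime_factors_prod) (auto dest: prime_gt_0_nat)
 also have "... = (\<Union>l\<in>S. {l})"
  by (rule SUP_cong[OF refl]) (use prime_setsD[OF assms] in \<open>auto simp: prime_factorization_prime\<close>)
 finally show ?thesis by simp
qed

lemma prime_sets_inj: "inj_on (%S. \<Prod>S) prime_sets"
 by (rule inj_onI) (metis prime_factors_prime_set)

lemma prime_set_prod_ge_1: "S \<in> prime_sets ==> \<Prod>S \<ge> 1"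
 using prime_setsD by (metis One_nat_def Suc_leI prime_gt_0_nat prod_pos)

lemma card_prime_set_le: "S \<in> prime_sets ==> card S < \<Prod>S"
proof -
 assume S: "S \<in> prime_sets"
 have "2 ^ card S = (\<Prod>l\<in>S. 2::nat)" by simp
 also have "... <= \<Prod>S" using prime_setsD[OF S] by (intro prod_mono) (auto dest: prime_ge_2_nat)
 finally show ?thesis using less_exp[of "card S"] by linarith
qed

lemma finite_prime_sets_le: "finite {S \<in> prime_sets. \<Prod>S \<le> N}"
proof (rule finite_imageD)
 show "finite ((%S. \<Prod>S) ` {S \<in> prime_sets. \<Prod>S \<le> N})" by (rule finite_subset[of _ "{..N}"]) auto
 show "inj_on (%S. \<Prod>S) {S \<in> prime_sets. \<Prod>S \<le> N}" by (rule inj_on_subset[OF prime_sets_inj]) auto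
qed

text \<open>A set of primes is determined by its product, so different sets give different integers
  and nothing is counted twice.\<close>

lemma sum_prime_sets_le:
 fixes f :: "nat => real"
 assumes "F \<subseteq> prime_sets" "(%S. \<Prod>S) ` F \<subseteq> D" "finite D" "\<And>d. d \<in> D ==> 0 <= f d"
 shows "(\<Sum>S\<in>F. f (\<Prod>S)) <= (\<Sum>d\<in>D. f d)"
proof -
 have "(\<Sum>S\<in>F. f (\<Prod>S)) = (\<Sum>d\<in>(%S. \<Prod>S) ` F. f d)"
  using inj_on_subset[OF prime_sets_inj assms(1)] by (simp add: sum.reindex)
 also have "... <= (\<Sum>d\<in>D. f d)" using assms by (intro sum_mono2) auto
 finally show ?thesis .
qed

lemma prime_set_dvd:
 assumes "S \<in> prime_sets" "\<And>l. l \<in> S ==> l dvd m"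
 shows "\<Prod>S dvd m"
proof -
 have "finite S" using assms by (rule_tac prime_setsD)
 then show ?thesis using assms
 proof (induction S rule: finite_induct)
  case (insert l S)
  have "S \<in> prime_sets" using insert.prems(1) prime_sets_subset by blast
  moreover have "coprime l (\<Prod>S)"
   using insert by (intro prod_coprime_right primes_coprime) (auto dest: prime_setsD)
  ultimately show ?case using insert by (simp add: divides_mult)
 qed simp
qed

lemma inverse_powr_tail:
 fixes a :: real
 assumes "a > 0" "Z >= 1" "finite D" "\<And>d. d \<in> D ==> d > Z"
 shows "(\<Sum>d\<in>D. real d powr (-1-a)) <= real Z powr (-a) / a"
proof -
 have inj: "inj_on (%d. d - (Z + 1)) D" using assms(4) by (auto intro!: inj_onI) (metis Suc_leI add.commute le_add_diff_inverse plus_1_eq_Suc)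
 have "(\<Sum>d\<in>D. real d powr (-1-a)) = (\<Sum>i\<in>(%d. d - (Z + 1)) ` D. real (i + Z + 1) powr (-1-a))"
  unfolding sum.reindex[OF inj] comp_def
 proof (rule sum.cong[OF refl])
  fix d assume "d \<in> D"
  then have "d - (Z + 1) + Z + 1 = d" using assms(4)[of d] by simp
  then show "real d powr (-1-a) = real (d - (Z + 1) + Z + 1) powr (-1-a)" by (simp only:)
 qed
 also have "... <= (\<Sum>i. real (i + Z + 1) powr (-1-a))"
  by (rule sum_le_suminf[OF powr_tail(1)[OF assms(1,2)]]) (use assms in auto)
 also have "... <= real Z powr (-a) / a" by (rule powr_tail(2)[OF assms(1,2)])
 finally show ?thesis .
qed

text \<open>2 h = l - 1 selects the Legendre symbol at each prime l and forces l to be odd. These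
  are the real primitive characters to odd squarefree moduli above 1.\<close>

definition quad_chars :: "(nat \<times> (nat => complex)) set" where
 "quad_chars = {(\<Prod>S, mchar S h) | S h. S \<in> prime_sets \<and> S \<noteq> {} \<and> (\<forall>l\<in>S. 0 < h l \<and> 2 * h l = l - 1)}"

text \<open>Every component is nonprincipal, which for a squarefree modulus is primitivity. The
  prime 2 cannot occur, as 0 < h l < 1 is impossible.\<close>

definition prim_chars :: "(nat \<times> (nat => complex)) set" where
 "prim_chars = {(\<Prod>S, mchar S h) | S h. S \<in> prime_sets \<and> S \<noteq> {} \<and> (\<forall>l\<in>S. 0 < h l \<and> h l < l - 1)}"

lemma mchar_prod_nonprincipal:
 assumes S: "S \<in> prime_sets" "T \<in> prime_sets" and l: "l \<in> S" "l \<notin> T" "\<not> (l - 1) dvd h l"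
 shows "nonprincipal (\<Prod>S * \<Prod>T) (%n. mchar S h n * mchar T k n)"
proof -
 have U: "finite (S \<union> T)" "\<And>r. r \<in> S \<union> T ==> prime r" "l \<in> S \<union> T"
  using S l prime_setsD by auto
 obtain a where a: "[a = pgen l] (mod l)" "\<And>r. r \<in> S \<union> T ==> r \<noteq> l ==> [a = 1] (mod r)" "\<And>r. r \<in> S \<union> T ==> coprime a r"
  using crt_prime[OF U] by blast
 have "mchar S h a = root1 (l - 1) (h l)"
  using a prime_setsD[OF S(1)] by (intro mchar_crt l) auto
 moreover have "mchar T k a = 1" unfolding mchar_def
 proof (rule prod.neutral, rule ballI)
  fix r assume "r \<in> T"
  then show "pchar r (k r) a = 1" using a(2)[of r] l(2) prime_setsD[OF S(2)] by (intro pchar_at_one) auto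
 qed
 moreover have "l - 1 > 0" using prime_gt_1_nat[OF prime_setsD(2)[OF S(1) l(1)]] by simp
 ultimately have "mchar S h a * mchar T k a \<noteq> 1" using l(3) root1_eq_1_iff by simp
 moreover have "coprime a (\<Prod>S * \<Prod>T)"
  using a(3) prod_coprime_right[of S a "%x. x"] prod_coprime_right[of T a "%x. x"] by (simp add: coprime_mult_right_iff)
 moreover have "dchar (\<Prod>S * \<Prod>T) (%n. mchar S h n * mchar T k n)"
  by (intro dchar_mult mchar_dchar) (use S prime_setsD in auto)
 ultimately show ?thesis unfolding nonprincipal_def by blast
qed

lemma half_not_dvd: "0 < h ==> h < m ==> \<not> m dvd (h::nat)"
 by (simp add: nat_dvd_not_less)

text \<open>The set S determines the character, so for distinct members some prime l belongs to
  exactly one of the two sets; at the integer of \<open>crt_prime\<close> for l the product takes a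
  value other than 1.\<close>

lemma quad_chars_family: "siegel_family quad_chars"
proof -
 have np: "nonprincipal (\<Prod>S) (mchar S h)"
  if S: "S \<in> prime_sets" and ne: "S \<noteq> {}" and h: "\<forall>l\<in>S. 0 < h l \<and> 2 * h l = l - 1" for S h
 proof -
  obtain l where l: "l \<in> S" using ne by auto
  have hl: "0 < h l" "2 * h l = l - 1" using h l by auto
  then have "\<not> (l - 1) dvd h l" by (intro half_not_dvd) linarith+
  then show ?thesis using l prime_setsD[OF S] by (intro mchar_nonprincipal[of S l]) auto
 qed
 have rl: "mchar S h n \<in> \<real>" if "S \<in> prime_sets" "\<forall>l\<in>S. 0 < h l \<and> 2 * h l = l - 1" for S h n
  unfolding mchar_def
 proof (rule prod_in_Reals)
  fix l assume "l \<in> S"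
  then have h: "0 < h l" "2 * h l = l - 1" using that by auto
  have "root1 (l - 1) (h l) = cis pi" unfolding root1_def h(2)[symmetric] using h(1) by simp
  then have "root1 (l - 1) (h l * pind l n) = (-1) ^ pind l n" by (simp add: root1_mult)
  then show "pchar l (h l) n \<in> \<real>" by (simp add: pchar_def)
 qed
 have pr: "nonprincipal (\<Prod>S * \<Prod>T) (%n. mchar S h n * mchar T k n)"
  if S: "S \<in> prime_sets" "\<forall>l\<in>S. 0 < h l \<and> 2 * h l = l - 1" and T: "T \<in> prime_sets" "\<forall>l\<in>T. 0 < k l \<and> 2 * k l = l - 1"
   and ne: "(\<Prod>S, mchar S h) \<noteq> (\<Prod>T, mchar T k)" for S T h k
 proof -
  have "S \<noteq> T"
  proof
   assume "S = T"
   then have "mchar S h = mchar T k" using S(2) T(2) unfolding mchar_def fun_eq_iff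
   proof (intro allI prod.cong refl)
    fix n l assume l: "l \<in> T"
    have "2 * h l = 2 * k l" using l S(2) T(2) \<open>S = T\<close> by auto
    then have "h l = k l" by simp
    then show "pchar l (h l) n = pchar l (k l) n" by simp
   qed (use \<open>S = T\<close> in auto)
   then show False using ne \<open>S = T\<close> by simp
  qed
  then consider l where "l \<in> S" "l \<notin> T" | l where "l \<in> T" "l \<notin> S" by blast
  then show ?thesis
  proof cases
   case 1
   have "0 < h l" "2 * h l = l - 1" using 1 S(2) by auto
   then have "\<not> (l - 1) dvd h l" by (intro half_not_dvd) linarith+
   then show ?thesis by (rule mchar_prod_nonprincipal[OF S(1) T(1) 1])
  next
   case 2
   have "0 < k l" "2 * k l = l - 1" using 2 T(2) by auto
   then have "\<not> (l - 1) dvd k l" by (intro half_not_dvd) linarith+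
   then have "nonprincipal (\<Prod>T * \<Prod>S) (%n. mchar T k n * mchar S h n)" by (rule mchar_prod_nonprincipal[OF T(1) S(1) 2])
   then show ?thesis by (simp add: mult.commute)
  qed
 qed
 show ?thesis unfolding siegel_family_def quad_chars_def using np rl pr by blast
qed

text \<open>Given 0 < h l < l - 1, the square of a component is principal exactly when 2 h l = l -
  1. Hence either all components are quadratic, or one of them keeps the square
  nonprincipal.\<close>

lemma prim_chars_class: "siegel_class prim_chars quad_chars"
 unfolding siegel_class_def
proof (intro conjI quad_chars_family, clarify)
 fix q \<xi> assume "(q, \<xi>) \<in> prim_chars"
 then obtain S h where S: "S \<in> prime_sets" "S \<noteq> {}" "\<forall>l\<in>S. 0 < h l \<and> h l < l - 1" and eq: "q = \<Prod>S" "\<xi> = mchar S h"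
  unfolding prim_chars_def by blast
 obtain l where l: "l \<in> S" using S(2) by auto
 have "\<not> (l - 1) dvd h l" using S(3) l by (intro half_not_dvd) auto
 then have "nonprincipal (\<Prod>S) (mchar S h)"
  using prime_setsD[OF S(1)] l by (intro mchar_nonprincipal[of S l]) auto
 moreover have "nonprincipal q (%n. \<xi> n ^ 2) \<or> (q, \<xi>) \<in> quad_chars"
 proof (cases "\<forall>l\<in>S. 2 * h l = l - 1")
  case True
  then have "(q, \<xi>) \<in> quad_chars" unfolding quad_chars_def eq using S by blast
  then show ?thesis ..
 next
  case False
  then obtain r where r: "r \<in> S" "2 * h r \<noteq> r - 1" by blast
  have "\<not> (r - 1) dvd 2 * h r"
  proof
   assume "(r - 1) dvd 2 * h r"
   then obtain j where j: "2 * h r = (r - 1) * j" by blast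
   have "0 < h r" "h r < r - 1" using S r by auto
   then have "(r - 1) * j < (r - 1) * 2" "(r - 1) * j > 0" unfolding j[symmetric] by linarith+
   then have "j < 2" "j > 0" unfolding mult_less_cancel1 nat_0_less_mult_iff by blast+
   then have "j = 1" by linarith
   then show False using j r by simp
  qed
  then have "nonprincipal (\<Prod>S) (mchar S (%l. 2 * h l))"
   using prime_setsD[OF S(1)] r by (intro mchar_nonprincipal[of S r]) auto
  then show ?thesis unfolding eq mchar_power2 by simp
 qed
 ultimately show "nonprincipal q \<xi> \<and> (nonprincipal q (%n. \<xi> n ^ 2) \<or> (q, \<xi>) \<in> quad_chars)" using eq by simp
qed

lemma finite_primes_le: "finite (primes_le x)"
proof (rule finite_subset)
 show "(primes_le x) \<subseteq> {..nat \<lfloor>x\<rfloor>}" by (auto intro: le_nat_floor)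
qed simp

text \<open>Dropping the primes with h l = 0 passes to a primitive character modulo the product of
  T. At primes the two characters can differ only on S, which accounts for the term
  \<open>card S\<close>.\<close>

lemma mchar_prime_sum_bound:
 assumes B: "B >= 1"
 shows "\<exists>C>0. \<forall>x\<ge>3. \<forall>S\<in>prime_sets. \<forall>h\<in>PiE S (%l. {..<l-1}). (\<exists>l\<in>S. h l \<noteq> 0) \<longrightarrow> real (\<Prod>S) <= ln x powr B \<longrightarrow>
   norm (\<Sum>p | prime p \<and> real p <= x. mchar S h p) <= real (card S) + C * x / ln x powr B"
proof -
 obtain C where C: "C > 0" "\<And>x q \<xi>. x >= 3 ==> (q,\<xi>) \<in> prim_chars ==> real q <= ln x powr B ==>
   norm (\<Sum>p | prime p \<and> real p <= x. \<xi> p) <= C * x / ln x powr B"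
  using siegel_walfisz[OF prim_chars_class B] by fast
 have "norm (\<Sum>p | prime p \<and> real p <= x. mchar S h p) <= real (card S) + C * x / ln x powr B"
  if x: "x >= 3" and S: "S \<in> prime_sets" and h: "h \<in> PiE S (%l. {..<l-1})" and ex: "\<exists>l\<in>S. h l \<noteq> 0"
   and d: "real (\<Prod>S) <= ln x powr B" for x S h
 proof -
  define P where "P = (primes_le x)"
  have fP: "finite P" unfolding P_def by (rule finite_primes_le)
  define T where "T = {l\<in>S. h l \<noteq> 0}"
  have T: "T \<in> prime_sets" "T \<subseteq> S" "T \<noteq> {}" using S ex by (auto simp: T_def intro: prime_sets_subset)
  have "(\<Prod>T, mchar T h) \<in> prim_chars" unfolding prim_chars_def using T h by (auto simp: T_def PiE_def Pi_def intro!: exI[of _ T] exI[of _ h])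
  moreover have "\<Prod>T \<le> \<Prod>S"
   using T S prime_setsD prime_gt_0_nat by (intro dvd_imp_le prod_dvd_prod_subset prod_pos) auto
  then have "real (\<Prod>T) <= ln x powr B" using d by (meson of_nat_mono order_trans)
  ultimately have 1: "norm (\<Sum>p\<in>P. mchar T h p) <= C * x / ln x powr B"
   unfolding P_def using C(2)[OF x] by blast
  have diff: "norm (mchar S h p - mchar T h p) <= (if p \<in> S then 1 else 0)" if p: "p \<in> P" for p
  proof (cases "p \<in> S")
   case True
   have "mchar S h p = 0" unfolding mchar_def
    using True prime_setsD(1)[OF S] by (intro prod_zero bexI[of _ p]) (auto simp: pchar_def)
   moreover have "norm (mchar T h p) <= 1"
    using T(1) prime_setsD by (intro dchar_norm_le[OF mchar_dchar]) auto
   ultimately show ?thesis using True by simp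
  next
   case False
   have "mchar S h p = mchar T h p" unfolding mchar_def
   proof (rule prod.mono_neutral_right[OF prime_setsD(1)[OF S] T(2)], rule ballI)
    fix l assume l: "l \<in> S - T"
    then have "h l = 0" by (simp add: T_def)
    moreover have "\<not> l dvd p" using l False p prime_setsD(2)[OF S, of l] primes_dvd_imp_eq[of l p] by (auto simp: P_def)
    ultimately show "pchar l (h l) p = 1" by (simp add: pchar_0)
   qed
   then show ?thesis using False by simp
  qed
  have "norm (\<Sum>p\<in>P. mchar S h p) <= norm (\<Sum>p\<in>P. mchar S h p - mchar T h p) + norm (\<Sum>p\<in>P. mchar T h p)"
   unfolding sum_subtractf by (metis diff_add_cancel norm_triangle_ineq)
  also have "norm (\<Sum>p\<in>P. mchar S h p - mchar T h p) <= (\<Sum>p\<in>P. if p \<in> S then 1 else 0)"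
   by (intro sum_norm_le diff)
  also have "... = real (card (P \<inter> S))" using fP by (simp add: sum.If_cases Int_def)
  also have "... <= real (card S)" using prime_setsD(1)[OF S] by (intro of_nat_mono card_mono) auto
  finally show ?thesis using 1 by (simp add: P_def)
 qed
 then show ?thesis using C(1) by (intro exI[of _ C]) blast
qed

section \<open>Counting primes congruent to 1\<close>

definition pi_one :: "nat set => real => nat" where
 "pi_one S x = card {p. prime p \<and> real p <= x \<and> (\<forall>l\<in>S. [p = 1] (mod l))}"

definition phi_set :: "nat set => nat" where "phi_set S = (\<Prod>l\<in>S. l - 1)"

lemma phi_set_pos: "S \<in> prime_sets ==> phi_set S > 0"
 unfolding phi_set_def using prime_setsD(2) prime_gt_1_nat by (intro prod_pos) fastforce

text \<open>Orthogonality over all h. The zero function gives the number of primes up to those in S,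
  whence a second \<open>card S\<close>; all other h are covered by
  \<open>mchar_prime_sum_bound\<close>.\<close>

theorem pi_one_asymp:
 assumes B: "B >= 1"
 shows "\<exists>C>0. \<forall>x\<ge>3. \<forall>S\<in>prime_sets. real (\<Prod>S) <= ln x powr B \<longrightarrow>
   \<bar>real (pi_one S x) - real (prime_pi x) / real (phi_set S)\<bar> <= 2 * real (card S) + C * x / ln x powr B"
proof -
 obtain C where C: "C > 0" "\<And>x S h. x >= 3 ==> S \<in> prime_sets ==> h \<in> PiE S (%l. {..<l-1}) ==> (\<exists>l\<in>S. h l \<noteq> 0) ==> real (\<Prod>S) <= ln x powr B ==>
   norm (\<Sum>p | prime p \<and> real p <= x. mchar S h p) <= real (card S) + C * x / ln x powr B"
  using mchar_prime_sum_bound[OF B] by fast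
 have "\<bar>real (pi_one S x) - real (prime_pi x) / real (phi_set S)\<bar> <= 2 * real (card S) + C * x / ln x powr B"
  if x: "x >= 3" and S: "S \<in> prime_sets" and d: "real (\<Prod>S) <= ln x powr B" for x S
 proof -
  define P where "P = (primes_le x)"
  have fP: "finite P" unfolding P_def by (rule finite_primes_le)
  define H where "H = PiE S (%l. {..<l-1})"
  have fH: "finite H" unfolding H_def using prime_setsD(1)[OF S] by (intro finite_PiE) auto
  have cH: "card H = phi_set S" unfolding H_def phi_set_def using prime_setsD(1)[OF S] by (simp add: card_PiE)
  define z where "z = restrict (%_. 0::nat) S"
  have zH: "z \<in> H" unfolding H_def z_def using prime_setsD(2)[OF S] prime_gt_1_nat by (fastforce simp: restrict_PiE_iff)
  have "(\<Sum>h\<in>H. \<Sum>p\<in>P. mchar S h p) = (\<Sum>p\<in>P. \<Sum>h\<in>H. mchar S h p)" by (rule sum.swap)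
  also have "... = (\<Sum>p\<in>P. if \<forall>l\<in>S. [p = 1] (mod l) then of_nat (phi_set S) else 0)"
   unfolding H_def phi_set_def by (rule sum.cong[OF refl], rule mchar_orthogonality) (use S prime_setsD in auto)
  also have "... = of_nat (phi_set S) * of_nat (pi_one S x)"
   using fP by (simp add: sum.If_cases pi_one_def P_def Int_def conj_ac)
  finally have tot: "(\<Sum>h\<in>H. \<Sum>p\<in>P. mchar S h p) = of_nat (phi_set S) * of_nat (pi_one S x)" .
  have zsum: "norm ((\<Sum>p\<in>P. mchar S z p) - of_nat (prime_pi x)) <= real (card S)"
  proof -
   have "(\<Sum>p\<in>P. mchar S z p) - of_nat (prime_pi x) = (\<Sum>p\<in>P. mchar S z p - 1)"
    by (simp add: sum_subtractf prime_pi_def P_def)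
   also have "norm ... <= (\<Sum>p\<in>P. if p \<in> S then 1 else 0)"
   proof (rule sum_norm_le)
    fix p assume p: "p \<in> P"
    show "norm (mchar S z p - 1) <= (if p \<in> S then 1 else 0)"
    proof (cases "p \<in> S")
     case True
     have "mchar S z p = 0" unfolding mchar_def
      using True prime_setsD(1)[OF S] by (intro prod_zero bexI[of _ p]) (auto simp: pchar_def)
     then show ?thesis using True by simp
    next
     case False
     have "mchar S z p = 1" unfolding mchar_def
     proof (rule prod.neutral, rule ballI)
      fix l assume l: "l \<in> S"
      have "\<not> l dvd p" using l False p prime_setsD(2)[OF S, of l] primes_dvd_imp_eq[of l p] by (auto simp: P_def)
      then show "pchar l (z l) p = 1" using l by (simp add: pchar_0 z_def)
     qed
     then show ?thesis using False by simp
    qed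
   qed
   also have "... = real (card (P \<inter> S))" using fP by (simp add: sum.If_cases Int_def)
   also have "... <= real (card S)" using prime_setsD(1)[OF S] by (intro of_nat_mono card_mono) auto
   finally show ?thesis .
  qed
  define E where "E = real (card S) + C * x / ln x powr B"
  have E0: "E >= 0" using C(1) x by (simp add: E_def)
  have "of_nat (phi_set S) * of_nat (pi_one S x) - (of_nat (prime_pi x) :: complex)
    = ((\<Sum>p\<in>P. mchar S z p) - of_nat (prime_pi x)) + (\<Sum>h\<in>H-{z}. \<Sum>p\<in>P. mchar S h p)"
   unfolding tot[symmetric] by (simp add: sum.remove[OF fH zH])
  also have "norm ... <= norm ((\<Sum>p\<in>P. mchar S z p) - of_nat (prime_pi x)) + norm (\<Sum>h\<in>H-{z}. \<Sum>p\<in>P. mchar S h p)"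
   by (rule norm_triangle_ineq)
  also have "norm (\<Sum>h\<in>H-{z}. \<Sum>p\<in>P. mchar S h p) <= (\<Sum>h\<in>H-{z}. E)"
  proof (rule sum_norm_le)
   fix h assume h: "h \<in> H - {z}"
   have "\<exists>l\<in>S. h l \<noteq> 0"
   proof (rule ccontr)
    assume "\<not> (\<exists>l\<in>S. h l \<noteq> 0)"
    then have "h = z" using h zH unfolding H_def z_def by (intro PiE_ext) auto
    then show False using h by simp
   qed
   then show "norm (\<Sum>p\<in>P. mchar S h p) <= E" unfolding E_def P_def using h by (intro C(2)[OF x S _ _ d]) (auto simp: H_def)
  qed
  also have "(\<Sum>h\<in>H-{z}. E) <= real (phi_set S) * E"
  proof -
   have "card (H - {z}) <= phi_set S" unfolding cH[symmetric] using fH by (intro card_mono) auto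
   then have "real (card (H - {z})) * E <= real (phi_set S) * E" using E0 by (intro mult_right_mono of_nat_mono)
   then show ?thesis by simp
  qed
  finally have "norm (of_nat (phi_set S) * of_nat (pi_one S x) - (of_nat (prime_pi x) :: complex)) <= real (card S) + real (phi_set S) * E"
   using zsum by simp
  moreover have "of_nat (phi_set S) * of_nat (pi_one S x) - (of_nat (prime_pi x) :: complex) = of_real (real (phi_set S) * real (pi_one S x) - real (prime_pi x))" by simp
  ultimately have ab: "\<bar>real (phi_set S) * real (pi_one S x) - real (prime_pi x)\<bar> <= real (card S) + real (phi_set S) * E" by (simp only: norm_of_real)
  have ph: "real (phi_set S) >= 1" using phi_set_pos[OF S] by simp
  have "\<bar>real (pi_one S x) - real (prime_pi x) / real (phi_set S)\<bar> = \<bar>real (phi_set S) * real (pi_one S x) - real (prime_pi x)\<bar> / real (phi_set S)"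
  proof -
   have "real (pi_one S x) - real (prime_pi x) / real (phi_set S) = (real (phi_set S) * real (pi_one S x) - real (prime_pi x)) / real (phi_set S)"
    using ph by (simp add: field_simps)
   then show ?thesis using ph by (simp only: abs_divide abs_of_nat)
  qed
  also have "... <= (real (card S) + real (phi_set S) * E) / real (phi_set S)" using ab ph by (intro divide_right_mono) auto
  also have "... = real (card S) / real (phi_set S) + E" using ph by (simp add: add_divide_distrib)
  also have "... <= real (card S) / 1 + E" using ph by (intro add_right_mono divide_left_mono) auto
  finally show ?thesis by (simp add: E_def)
 qed
 then show ?thesis using C(1) by (intro exI[of _ C]) blast
qed

subsection \<open>The average density of primitive roots\<close>

text \<open>This is \<mu>(d) / d for d the product of S.\<close>

definition csgn :: "nat set => real" where "csgn S = (\<Prod>l\<in>S. - (1 / real l))"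

lemma abs_csgn: "\<bar>csgn S\<bar> = 1 / real (\<Prod>S)"
 unfolding csgn_def abs_prod by (simp add: prod_dividef)

lemma totient_ratio_sum:
 assumes "n > 0"
 shows "real (totient n) / real n = (\<Sum>S\<in>Pow (prime_factors n). csgn S)"
proof -
 have "real (totient n) / real n = (\<Prod>p\<in>prime_factors n. - (1 / real p) + 1)"
  using assms by (simp add: totient_formula2)
 also have "... = (\<Sum>S\<in>Pow (prime_factors n). csgn S)"
  by (subst prod_add) (simp_all add: csgn_def)
 finally show ?thesis .
qed

text \<open>This is \<mu>(d) / (d \<phi>(d)); its sum over all squarefree d is Artin's
  constant.\<close>

definition gset :: "nat set => real" where "gset S = csgn S / real (phi_set S)"

text \<open>l <= (l - 1)^2 for every prime l > 2, and the prime 2 accounts for the factor 2. This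
  cheap lower bound for \<phi>(d) makes \<mu>(d) / (d \<phi>(d)) absolutely summable, with a tail of
  order Z^(-1/2).\<close>

lemma phi_set_square:
 assumes "S \<in> prime_sets"
 shows "\<Prod>S \<le> 2 * (phi_set S)\<^sup>2"
proof -
 have *: "l <= (l - 1)\<^sup>2" if "prime l" "l \<noteq> 2" for l :: nat
 proof -
  have l: "l >= 3" using prime_ge_2_nat[OF that(1)] that(2) by linarith
  define m where "m = l - 1"
  have m: "l = m + 1" "m >= 2" using l by (auto simp: m_def)
  have "2 * m <= m * m" using m by (intro mult_right_mono) auto
  then have "m + 1 <= m\<^sup>2" using m unfolding power2_eq_square by linarith
  then show ?thesis using m by simp
 qed
 have e: "(phi_set T)\<^sup>2 = (\<Prod>l\<in>T. (l - 1)\<^sup>2)" for T by (simp add: phi_set_def prod_power_distrib)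
 have fin: "finite S" by (rule prime_setsD[OF assms])
 have no2: "\<Prod>(S - {2}) <= (phi_set (S - {2}))\<^sup>2"
  unfolding e using * prime_setsD[OF assms] by (intro prod_mono) auto
 show ?thesis
 proof (cases "2 \<in> S")
  case True
  have "\<Prod>S = 2 * \<Prod>(S - {2})" using fin True by (simp add: prod.remove)
  moreover have "phi_set S = phi_set (S - {2})" unfolding phi_set_def using fin True by (simp add: prod.remove)
  ultimately show ?thesis using no2 by simp
 next
  case False
  then show ?thesis using no2 by simp
 qed
qed

lemma abs_gset_le:
 assumes S: "S \<in> prime_sets"
 shows "\<bar>gset S\<bar> <= 2 * real (\<Prod>S) powr (-3/2)"
proof -
 define d where "d = real (\<Prod>S)"
 define f where "f = real (phi_set S)"
 have d: "d >= 1" using prime_set_prod_ge_1[OF S] unfolding d_def by (metis of_nat_1 of_nat_mono)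
 have f: "f >= 1" using phi_set_pos[OF S] by (simp add: f_def)
 have "d <= 2 * f\<^sup>2" using phi_set_square[OF S] unfolding d_def f_def by (metis of_nat_mono of_nat_mult of_nat_numeral of_nat_power)
 also have "... <= (2 * f)\<^sup>2" by (simp add: power2_eq_square)
 finally have "sqrt d <= 2 * f" using f d by (intro real_le_lsqrt) auto
 then have "d powr (1/2) <= 2 * f" using d by (simp add: powr_half_sqrt)
 then have "1 / f <= 2 / d powr (1/2)" using f d by (simp add: field_simps)
 then have "1 / d * (1 / f) <= 1 / d * (2 / d powr (1/2))" using d by (intro mult_left_mono) auto
 also have "... = 2 * (d powr (-1) * d powr (-(1/2)))"
  unfolding powr_neg_one[OF less_le_trans[OF zero_less_one d]] powr_minus_divide using d by simp
 also have "... = 2 * d powr (-3/2)" unfolding powr_add[symmetric] by simp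
 finally show ?thesis using f by (simp add: gset_def abs_csgn d_def f_def)
qed

lemma gset_tail:
 assumes "F \<subseteq> prime_sets" "finite F" "\<And>S. S \<in> F ==> \<Prod>S > Z" "Z >= 1"
 shows "\<bar>\<Sum>S\<in>F. gset S\<bar> <= 4 * real Z powr (-1/2)"
proof -
 have "\<bar>\<Sum>S\<in>F. gset S\<bar> <= (\<Sum>S\<in>F. 2 * real (\<Prod>S) powr (-3/2))"
  by (rule order_trans[OF sum_abs], rule sum_mono) (use assms abs_gset_le in auto)
 also have "... <= (\<Sum>d\<in>(%S. \<Prod>S) ` F. 2 * real d powr (-3/2))"
  by (rule sum_prime_sets_le[of F _ "%d. 2 * real d powr (-3/2)"]) (use assms in auto)
 also have "... = 2 * (\<Sum>d\<in>(%S. \<Prod>S) ` F. real d powr (-1-1/2))" by (simp add: sum_distrib_left)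
 also have "... <= 2 * (real Z powr (-(1/2)) / (1/2))"
  by (intro mult_left_mono inverse_powr_tail) (use assms in auto)
 finally show ?thesis by simp
qed

text \<open>\<open>artin_const\<close> is a \<open>lim\<close>, so convergence has to be shown: the
  partial products are nonnegative and decrease. For n >= Z the n-th one expands into a sum over
  sets of primes up to n, and differs from the truncated sum by a tail bounded uniformly in
  n.\<close>

lemma artin_const_approx:
 assumes Z: "Z >= 1"
 shows "\<bar>artin_const - (\<Sum>S | S \<in> prime_sets \<and> \<Prod>S \<le> Z. gset S)\<bar> <= 4 * real Z powr (-1/2)"
proof -
 define X where "X = (%n. \<Prod>l\<in>{l::nat. prime l \<and> l <= n}. (1 - 1 / (real l * (real l - 1))))"
 define P where "P = (%n::nat. {l::nat. prime l \<and> l <= n})"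
 have finP: "finite (P n)" for n unfolding P_def by (rule finite_subset[of _ "{..n}"]) auto
 have f01: "0 <= 1 - 1 / (real l * (real l - 1))" "1 - 1 / (real l * (real l - 1)) <= 1" if "prime l" for l
 proof -
  have "real l >= 2" using prime_ge_2_nat[OF that] by simp
  then have "1 * 1 <= real l * (real l - 1)" by (intro mult_mono) auto
  then show "0 <= 1 - 1 / (real l * (real l - 1))" "1 - 1 / (real l * (real l - 1)) <= 1" by auto
 qed
 have "decseq X"
 proof (rule decseq_SucI)
  fix n
  have "P (Suc n) = P n \<union> (if prime (Suc n) then {Suc n} else {})" by (auto simp: P_def le_Suc_eq)
  moreover have "Suc n \<notin> P n" by (simp add: P_def)
  moreover have "X n >= 0" unfolding X_def by (intro prod_nonneg) (use f01 in auto)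
  moreover have "X m = (\<Prod>l\<in>P m. 1 - 1 / (real l * (real l - 1)))" for m by (simp add: X_def P_def)
  ultimately show "X (Suc n) <= X n" using finP[of n] f01[of "Suc n"]
   by (cases "prime (Suc n)") (simp_all add: mult_left_le_one_le del: of_nat_Suc)
 qed
 moreover have "\<forall>i. 0 <= X i" unfolding X_def by (intro allI prod_nonneg) (use f01 in auto)
 ultimately obtain A where A: "X \<longlonglongrightarrow> A" by (rule decseq_convergent)
 then have AA: "artin_const = A" unfolding artin_const_def X_def[symmetric] by (rule limI)
 have Xsum: "X n = (\<Sum>S\<in>Pow (P n). gset S)" for n
 proof -
  have "X n = (\<Prod>l\<in>P n. - (1 / real l) / real (l - 1) + 1)" unfolding X_def P_def
   by (rule prod.cong) (auto simp: of_nat_diff dest: prime_ge_1_nat)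
  also have "... = (\<Sum>S\<in>Pow (P n). gset S)"
   unfolding gset_def csgn_def phi_set_def of_nat_prod prod_dividef[symmetric] by (subst prod_add[OF finP]) (simp only: prod.neutral_const mult_1_right)
  finally show ?thesis .
 qed
 define Y where "Y = {S. S \<in> prime_sets \<and> \<Prod>S \<le> Z}"
 have Pps: "Pow (P n) \<subseteq> prime_sets" for n using finP[of n] finite_subset by (auto simp: prime_sets_def P_def)
 have "\<bar>X n - (\<Sum>S\<in>Y. gset S)\<bar> <= 4 * real Z powr (-1/2)" if n: "n >= Z" for n
 proof -
  have "Y \<subseteq> Pow (P n)"
  proof
   fix S assume S: "S \<in> Y"
   then have S': "S \<in> prime_sets" by (simp add: Y_def)
   have "l <= n" if "l \<in> S" for l
   proof -
    have "l dvd \<Prod>S" using that prime_setsD(1)[OF S'] by (rule dvd_prodI[rotated])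
    then have "l <= \<Prod>S" using prime_set_prod_ge_1[OF S'] by (intro dvd_imp_le) auto
    then show ?thesis using S n by (simp add: Y_def)
   qed
   then show "S \<in> Pow (P n)" using prime_setsD(2)[OF S'] by (auto simp: P_def)
  qed
  then have "X n - (\<Sum>S\<in>Y. gset S) = (\<Sum>S\<in>Pow (P n) - Y. gset S)"
   unfolding Xsum using finP[of n] by (simp add: sum_diff)
  also have "\<bar>...\<bar> <= 4 * real Z powr (-1/2)"
   by (rule gset_tail[OF _ _ _ Z]) (use Pps[of n] finP[of n] in \<open>auto simp: Y_def\<close>)
  finally show ?thesis .
 qed
 then have "eventually (%n. \<bar>X n - (\<Sum>S\<in>Y. gset S)\<bar> <= 4 * real Z powr (-1/2)) sequentially"
  unfolding eventually_sequentially by blast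
 moreover have "(%n. \<bar>X n - (\<Sum>S\<in>Y. gset S)\<bar>) \<longlonglongrightarrow> \<bar>A - (\<Sum>S\<in>Y. gset S)\<bar>"
  by (intro tendsto_rabs tendsto_diff A tendsto_const)
 ultimately show ?thesis unfolding AA Y_def[symmetric] by (intro tendsto_upperbound) auto
qed

text \<open>All these primes are of the form d k + 1 with 1 <= k <= x/d. The value k = 0 is excluded
  because 1 is not prime, so no additive error appears.\<close>

lemma pi_one_le:
 assumes S: "S \<in> prime_sets" and x: "x >= 0"
 shows "real (pi_one S x) <= x / real (\<Prod>S)"
proof -
 define d where "d = \<Prod>S"
 have d: "d >= 1" using prime_set_prod_ge_1[OF S] by (simp add: d_def)
 define Q where "Q = {p. prime p \<and> real p <= x \<and> (\<forall>l\<in>S. [p = 1] (mod l))}"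
 have ex: "\<exists>k. p = d * k + 1 \<and> k >= 1 \<and> real k <= x / real d" if p: "p \<in> Q" for p
 proof -
  have p2: "p >= 2" using p prime_ge_2_nat by (auto simp: Q_def)
  have "l dvd p - 1" if "l \<in> S" for l
   using p that p2 by (auto simp: Q_def cong_altdef_nat)
  then have "d dvd p - 1" unfolding d_def by (rule prime_set_dvd[OF S])
  then obtain k where k: "p - 1 = d * k" by blast
  then have pk: "p = d * k + 1" "k >= 1" using p2 by (linarith, cases k, auto)
  have "real d * real k <= x" using p unfolding Q_def pk(1) by simp
  then show ?thesis using pk d by (auto simp: pos_le_divide_eq mult.commute)
 qed
 have "Q \<subseteq> (%k. d * k + 1) ` {1..nat \<lfloor>x / real d\<rfloor>}"
 proof
  fix p assume "p \<in> Q"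
  then obtain k where "p = d * k + 1" "k >= 1" "real k <= x / real d" using ex by blast
  then show "p \<in> (%k. d * k + 1) ` {1..nat \<lfloor>x / real d\<rfloor>}" by (auto intro!: imageI le_nat_floor)
 qed
 then have "card Q <= card ((%k. d * k + 1) ` {1..nat \<lfloor>x / real d\<rfloor>})" by (intro card_mono) auto
 also have "... <= nat \<lfloor>x / real d\<rfloor>" by (rule order_trans[OF card_image_le]) auto
 finally have "real (card Q) <= real (nat \<lfloor>x / real d\<rfloor>)" by simp
 also have "... <= x / real d" using x by (intro of_nat_floor) simp
 finally show ?thesis by (simp add: pi_one_def Q_def d_def)
qed

lemma prime_pi_le: "x >= 0 ==> real (prime_pi x) <= x"
 using pi_one_le[of "{}" x] by (simp add: pi_one_def prime_pi_def prime_sets_def)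

abbreviation totient_sum :: "real => real" where
 "totient_sum x \<equiv> (\<Sum>p | prime p \<and> real p <= x. real (totient (p - 1)) / real (p - 1))"

text \<open>\<phi>(p-1)/(p-1) is the sum of \<mu>(d)/d over the divisors d of p - 1, and for
  squarefree d divisibility of p - 1 means p = 1 modulo every prime of d.\<close>

lemma totient_sum_swap:
 fixes x :: real
 assumes "nat \<lfloor>x\<rfloor> <= M"
 shows "totient_sum x
   = (\<Sum>S | S \<in> prime_sets \<and> \<Prod>S \<le> M. csgn S * real (pi_one S x))"
proof -
 define P where "P = (primes_le x)"
 define U where "U = {S. S \<in> prime_sets \<and> \<Prod>S \<le> M}"
 have fP: "finite P" unfolding P_def by (rule finite_primes_le)
 have fU: "finite U" unfolding U_def by (rule finite_prime_sets_le)
 have "(\<Sum>p\<in>P. real (totient (p - 1)) / real (p - 1)) = (\<Sum>p\<in>P. \<Sum>S\<in>U. if \<forall>l\<in>S. [p = 1] (mod l) then csgn S else 0)"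
 proof (rule sum.cong[OF refl])
  fix p assume p: "p \<in> P"
  then have p2: "p >= 2" using prime_ge_2_nat by (auto simp: P_def)
  have pM: "p <= M" using p assms by (auto simp: P_def dest!: le_nat_floor)
  have eq: "Pow (prime_factors (p - 1)) = {S\<in>U. \<forall>l\<in>S. [p = 1] (mod l)}"
  proof (intro subset_antisym subsetI)
   fix S assume S: "S \<in> Pow (prime_factors (p - 1))"
   then have 1: "S \<in> prime_sets" by (auto simp: prime_sets_def intro: finite_subset)
   have dv: "l dvd p - 1" if "l \<in> S" for l using S that by auto
   then have "\<Prod>S dvd p - 1" by (rule prime_set_dvd[OF 1])
   then have "\<Prod>S \<le> p - 1" using p2 by (intro dvd_imp_le) auto
   then have "\<Prod>S \<le> M" using pM by linarith
   moreover have "\<forall>l\<in>S. [p = 1] (mod l)" using dv p2 by (simp add: cong_altdef_nat)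
   ultimately show "S \<in> {S\<in>U. \<forall>l\<in>S. [p = 1] (mod l)}" using 1 by (simp add: U_def)
  next
   fix S assume S: "S \<in> {S\<in>U. \<forall>l\<in>S. [p = 1] (mod l)}"
   then show "S \<in> Pow (prime_factors (p - 1))"
    using p2 by (auto simp: U_def prime_sets_def cong_altdef_nat prime_factors_dvd)
  qed
  have "real (totient (p - 1)) / real (p - 1) = (\<Sum>S | S\<in>U \<and> (\<forall>l\<in>S. [p = 1] (mod l)). csgn S)"
   using totient_ratio_sum[of "p - 1"] p2 unfolding eq by simp
  also have "... = (\<Sum>S\<in>U. if \<forall>l\<in>S. [p = 1] (mod l) then csgn S else 0)"
   using fU by (simp add: sum.inter_filter)
  finally show "real (totient (p - 1)) / real (p - 1) = ..." .
 qed
 also have "... = (\<Sum>S\<in>U. \<Sum>p\<in>P. if \<forall>l\<in>S. [p = 1] (mod l) then csgn S else 0)" by (rule sum.swap)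
 also have "... = (\<Sum>S\<in>U. csgn S * real (pi_one S x))"
 proof (rule sum.cong[OF refl])
  fix S
  show "(\<Sum>p\<in>P. if \<forall>l\<in>S. [p = 1] (mod l) then csgn S else 0) = csgn S * real (pi_one S x)"
   using fP by (simp add: sum.inter_filter[symmetric] pi_one_def P_def conj_ac)
 qed
 finally show ?thesis by (simp add: P_def U_def)
qed

theorem main_term:
 assumes B: "B >= 1"
 shows "\<exists>C>0. \<forall>x\<ge>3. \<bar>totient_sum x - artin_const * real (prime_pi x)\<bar>
   <= C * x / ln x powr B"
proof -
 have B4: "4 * B >= 1" using B by simp
 obtain C where C: "C > 0" "\<And>x S. x >= 3 ==> S \<in> prime_sets ==> real (\<Prod>S) <= ln x powr (4*B) ==>
   \<bar>real (pi_one S x) - real (prime_pi x) / real (phi_set S)\<bar> <= 2 * real (card S) + C * x / ln x powr (4*B)"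
  using pi_one_asymp[OF B4] by fast
 define C1 where "C1 = (4 * (3 * B)) powr (3 * B)"
 define C2 where "C2 = 4 * C1 + C + 10"
 have "\<bar>totient_sum x - artin_const * real (prime_pi x)\<bar> <= C2 * x / ln x powr B"
  if x: "x >= 3" for x
 proof -
  define L where "L = ln x"
  have xe: "x >= exp 1" using x exp_le by linarith
  have L1: "L >= 1" using xe x by (simp add: L_def ln_ge_iff)
  define w where "w = L powr (-B)"
  have LB: "L powr B >= 1" using L1 B by (simp add: ge_one_powr_ge_zero)
  have w: "w > 0" "w <= 1" "L powr (-(2*B)) = w * w" "L powr B * w = 1"
  proof -
   show "w > 0" using L1 by (simp add: w_def)
   show "w <= 1" unfolding w_def powr_minus using LB by (simp add: inverse_le_1_iff)
   show "L powr (-(2*B)) = w * w" by (simp add: w_def powr_add[symmetric])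
   show "L powr B * w = 1" using L1 by (simp add: w_def powr_minus)
  qed
  \<comment> \<open>For d up to L^(2B), at most L^(2B) in number, the error x L^(-4B) of
    \<open>pi_one_asymp\<close> adds up to x L^(-2B). Larger d are bounded by x/d^2. Truncating
    Artin's constant costs Z^(-1/2), of order L^(-B), and this fixes the exponent 2B.\<close>
  define Z where "Z = nat \<lfloor>L powr (2*B)\<rfloor>"
  have L2: "L powr (2*B) >= 1" using L1 B by (simp add: ge_one_powr_ge_zero)
  have Z1: "real Z <= L powr (2*B)" unfolding Z_def by (intro of_nat_floor) simp
  have Z2: "Z >= 1" unfolding Z_def using L2 by (simp add: le_nat_iff)
  have "L powr (2*B) < real Z + 1" unfolding Z_def by linarith
  then have Z3: "L powr (2*B) <= 2 * real Z" using Z2 by simp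
  have Zi: "1 / real Z <= 2 * (w * w)"
  proof -
   have "L powr (2*B) * (w * w) = 1" using L1 by (simp add: w(3)[symmetric] powr_minus)
   then have "1 <= (2 * real Z) * (w * w)" using mult_right_mono[OF Z3, of "w * w"] w by simp
   then show ?thesis using Z2 by (simp add: field_simps)
  qed
  \<comment> \<open>The maximum guarantees that Y is contained in U even where Z exceeds x.\<close>
  define M where "M = max (nat \<lfloor>x\<rfloor>) Z"
  define U where "U = {S. S \<in> prime_sets \<and> \<Prod>S \<le> M}"
  define Y where "Y = {S. S \<in> prime_sets \<and> \<Prod>S \<le> Z}"
  define pp where "pp = real (prime_pi x)"
  have pp: "0 <= pp" "pp <= x" using prime_pi_le[of x] x by (auto simp: pp_def)
  have fin: "finite U" "finite Y" unfolding U_def Y_def by (rule finite_prime_sets_le)+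
  have YU: "Y \<subseteq> U" by (auto simp: Y_def U_def M_def)
  have "totient_sum x = (\<Sum>S\<in>U. csgn S * real (pi_one S x))"
   unfolding U_def by (rule totient_sum_swap) (simp add: M_def)
  also have "... = (\<Sum>S\<in>Y. csgn S * real (pi_one S x)) + (\<Sum>S\<in>U-Y. csgn S * real (pi_one S x))"
   using sum.subset_diff[OF YU fin(1)] by (simp add: add.commute)
  also have "(\<Sum>S\<in>Y. csgn S * real (pi_one S x)) = (\<Sum>S\<in>Y. csgn S * (real (pi_one S x) - pp / real (phi_set S))) + pp * (\<Sum>S\<in>Y. gset S)"
   unfolding sum_distrib_left sum.distrib[symmetric] by (rule sum.cong) (auto simp: gset_def algebra_simps)
  finally have eq: "totient_sum x - artin_const * pp
    = (\<Sum>S\<in>Y. csgn S * (real (pi_one S x) - pp / real (phi_set S))) + (\<Sum>S\<in>U-Y. csgn S * real (pi_one S x)) - pp * (artin_const - (\<Sum>S\<in>Y. gset S))"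
   by (simp add: algebra_simps)
  have t1: "\<bar>\<Sum>S\<in>Y. csgn S * (real (pi_one S x) - pp / real (phi_set S))\<bar> <= (2 * C1 + C) * x * w"
  proof -
   have "\<bar>\<Sum>S\<in>Y. csgn S * (real (pi_one S x) - pp / real (phi_set S))\<bar> <= (\<Sum>S\<in>Y. 2 + C * x / L powr (4*B))"
   proof (rule order_trans[OF sum_abs], rule sum_mono)
    fix S assume S: "S \<in> Y"
    then have S': "S \<in> prime_sets" "\<Prod>S \<le> Z" by (auto simp: Y_def)
    have d1: "real (\<Prod>S) >= 1" using prime_set_prod_ge_1[OF S'(1)] by (metis of_nat_1 of_nat_mono)
    have "real (\<Prod>S) <= real Z" using S'(2) by (rule of_nat_mono)
    also have "... <= L powr (4*B)" using Z1 powr_mono[of "2*B" "4*B" L] L1 B by simp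
    finally have "\<bar>real (pi_one S x) - pp / real (phi_set S)\<bar> <= 2 * real (card S) + C * x / L powr (4*B)"
     using C(2)[OF x S'(1)] by (simp add: L_def pp_def)
    also have "... <= 2 * real (\<Prod>S) + (C * x / L powr (4*B)) * real (\<Prod>S)"
    proof (intro add_mono mult_left_mono of_nat_mono)
     show "card S <= \<Prod>S" using card_prime_set_le[OF S'(1)] by simp
     have "C * x / L powr (4*B) * 1 <= C * x / L powr (4*B) * real (\<Prod>S)" using d1 C(1) x by (intro mult_left_mono) auto
     then show "C * x / L powr (4*B) <= C * x / L powr (4*B) * real (\<Prod>S)" by simp
    qed auto
    finally have "\<bar>csgn S\<bar> * \<bar>real (pi_one S x) - pp / real (phi_set S)\<bar> <= 1 / real (\<Prod>S) * ((2 + C * x / L powr (4*B)) * real (\<Prod>S))"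
     unfolding abs_csgn distrib_right by (intro mult_left_mono) (use d1 in simp_all)
    then show "\<bar>csgn S * (real (pi_one S x) - pp / real (phi_set S))\<bar> <= 2 + C * x / L powr (4*B)"
     using d1 by (simp add: abs_mult)
   qed
   also have "... = real (card Y) * (2 + C * x / L powr (4*B))" by simp
   also have "... <= L powr (2*B) * (2 + C * x / L powr (4*B))"
   proof (intro mult_right_mono)
    have "card Y = (\<Sum>S\<in>Y. 1)" by simp
    have "(\<Sum>S\<in>Y. (1::real)) <= (\<Sum>d\<in>{1..Z}. 1)"
     by (rule sum_prime_sets_le[of Y "{1..Z}" "%_. 1"]) (use prime_set_prod_ge_1 in \<open>auto simp: Y_def\<close>)
    then have "real (card Y) <= real Z" by simp
    then show "real (card Y) <= L powr (2*B)" using Z1 by linarith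
   qed (use C x in auto)
   also have "... = 2 * L powr (2*B) + C * x * (L powr (2*B) / L powr (4*B))" by (simp add: algebra_simps)
   also have "L powr (2*B) / L powr (4*B) = w * w" by (simp add: powr_diff[symmetric] w(3)[symmetric])
   also have "C * x * (w * w) <= C * x * (w * 1)" using w C x by (intro mult_left_mono) auto
   also have "L powr (2*B) <= C1 * x * w"
   proof -
    have "L powr (3*B) <= C1 * x powr (1/4)" unfolding L_def C1_def using B x by (intro ln_powr_le) auto
    also have "... <= C1 * x powr 1" using x by (intro mult_left_mono powr_mono) (auto simp: C1_def)
    finally have "L powr (3*B) * w <= C1 * x * w" using w x by (intro mult_right_mono) auto
    moreover have "L powr (3*B) * w = L powr (2*B)" by (simp add: w_def powr_add[symmetric])
    ultimately show ?thesis by simp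
   qed
   finally show ?thesis by (simp add: algebra_simps)
  qed
  have t2: "\<bar>\<Sum>S\<in>U-Y. csgn S * real (pi_one S x)\<bar> <= 2 * x * w"
  proof -
   have "\<bar>\<Sum>S\<in>U-Y. csgn S * real (pi_one S x)\<bar> <= (\<Sum>S\<in>U-Y. x * real (\<Prod>S) powr (-1-1))"
   proof (rule order_trans[OF sum_abs], rule sum_mono)
    fix S assume S: "S \<in> U - Y"
    then have S': "S \<in> prime_sets" by (auto simp: U_def)
    have d1: "real (\<Prod>S) >= 1" using prime_set_prod_ge_1[OF S'] by (metis of_nat_1 of_nat_mono)
    have "\<bar>csgn S * real (pi_one S x)\<bar> = 1 / real (\<Prod>S) * real (pi_one S x)" by (simp add: abs_mult abs_csgn)
    also have "... <= 1 / real (\<Prod>S) * (x / real (\<Prod>S))" using pi_one_le[OF S', of x] x d1 by (intro mult_left_mono) auto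
    also have "... = x * real (\<Prod>S) powr (-1-1)"
    proof -
     have "real (\<Prod>S) powr (-1-1) = real (\<Prod>S) powr (-1 + -1)" by simp
     also have "... = 1 / real (\<Prod>S) * (1 / real (\<Prod>S))"
      unfolding powr_add powr_neg_one[OF less_le_trans[OF zero_less_one d1]] ..
     finally show ?thesis by simp
    qed
    finally show "\<bar>csgn S * real (pi_one S x)\<bar> <= x * real (\<Prod>S) powr (-1-1)" .
   qed
   also have "... <= (\<Sum>d\<in>(%S. \<Prod>S) ` (U-Y). x * real d powr (-1-1))"
    by (rule sum_prime_sets_le[of "U-Y" _ "%d. x * real d powr (-1-1)"]) (use fin x in \<open>auto simp: U_def\<close>)
   also have "... = x * (\<Sum>d\<in>(%S. \<Prod>S) ` (U-Y). real d powr (-1-1))" by (simp only: sum_distrib_left)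
   also have "... <= x * (real Z powr (-1) / 1)"
    by (intro mult_left_mono inverse_powr_tail) (use fin x Z2 in \<open>auto simp: U_def Y_def\<close>)
   also have "... = x * (1 / real Z)" using Z2 by (simp only: powr_neg_one of_nat_0_less_iff div_by_1)
   also have "... <= x * (2 * (w * w))" using Zi x by (intro mult_left_mono) auto
   also have "... <= x * (2 * (w * 1))" using x w by (intro mult_left_mono) auto
   finally show ?thesis by (simp add: mult_ac)
  qed
  have t3: "\<bar>pp * (artin_const - (\<Sum>S\<in>Y. gset S))\<bar> <= 8 * x * w"
  proof -
   have "real Z powr (-1/2) = real Z powr (-(1/2))" by simp
   also have "... = 1 / sqrt (real Z)" unfolding powr_minus_divide using Z2 by (simp only: powr_half_sqrt of_nat_0_le_iff)
   also have "... = sqrt (1 / real Z)" by (simp add: real_sqrt_divide)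
   also have "... <= sqrt ((2 * w)\<^sup>2)" using Zi zero_le_square[of w] unfolding power2_eq_square by (intro real_sqrt_le_mono) linarith
   also have "... = 2 * w" unfolding real_sqrt_abs using w by simp
   finally have "\<bar>artin_const - (\<Sum>S\<in>Y. gset S)\<bar> <= 8 * w" using artin_const_approx[OF Z2] by (simp add: Y_def)
   then have "pp * \<bar>artin_const - (\<Sum>S\<in>Y. gset S)\<bar> <= x * (8 * w)" using pp by (intro mult_mono) auto
   then show ?thesis using pp by (simp add: abs_mult mult_ac)
  qed
  have "\<bar>totient_sum x - artin_const * pp\<bar> <= (2 * C1 + C) * x * w + 2 * x * w + 8 * x * w"
   unfolding eq using t1 t2 t3 by linarith
  also have "... = (2 * C1 + C + 10) * (x * w)" by (simp add: algebra_simps)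
  also have "... <= C2 * (x * w)" unfolding C2_def using x w by (intro mult_right_mono) (auto simp: C1_def)
  finally show ?thesis by (simp add: w_def pp_def L_def powr_minus divide_inverse mult_ac)
 qed
 moreover have "C2 > 0" unfolding C2_def C1_def using C(1) by (intro add_pos_pos add_nonneg_pos) auto
 ultimately show ?thesis by (intro exI[of _ C2]) blast
qed

subsection \<open>A large sieve inequality for almost orthogonal functions\<close>

lemma square_sum_le:
 fixes f :: "'a => real"
 shows "(\<Sum>i\<in>A. f i)\<^sup>2 <= real (card A) * (\<Sum>i\<in>A. (f i)\<^sup>2)"
proof (cases "finite A")
 case True
 have "(\<Sum>i\<in>A. 1 * f i)\<^sup>2 <= (\<Sum>i\<in>A. 1\<^sup>2) * (\<Sum>i\<in>A. (f i)\<^sup>2)" by (rule Cauchy_Schwarz_ineq_sum)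
 then show ?thesis by simp
qed simp

text \<open>Expanding the square produces the Gram matrix of the f i, with diagonal at most
  \<open>card A\<close> and other entries at most Q; Cauchy-Schwarz turns the off-diagonal part into
  Q \<open>card I\<close>.\<close>

lemma dual_large_sieve:
 fixes b :: "'i => complex" and f :: "'i => nat => complex"
 assumes fin: "finite I" "finite A" and Q: "Q >= 0"
  and nrm: "\<And>i n. i \<in> I ==> n \<in> A ==> norm (f i n) <= 1"
  and orth: "\<And>i j. i \<in> I ==> j \<in> I ==> i \<noteq> j ==> norm (\<Sum>n\<in>A. f i n * cnj (f j n)) <= Q"
 shows "(\<Sum>n\<in>A. (norm (\<Sum>i\<in>I. b i * f i n))\<^sup>2) <= (real (card A) + Q * real (card I)) * (\<Sum>i\<in>I. (norm (b i))\<^sup>2)"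
proof -
 define G where "G = (%i j. \<Sum>n\<in>A. f i n * cnj (f j n))"
 have sq: "of_real ((norm z)\<^sup>2) = z * cnj z" for z by (rule complex_norm_square)
 have "of_real (\<Sum>n\<in>A. (norm (\<Sum>i\<in>I. b i * f i n))\<^sup>2) = (\<Sum>n\<in>A. \<Sum>i\<in>I. \<Sum>j\<in>I. b i * cnj (b j) * (f i n * cnj (f j n)))"
  unfolding of_real_sum sq by (simp add: cnj_sum sum_product mult_ac)
 also have "... = (\<Sum>i\<in>I. \<Sum>n\<in>A. \<Sum>j\<in>I. b i * cnj (b j) * (f i n * cnj (f j n)))" by (rule sum.swap)
 also have "... = (\<Sum>i\<in>I. \<Sum>j\<in>I. b i * cnj (b j) * G i j)"
  unfolding G_def sum_distrib_left by (rule sum.cong[OF refl], rule sum.swap)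
 finally have eq: "of_real (\<Sum>n\<in>A. (norm (\<Sum>i\<in>I. b i * f i n))\<^sup>2) = (\<Sum>i\<in>I. \<Sum>j\<in>I. b i * cnj (b j) * G i j)" .
 have Gb: "norm (G i j) <= (if i = j then real (card A) else 0) + Q" if "i \<in> I" "j \<in> I" for i j
 proof (cases "i = j")
  case True
  have "norm (G i j) <= (\<Sum>n\<in>A. 1)" unfolding G_def True
  proof (rule sum_norm_le)
   fix n assume "n \<in> A"
   have "norm (f j n) * norm (f j n) <= 1 * 1" by (intro mult_mono nrm that \<open>n \<in> A\<close>) auto
   then show "norm (f j n * cnj (f j n)) <= 1" by (simp add: norm_mult)
  qed
  then show ?thesis using True Q by simp
 next
  case False
  then show ?thesis using orth[OF that] by (simp add: G_def)
 qed
 have "(\<Sum>n\<in>A. (norm (\<Sum>i\<in>I. b i * f i n))\<^sup>2) = norm (of_real (\<Sum>n\<in>A. (norm (\<Sum>i\<in>I. b i * f i n))\<^sup>2) :: complex)"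
  by (simp only: norm_of_real) (simp add: sum_nonneg)
 also have "... <= (\<Sum>i\<in>I. \<Sum>j\<in>I. norm (b i) * norm (b j) * ((if i = j then real (card A) else 0) + Q))"
  unfolding eq
 proof (intro sum_norm_le)
  fix i j assume "i \<in> I" "j \<in> I"
  then have "norm (b i) * norm (b j) * norm (G i j) <= norm (b i) * norm (b j) * ((if i = j then real (card A) else 0) + Q)"
   by (intro mult_left_mono Gb) auto
  then show "norm (b i * cnj (b j) * G i j) <= norm (b i) * norm (b j) * ((if i = j then real (card A) else 0) + Q)"
   by (simp add: norm_mult)
 qed
 also have "... = (\<Sum>i\<in>I. (\<Sum>j\<in>I. if i = j then norm (b i) * norm (b j) * real (card A) else 0) + (\<Sum>j\<in>I. Q * (norm (b i) * norm (b j))))"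
  unfolding sum.distrib[symmetric] by (intro sum.cong refl) (simp add: algebra_simps)
 also have "... = real (card A) * (\<Sum>i\<in>I. (norm (b i))\<^sup>2) + Q * (\<Sum>i\<in>I. norm (b i))\<^sup>2"
  using fin(1) by (simp add: sum.distrib sum_distrib_left[symmetric] power2_eq_square sum_product)
   (simp add: sum_distrib_left mult_ac)
 also have "... <= real (card A) * (\<Sum>i\<in>I. (norm (b i))\<^sup>2) + Q * (real (card I) * (\<Sum>i\<in>I. (norm (b i))\<^sup>2))"
  by (intro add_left_mono mult_left_mono square_sum_le Q)
 finally show ?thesis by (simp add: algebra_simps)
qed

text \<open>Duality: the left side V is the sum of a n D n, where D is the dual sum with
  coefficients cnj (S i). Cauchy-Schwarz and \<open>dual_large_sieve\<close> bound V^2 by \<Delta> V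
  times the square norm of a, and one factor V cancels.\<close>

lemma large_sieve:
 fixes a :: "nat => complex" and f :: "'i => nat => complex"
 assumes fin: "finite I" "finite A" and Q: "Q >= 0"
  and nrm: "\<And>i n. i \<in> I ==> n \<in> A ==> norm (f i n) <= 1"
  and orth: "\<And>i j. i \<in> I ==> j \<in> I ==> i \<noteq> j ==> norm (\<Sum>n\<in>A. f i n * cnj (f j n)) <= Q"
 shows "(\<Sum>i\<in>I. (norm (\<Sum>n\<in>A. a n * f i n))\<^sup>2) <= (real (card A) + Q * real (card I)) * (\<Sum>n\<in>A. (norm (a n))\<^sup>2)"
proof -
 define S where "S = (%i. \<Sum>n\<in>A. a n * f i n)"
 define V where "V = (\<Sum>i\<in>I. (norm (S i))\<^sup>2)"
 define D where "D = (%n. \<Sum>i\<in>I. cnj (S i) * f i n)"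
 define \<Delta> where "\<Delta> = real (card A) + Q * real (card I)"
 have V0: "V >= 0" by (simp add: V_def sum_nonneg)
 have "complex_of_real V = (\<Sum>i\<in>I. S i * cnj (S i))" unfolding V_def of_real_sum by (simp only: complex_norm_square)
 also have "... = (\<Sum>i\<in>I. \<Sum>n\<in>A. a n * (cnj (S i) * f i n))"
  by (rule sum.cong[OF refl]) (subst (1) S_def, simp add: sum_distrib_left mult_ac)
 also have "... = (\<Sum>n\<in>A. a n * D n)" unfolding D_def sum_distrib_left by (rule sum.swap)
 finally have "V = norm (\<Sum>n\<in>A. a n * D n)" using V0 by (metis norm_of_real abs_of_nonneg)
 also have "... <= (\<Sum>n\<in>A. norm (a n) * norm (D n))" by (rule sum_norm_le) (simp add: norm_mult)
 finally have "V\<^sup>2 <= (\<Sum>n\<in>A. norm (a n) * norm (D n))\<^sup>2" using V0 by (intro power_mono)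
 also have "... <= (\<Sum>n\<in>A. (norm (a n))\<^sup>2) * (\<Sum>n\<in>A. (norm (D n))\<^sup>2)" by (rule Cauchy_Schwarz_ineq_sum)
 also have "(\<Sum>n\<in>A. (norm (D n))\<^sup>2) <= \<Delta> * V"
  using dual_large_sieve[where b = "%i. cnj (S i)", OF fin Q nrm orth] by (simp add: D_def \<Delta>_def V_def)
 finally have "V\<^sup>2 <= (\<Sum>n\<in>A. (norm (a n))\<^sup>2) * (\<Delta> * V)" by (simp add: mult_left_mono sum_nonneg)
 then have "V * V <= (\<Delta> * (\<Sum>n\<in>A. (norm (a n))\<^sup>2)) * V" by (simp add: power2_eq_square mult_ac)
 then have "V <= \<Delta> * (\<Sum>n\<in>A. (norm (a n))\<^sup>2)"
 proof (cases "V = 0")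
  case True
  then show ?thesis using Q by (simp add: \<Delta>_def sum_nonneg)
 next
  case False
  then have "V > 0" using V0 by simp
  then show ?thesis using \<open>V * V <= (\<Delta> * (\<Sum>n\<in>A. (norm (a n))\<^sup>2)) * V\<close> by (rule mult_right_le_imp_le[rotated])
 qed
 then show ?thesis by (simp add: V_def S_def \<Delta>_def)
qed

subsection \<open>High moments through products\<close>

definition tuples :: "nat set => nat => nat list set" where
 "tuples A k = {xs. set xs \<subseteq> A \<and> length xs = k}"

lemma tuples_0: "tuples A 0 = {[]}" by (auto simp: tuples_def)

lemma tuples_Suc: "tuples A (Suc k) = (%(x,xs). x # xs) ` (A \<times> tuples A k)"
 by (auto simp: tuples_def length_Suc_conv image_iff)

lemma finite_tuples: "finite A ==> finite (tuples A k)"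
 unfolding tuples_def by (rule finite_lists_length_eq)

lemma card_tuples: "finite A ==> card (tuples A k) = card A ^ k"
 unfolding tuples_def by (rule card_lists_length_eq)

lemma sum_power_tuples:
 fixes g :: "nat => 'a::comm_semiring_1"
 shows "(\<Sum>n\<in>A. g n) ^ k = (\<Sum>xs\<in>tuples A k. prod_list (map g xs))"
proof (induction k)
 case 0
 then show ?case by (simp add: tuples_0)
next
 case (Suc k)
 have inj: "inj_on (%(x,xs). x # xs) (A \<times> tuples A k)" by (auto simp: inj_on_def)
 have "(\<Sum>n\<in>A. g n) ^ Suc k = (\<Sum>x\<in>A. \<Sum>xs\<in>tuples A k. g x * prod_list (map g xs))"
  by (simp add: Suc.IH sum_product)
 also have "... = (\<Sum>xs\<in>tuples A (Suc k). prod_list (map g xs))"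
  unfolding tuples_Suc sum.reindex[OF inj] by (simp add: sum.cartesian_product case_prod_unfold)
 finally show ?case .
qed

definition reps :: "nat set => nat => nat => nat" where
 "reps A k m = card {xs \<in> tuples A k. prod_list xs = m}"

lemma prod_list_le_power:
 assumes "\<And>x. x \<in> set xs ==> x <= (N::nat)"
 shows "prod_list xs <= N ^ length xs"
 using assms by (induction xs) (auto intro!: mult_mono)

lemma prod_list_pos: "(\<And>x. x \<in> set xs ==> x > 0) ==> prod_list xs > (0::nat)"
 by (induction xs) auto

text \<open>Phases \<epsilon> n turn the left side into the sum of b i S i, each S i being a sum
  over A. The k-th power of S i is a sum over products m <= N^k, long enough, by Q card I <= N^k,
  for the diagonal to dominate in the large sieve. Its coefficients are at most the numbers of
  representations, whose squares sum to at most R N^k. The threshold \<tau> separates typical S i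
  from the few large ones.\<close>

theorem moment_bound:
 fixes b :: "'i => complex" and f :: "'i => nat => complex"
 assumes fin: "finite I" and Q: "Q >= 0" and A: "A \<subseteq> {1..N}" and k: "k >= 1" and \<tau>: "\<tau> > 0"
  and cm: "\<And>i. i \<in> I ==> f i 1 = 1" "\<And>i m n. i \<in> I ==> f i (m * n) = f i m * f i n"
  and nrm: "\<And>i n. i \<in> I ==> norm (f i n) <= 1"
  and orth: "\<And>i j M. i \<in> I ==> j \<in> I ==> i \<noteq> j ==> norm (\<Sum>n=1..M. f i n * cnj (f j n)) <= Q"
  and QI: "Q * real (card I) <= real N ^ k"
  and R: "\<And>m. real (reps A k m) <= R" and \<beta>: "\<And>i. i \<in> I ==> norm (b i) <= \<beta>" "\<beta> >= 0"
 shows "(\<Sum>n\<in>A. norm (\<Sum>i\<in>I. b i * f i n)) <= \<tau> * (\<Sum>i\<in>I. norm (b i)) + 2 * \<beta> * R * real N ^ (2 * k) * \<tau> / \<tau> ^ (2 * k)"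
proof -
 have finA: "finite A" using A finite_subset by blast
 define \<epsilon> where "\<epsilon> = (%n. cnj (sgn (\<Sum>i\<in>I. b i * f i n)))"
 have \<epsilon>: "norm (\<epsilon> n) <= 1" for n by (simp add: \<epsilon>_def norm_sgn)
 have ph: "of_real (norm z) = cnj (sgn z) * z" for z :: complex
 proof (cases "z = 0")
  case False
  have "cnj (sgn z) * z = (z * cnj z) / of_real (norm z)" by (simp add: sgn_eq)
  also have "... = of_real (norm z)" unfolding complex_norm_square[symmetric] using False by (simp add: power2_eq_square)
  finally show ?thesis by simp
 qed simp
 define S where "S = (%i. \<Sum>n\<in>A. \<epsilon> n * f i n)"
 define E where "E = (%xs. prod_list (map \<epsilon> xs))"
 have nE: "norm (E xs) <= 1" for xs
  unfolding E_def by (induction xs) (auto simp: norm_mult intro: mult_le_one \<epsilon>)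
 define a where "a = (%m. \<Sum>xs | xs \<in> tuples A k \<and> prod_list xs = m. E xs)"
 have fT: "finite (tuples A k)" using finA by (rule finite_tuples)
 have R0: "R >= 0" using R[of 0] of_nat_0_le_iff[of "reps A k 0"] by linarith
 have img: "prod_list ` tuples A k \<subseteq> {1..N ^ k}"
 proof
  fix m assume "m \<in> prod_list ` tuples A k"
  then obtain xs where xs: "set xs \<subseteq> A" "length xs = k" "m = prod_list xs" by (auto simp: tuples_def)
  have "prod_list xs <= N ^ k" unfolding xs(2)[symmetric] by (rule prod_list_le_power) (use xs(1) A in auto)
  moreover have "prod_list xs > 0" by (rule prod_list_pos) (use xs(1) A in auto)
  ultimately show "m \<in> {1..N ^ k}" using xs(3) by auto
 qed
 have fm: "prod_list (map (%n. \<epsilon> n * f i n) xs) = E xs * f i (prod_list xs)" if "i \<in> I" for i xs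
  by (induction xs) (use cm that in \<open>auto simp: E_def mult_ac\<close>)
 have Sk: "S i ^ k = (\<Sum>m=1..N^k. a m * f i m)" if i: "i \<in> I" for i
 proof -
  have "S i ^ k = (\<Sum>xs\<in>tuples A k. E xs * f i (prod_list xs))"
   unfolding S_def sum_power_tuples by (rule sum.cong[OF refl]) (rule fm[OF i])
  also have "... = (\<Sum>m=1..N^k. \<Sum>xs | xs \<in> tuples A k \<and> prod_list xs = m. E xs * f i (prod_list xs))"
   by (rule sum.group[OF fT _ img, symmetric]) simp
  also have "... = (\<Sum>m=1..N^k. a m * f i m)" unfolding a_def sum_distrib_right by (intro sum.cong) auto
  finally show ?thesis .
 qed
 have na: "norm (a m) <= real (reps A k m)" for m
 proof -
  have "norm (a m) <= (\<Sum>xs | xs \<in> tuples A k \<and> prod_list xs = m. 1)" unfolding a_def by (intro sum_norm_le nE)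
  then show ?thesis by (simp add: reps_def)
 qed
 have sr: "(\<Sum>m=1..N^k. reps A k m) = card A ^ k"
 proof -
  have "(\<Sum>m=1..N^k. reps A k m) = (\<Sum>m=1..N^k. \<Sum>xs | xs \<in> tuples A k \<and> prod_list xs = m. 1)" by (simp add: reps_def)
  also have "... = (\<Sum>xs\<in>tuples A k. 1)" by (rule sum.group[OF fT _ img]) simp
  finally show ?thesis using finA by (simp add: card_tuples)
 qed
 have "card A <= N" using card_mono[OF _ A] by simp
 then have cA: "real (card A) ^ k <= real N ^ k" by (intro power_mono) auto
 have "(\<Sum>m=1..N^k. (norm (a m))\<^sup>2) <= (\<Sum>m=1..N^k. R * real (reps A k m))"
  unfolding power2_eq_square by (intro sum_mono mult_mono order_trans[OF na R] na R0) auto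
 also have "... = R * real (\<Sum>m=1..N^k. reps A k m)" by (simp add: sum_distrib_left)
 also have "... <= R * real N ^ k" unfolding sr using cA R0 by (simp add: mult_left_mono)
 finally have sa: "(\<Sum>m=1..N^k. (norm (a m))\<^sup>2) <= R * real N ^ k" .
 have "(\<Sum>i\<in>I. norm (S i) ^ (2 * k)) = (\<Sum>i\<in>I. (norm (\<Sum>m=1..N^k. a m * f i m))\<^sup>2)"
 proof (rule sum.cong[OF refl])
  fix i assume i: "i \<in> I"
  show "norm (S i) ^ (2 * k) = (norm (\<Sum>m=1..N^k. a m * f i m))\<^sup>2"
   unfolding Sk[OF i, symmetric] norm_power by (simp add: power_mult[symmetric] mult.commute)
 qed
 also have "... <= (real (card {1..N^k}) + Q * real (card I)) * (\<Sum>m=1..N^k. (norm (a m))\<^sup>2)"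
  by (rule large_sieve[OF fin _ Q nrm orth]) auto
 also have "... <= (2 * real N ^ k) * (R * real N ^ k)"
  using QI sa Q by (intro mult_mono) (auto intro: sum_nonneg)
 also have "... = 2 * R * real N ^ (2 * k)"
 proof -
  have "real N ^ (2 * k) = real N ^ k * real N ^ k" by (simp only: mult_2 power_add)
  then show ?thesis by (simp only: mult_ac)
 qed
 finally have mom: "(\<Sum>i\<in>I. norm (S i) ^ (2 * k)) <= 2 * R * real N ^ (2 * k)" .
 text \<open>Either \<open>u <= \<tau>\<close>, or the ratio \<open>u / \<tau>\<close> exceeds 1 and its \<open>(2k)\<close>-th power dominates it.\<close>
 have split: "u <= \<tau> + \<tau> * (u ^ (2 * k) / \<tau> ^ (2 * k))" if "u >= 0" for u
 proof (cases "u <= \<tau>")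
  case False
  then have "1 <= u / \<tau>" using \<tau> by simp
  then have "(u / \<tau>) ^ 1 <= (u / \<tau>) ^ (2 * k)" using k by (intro power_increasing) auto
  then have "\<tau> * (u / \<tau>) <= \<tau> * (u ^ (2 * k) / \<tau> ^ (2 * k))" using \<tau> by (intro mult_left_mono) (auto simp: power_divide)
  then show ?thesis using \<tau> by simp
 qed (use \<tau> that in \<open>simp add: add_increasing2\<close>)
 have "complex_of_real (\<Sum>n\<in>A. norm (\<Sum>i\<in>I. b i * f i n)) = (\<Sum>n\<in>A. \<Sum>i\<in>I. b i * (\<epsilon> n * f i n))"
  unfolding of_real_sum ph \<epsilon>_def by (rule sum.cong[OF refl]) (simp only: sum_distrib_left mult.left_commute)
 also have "... = (\<Sum>i\<in>I. b i * S i)" unfolding S_def sum_distrib_left by (rule sum.swap)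
 finally have "norm (complex_of_real (\<Sum>n\<in>A. norm (\<Sum>i\<in>I. b i * f i n))) = norm (\<Sum>i\<in>I. b i * S i)" by (rule arg_cong)
 then have "(\<Sum>n\<in>A. norm (\<Sum>i\<in>I. b i * f i n)) = norm (\<Sum>i\<in>I. b i * S i)"
  unfolding norm_of_real by (simp add: sum_nonneg)
 also have "... <= (\<Sum>i\<in>I. norm (b i) * \<tau> + \<beta> * (\<tau> * (norm (S i) ^ (2 * k) / \<tau> ^ (2 * k))))"
 proof (rule sum_norm_le)
  fix i assume i: "i \<in> I"
  have "norm (b i * S i) <= norm (b i) * (\<tau> + \<tau> * (norm (S i) ^ (2 * k) / \<tau> ^ (2 * k)))"
   unfolding norm_mult by (intro mult_left_mono split) auto
  also have "... <= norm (b i) * \<tau> + \<beta> * (\<tau> * (norm (S i) ^ (2 * k) / \<tau> ^ (2 * k)))"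
   unfolding distrib_left using \<tau> by (intro add_left_mono mult_right_mono \<beta>(1)[OF i]) auto
  finally show "norm (b i * S i) <= norm (b i) * \<tau> + \<beta> * (\<tau> * (norm (S i) ^ (2 * k) / \<tau> ^ (2 * k)))" .
 qed
 also have "... = \<tau> * (\<Sum>i\<in>I. norm (b i)) + \<beta> * \<tau> / \<tau> ^ (2 * k) * (\<Sum>i\<in>I. norm (S i) ^ (2 * k))"
  by (simp add: sum.distrib sum_distrib_left mult_ac)
 also have "... <= \<tau> * (\<Sum>i\<in>I. norm (b i)) + \<beta> * \<tau> / \<tau> ^ (2 * k) * (2 * R * real N ^ (2 * k))"
  using \<tau> \<beta>(2) by (intro add_left_mono mult_left_mono mom) auto
 finally show ?thesis by (simp add: mult_ac)
qed

section \<open>Ordered factorizations and the number of prime factors\<close>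

abbreviation bigomega :: "nat => nat" where "bigomega n \<equiv> size (prime_factorization n)"

text \<open>Every divisor of p m divides m or is p times a divisor of m; the latter carry one more
  factor k, hence a factor k + 1 for each prime.\<close>

lemma sum_divisors_power_bigomega:
 fixes k m :: nat
 assumes "m > 0"
 shows "(\<Sum>d | d dvd m. k ^ bigomega d) <= (k + 1) ^ bigomega m"
 using assms
proof (induction m rule: prime_divisors_induct)
 case (factor p m)
 have m0: "m > 0" using factor.prems by simp
 have fin: "finite {d. d dvd m}" using m0 by simp
 have p: "p > 0" "prime p" using factor.hyps prime_gt_0_nat by auto
 have sz: "bigomega (p * d) = Suc (bigomega d)" if "d > 0" for d
  using that p by (subst prime_factorization_mult) (auto simp: prime_factorization_prime)
 have sub: "{d. d dvd p * m} \<subseteq> {d. d dvd m} \<union> (%d. p * d) ` {d. d dvd m}"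
 proof
  fix d assume "d \<in> {d. d dvd p * m}"
  then have d: "d dvd p * m" by simp
  show "d \<in> {d. d dvd m} \<union> (%d. p * d) ` {d. d dvd m}"
  proof (cases "p dvd d")
   case True
   then obtain e where "d = p * e" by blast
   then show ?thesis using d p by auto
  next
   case False
   then have "coprime d p" using p(2) prime_imp_coprime coprime_commute by blast
   then show ?thesis using d by (simp add: coprime_dvd_mult_right_iff)
  qed
 qed
 have "(\<Sum>d | d dvd p * m. k ^ bigomega d) <= (\<Sum>d\<in>{d. d dvd m} \<union> (%d. p * d) ` {d. d dvd m}. k ^ bigomega d)"
  by (rule sum_mono2[OF _ sub]) (use fin in auto)
 also have "... <= (\<Sum>d | d dvd m. k ^ bigomega d) + (\<Sum>d\<in>(%d. p * d) ` {d. d dvd m}. k ^ bigomega d)"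
  by (rule sum_Un_nat[THEN eq_refl, THEN order_trans]) (use fin in auto)
 also have "(\<Sum>d\<in>(%d. p * d) ` {d. d dvd m}. k ^ bigomega d) = (\<Sum>d | d dvd m. k ^ bigomega (p * d))"
  using p by (subst sum.reindex) (auto simp: inj_on_def)
 also have "... = k * (\<Sum>d | d dvd m. k ^ bigomega d)"
  unfolding sum_distrib_left
 proof (rule sum.cong[OF refl])
  fix d assume "d \<in> {d. d dvd m}"
  then have "d > 0" using m0 dvd_pos_nat by auto
  then show "k ^ bigomega (p * d) = k * k ^ bigomega d" by (simp add: sz)
 qed
 also have "(\<Sum>d | d dvd m. k ^ bigomega d) + k * (\<Sum>d | d dvd m. k ^ bigomega d)
   = (k + 1) * (\<Sum>d | d dvd m. k ^ bigomega d)" by simp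
 also have "... <= (k + 1) * (k + 1) ^ bigomega m" using factor.IH[OF m0] by (intro mult_left_mono) auto
 also have "... = (k + 1) ^ bigomega (p * m)" using sz[OF m0] by simp
 finally show ?case .
qed auto

text \<open>Once the product d of all factors but the first is fixed, the first factor is m div d;
  the sum over d is closed by \<open>sum_divisors_power_bigomega\<close>.\<close>

lemma reps_le:
 assumes A: "finite A" "0 \<notin> A"
 shows "m > 0 ==> reps A k m <= k ^ bigomega m"
proof (induction k arbitrary: m)
 case 0
 have "{xs \<in> tuples A 0. prod_list xs = m} = (if m = 1 then {[]} else {})" by (auto simp: tuples_0)
 then show ?case by (auto simp: reps_def)
next
 case (Suc k)
 have fd: "finite {d. d dvd m}" using Suc.prems by simp
 have "{xs \<in> tuples A (Suc k). prod_list xs = m} \<subseteq> (\<Union>d\<in>{d. d dvd m}. (%xs. (m div d) # xs) ` {xs \<in> tuples A k. prod_list xs = d})"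
 proof
  fix ys assume ys: "ys \<in> {xs \<in> tuples A (Suc k). prod_list xs = m}"
  then obtain x xs where x: "ys = x # xs" "x \<in> A" "xs \<in> tuples A k" by (auto simp: tuples_Suc)
  have eq: "m = x * prod_list xs" using ys x by simp
  then have "prod_list xs \<noteq> 0" using Suc.prems by auto
  then have "m div prod_list xs = x" using eq by simp
  then show "ys \<in> (\<Union>d\<in>{d. d dvd m}. (%xs. (m div d) # xs) ` {xs \<in> tuples A k. prod_list xs = d})"
   using x eq by (intro UN_I[of "prod_list xs"]) auto
 qed
 then have "reps A (Suc k) m <= card (\<Union>d\<in>{d. d dvd m}. (%xs. (m div d) # xs) ` {xs \<in> tuples A k. prod_list xs = d})"
  unfolding reps_def using fd finite_tuples[OF A(1)] by (intro card_mono) auto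
 also have "... <= (\<Sum>d | d dvd m. card ((%xs. (m div d) # xs) ` {xs \<in> tuples A k. prod_list xs = d}))" by (rule card_UN_le[OF fd])
 also have "... <= (\<Sum>d | d dvd m. k ^ bigomega d)"
 proof (rule sum_mono)
  fix d assume "d \<in> {d. d dvd m}"
  then have "d > 0" using Suc.prems dvd_pos_nat by auto
  then have "reps A k d <= k ^ bigomega d" by (rule Suc.IH)
  moreover have "card ((%xs. (m div d) # xs) ` {xs \<in> tuples A k. prod_list xs = d}) <= reps A k d"
   unfolding reps_def by (rule card_image_le) (use finite_tuples[OF A(1)] in auto)
  ultimately show "card ((%xs. (m div d) # xs) ` {xs \<in> tuples A k. prod_list xs = d}) <= k ^ bigomega d" by linarith
 qed
 also have "... <= (k + 1) ^ bigomega m" by (rule sum_divisors_power_bigomega[OF Suc.prems])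
 finally show ?case by simp
qed

section \<open>Rough and smooth integers\<close>

definition rough :: "real => nat => bool" where
 "rough z n \<longleftrightarrow> n > 0 \<and> (\<forall>p\<in>prime_factors n. real p > z)"

definition smooth_nat :: "real => nat => bool" where
 "smooth_nat z n \<longleftrightarrow> n > 0 \<and> (\<forall>p\<in>prime_factors n. real p <= z)"

lemma rough_mult: "rough z m ==> rough z n ==> rough z (m * n)"
 by (auto simp: rough_def prime_factors_product)

lemma rough_1: "rough z 1" by (simp add: rough_def)

lemma rough_prod_list: "(\<And>n. n \<in> set xs ==> rough z n) ==> rough z (prod_list xs)"
 by (induction xs) (simp_all add: rough_mult rough_1[simplified])

lemma smooth_rough_split:
 assumes "n > 0"
 shows "\<exists>s r. n = s * r \<and> smooth_nat z s \<and> rough z r"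
 using assms
proof (induction n rule: prime_divisors_induct)
 case (factor p n)
 then obtain s r where sr: "n = s * r" "smooth_nat z s" "rough z r" by auto
 have p: "prime p" using factor by simp
 have pf: "prime_factors (p * m) = insert p (prime_factors m)" if "m > 0" for m
  using that p by (subst prime_factors_product) (auto simp: prime_factorization_prime dest: prime_gt_0_nat)
 show ?case
 proof (cases "real p <= z")
  case True
  then have "smooth_nat z (p * s)" using sr(2) pf[of s] p by (auto simp: smooth_nat_def prime_gt_0_nat)
  then show ?thesis using sr by (intro exI[of _ "p * s"] exI[of _ r]) auto
 next
  case False
  then have "rough z (p * r)" using sr(3) pf[of r] p by (auto simp: rough_def prime_gt_0_nat)
  then show ?thesis using sr by (intro exI[of _ s] exI[of _ "p * r"]) auto
 qed
next
 case (unit x)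
 then show ?case by (intro exI[of _ 1] exI[of _ 1]) (auto simp: smooth_nat_def rough_def)
qed auto

lemma bigomega_rough:
 assumes "rough z m" "z > 1"
 shows "real (bigomega m) * ln z <= ln (real m)"
proof -
 have pw: "z ^ size M <= real (prod_mset M)" if "\<And>p. p \<in># M ==> real p > z" for M
  using that
 proof (induction M)
  case (add p M)
  have "z * z ^ size M <= real p * real (prod_mset M)"
   by (rule mult_mono) (use add assms(2) in \<open>auto intro: less_imp_le\<close>)
  then show ?case by simp
 qed simp
 have "z ^ bigomega m <= real (prod_mset (prime_factorization m))" by (rule pw) (use assms(1) in \<open>auto simp: rough_def\<close>)
 also have "prod_mset (prime_factorization m) = m" using assms(1) by (simp add: rough_def prod_mset_prime_factorization_nat)
 finally have "ln (z ^ bigomega m) <= ln (real m)" using assms by (intro ln_mono) (auto simp: rough_def)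
 then show ?thesis using assms(2) by (simp add: ln_realpow)
qed

text \<open>A product of k rough integers up to N has at most k ln N / ln z prime factors, and the
  number of factorizations is at most k to that power.\<close>

lemma reps_rough_le:
 assumes A: "\<And>n. n \<in> A ==> rough z n" "A \<subseteq> {1..N}" and z: "z > 1" and k: "k >= 1" and N: "N >= 1"
 shows "real (reps A k m) <= exp (ln (real k) * (real k * ln (real N)) / ln z)"
proof (cases "{xs \<in> tuples A k. prod_list xs = m} = {}")
 case True
 then have "reps A k m = 0" by (simp only: reps_def card.empty)
 then show ?thesis by simp
next
 case False
 then obtain xs where xs: "set xs \<subseteq> A" "length xs = k" "m = prod_list xs" by (auto simp: tuples_def)
 have r: "rough z m" unfolding xs(3) by (rule rough_prod_list) (use A(1) xs(1) in blast)
 have fA: "finite A" "0 \<notin> A" using A finite_subset by auto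
 have "m <= N ^ k" unfolding xs(3) xs(2)[symmetric] by (rule prod_list_le_power) (use xs A in auto)
 then have "ln (real m) <= ln (real N ^ k)" using r by (intro ln_mono) (auto simp: rough_def simp flip: of_nat_power)
 also have "... = real k * ln (real N)" using N by (simp add: ln_realpow)
 finally have om: "real (bigomega m) * ln z <= real k * ln (real N)" using bigomega_rough[OF r z] by linarith
 have "real (reps A k m) <= real k ^ bigomega m"
  using reps_le[OF fA, of m k] r by (metis of_nat_mono of_nat_power rough_def)
 also have "... = exp (ln (real k) * real (bigomega m))"
  using k by (simp add: powr_realpow[symmetric] powr_def mult.commute)
 also have "... <= exp (ln (real k) * ((real k * ln (real N)) / ln z))"
 proof -
  have "real (bigomega m) <= (real k * ln (real N)) / ln z" using om z by (simp add: pos_le_divide_eq)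
  then have "ln (real k) * real (bigomega m) <= ln (real k) * ((real k * ln (real N)) / ln z)"
   by (rule mult_left_mono) (use k in simp)
  then show ?thesis unfolding exp_le_cancel_iff .
 qed
 finally show ?thesis by simp
qed

subsection \<open>Smooth numbers and elementary prime estimates\<close>

lemma geometric_sum_le:
 fixes t :: real
 assumes "0 <= t" "t < 1"
 shows "(\<Sum>i\<le>n. t ^ i) <= 1 / (1 - t)"
proof -
 have "(1 - t) * (\<Sum>i\<le>n. t ^ i) = 1 - t ^ Suc n" by (rule sum_gp_basic)
 also have "... <= 1" using assms by simp
 finally show ?thesis using assms by (simp add: pos_le_divide_eq mult.commute)
qed

text \<open>A finite Euler product, by induction on the primes: s -> (e, u) with s = q^e u and u
  free of q is injective, and enlarging the image to a product set separates the sums over e and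
  u.\<close>

lemma rankin_sum:
 assumes "finite Q" "\<And>p. p \<in> Q ==> prime p" "\<sigma> > 0"
  and "finite F" "\<And>s. s \<in> F ==> s > 0 \<and> prime_factors s \<subseteq> Q"
 shows "(\<Sum>s\<in>F. real s powr (-\<sigma>)) <= (\<Prod>p\<in>Q. 1 / (1 - real p powr (-\<sigma>)))"
 using assms(1,2,4,5)
proof (induction Q arbitrary: F rule: finite_induct)
 case empty
 have "F \<subseteq> {1}"
 proof
  fix s assume "s \<in> F"
  then have "s > 0" "prime_factors s = {}" using empty by auto
  then show "s \<in> {1}" by (auto simp: set_mset_eq_empty_iff prime_factorization_empty_iff)
 qed
 then have "(\<Sum>s\<in>F. real s powr (-\<sigma>)) <= (\<Sum>s\<in>{1}. real s powr (-\<sigma>))" by (intro sum_mono2) auto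
 then show ?case by simp
next
 case (insert q Q)
 have q: "prime q" using insert.prems by simp
 define t where "t = real q powr (-\<sigma>)"
 have t: "0 <= t" "t < 1"
 proof -
  have "real q > 1" using prime_gt_1_nat[OF q] by simp
  then have "real q powr (-\<sigma>) < real q powr 0" using assms(3) by (intro powr_less_mono) auto
  then show "0 <= t" "t < 1" using \<open>real q > 1\<close> by (auto simp: t_def)
 qed
 define u where "u = (%s. s div q ^ multiplicity q s)"
 define M where "M = Max (multiplicity q ` F)"
 have dec: "s = q ^ multiplicity q s * u s" for s unfolding u_def by (simp add: multiplicity_dvd)
 have u0: "u s > 0 \<and> prime_factors (u s) \<subseteq> Q" if "s \<in> F" for s
 proof -
  have s: "s > 0" "prime_factors s \<subseteq> insert q Q" using insert.prems(3)[OF that] by auto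
  have us: "u s > 0" using dec[of s] s(1) by (metis gr0I mult_0_right less_irrefl)
  have "u s dvd s" using dec[of s] by (metis dvd_triv_right)
  then have "prime_factors (u s) \<subseteq> prime_factors s" using s(1) by (intro dvd_prime_factors) auto
  moreover have "\<not> q dvd u s" unfolding u_def by (rule multiplicity_decompose) (use s(1) prime_gt_1_nat[OF q] in auto)
  ultimately show ?thesis using s us by (auto simp: prime_factors_dvd)
 qed
 have "(\<Sum>s\<in>F. real s powr (-\<sigma>)) = (\<Sum>s\<in>F. (%(e,s'). t ^ e * real s' powr (-\<sigma>)) (multiplicity q s, u s))"
 proof (rule sum.cong[OF refl])
  fix s assume "s \<in> F"
  have "real s powr (-\<sigma>) = (real q ^ multiplicity q s * real (u s)) powr (-\<sigma>)"
   by (subst dec[of s]) simp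
  also have "... = (real q ^ multiplicity q s) powr (-\<sigma>) * real (u s) powr (-\<sigma>)" by (simp only: powr_mult)
  also have "(real q ^ multiplicity q s) powr (-\<sigma>) = t ^ multiplicity q s"
   using prime_gt_0_nat[OF q] by (simp add: t_def powr_realpow[symmetric] powr_powr mult.commute)
  finally show "real s powr (-\<sigma>) = (%(e,s'). t ^ e * real s' powr (-\<sigma>)) (multiplicity q s, u s)" by simp
 qed
 also have "... = (\<Sum>z\<in>(%s. (multiplicity q s, u s)) ` F. (%(e,s'). t ^ e * real s' powr (-\<sigma>)) z)"
 proof (subst sum.reindex)
  show "inj_on (%s. (multiplicity q s, u s)) F" by (rule inj_onI) (metis dec prod.inject)
 qed (simp add: comp_def)
 also have "... <= (\<Sum>z\<in>{..M} \<times> u ` F. (%(e,s'). t ^ e * real s' powr (-\<sigma>)) z)"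
  by (rule sum_mono2) (use insert.prems(2) t in \<open>auto simp: M_def\<close>)
 also have "... = (\<Sum>e\<le>M. t ^ e) * (\<Sum>s\<in>u ` F. real s powr (-\<sigma>))"
  by (simp add: sum_product sum.cartesian_product)
 also have "... <= (1 / (1 - t)) * (\<Prod>p\<in>Q. 1 / (1 - real p powr (-\<sigma>)))"
 proof (rule mult_mono)
  show "(\<Sum>e\<le>M. t ^ e) <= 1 / (1 - t)" by (rule geometric_sum_le[OF t])
  show "(\<Sum>s\<in>u ` F. real s powr (-\<sigma>)) <= (\<Prod>p\<in>Q. 1 / (1 - real p powr (-\<sigma>)))"
   by (rule insert.IH) (use insert.prems u0 in auto)
 qed (use t in \<open>auto intro: sum_nonneg\<close>)
 finally show ?case using insert.hyps by (simp add: t_def)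
qed

lemma sum_prime_divisors_ln:
 assumes "n > 0"
 shows "(\<Sum>p\<in>prime_factors n. ln (real p)) <= ln (real n)"
proof -
 have S: "prime_factors n \<in> prime_sets" by (auto simp: prime_sets_def)
 have "(\<Sum>p\<in>prime_factors n. ln (real p)) = ln (\<Prod>p\<in>prime_factors n. real p)"
  by (rule ln_prod[symmetric]) (auto intro: prime_gt_0_nat)
 also have "... = ln (real (\<Prod>(prime_factors n)))" by (simp only: of_nat_prod)
 also have "\<Prod>(prime_factors n) dvd n" by (rule prime_set_dvd[OF S]) auto
 then have "\<Prod>(prime_factors n) <= n" using assms by (rule dvd_imp_le)
 then have "ln (real (\<Prod>(prime_factors n))) <= ln (real n)"
 proof (intro ln_mono of_nat_mono)
  show "0 < real (\<Prod>(prime_factors n))" unfolding of_nat_0_less_iff using prime_set_prod_ge_1[OF S] by linarith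
 qed
 finally show ?thesis .
qed

text \<open>Pairs of a prime p and a multiple n <= N are counted twice, with weight ln p. Each p has
  floor(N/p) >= N/(2p) multiples since p <= N, and each n contributes at most ln n.\<close>

lemma mertens_upper:
 assumes z: "z >= 1"
 shows "(\<Sum>p | prime p \<and> real p <= z. ln (real p) / real p) <= 2 * ln z"
proof -
 define N where "N = nat \<lfloor>z\<rfloor>"
 have N: "N >= 1" "real N <= z" using z unfolding N_def by (auto simp: le_nat_iff)
 define P where "P = {p::nat. prime p \<and> real p <= z}"
 have fP: "finite P" unfolding P_def by (rule finite_primes_le)
 have PN: "p <= N" "prime p" if "p \<in> P" for p using that by (auto simp: P_def N_def intro: le_nat_floor)
 have "real N / 2 * (\<Sum>p\<in>P. ln (real p) / real p) <= (\<Sum>p\<in>P. \<Sum>n=1..N. if p dvd n then ln (real p) else 0)"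
  unfolding sum_distrib_left
 proof (rule sum_mono)
  fix p assume p: "p \<in> P"
  have p0: "p > 0" "ln (real p) >= 0" using PN(2)[OF p] prime_ge_1_nat[of p] by auto
  have "(%k. p * k) ` {1..N div p} \<subseteq> {n\<in>{1..N}. p dvd n}"
   using p0 by (auto simp: less_eq_div_iff_mult_less_eq mult.commute Suc_le_eq)
  then have "card ((%k. p * k) ` {1..N div p}) <= card {n\<in>{1..N}. p dvd n}" by (intro card_mono) auto
  moreover have "card ((%k. p * k) ` {1..N div p}) = N div p" using p0 by (subst card_image) (auto simp: inj_on_def)
  ultimately have c: "real (N div p) <= real (card {n\<in>{1..N}. p dvd n})" by simp
  have d1: "1 <= N div p" using PN(1)[OF p] p0 by (simp add: less_eq_div_iff_mult_less_eq)
  moreover have "N < p * (N div p) + p" using p0 by (metis add.commute mult_div_mod_eq mod_less_divisor nat_add_left_cancel_less add_less_cancel_left)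
  ultimately have "N <= 2 * (N div p * p)" using mult_le_mono1[OF d1, of p] unfolding mult.commute[of p "N div p"] by linarith
  then have "real N <= 2 * (real (N div p) * real p)" by (metis of_nat_mono of_nat_mult of_nat_numeral)
  then have "real N / 2 / real p <= real (N div p)" using p0 by (simp add: pos_divide_le_eq)
  then have "real N / 2 / real p * ln (real p) <= real (card {n\<in>{1..N}. p dvd n}) * ln (real p)"
   using c p0 by (intro mult_right_mono) auto
  then show "real N / 2 * (ln (real p) / real p) <= (\<Sum>n=1..N. if p dvd n then ln (real p) else 0)"
   by (simp add: sum.inter_filter[symmetric])
 qed
 also have "... = (\<Sum>n=1..N. \<Sum>p\<in>P. if p dvd n then ln (real p) else 0)" by (rule sum.swap)
 also have "... <= (\<Sum>n=1..N. ln (real N))"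
 proof (rule sum_mono)
  fix n assume n: "n \<in> {1..N}"
  have "(\<Sum>p\<in>P. if p dvd n then ln (real p) else 0) = (\<Sum>p\<in>{p\<in>P. p dvd n}. ln (real p))"
   by (rule sum.inter_filter[OF fP, symmetric])
  also have "... <= (\<Sum>p\<in>prime_factors n. ln (real p))"
   by (rule sum_mono2) (use n in \<open>auto simp: P_def prime_factors_dvd prime_ge_1_nat\<close>)
  also have "... <= ln (real n)" by (rule sum_prime_divisors_ln) (use n in auto)
  also have "... <= ln (real N)" using n by (intro ln_mono) auto
  finally show "(\<Sum>p\<in>P. if p dvd n then ln (real p) else 0) <= ln (real N)" .
 qed
 also have "... = real N / 2 * (2 * ln (real N))" by simp
 finally have "(\<Sum>p\<in>P. ln (real p) / real p) <= 2 * ln (real N)" using N by simp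
 also have "... <= 2 * ln z" using N z by (intro mult_left_mono ln_mono) auto
 finally show ?thesis by (simp add: P_def)
qed

text \<open>Primes up to exp(sqrt(ln z)) are bounded by the harmonic sum, the others by
  \<open>mertens_upper\<close> with ln p >= sqrt(ln z). The true order ln ln z is not reached, but
  for ln z = 20 l and z^\<theta> = l^(2/5) the exponent in Rankin's bound is then of order l^(9/10),
  still below l.\<close>

lemma sum_inverse_primes_le:
 assumes z: "ln z >= 1" "z > 0"
 shows "(\<Sum>p | prime p \<and> real p <= z. 1 / real p) <= 1 + 3 * sqrt (ln z)"
proof -
 define u where "u = sqrt (ln z)"
 have u: "u >= 1" "u * u = ln z" using z by (auto simp: u_def)
 have z1: "z >= 1" using z by (simp add: ln_ge_zero_iff[symmetric] del: ln_ge_zero_iff)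
 define P where "P = {p::nat. prime p \<and> real p <= z}"
 have fP: "finite P" unfolding P_def by (rule finite_primes_le)
 define N where "N = nat \<lfloor>exp u\<rfloor>"
 have N: "N >= 1" "real N <= exp u" using u unfolding N_def by (auto simp: le_nat_iff)
 have "(\<Sum>p\<in>P. 1 / real p) <= (\<Sum>p\<in>P. (if p <= N then 1 / real p else 0) + (ln (real p) / real p) / u)"
 proof (rule sum_mono)
  fix p assume "p \<in> P"
  then have p: "real p >= 1" using prime_ge_1_nat[of p] by (simp add: P_def)
  show "1 / real p <= (if p <= N then 1 / real p else 0) + (ln (real p) / real p) / u"
  proof (cases "p <= N")
   case True
   have "0 <= (ln (real p) / real p) / u" using p u by (intro divide_nonneg_nonneg ln_ge_zero) linarith+
   then show ?thesis using True by simp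
  next
   case False
   then have "\<not> real p <= exp u" unfolding N_def using le_nat_floor by blast
   then have "exp u < real p" by simp
   then have "ln (exp u) < ln (real p)" using p by (subst ln_less_cancel_iff) auto
   then have "u < ln (real p)" by simp
   then have "1 <= ln (real p) / u" using u by simp
   then have "1 / real p * 1 <= 1 / real p * (ln (real p) / u)" using p by (intro mult_left_mono) auto
   then show ?thesis using False by simp
  qed
 qed
 also have "... = (\<Sum>p\<in>{p\<in>P. p <= N}. 1 / real p) + (\<Sum>p\<in>P. ln (real p) / real p) / u"
  unfolding sum.distrib sum.inter_filter[OF fP, symmetric] sum_divide_distrib ..
 also have "(\<Sum>p\<in>{p\<in>P. p <= N}. 1 / real p) <= (\<Sum>n=1..N. 1 / real n)"
  by (rule sum_mono2) (auto simp: P_def Suc_le_eq prime_gt_0_nat)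
 also have "... <= 1 + ln (real N)" by (rule harmonic_le[OF N(1)])
 also have "ln (real N) <= u"
 proof -
  have "ln (real N) <= ln (exp u)" using N by (intro ln_mono) auto
  then show ?thesis by simp
 qed
 also have "(\<Sum>p\<in>P. ln (real p) / real p) / u <= (2 * (u * u)) / u"
  unfolding u(2) P_def using u by (intro divide_right_mono mertens_upper[OF z1]) auto
 also have "(2 * (u * u)) / u = 2 * u" using u(1) by simp
 finally show ?thesis by (simp add: P_def u_def[symmetric])
qed

text \<open>For \<theta> <= 1/2 the prime 2 is the worst case: t = p^(\<theta>-1) is at most 1/sqrt
  2 <= 3/4, so 1/(1 - t) <= exp(4t).\<close>

lemma euler_factor_le:
 assumes p: "prime p" and \<theta>: "0 <= \<theta>" "\<theta> <= 1/2" and z: "real p <= z"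
 shows "1 / (1 - real p powr (\<theta> - 1)) <= exp (4 * (z powr \<theta> * (1 / real p)))"
proof -
 define t where "t = real p powr (\<theta> - 1)"
 have p2: "real p >= 2" using prime_ge_2_nat[OF p] by simp
 have t: "0 <= t" "t <= 3/4"
 proof -
  have "t <= real p powr (-(1/2))" unfolding t_def using p2 \<theta> by (intro powr_mono) auto
  also have "... = 1 / sqrt (real p)" unfolding powr_minus_divide by (simp only: powr_half_sqrt of_nat_0_le_iff)
  also have "... <= 1 / (4/3)"
  proof (rule divide_left_mono)
   show "4/3 <= sqrt (real p)" using p2 by (intro real_le_rsqrt) (simp add: power2_eq_square)
   show "0 < sqrt (real p) * (4/3)" using p2 by simp
  qed simp
  finally show "t <= 3/4" by simp
  show "0 <= t" by (simp add: t_def)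
 qed
 have "1 / (1 - t) = 1 + t / (1 - t)" using t by (simp add: field_simps)
 also have "... <= exp (t / (1 - t))" by (rule exp_ge_add_one_self)
 also have "t / (1 - t) <= t / (1/4)" using t by (intro divide_left_mono) auto
 also have "t / (1/4) <= 4 * (z powr \<theta> * (1 / real p))"
 proof -
  have "t = real p powr \<theta> * (1 / real p)" using p2 by (simp add: t_def powr_diff)
  also have "... <= z powr \<theta> * (1 / real p)" using z \<theta> by (intro mult_right_mono powr_mono2) auto
  finally show ?thesis by simp
 qed
 finally show ?thesis by (simp add: t_def)
qed

text \<open>Rankin's method: for s r <= N the weight (N/(s r))^(1-\<theta>) is at least 1. Its sum
  over smooth s is an Euler product, and the sum over r <= V gives V^\<theta> (1 + ln V).\<close>

theorem smooth_part_count: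
 assumes z: "ln z >= 1" "z > 0" and \<theta>: "0 <= \<theta>" "\<theta> <= 1/2" and V: "V >= 1"
 shows "real (card {n\<in>{1..N}. \<exists>s r. n = s * r \<and> smooth_nat z s \<and> 1 <= r \<and> r <= V})
   <= real N powr (1 - \<theta>) * (real V powr \<theta> * (1 + ln (real V))) * exp (4 * (z powr \<theta> * (1 + 3 * sqrt (ln z))))"
proof -
 define E where "E = exp (4 * (z powr \<theta> * (1 + 3 * sqrt (ln z))))"
 define P where "P = {p::nat. prime p \<and> real p <= z}"
 have fP: "finite P" unfolding P_def by (rule finite_primes_le)
 have \<sigma>: "- (1 - \<theta>) = \<theta> - 1" by simp
 have prodE: "(\<Prod>p\<in>P. 1 / (1 - real p powr (\<theta> - 1))) <= E"
 proof -
  have "(\<Prod>p\<in>P. 1 / (1 - real p powr (\<theta> - 1))) <= (\<Prod>p\<in>P. exp (4 * (z powr \<theta> * (1 / real p))))"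
  proof (rule prod_mono, rule conjI)
   fix p assume p: "p \<in> P"
   then have "real p >= 1" using prime_ge_1_nat[of p] by (simp add: P_def)
   then have "real p powr (\<theta> - 1) <= real p powr 0" using \<theta> by (intro powr_mono) auto
   then show "0 <= 1 / (1 - real p powr (\<theta> - 1))" using \<open>real p >= 1\<close> by simp
   show "1 / (1 - real p powr (\<theta> - 1)) <= exp (4 * (z powr \<theta> * (1 / real p)))"
    using p by (intro euler_factor_le \<theta>) (auto simp: P_def)
  qed
  also have "... = exp (\<Sum>p\<in>P. 4 * (z powr \<theta> * (1 / real p)))" using fP by (simp add: exp_sum)
  also have "(\<Sum>p\<in>P. 4 * (z powr \<theta> * (1 / real p))) = 4 * (z powr \<theta> * (\<Sum>p\<in>P. 1 / real p))"
   by (simp only: sum_distrib_left)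
  also have "... <= 4 * (z powr \<theta> * (1 + 3 * sqrt (ln z)))"
   unfolding P_def by (intro mult_left_mono sum_inverse_primes_le z) auto
  finally show ?thesis by (simp add: E_def)
 qed
 define F where "F = (%r. {s. smooth_nat z s \<and> s * r <= N})"
 have fF: "finite (F r)" if "r >= 1" for r
 proof (rule finite_subset)
  show "F r \<subseteq> {..N}"
  proof
   fix s assume "s \<in> F r"
   then have "s * r <= N" by (simp add: F_def)
   moreover have "s * 1 <= s * r" using that by (intro mult_left_mono) auto
   ultimately show "s \<in> {..N}" unfolding atMost_iff by linarith
  qed
 qed simp
 have cF: "real (card (F r)) <= real N powr (1 - \<theta>) * (real V powr \<theta> * (1 / real r)) * E" if r: "r \<in> {1..V}" for r
 proof -
  have r1: "r >= 1" "real r >= 1" using r by auto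
  have "real (card (F r)) = (\<Sum>s\<in>F r. 1)" by simp
  also have "... <= (\<Sum>s\<in>F r. real N powr (1 - \<theta>) * real r powr (\<theta> - 1) * real s powr (\<theta> - 1))"
  proof (rule sum_mono)
   fix s assume s: "s \<in> F r"
   then have s0: "s > 0" "s * r <= N" by (auto simp: F_def smooth_nat_def)
   have "real s * real r <= real N" using s0(2) by (metis of_nat_mono of_nat_mult)
   then have "1 powr (1 - \<theta>) <= (real N / (real s * real r)) powr (1 - \<theta>)"
    using s0 r1 \<theta> by (intro powr_mono2) (auto simp: le_divide_eq)
   also have "... = real N powr (1 - \<theta>) * (real s * real r) powr (\<theta> - 1)"
    using s0 r1 by (simp add: powr_divide powr_minus_divide[of _ "1 - \<theta>", simplified])
   also have "(real s * real r) powr (\<theta> - 1) = real r powr (\<theta> - 1) * real s powr (\<theta> - 1)" by (simp only: powr_mult mult.commute)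
   finally show "1 <= real N powr (1 - \<theta>) * real r powr (\<theta> - 1) * real s powr (\<theta> - 1)" by (simp add: mult.assoc)
  qed
  also have "... = real N powr (1 - \<theta>) * real r powr (\<theta> - 1) * (\<Sum>s\<in>F r. real s powr (\<theta> - 1))" by (simp only: sum_distrib_left)
  also have "(\<Sum>s\<in>F r. real s powr (\<theta> - 1)) <= (\<Prod>p\<in>P. 1 / (1 - real p powr (\<theta> - 1)))"
  proof -
   have "(\<Sum>s\<in>F r. real s powr (-(1 - \<theta>))) <= (\<Prod>p\<in>P. 1 / (1 - real p powr (-(1 - \<theta>))))"
   proof (rule rankin_sum[OF fP _ _ fF[OF r1(1)]])
    show "0 < s \<and> prime_factors s \<subseteq> P" if "s \<in> F r" for s
     using that by (auto simp: P_def F_def smooth_nat_def)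
   qed (use \<theta> in \<open>auto simp: P_def\<close>)
   then show ?thesis unfolding \<sigma> .
  qed
  also have "... <= E" by (rule prodE)
  also have "real r powr (\<theta> - 1) = real r powr \<theta> * (1 / real r)" using r1 by (simp add: powr_diff)
  also have "real r powr \<theta> <= real V powr \<theta>" using r \<theta> by (intro powr_mono2) auto
  finally show ?thesis using r1 by (simp add: E_def mult_left_mono mult_right_mono divide_right_mono)
 qed
 have "{n\<in>{1..N}. \<exists>s r. n = s * r \<and> smooth_nat z s \<and> 1 <= r \<and> r <= V} \<subseteq> (\<Union>r\<in>{1..V}. (%s. s * r) ` F r)"
  by (auto simp: F_def)
 then have "card {n\<in>{1..N}. \<exists>s r. n = s * r \<and> smooth_nat z s \<and> 1 <= r \<and> r <= V} <= card (\<Union>r\<in>{1..V}. (%s. s * r) ` F r)"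
  using fF by (intro card_mono) auto
 also have "... <= (\<Sum>r=1..V. card ((%s. s * r) ` F r))" by (rule card_UN_le) simp
 also have "... <= (\<Sum>r=1..V. card (F r))" by (intro sum_mono card_image_le fF) auto
 finally have "real (card {n\<in>{1..N}. \<exists>s r. n = s * r \<and> smooth_nat z s \<and> 1 <= r \<and> r <= V}) <= real (\<Sum>r=1..V. card (F r))"
  by (rule of_nat_mono)
 also have "... = (\<Sum>r=1..V. real (card (F r)))" by simp
 also have "... <= (\<Sum>r=1..V. real N powr (1 - \<theta>) * (real V powr \<theta> * (1 / real r)) * E)" by (rule sum_mono) (rule cF)
 also have "... = real N powr (1 - \<theta>) * (real V powr \<theta> * (\<Sum>r=1..V. 1 / real r)) * E"
  by (simp only: sum_distrib_left sum_distrib_right)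
 also have "... <= real N powr (1 - \<theta>) * (real V powr \<theta> * (1 + ln (real V))) * E"
  by (intro mult_right_mono mult_left_mono harmonic_le V) (auto simp: E_def)
 finally show ?thesis by (simp add: E_def)
qed

section \<open>Chebyshev's lower bound for the number of primes\<close>

lemma sum_ln_mangoldt:
 assumes "M <= K"
 shows "(\<Sum>n=1..M. ln (real n)) = (\<Sum>d=1..K. mangoldt d * real (M div d))"
proof -
 have "(\<Sum>n=1..M. ln (real n)) = (\<Sum>n=1..M. \<Sum>d=1..K. if d dvd n then mangoldt d else 0)"
 proof (rule sum.cong[OF refl])
  fix n assume n: "n \<in> {1..M}"
  have "{d. d dvd n} = {d\<in>{1..K}. d dvd n}" using n assms by (auto dest: dvd_imp_le intro: Suc_leI dvd_pos_nat)
  then have "ln (real n) = (\<Sum>d\<in>{d\<in>{1..K}. d dvd n}. mangoldt d)" using mangoldt_sum[of n, where 'a=real] n by simp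
  also have "... = (\<Sum>d=1..K. if d dvd n then mangoldt d else 0)" by (rule sum.inter_filter) simp
  finally show "ln (real n) = ..." .
 qed
 also have "... = (\<Sum>d=1..K. \<Sum>n=1..M. if d dvd n then mangoldt d else 0)" by (rule sum.swap)
 also have "... = (\<Sum>d=1..K. mangoldt d * real (M div d))"
 proof (rule sum.cong[OF refl])
  fix d assume d: "d \<in> {1..K}"
  have "{n\<in>{1..M}. d dvd n} = (%k. d * k) ` {1..M div d}"
  proof (intro subset_antisym subsetI)
   fix n assume "n \<in> {n\<in>{1..M}. d dvd n}"
   then obtain k where k: "n = d * k" "1 <= d * k" "d * k <= M" by auto
   then have "k <= M div d" using d by (simp add: less_eq_div_iff_mult_less_eq mult.commute)
   moreover have "k >= 1" using k by (cases k) auto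
   ultimately show "n \<in> (%k. d * k) ` {1..M div d}" using k by auto
  qed (use d in \<open>auto simp: less_eq_div_iff_mult_less_eq mult.commute Suc_le_eq\<close>)
  then have "card {n\<in>{1..M}. d dvd n} = M div d" using d by (simp add: card_image inj_on_def)
  then show "(\<Sum>n=1..M. if d dvd n then mangoldt d else 0) = mangoldt d * real (M div d)"
   by (simp add: sum.inter_filter[symmetric])
 qed
 finally show ?thesis .
qed

text \<open>Chebyshev's argument with n = floor(x/2): the logarithm of the central binomial
  coefficient is the sum of \<Lambda>(d) times floor(2n/d) - 2 floor(n/d) <= 1. So n ln 4 - ln(2n)
  is at most ln x times the number of prime powers up to x, few of which are proper powers.\<close>

theorem prime_pi_lower: "\<exists>x0. \<forall>x\<ge>x0. real (prime_pi x) >= x / (4 * ln x)"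
proof -
 have "eventually (%x::real. x / (4 * ln x) <= (2 * x / 3 - 4/3 - ln x) / ln x - (sqrt x + 1) * (2 * ln x + 1)) at_top"
  by real_asymp
 then obtain x0 where x0: "\<And>x. x >= x0 ==> x / (4 * ln x) <= (2 * x / 3 - 4/3 - ln x) / ln x - (sqrt x + 1) * (2 * ln x + 1)"
  unfolding eventually_at_top_linorder by blast
 have "real (prime_pi x) >= x / (4 * ln x)" if x: "x >= max x0 3" for x
 proof -
  define n where "n = nat \<lfloor>x / 2\<rfloor>"
  define N where "N = 2 * n"
  have n: "n >= 1" "real N <= x" "x < real N + 2" using x unfolding n_def N_def by (auto simp: le_nat_iff) linarith+
  have N1: "real N >= 2" using n by (simp add: N_def)
  have lf: "(\<Sum>k=1..m. ln (real k)) = ln (fact m)" for m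
   by (induction m) (auto simp: ln_mult add.commute)
  have "real n * ln 4 - ln (real N) = ln (4 ^ n / (2 * real n))" using n(1) by (simp add: ln_div ln_realpow N_def)
  also have "... <= ln (real (N choose n))"
   unfolding N_def using central_binomial_lower_bound[of n] n(1) by (intro ln_mono) auto
  also have "real (N choose n) = fact N / (fact n * fact n)"
   unfolding N_def using binomial_fact[of n "2 * n", where 'a=real] by (simp add: mult_2)
  also have "ln (fact N / (fact n * fact n)) = ln (fact N) - 2 * ln (fact n :: real)" by (simp add: ln_div ln_mult)
  also have "... = (\<Sum>d=1..N. mangoldt d * (real (N div d) - 2 * real (n div d)))"
   unfolding lf[symmetric] using sum_ln_mangoldt[of N N] sum_ln_mangoldt[of n N]
   by (simp add: N_def algebra_simps sum_subtractf sum_distrib_left)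
  also have "... <= (\<Sum>d=1..N. mangoldt d)"
  proof (rule sum_mono)
   fix d assume "d \<in> {1..N}"
   have "N div d <= 2 * (n div d) + 1"
   proof -
    have "N < (2 * (n div d) + 2) * d"
     using \<open>d \<in> {1..N}\<close> dividend_less_div_times[of d n] by (simp add: N_def algebra_simps)
    then show ?thesis using \<open>d \<in> {1..N}\<close> by (simp add: div_less_iff_less_mult less_Suc_eq_le[symmetric])
   qed
   then have "real (N div d) <= 2 * real (n div d) + 1" by linarith
   then have "mangoldt d * (real (N div d) - 2 * real (n div d)) <= mangoldt d * 1" by (intro mult_left_mono mangoldt_nonneg) auto
   then show "mangoldt d * (real (N div d) - 2 * real (n div d)) <= mangoldt d" by simp
  qed
  also have "... = (\<Sum>d\<in>{d\<in>{1..N}. primepow d}. mangoldt d)"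
   by (rule sum.mono_neutral_right) (auto simp: mangoldt_def)
  also have "... <= (\<Sum>d\<in>{d\<in>{1..N}. primepow d}. ln x)"
  proof (rule sum_mono)
   fix d assume "d \<in> {d\<in>{1..N}. primepow d}"
   then have d: "d >= 1" "d <= N" by auto
   have "mangoldt d <= ln (real d)" using d by (intro mangoldt_le) auto
   also have "... <= ln x" using d n by (intro ln_mono) auto
   finally show "mangoldt d <= ln x" .
  qed
  also have "... = real (card {d\<in>{1..N}. primepow d}) * ln x" by simp
  also have "real (card {d\<in>{1..N}. primepow d}) <= real (prime_pi x) + (sqrt x + 1) * (2 * ln x + 1)"
  proof -
   have "{d\<in>{1..N}. primepow d} \<subseteq> (primes_le x) \<union> {n. primepow n \<and> \<not> prime n \<and> n <= nat \<lfloor>x\<rfloor>}"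
    using n(2) by (auto intro!: le_nat_floor)
   then have "card {d\<in>{1..N}. primepow d} <= card ((primes_le x) \<union> {n. primepow n \<and> \<not> prime n \<and> n <= nat \<lfloor>x\<rfloor>})"
    by (intro card_mono) (use finite_primes_le in auto)
   also have "... <= prime_pi x + card {n. primepow n \<and> \<not> prime n \<and> n <= nat \<lfloor>x\<rfloor>}" unfolding prime_pi_def by (rule card_Un_le)
   finally have "real (card {d\<in>{1..N}. primepow d}) <= real (prime_pi x) + real (card {n. primepow n \<and> \<not> prime n \<and> n <= nat \<lfloor>x\<rfloor>})" by linarith
   also have "real (card {n. primepow n \<and> \<not> prime n \<and> n <= nat \<lfloor>x\<rfloor>}) <= (sqrt x + 1) * (2 * ln x + 1)"
    using x by (intro card_prime_powers_le) auto
   finally show ?thesis by simp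
  qed
  finally have "real n * ln 4 - ln (real N) <= (real (prime_pi x) + (sqrt x + 1) * (2 * ln x + 1)) * ln x"
   using x by (simp add: mult_right_mono)
  moreover have "real n * (4/3) <= real n * ln 4"
  proof (intro mult_left_mono)
   have "ln (4::real) = 2 * ln 2" using ln_realpow[of 2 2] by simp
   then show "4/3 <= ln (4::real)" using ln2_ge_two_thirds by simp
  qed simp
  moreover have "2 * x / 3 - 4/3 <= real n * (4/3)" using n(3) by (simp add: N_def)
  moreover have "ln (real N) <= ln x" using n N1 by (intro ln_mono) auto
  ultimately have "2 * x / 3 - 4/3 - ln x <= (real (prime_pi x) + (sqrt x + 1) * (2 * ln x + 1)) * ln x" by linarith
  then have "(2 * x / 3 - 4/3 - ln x) / ln x <= real (prime_pi x) + (sqrt x + 1) * (2 * ln x + 1)"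
   using x by (simp add: pos_divide_le_eq)
  then show ?thesis using x0[of x] x by linarith
 qed
 then show ?thesis by blast
qed

subsection \<open>Detecting primitive roots by characters\<close>

lemma primroot_iff:
 assumes p: "prime p" and n: "\<not> p dvd n"
 shows "residue_primroot p n \<longleftrightarrow> coprime (pind p n) (p - 1)"
proof -
 have p1: "p - 1 > 0" using prime_gt_1_nat[OF p] by simp
 have "residue_primroot p n \<longleftrightarrow> residue_primroot p (pgen p ^ pind p n)"
  using pind[OF p n] by (intro residue_primroot_cong refl) (rule cong_sym)
 also have "... \<longleftrightarrow> ord p (pgen p ^ pind p n) = p - 1"
  using pgen_coprime[OF p] prime_gt_0_nat[OF p] by (auto simp: residue_primroot_def totient_prime[OF p])
 also have "... \<longleftrightarrow> gcd (pind p n) (p - 1) = 1"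
 proof -
  have e: "ord p (pgen p ^ pind p n) * gcd (pind p n) (p - 1) = p - 1"
   using ord_power_aux[of p "pgen p" "pind p n"] by (simp only: pgen_ord[OF p])
  show ?thesis
  proof
   assume o: "ord p (pgen p ^ pind p n) = p - 1"
   have "(p - 1) * gcd (pind p n) (p - 1) = (p - 1) * 1" using e unfolding o by (simp only: mult_1_right)
   then show "gcd (pind p n) (p - 1) = 1" using p1 by (simp only: mult_cancel1) linarith
  next
   assume g: "gcd (pind p n) (p - 1) = 1"
   show "ord p (pgen p ^ pind p n) = p - 1" using e unfolding g by (simp only: mult_1_right)
  qed
 qed
 finally show ?thesis by (simp only: coprime_iff_gcd_eq_1)
qed

text \<open>The coefficient of \<open>pchar p h\<close> in the indicator of primitive roots. A
  residue with discrete logarithm i is one if and only if i is coprime to p - 1; this is detected by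
  \<mu>(d)/d times the sum over j < d of exp(2 pi i j sqrt(-1) / d), and the j-th of these terms is
  the character with index j (p-1)/d.\<close>

definition pcoef :: "nat => nat => real" where
 "pcoef p h = (\<Sum>S\<in>Pow (prime_factors (p - 1)). csgn S * real (card {j. j < \<Prod>S \<and> ((p - 1) div \<Prod>S) * j = h}))"

lemma root1_scale: "d > 0 ==> e > 0 ==> root1 (d * e) (e * k) = root1 d k"
 by (simp add: root1_def field_simps)

text \<open>Both sides are \<mu>(d) if d, the product of S, divides i, and 0 otherwise.\<close>

lemma csgn_dvd:
 assumes S: "S \<in> prime_sets"
 shows "csgn S * (if \<Prod>S dvd i then real (\<Prod>S) else 0) = (\<Prod>l\<in>S. if l dvd i then - 1 else 0)"
proof (cases "\<forall>l\<in>S. l dvd i")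
 case True
 then have "\<Prod>S dvd i" by (intro prime_set_dvd[OF S]) auto
 then have "csgn S * (if \<Prod>S dvd i then real (\<Prod>S) else 0) = (\<Prod>l\<in>S. - (1 / real l) * real l)"
  by (simp only: if_True csgn_def of_nat_prod prod.distrib)
 also have "... = (\<Prod>l\<in>S. if l dvd i then - 1 else 0)"
  by (rule prod.cong[OF refl]) (use True prime_setsD(2)[OF S] prime_gt_0_nat in force)
 finally show ?thesis .
next
 case False
 then obtain l where l: "l \<in> S" "\<not> l dvd i" by blast
 have "l dvd \<Prod>S" using l(1) prime_setsD(1)[OF S] by (rule dvd_prodI[rotated])
 then have "\<not> \<Prod>S dvd i" using l(2) dvd_trans by blast
 moreover have "(\<Prod>l\<in>S. if l dvd i then - 1 else (0::real)) = 0"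
  using l by (intro prod_zero prime_setsD(1)[OF S]) auto
 ultimately show ?thesis by simp
qed

lemma sum_card_fiber:
 fixes F :: "nat => complex"
 assumes "\<And>j. j < d ==> e * j < m"
 shows "(\<Sum>h<m. of_nat (card {j. j < d \<and> e * j = h}) * F h) = (\<Sum>j<d. F (e * j))"
proof -
 have "(\<Sum>j<d. F (e * j)) = (\<Sum>h<m. \<Sum>j | j \<in> {..<d} \<and> e * j = h. F (e * j))"
  by (rule sum.group[symmetric]) (use assms in auto)
 also have "... = (\<Sum>h<m. of_nat (card {j. j < d \<and> e * j = h}) * F h)"
  by (rule sum.cong[OF refl]) simp
 finally show ?thesis ..
qed

lemma subset_prime_factors_split:
 assumes "S \<in> Pow (prime_factors m)" "m > 0"
 obtains e where "m = \<Prod>S * e" "e > 0" "\<Prod>S > 0" "S \<in> prime_sets"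
proof -
 have S: "S \<in> prime_sets" using assms by (auto simp: prime_sets_def intro: finite_subset)
 have "\<Prod>S dvd m" by (rule prime_set_dvd[OF S]) (use assms in auto)
 then obtain e where "m = \<Prod>S * e" by blast
 then show ?thesis using that[of e] S assms(2) prime_set_prod_ge_1[OF S] by (cases "e = 0") auto
qed

lemma pcoef_indicator:
 assumes p: "prime p" and n: "\<not> p dvd n"
 shows "(\<Sum>h<p-1. of_real (pcoef p h) * pchar p h n) = (if residue_primroot p n then 1 else 0)"
proof -
 define m where "m = p - 1"
 define i where "i = pind p n"
 have m: "m > 0" using prime_gt_1_nat[OF p] by (simp add: m_def)
 have pc: "pchar p h n = root1 m (h * i)" for h using n by (simp add: pchar_def m_def i_def)
 define c where "c = (%S h. complex_of_nat (card {j. j < \<Prod>S \<and> (m div \<Prod>S) * j = h}))"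
 have "(\<Sum>h<p-1. of_real (pcoef p h) * pchar p h n) = (\<Sum>h<m. \<Sum>S\<in>Pow (prime_factors m). of_real (csgn S) * (c S h * root1 m (h * i)))"
  unfolding pc pcoef_def m_def[symmetric] c_def by (simp add: sum_distrib_left mult_ac)
 also have "... = (\<Sum>S\<in>Pow (prime_factors m). of_real (csgn S) * (\<Sum>h<m. c S h * root1 m (h * i)))"
  unfolding sum_distrib_left by (rule sum.swap)
 also have "... = (\<Sum>S\<in>Pow (prime_factors m). of_real (\<Prod>l\<in>S. if l dvd i then - 1 else 0))"
 proof (rule sum.cong[OF refl])
  fix S assume "S \<in> Pow (prime_factors m)"
  then obtain e where e: "m = \<Prod>S * e" "e > 0" "\<Prod>S > 0" "S \<in> prime_sets" using m by (rule subset_prime_factors_split)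
  have me: "m div \<Prod>S = e" using e(1,3) by simp
  have "(\<Sum>h<m. c S h * root1 m (h * i)) = (\<Sum>j<\<Prod>S. root1 m (e * j * i))"
   unfolding c_def me by (rule sum_card_fiber) (use e in \<open>simp add: mult.commute\<close>)
  also have "... = (\<Sum>j<\<Prod>S. root1 (\<Prod>S) (j * i))"
   unfolding e(1) mult.assoc using e by (intro sum.cong refl root1_scale)
  also have "... = of_real (if \<Prod>S dvd i then real (\<Prod>S) else 0)" unfolding root1_sum[OF e(3)] by simp
  finally show "of_real (csgn S) * (\<Sum>h<m. c S h * root1 m (h * i)) = of_real (\<Prod>l\<in>S. if l dvd i then - 1 else 0)"
   unfolding csgn_dvd[OF e(4), symmetric] by simp
 qed
 \<comment> \<open>Inclusion-exclusion over the prime factors of p - 1 in product form; a factor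
   vanishes as soon as its prime divides i.\<close>
 also have "... = of_real (\<Prod>l\<in>prime_factors m. (if l dvd i then - 1 else 0) + 1)"
  by (subst prod_add) (simp_all only: finite_set_mset prod.neutral_const mult_1_right of_real_sum)
 also have "(\<Prod>l\<in>prime_factors m. (if l dvd i then - 1 else 0) + 1) = (if coprime i m then 1 else (0::real))"
 proof (cases "coprime i m")
  case True
  have "\<not> l dvd i" if "l \<in> prime_factors m" for l
   using that True by (metis coprime_common_divisor_nat in_prime_factors_iff not_prime_1)
  then show ?thesis using True by (simp add: prod.neutral)
 next
  case False
  then obtain l where "prime l" "l dvd i" "l dvd m"
   by (metis coprime_iff_gcd_eq_1 gcd_greatest_iff prime_factor_nat)
  then have "(\<Prod>l\<in>prime_factors m. (if l dvd i then - 1 else 0) + 1) = (0::real)"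
   using m by (intro prod_zero bexI[of _ l]) (auto simp: prime_factors_dvd)
  then show ?thesis using False by simp
 qed
 also have "of_real (if coprime i m then 1 else (0::real)) = (if residue_primroot p n then 1 else (0::complex))"
  unfolding primroot_iff[OF p n] i_def m_def by simp
 finally show ?thesis .
qed

lemma pcoef_0: "prime p ==> pcoef p 0 = real (totient (p - 1)) / real (p - 1)"
proof -
 assume p: "prime p"
 have m: "p - 1 > 0" using prime_gt_1_nat[OF p] by simp
 have "pcoef p 0 = (\<Sum>S\<in>Pow (prime_factors (p - 1)). csgn S)"
  unfolding pcoef_def
 proof (rule sum.cong[OF refl])
  fix S assume "S \<in> Pow (prime_factors (p - 1))"
  then obtain e where e: "p - 1 = \<Prod>S * e" "e > 0" "\<Prod>S > 0" "S \<in> prime_sets" using m by (rule subset_prime_factors_split)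
  have me: "(p - 1) div \<Prod>S = e" using e(3) unfolding e(1) by simp
  have "{j. j < \<Prod>S \<and> e * j = 0} = {0}" using e by auto
  then show "csgn S * real (card {j. j < \<Prod>S \<and> ((p - 1) div \<Prod>S) * j = 0}) = csgn S" unfolding me by simp
 qed
 then show ?thesis by (simp only: totient_ratio_sum[OF m])
qed

lemma prime_factor_subsets_prods:
 assumes "m > 0"
 shows "Pow (prime_factors m) \<subseteq> prime_sets" "(%S. \<Prod>S) ` Pow (prime_factors m) \<subseteq> {d. d dvd m}"
  "{d. d dvd m} \<subseteq> {1..m}"
proof -
 show 1: "Pow (prime_factors m) \<subseteq> prime_sets" by (auto simp: prime_sets_def intro: finite_subset)
 show "(%S. \<Prod>S) ` Pow (prime_factors m) \<subseteq> {d. d dvd m}"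
  using 1 by (auto intro!: prime_set_dvd)
 show "{d. d dvd m} \<subseteq> {1..m}" using assms by (auto intro: dvd_imp_le Suc_leI dvd_pos_nat)
qed

text \<open>Each squarefree d reaches a given h for at most one j, which leaves a sum of 1/d over
  divisors of p - 1.\<close>

lemma pcoef_abs:
 assumes p: "prime p" and x: "real p <= x"
 shows "\<bar>pcoef p h\<bar> <= 1 + ln x"
proof -
 have m: "p - 1 > 0" using prime_gt_1_nat[OF p] by simp
 have "\<bar>pcoef p h\<bar> <= (\<Sum>S\<in>Pow (prime_factors (p - 1)). 1 / real (\<Prod>S))"
  unfolding pcoef_def
 proof (rule order_trans[OF sum_abs], rule sum_mono)
  fix S assume "S \<in> Pow (prime_factors (p - 1))"
  then obtain e where e: "p - 1 = \<Prod>S * e" "e > 0" "\<Prod>S > 0" "S \<in> prime_sets" using m by (rule subset_prime_factors_split)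
  have me: "(p - 1) div \<Prod>S = e" using e(3) unfolding e(1) by simp
  have "card {j. j < \<Prod>S \<and> e * j = h} <= card {h div e}" by (intro card_mono) (use e in auto)
  then have "real (card {j. j < \<Prod>S \<and> e * j = h}) <= 1" by simp
  then have "1 / real (\<Prod>S) * real (card {j. j < \<Prod>S \<and> e * j = h}) <= 1 / real (\<Prod>S) * 1" by (intro mult_left_mono) (auto intro: prod_nonneg)
  then show "\<bar>csgn S * real (card {j. j < \<Prod>S \<and> ((p - 1) div \<Prod>S) * j = h})\<bar> <= 1 / real (\<Prod>S)"
   unfolding me abs_mult abs_csgn by simp
 qed
 also have "... <= (\<Sum>d=1..p-1. 1 / real d)"
  by (rule sum_prime_sets_le[of "Pow (prime_factors (p - 1))" "{1..p-1}" "%d. 1 / real d"]) (use prime_factor_subsets_prods[OF m] in auto)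
 also have "... <= 1 + ln (real (p - 1))" using m by (intro harmonic_le) simp
 also have "... <= 1 + ln x" using m x by (intro add_left_mono ln_mono) auto
 finally show ?thesis .
qed

text \<open>Each squarefree d contributes its d values of j with weight 1/d, in total 1.\<close>

lemma pcoef_sum:
 assumes p: "prime p"
 shows "(\<Sum>h<p-1. \<bar>pcoef p h\<bar>) <= real (card {d. d dvd p - 1})"
proof -
 define m where "m = p - 1"
 have m: "m > 0" using prime_gt_1_nat[OF p] by (simp add: m_def)
 have "(\<Sum>h<m. \<bar>pcoef p h\<bar>) <= (\<Sum>h<m. \<Sum>S\<in>Pow (prime_factors m). 1 / real (\<Prod>S) * real (card {j. j < \<Prod>S \<and> (m div \<Prod>S) * j = h}))"
  unfolding pcoef_def m_def[symmetric]
  by (intro sum_mono order_trans[OF sum_abs]) (simp add: abs_mult abs_csgn prod_nonneg)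
 also have "... = (\<Sum>S\<in>Pow (prime_factors m). \<Sum>h<m. 1 / real (\<Prod>S) * real (card {j. j < \<Prod>S \<and> (m div \<Prod>S) * j = h}))" by (rule sum.swap)
 also have "... = (\<Sum>S\<in>Pow (prime_factors m). 1)"
 proof (rule sum.cong[OF refl])
  fix S assume "S \<in> Pow (prime_factors m)"
  then obtain e where e: "m = \<Prod>S * e" "e > 0" "\<Prod>S > 0" "S \<in> prime_sets" using m by (rule subset_prime_factors_split)
  have me: "m div \<Prod>S = e" using e(1,3) by simp
  have "of_real (\<Sum>h<m. real (card {j. j < \<Prod>S \<and> e * j = h})) = (\<Sum>h<m. of_nat (card {j. j < \<Prod>S \<and> e * j = h}) * (1::complex))" by simp
  also have "... = (\<Sum>j<\<Prod>S. 1)" by (rule sum_card_fiber) (use e in \<open>simp add: mult.commute\<close>)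
  also have "... = of_real (real (\<Prod>S))" by (simp only: sum_constant card_lessThan of_real_of_nat_eq mult_1_right)
  finally have "(\<Sum>h<m. real (card {j. j < \<Prod>S \<and> e * j = h})) = real (\<Prod>S)" by (simp only: of_real_eq_iff)
  moreover have "real (\<Prod>S) \<noteq> 0" using e(3) by (simp only: of_nat_eq_0_iff)
  then have "1 / real (\<Prod>S) * real (\<Prod>S) = 1" unfolding times_divide_eq_left mult_1_left by (rule divide_self)
  ultimately have "1 / real (\<Prod>S) * (\<Sum>h<m. real (card {j. j < \<Prod>S \<and> e * j = h})) = 1" by (simp only:)
  then show "(\<Sum>h<m. 1 / real (\<Prod>S) * real (card {j. j < \<Prod>S \<and> (m div \<Prod>S) * j = h})) = 1"
   unfolding me sum_distrib_left .
 qed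
 also have "... <= (\<Sum>d | d dvd m. 1)"
  by (rule sum_prime_sets_le[of "Pow (prime_factors m)" _ "%_. 1"]) (use prime_factor_subsets_prods[OF m] m in auto)
 finally show ?thesis by (simp add: m_def)
qed

section \<open>The family of characters in the large sieve\<close>

definition pidx :: "real => (nat \<times> nat) set" where
 "pidx x = (SIGMA p:(primes_le x). {0<..<p-1})"

lemma finite_pidx: "finite (pidx x)"
 unfolding pidx_def using finite_primes_le by (intro finite_SigmaI) auto

lemma card_pidx: "card (pidx x) <= (nat \<lfloor>x\<rfloor>)\<^sup>2"
proof -
 have "pidx x \<subseteq> {1..nat \<lfloor>x\<rfloor>} \<times> {1..nat \<lfloor>x\<rfloor>}"
  by (auto simp: pidx_def Suc_le_eq prime_gt_0_nat dest!: le_nat_floor)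
 then have "card (pidx x) <= card ({1..nat \<lfloor>x\<rfloor>} \<times> {1..nat \<lfloor>x\<rfloor>})" by (intro card_mono) auto
 then show ?thesis by (simp add: power2_eq_square)
qed

lemma sum_card_dvd_le:
 assumes "finite M" "\<And>d. d \<in> M ==> d > 0"
 shows "(\<Sum>n=1..N. real (card {d\<in>M. d dvd n})) <= real N * (\<Sum>d\<in>M. 1 / real d)"
proof -
 have "(\<Sum>n=1..N. real (card {d\<in>M. d dvd n})) = (\<Sum>n=1..N. \<Sum>d\<in>M. if d dvd n then 1 else 0)"
  using assms(1) by (simp add: sum.inter_filter[symmetric])
 also have "... = (\<Sum>d\<in>M. \<Sum>n=1..N. if d dvd n then 1 else 0)" by (rule sum.swap)
 also have "... <= (\<Sum>d\<in>M. real N * (1 / real d))"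
 proof (rule sum_mono)
  fix d assume "d \<in> M"
  then have d: "d > 0" by (rule assms(2))
  have "{n \<in> {1..N}. d dvd n} \<subseteq> (%k. d * k) ` {1..N div d}"
  proof
   fix n assume "n \<in> {n \<in> {1..N}. d dvd n}"
   then obtain k where k: "n = d * k" "1 <= d * k" "d * k <= N" by auto
   then have "k <= N div d" using d by (simp add: less_eq_div_iff_mult_less_eq mult.commute)
   moreover have "k >= 1" using k by (cases k) auto
   ultimately show "n \<in> (%k. d * k) ` {1..N div d}" using k by auto
  qed
  then have "card {n \<in> {1..N}. d dvd n} <= card ((%k. d * k) ` {1..N div d})" by (intro card_mono) auto
  also have "... <= N div d" by (rule order_trans[OF card_image_le]) auto
  finally have "real (card {n \<in> {1..N}. d dvd n}) <= real (N div d)" by simp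
  also have "... <= real N * (1 / real d)"
  proof -
   have "N div d * d <= N" by (rule div_times_less_eq_dividend)
   then have "real (N div d) * real d <= real N" unfolding of_nat_mult[symmetric] by (rule of_nat_mono)
   then show ?thesis using d by (simp add: pos_le_divide_eq)
  qed
  finally show "(\<Sum>n=1..N. if d dvd n then 1 else 0) <= real N * (1 / real d)"
   by (simp add: sum.inter_filter[symmetric])
 qed
 finally show ?thesis by (simp add: sum_distrib_left)
qed

text \<open>By \<open>pcoef_sum\<close> the sum over h is at most the number of divisors of p - 1.
  Extending from p - 1 to all m <= x gives a harmonic sum. Although there may be about x^2 pairs,
  the coefficients add up to little more than x.\<close>

lemma sum_pidx_pcoef:
 assumes x: "x >= 1"
 shows "(\<Sum>(p,h)\<in>pidx x. \<bar>pcoef p h\<bar>) <= x * (1 + ln x)"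
proof -
 define N where "N = nat \<lfloor>x\<rfloor>"
 have N: "N >= 1" "real N <= x" using x unfolding N_def by (auto simp: le_nat_iff)
 define P where "P = (primes_le x)"
 have fP: "finite P" unfolding P_def by (rule finite_primes_le)
 have "(\<Sum>(p,h)\<in>pidx x. \<bar>pcoef p h\<bar>) = (\<Sum>p\<in>P. \<Sum>h\<in>{0<..<p-1}. \<bar>pcoef p h\<bar>)"
  unfolding pidx_def P_def[symmetric] by (rule sum.Sigma[symmetric]) (use fP in auto)
 also have "... <= (\<Sum>p\<in>P. real (card {d\<in>{1..N}. d dvd p - 1}))"
 proof (rule sum_mono)
  fix p assume p: "p \<in> P"
  have pN: "p <= N" "prime p" using p by (auto simp: P_def N_def intro: le_nat_floor)
  then have m: "p - 1 > 0" using prime_gt_1_nat by fastforce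
  have "(\<Sum>h\<in>{0<..<p-1}. \<bar>pcoef p h\<bar>) <= (\<Sum>h<p-1. \<bar>pcoef p h\<bar>)" by (rule sum_mono2) auto
  also have "... <= real (card {d. d dvd p - 1})" by (rule pcoef_sum[OF pN(2)])
  also have "{d. d dvd p - 1} = {d\<in>{1..N}. d dvd p - 1}" using prime_factor_subsets_prods(3)[OF m] pN(1) by fastforce
  finally show "(\<Sum>h\<in>{0<..<p-1}. \<bar>pcoef p h\<bar>) <= real (card {d\<in>{1..N}. d dvd p - 1})" .
 qed
 also have "... = (\<Sum>m\<in>(%p. p - 1) ` P. real (card {d\<in>{1..N}. d dvd m}))"
 proof (subst sum.reindex)
  show "inj_on (%p. p - 1) P"
  proof (rule inj_onI)
   fix p q assume "p \<in> P" "q \<in> P" "p - 1 = q - 1"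
   moreover have "p > 0" "q > 0" using \<open>p \<in> P\<close> \<open>q \<in> P\<close> by (auto simp: P_def prime_gt_0_nat)
   ultimately show "p = q" by linarith
  qed
 qed simp
 also have "... <= (\<Sum>m=1..N. real (card {d\<in>{1..N}. d dvd m}))"
 proof (rule sum_mono2)
  show "(%p. p - 1) ` P \<subseteq> {1..N}"
  proof
   fix m assume "m \<in> (%p. p - 1) ` P"
   then obtain p where "p \<in> P" "m = p - 1" by blast
   then show "m \<in> {1..N}" using prime_gt_1_nat[of p] le_nat_floor[of p x] by (auto simp: P_def N_def)
  qed
 qed auto
 also have "... <= real N * (\<Sum>d=1..N. 1 / real d)" by (rule sum_card_dvd_le) auto
 also have "... <= real N * (1 + ln (real N))" using N by (intro mult_left_mono harmonic_le) auto
 also have "... <= x * (1 + ln x)" using N x by (intro mult_mono add_left_mono ln_mono) auto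
 finally show ?thesis .
qed

text \<open>For p = q the product has index h - k, nonzero modulo p - 1, and is nontrivial at
  \<open>pgen p\<close>; for distinct p and q the integer of \<open>crt_prime\<close> isolates the
  first factor. The modulus p q is at most x^2 and bounds the incomplete sum.\<close>

lemma pidx_orth:
 assumes i: "(p,h) \<in> pidx x" "(q,k) \<in> pidx x" "(p,h) \<noteq> (q,k)"
 shows "norm (\<Sum>n=1..M. pchar p h n * cnj (pchar q k n)) <= real ((nat \<lfloor>x\<rfloor>)\<^sup>2)"
proof -
 have pq: "prime p" "prime q" "p <= nat \<lfloor>x\<rfloor>" "q <= nat \<lfloor>x\<rfloor>" "0 < h" "h < p - 1" "0 < k" "k < q - 1"
  using i by (auto simp: pidx_def intro: le_nat_floor)
 define f where "f = (%n. pchar p h n * cnj (pchar q k n))"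
 have d: "dchar (p * q) f" unfolding f_def by (intro dchar_mult dchar_cnj pchar_dchar pq)
 have "\<exists>a. coprime a (p * q) \<and> f a \<noteq> 1"
 proof (cases "p = q")
  case True
  have hk: "h \<noteq> k" using i(3) True by auto
  have val: "f (pgen p) = root1 (p - 1) h * cnj (root1 (p - 1) k)"
   using pchar_at_gen[OF pq(1), of "pgen p"] True by (simp add: f_def)
  have "f (pgen p) \<noteq> 1"
  proof
   assume "f (pgen p) = 1"
   then have f1: "root1 (p - 1) h * cnj (root1 (p - 1) k) = 1" unfolding val .
   have "cnj (root1 (p - 1) k) * root1 (p - 1) k = 1" using complex_norm_square[of "root1 (p - 1) k"] by (simp add: mult.commute)
   then have "root1 (p - 1) h = root1 (p - 1) h * (cnj (root1 (p - 1) k) * root1 (p - 1) k)" by (simp only: mult_1_right)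
   also have "... = root1 (p - 1) k" unfolding mult.assoc[symmetric] f1 by (rule mult_1_left)
   finally have eq: "root1 (p - 1) h = root1 (p - 1) k" .
   have nz: "root1 (p - 1) j \<noteq> 0" for j by (metis root1_norm norm_zero zero_neq_one)
   have aux: False if "u < v" "v < p - 1" "root1 (p - 1) u = root1 (p - 1) v" for u v
   proof -
    have "root1 (p - 1) u * root1 (p - 1) (v - u) = root1 (p - 1) u * 1"
     unfolding root1_add[symmetric] using that by simp
    then have "root1 (p - 1) (v - u) = 1" using nz by (simp only: mult_cancel_left) simp
    then have "(p - 1) dvd (v - u)" using root1_eq_1_iff[of "p - 1"] that by simp
    then show False using that by (auto dest: dvd_imp_le)
   qed
   have kp: "k < p - 1" using pq(8) True by simp
   show False
   proof (cases "h < k")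
    case True
    then show ?thesis by (rule aux[OF _ kp eq])
   next
    case False
    then have "k < h" using hk by simp
    then show ?thesis by (rule aux[OF _ pq(6) eq[symmetric]])
   qed
  qed
  moreover have "coprime (pgen p) (p * q)" using pgen_coprime[OF pq(1)] True by (simp add: coprime_commute)
  ultimately show ?thesis by blast
 next
  case False
  have U: "finite {p, q}" "\<And>r. r \<in> {p, q} ==> prime r" "p \<in> {p, q}" using pq(1,2) by auto
  obtain a where a: "[a = pgen p] (mod p)" "\<And>r. r \<in> {p, q} ==> r \<noteq> p ==> [a = 1] (mod r)" "\<And>r. r \<in> {p, q} ==> coprime a r"
   using crt_prime[OF U] by blast
  have "f a = root1 (p - 1) h" unfolding f_def using pchar_at_gen[OF pq(1) a(1)] pchar_at_one[OF pq(2) a(2)[of q]] False by simp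
  moreover have "root1 (p - 1) h \<noteq> 1" using root1_eq_1_iff[of "p - 1" h] pq by (auto dest: dvd_imp_le)
  moreover have "coprime a (p * q)" using a(3) by simp
  ultimately show ?thesis by auto
 qed
 then have "nonprincipal (p * q) f" using d unfolding nonprincipal_def by blast
 then have "norm (\<Sum>n=1..M. f n) <= real (p * q)" by (rule nonprincipal_sum_bound)
 also have "p * q <= (nat \<lfloor>x\<rfloor>)\<^sup>2" unfolding power2_eq_square using pq by (intro mult_mono) auto
 then have "real (p * q) <= real ((nat \<lfloor>x\<rfloor>)\<^sup>2)" by (rule of_nat_mono)
 finally show ?thesis by (simp add: f_def)
qed

text \<open>\<open>pchar p h (p - 1)\<close> is the value of the character at -1; with it negative a
  are treated through sums over positive n.\<close>

definition bsgn :: "bool => nat \<times> nat => complex" where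
 "bsgn neg i = of_real (pcoef (fst i) (snd i)) * (if neg then pchar (fst i) (snd i) (fst i - 1) else 1)"

definition Tsum :: "bool => real => nat => complex" where
 "Tsum neg x n = (\<Sum>i\<in>pidx x. bsgn neg i * pchar (fst i) (snd i) n)"

lemma pidx_prime: "i \<in> pidx x ==> prime (fst i)" "i \<in> pidx x ==> real (fst i) <= x"
 by (auto simp: pidx_def)

lemma bsgn_le: "i \<in> pidx x ==> norm (bsgn neg i) <= \<bar>pcoef (fst i) (snd i)\<bar>"
 using dchar_norm_le[OF pchar_dchar[OF pidx_prime(1)]] by (auto simp: bsgn_def norm_mult mult_left_le)

lemma pchar_neg:
 assumes p: "prime p"
 shows "pchar p h (nat ((- int n) mod int p)) = pchar p h (p - 1) * pchar p h n"
proof -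
 have p0: "int p > 0" using prime_gt_0_nat[OF p] by simp
 have "[int (nat ((- int n) mod int p)) = int ((p - 1) * n)] (mod int p)"
 proof -
  have "int (nat ((- int n) mod int p)) = (- int n) mod int p" using p0 by simp
  moreover have "int ((p - 1) * n) = - int n + int p * int n" using prime_ge_1_nat[OF p] by (simp add: of_nat_diff algebra_simps)
  ultimately show ?thesis by (simp only: nat_cong_def mod_mult_self2 mod_mod_trivial)
 qed
 then have "[nat ((- int n) mod int p) = (p - 1) * n] (mod p)" by (simp only: cong_int_iff)
 then have "pchar p h (nat ((- int n) mod int p)) = pchar p h ((p - 1) * n)" by (rule dchar_cong[OF pchar_dchar[OF p]])
 then show ?thesis using dcharD(3)[OF pchar_dchar[OF p]] by simp
qed

definition signed :: "bool => nat => int" where "signed neg n = (if neg then - int n else int n)"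

lemma pchar_signed:
 assumes p: "prime p"
 shows "pchar p h (nat (signed neg n mod int p)) = (if neg then pchar p h (p - 1) else 1) * pchar p h n"
proof -
 have "nat (int n mod int p) = n mod p" by (simp flip: zmod_int)
 then show ?thesis using pchar_neg[OF p] dchar_mod[OF pchar_dchar[OF p]] by (simp add: signed_def)
qed

text \<open>The index h = 0 gives \<phi>(p-1)/(p-1) by \<open>pcoef_0\<close>. At primes dividing n
  all characters vanish, and a is not a primitive root, so these primes are left out of the first
  sum.\<close>

lemma N_artin_formula:
 "of_nat (N_artin (signed neg n) x) = of_real (\<Sum>p | prime p \<and> real p <= x \<and> \<not> p dvd n. real (totient (p - 1)) / real (p - 1)) + Tsum neg x n"
proof -
 define P where "P = (primes_le x)"
 have fP: "finite P" unfolding P_def by (rule finite_primes_le)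
 define a where "a = signed neg n"
 have dv: "int p dvd a \<longleftrightarrow> p dvd n" for p by (simp add: a_def signed_def)
 have per: "(if is_primroot_mod p a then 1 else 0) = (if p dvd n then 0 else of_real (real (totient (p - 1)) / real (p - 1)))
   + (\<Sum>h\<in>{0<..<p-1}. bsgn neg (p,h) * pchar p h n)" if "p \<in> P" for p
 proof -
  have p: "prime p" using that by (simp add: P_def)
  have m: "p - 1 > 0" using prime_gt_1_nat[OF p] by simp
  show ?thesis
  proof (cases "p dvd n")
   case True
   then have "a mod int p = 0" using dv[of p] by simp
   then have "\<not> is_primroot_mod p a" using p by (auto simp: is_primroot_mod_def)
   then show ?thesis using True by (simp add: pchar_def)
  next
   case False
   have nd: "\<not> p dvd nat (a mod int p)"
   proof
    assume "p dvd nat (a mod int p)"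
    then have "int p dvd int (nat (a mod int p))" by (simp only: int_dvd_int_iff)
    then have "int p dvd a mod int p" using prime_gt_0_nat[OF p] by simp
    then show False using False dv[of p] by (simp add: dvd_mod_iff)
   qed
   have "(if is_primroot_mod p a then 1 else 0) = (\<Sum>h<p-1. of_real (pcoef p h) * pchar p h (nat (a mod int p)))"
    using pcoef_indicator[OF p nd] by (simp add: is_primroot_mod_def)
   also have "... = (\<Sum>h<p-1. bsgn neg (p,h) * pchar p h n)"
    unfolding a_def pchar_signed[OF p] by (cases neg) (simp_all add: bsgn_def mult.assoc)
   also have "{..<p-1} = insert 0 {0<..<p-1}" using m by auto
   also have "(\<Sum>h\<in>insert 0 {0<..<p-1}. bsgn neg (p,h) * pchar p h n) = bsgn neg (p,0) * pchar p 0 n + (\<Sum>h\<in>{0<..<p-1}. bsgn neg (p,h) * pchar p h n)"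
    by simp
   also have "bsgn neg (p,0) * pchar p 0 n = of_real (real (totient (p - 1)) / real (p - 1))"
    using False m by (auto simp: bsgn_def pchar_0 pcoef_0[OF p] dest: dvd_imp_le)
   finally show ?thesis using False by simp
  qed
 qed
 have "of_nat (N_artin a x) = (\<Sum>p\<in>P. if is_primroot_mod p a then 1 else (0::complex))"
  using fP by (simp add: sum.inter_filter[symmetric] N_artin_def P_def conj_ac)
 also have "... = (\<Sum>p\<in>P. (if p dvd n then 0 else of_real (real (totient (p - 1)) / real (p - 1)))
   + (\<Sum>h\<in>{0<..<p-1}. bsgn neg (p,h) * pchar p h n))"
  by (rule sum.cong[OF refl]) (rule per)
 also have "... = (\<Sum>p\<in>P. if p dvd n then 0 else of_real (real (totient (p - 1)) / real (p - 1)))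
   + (\<Sum>p\<in>P. \<Sum>h\<in>{0<..<p-1}. bsgn neg (p,h) * pchar p h n)" by (rule sum.distrib)
 also have "(\<Sum>p\<in>P. if p dvd n then 0 else of_real (real (totient (p - 1)) / real (p - 1)))
   = complex_of_real (\<Sum>p | p \<in> P \<and> \<not> p dvd n. real (totient (p - 1)) / real (p - 1))"
  unfolding of_real_sum sum.inter_filter[OF fP] by (rule sum.cong) auto
 also have "(\<Sum>p\<in>P. \<Sum>h\<in>{0<..<p-1}. bsgn neg (p,h) * pchar p h n) = Tsum neg x n"
 proof -
  have "(\<Sum>p\<in>P. \<Sum>h\<in>{0<..<p-1}. bsgn neg (p,h) * pchar p h n) = (\<Sum>(p,h)\<in>Sigma P (%p. {0<..<p-1}). bsgn neg (p,h) * pchar p h n)"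
   by (rule sum.Sigma) (use fP in auto)
  also have "... = Tsum neg x n" unfolding Tsum_def pidx_def P_def[symmetric] by (rule sum.cong) auto
  finally show ?thesis .
 qed
 finally show ?thesis unfolding a_def P_def mem_Collect_eq conj_assoc .
qed

lemma N_artin_diff:
 "\<bar>real (N_artin (signed neg n) x) - artin_const * real (prime_pi x)\<bar>
   <= \<bar>totient_sum x - artin_const * real (prime_pi x)\<bar>
    + (real (card {p\<in>(primes_le x). p dvd n}) + norm (Tsum neg x n))"
proof -
 define P where "P = (primes_le x)"
 have fP: "finite P" unfolding P_def by (rule finite_primes_le)
 define g where "g = (%p::nat. real (totient (p - 1)) / real (p - 1))"
 have g: "0 <= g p" "g p <= 1" for p
  using totient_le[of "p - 1"] by (auto simp: g_def divide_le_eq_1)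
 have set: "{p. prime p \<and> real p <= x \<and> \<not> p dvd n} = P - {p\<in>P. p dvd n}" by (auto simp: P_def)
 have "of_real (real (N_artin (signed neg n) x) - (\<Sum>p | prime p \<and> real p <= x \<and> \<not> p dvd n. g p)) = Tsum neg x n"
  using N_artin_formula[of neg n x] by (simp add: g_def)
 then have 1: "\<bar>real (N_artin (signed neg n) x) - (\<Sum>p | prime p \<and> real p <= x \<and> \<not> p dvd n. g p)\<bar> = norm (Tsum neg x n)"
  by (metis norm_of_real)
 have "(\<Sum>p | prime p \<and> real p <= x \<and> \<not> p dvd n. g p) = (\<Sum>p\<in>P. g p) - (\<Sum>p | p \<in> P \<and> p dvd n. g p)"
  unfolding set using fP by (intro sum_diff) auto
 moreover have "0 <= (\<Sum>p | p \<in> P \<and> p dvd n. g p)" by (intro sum_nonneg g)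
 moreover have "(\<Sum>p | p \<in> P \<and> p dvd n. g p) <= (\<Sum>p | p \<in> P \<and> p dvd n. 1)" by (intro sum_mono g)
 ultimately have 2: "\<bar>(\<Sum>p | prime p \<and> real p <= x \<and> \<not> p dvd n. g p) - (\<Sum>p\<in>P. g p)\<bar> <= real (card {p\<in>P. p dvd n})"
  by simp
 have "\<bar>c - t\<bar> <= \<bar>s - t\<bar> + (e + w)" if "\<bar>c - u\<bar> = w" "\<bar>u - s\<bar> <= e" for c t s u e w :: real using that by linarith
 then show ?thesis using 1 2 unfolding g_def P_def by blast
qed

subsection \<open>The exceptional set\<close>

text \<open>\<open>moment_bound\<close> with threshold \<tau> = N / \<rho>; the condition on \<rho>
  makes the large S i contribute no more than the threshold does. The fourth power of floor(x) is
  the bound x^2 for incomplete sums times the bound x^2 for the number of characters. A fixed factor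
  m only multiplies the coefficients by numbers of modulus at most 1.\<close>

lemma Tsum_block:
 assumes x: "x >= 1" and A: "A \<subseteq> {1..N}" "N >= 1" and k: "k >= 1" and Nk: "(nat \<lfloor>x\<rfloor>) ^ 4 <= N ^ k"
  and R: "\<And>m. real (reps A k m) <= R" and lam: "\<rho> > 0" "2 * R * \<rho> ^ (2 * k) <= x"
 shows "(\<Sum>n\<in>A. norm (Tsum neg x (m * n))) <= 2 * (real N / \<rho>) * (x * (1 + ln x))"
proof -
 define \<tau> where "\<tau> = real N / \<rho>"
 have N0: "real N > 0" using A(2) by simp
 have \<tau>: "\<tau> > 0" using N0 lam by (simp add: \<tau>_def)
 define f where "f = (%(i::nat\<times>nat) n. pchar (fst i) (snd i) n)"
 define b where "b = (%i. bsgn neg i * f i m)"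
 define Q where "Q = real ((nat \<lfloor>x\<rfloor>)\<^sup>2)"
 have d: "dchar (fst i) (f i)" if "i \<in> pidx x" for i
  unfolding f_def using that by (intro pchar_dchar pidx_prime(1))
 have b1: "norm (b i) <= \<bar>pcoef (fst i) (snd i)\<bar>" if "i \<in> pidx x" for i
 proof -
  have "norm (b i) <= norm (bsgn neg i) * 1" unfolding b_def norm_mult
   using dchar_norm_le[OF d[OF that]] by (intro mult_left_mono) auto
  then show ?thesis using bsgn_le[OF that, of neg] by simp
 qed
 have beta: "norm (b i) <= 1 + ln x" if "i \<in> pidx x" for i
  using b1[OF that] pcoef_abs[OF pidx_prime[OF that], of "snd i"] by linarith
 have L0: "0 <= 1 + ln x" using x ln_ge_zero[of x] by linarith
 have Tb: "Tsum neg x (m * n) = (\<Sum>i\<in>pidx x. b i * f i n)" for n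
  unfolding Tsum_def by (rule sum.cong[OF refl]) (use dcharD(3)[OF d] in \<open>simp add: b_def f_def mult.assoc\<close>)
 have QI: "Q * real (card (pidx x)) <= real N ^ k"
 proof -
  have "(nat \<lfloor>x\<rfloor>)\<^sup>2 * card (pidx x) <= (nat \<lfloor>x\<rfloor>)\<^sup>2 * (nat \<lfloor>x\<rfloor>)\<^sup>2" by (intro mult_left_mono card_pidx) simp
  also have "... = (nat \<lfloor>x\<rfloor>) ^ 4" by (simp add: power_add[symmetric])
  also have "... <= N ^ k" by (rule Nk)
  finally show ?thesis unfolding Q_def by (metis of_nat_mono of_nat_mult of_nat_power)
 qed
 have "(\<Sum>n\<in>A. norm (\<Sum>i\<in>pidx x. b i * f i n)) <= \<tau> * (\<Sum>i\<in>pidx x. norm (b i)) + 2 * (1 + ln x) * R * real N ^ (2 * k) * \<tau> / \<tau> ^ (2 * k)"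
 proof (rule moment_bound[OF finite_pidx _ A(1) k \<tau> _ _ _ _ QI R beta L0])
  show "0 <= Q" by (simp add: Q_def)
  show "f i 1 = 1" if "i \<in> pidx x" for i by (rule dcharD(2)[OF d[OF that]])
  show "f i (u * v) = f i u * f i v" if "i \<in> pidx x" for i u v by (rule dcharD(3)[OF d[OF that]])
  show "norm (f i n) <= 1" if "i \<in> pidx x" for i n by (rule dchar_norm_le[OF d[OF that]])
  show "norm (\<Sum>n=1..M. f i n * cnj (f j n)) <= Q" if "i \<in> pidx x" "j \<in> pidx x" "i \<noteq> j" for i j M
   unfolding f_def Q_def by (rule pidx_orth) (use that in auto)
 qed
 also have "(\<Sum>i\<in>pidx x. norm (b i)) <= x * (1 + ln x)"
 proof -
  have "(\<Sum>i\<in>pidx x. norm (b i)) <= (\<Sum>i\<in>pidx x. \<bar>pcoef (fst i) (snd i)\<bar>)" by (intro sum_mono b1)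
  also have "... <= x * (1 + ln x)" using sum_pidx_pcoef[OF x] by (simp add: case_prod_unfold)
  finally show ?thesis .
 qed
 also have "2 * (1 + ln x) * R * real N ^ (2 * k) * \<tau> / \<tau> ^ (2 * k) = \<tau> * ((1 + ln x) * (2 * R * \<rho> ^ (2 * k)))"
  using N0 lam(1) by (simp add: \<tau>_def power_divide)
 also have "... <= \<tau> * ((1 + ln x) * x)" using \<tau> L0 lam(2) by (intro mult_left_mono) auto
 finally have "(\<Sum>n\<in>A. norm (\<Sum>i\<in>pidx x. b i * f i n)) <= \<tau> * (x * (1 + ln x)) + \<tau> * ((1 + ln x) * x)"
  using \<tau> by (simp add: mult_left_mono)
 then show ?thesis unfolding Tb \<tau>_def by (simp add: algebra_simps add_divide_distrib)
qed

lemma least_power_exceeding: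
 fixes B N :: nat
 assumes "B > 1" "N >= 2"
 obtains k where "k >= 1" "B <= N ^ k" "N ^ (k - 1) < B"
proof -
 have ex: "B <= N ^ B"
 proof -
  have "B < 2 ^ B" by (rule less_exp)
  also have "(2::nat) ^ B <= N ^ B" using assms by (intro power_mono) auto
  finally show ?thesis by simp
 qed
 define k where "k = (LEAST k. B <= N ^ k)"
 have k: "B <= N ^ k" unfolding k_def by (rule LeastI[of _ B]) (rule ex)
 have "k \<noteq> 0"
 proof
  assume "k = 0"
  then show False using k assms by simp
 qed
 moreover from this have "\<not> B <= N ^ (k - 1)" unfolding k_def by (intro not_less_Least) simp
 ultimately show ?thesis using that[of k] k by simp
qed

text \<open>With l = ln L three exponents must add up to at most L = ln x. Rough products give R =
  exp(9L/20), from k ln N <= 9L and ln k <= l against ln z = 20 l. From (k - 1) ln N <= 4L and ln N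
  >= 64 a0 l the power \<rho>^(2(k-1)) is at most exp(L/8). \<open>cond\<close> bounds the remaining
  \<rho>^2 and the factor 2 by exp(2L/5). The sum is 39/40 of L.\<close>

lemma Tsum_rough_block:
 fixes a0 :: real
 assumes a0: "a0 >= 1" and L: "L = ln x" "L >= 2" "ln L >= 1" and cond: "1 + 2 * a0 * ln L <= 2/5 * L"
  and x: "x >= 3" and W: "L powr (64 * a0) <= real W" "real W <= x ^ 4"
 shows "(\<Sum>r | rough (L powr 20) r \<and> W < r \<and> r <= 2 * W. norm (Tsum neg x (m * r))) <= 4 * real W / L powr a0 * (x * (1 + L))"
proof -
 define l where "l = ln L"
 define nx where "nx = nat \<lfloor>x\<rfloor>"
 have l: "l >= 1" "l <= L" using L ln_le_minus_one[of L] by (auto simp: l_def)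
 have nx: "real nx <= x" "nx >= 3" using x unfolding nx_def by (auto simp: le_nat_iff le_floor_iff)
 have Lp: "L powr (64 * a0) >= 1" using L a0 by (intro ge_one_powr_ge_zero) auto
 then have W1: "W >= 1" using W(1) by (cases W) auto
 define N where "N = 2 * W"
 have N: "N >= 2" "real N >= 2" using W1 by (auto simp: N_def)
 have "3 ^ 4 <= nx ^ 4" using nx(2) by (intro power_mono) auto
 then have "nx ^ 4 > 1" by simp
 \<comment> \<open>Minimality of k keeps N^(k-1) below x^4, so N^k overshoots by at most one factor
   N.\<close>
 then obtain k where k: "k >= 1" "nx ^ 4 <= N ^ k" "N ^ (k - 1) < nx ^ 4" using N(1) by (rule least_power_exceeding)
 define A where "A = {r. rough (L powr 20) r \<and> W < r \<and> r <= N}"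
 have A: "A \<subseteq> {1..N}" "\<And>n. n \<in> A ==> rough (L powr 20) n" by (auto simp: A_def)
 have z: "L powr 20 > 1" using L by simp
 have lnz: "ln (L powr 20) = 20 * l" unfolding l_def by (rule ln_powr)
 have lnN: "ln (real N) >= 64 * a0 * l"
 proof -
  have "L powr (64 * a0) <= real N" using W(1) by (simp add: N_def)
  then have "ln (L powr (64 * a0)) <= ln (real N)" using Lp by (intro ln_mono) auto
  then show ?thesis using L by (simp add: ln_powr l_def)
 qed
 have lnk: "real (k - 1) * ln (real N) <= 4 * L"
 proof -
  have "real (N ^ (k - 1)) <= real (nx ^ 4)" using k(3) by (intro of_nat_mono) simp
  also have "... <= x ^ 4" using nx by (simp add: power_mono)
  finally have "ln (real N ^ (k - 1)) <= ln (x ^ 4)" using N by (intro ln_mono) auto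
  then show ?thesis using x N by (simp add: ln_realpow L)
 qed
 have lnN2: "ln (real N) <= 5 * L"
 proof -
  have "real N <= x * x ^ 4" unfolding N_def using W(2) x by (auto intro!: mult_mono)
  then have "ln (real N) <= ln (x ^ 5)" using N by (intro ln_mono) (auto simp: power_Suc[symmetric] simp del: power_Suc)
  then show ?thesis using x by (simp add: ln_realpow L)
 qed
 have km: "real k = real (k - 1) + 1" using k(1) by simp
 have klnN: "real k * ln (real N) <= 9 * L" unfolding km distrib_right using lnk lnN2 by simp
 have kb: "real (k - 1) * (a0 * l) <= L / 16"
 proof -
  have "real (k - 1) * (64 * a0 * l) <= real (k - 1) * ln (real N)" using lnN by (intro mult_left_mono) auto
  then show ?thesis using lnk by simp
 qed
 have kL: "real k <= L"
 proof -
  have "real (k - 1) * (1 * 1) <= real (k - 1) * (a0 * l)" using a0 l by (intro mult_left_mono mult_mono) auto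
  then have "real (k - 1) <= L / 16" using kb unfolding mult_1_right by (rule order_trans)
  then show ?thesis using km L(2) by linarith
 qed
 define R where "R = exp (9 * L / 20)"
 have Rb: "real (reps A k n) <= R" for n
 proof -
  have "real (reps A k n) <= exp (ln (real k) * (real k * ln (real N)) / ln (L powr 20))"
   by (rule reps_rough_le[OF A(2) A(1) z k(1)]) (use N in auto)
  also have "ln (real k) * (real k * ln (real N)) / ln (L powr 20) <= l * (9 * L) / (20 * l)"
   unfolding lnz
  proof (rule divide_right_mono[OF mult_mono])
   show "ln (real k) <= l" unfolding l_def using k(1) kL by (intro ln_mono) auto
  qed (use klnN l N in auto)
  also have "l * (9 * L) / (20 * l) = 9 * L / 20" using l by simp
  finally show ?thesis by (simp add: R_def)
 qed
 have lam: "L powr a0 = exp (a0 * l)" using L by (simp add: powr_def l_def)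
 have cnd: "2 * R * (L powr a0) ^ (2 * k) <= x"
 proof -
  have "(L powr a0) ^ (2 * k) = exp (real (2 * k) * (a0 * l))" unfolding lam by (rule exp_of_nat_mult[symmetric])
  also have "real (2 * k) * (a0 * l) = 2 * (real (k - 1) * (a0 * l)) + 2 * (a0 * l)"
   unfolding of_nat_mult of_nat_numeral km by (simp only: distrib_left distrib_right mult_1_left mult_1_right mult.assoc)
  finally have e: "(L powr a0) ^ (2 * k) = exp (2 * (real (k - 1) * (a0 * l)) + 2 * (a0 * l))" .
  have "2 * R * (L powr a0) ^ (2 * k) <= exp 1 * R * (L powr a0) ^ (2 * k)"
   using exp_ge_add_one_self[of 1] by (intro mult_right_mono) (auto simp: R_def)
  also have "... = exp (1 + 9 * L / 20 + (2 * (real (k - 1) * (a0 * l)) + 2 * (a0 * l)))"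
   unfolding e R_def by (simp only: exp_add)
  also have "... <= exp L"
  proof -
   have "1 + 2 * (a0 * l) <= 2/5 * L" using cond unfolding l_def mult.assoc .
   then have "1 + 9 * L / 20 + (2 * (real (k - 1) * (a0 * l)) + 2 * (a0 * l)) <= L" using kb L(2) by linarith
   then show ?thesis by (simp only: exp_le_cancel_iff)
  qed
  also have "... = x" using x L by simp
  finally show ?thesis .
 qed
 have "(\<Sum>n\<in>A. norm (Tsum neg x (m * n))) <= 2 * (real N / L powr a0) * (x * (1 + ln x))"
  by (rule Tsum_block[OF _ A(1) _ k(1) _ Rb _ cnd]) (use x N k(2) L(2) in \<open>simp_all add: nx_def\<close>)
 then show ?thesis unfolding A_def N_def L(1)[symmetric] by simp
qed

lemma dyadic_position:
 fixes r :: nat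
 assumes "r > 2 ^ j0"
 obtains j where "j >= j0" "2 ^ j < r" "r <= 2 * 2 ^ j"
proof -
 have r1: "r > 1" using assms one_le_power[of "2::nat" j0] by linarith
 obtain k where k: "k >= 1" "r <= 2 ^ k" "2 ^ (k - 1) < r" using r1 least_power_exceeding[of r 2] by auto
 have "(2::nat) ^ j0 < 2 ^ k" using assms k(2) by linarith
 then have "j0 < k" by (simp add: power_strict_increasing_iff)
 moreover have "2 * 2 ^ (k - 1) = (2::nat) ^ k" using k(1) by (simp add: power_Suc[symmetric] del: power_Suc)
 ultimately show ?thesis using that[of "k - 1"] k by simp
qed

text \<open>Each n is s r with r in a dyadic block above 2^j. For fixed j the block estimate is
  applied with m = s, and the number of s times 2^j is at most N; at most 7L blocks occur, whence 28
  = 4 times 7. Several representations of one n do no harm, as all terms are nonnegative.\<close>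

lemma Tsum_rough_total:
 fixes a0 :: real
 assumes a0: "a0 >= 1" and L: "L = ln x" "L >= 2" "ln L >= 1" and cond: "1 + 2 * a0 * ln L <= 2/5 * L"
  and x: "x >= 3" and j0: "L powr (64 * a0) <= 2 ^ j0" and N: "real N <= x ^ 4"
 shows "(\<Sum>n | n \<in> {1..N} \<and> (\<exists>s r. n = s * r \<and> rough (L powr 20) r \<and> 2 ^ j0 < r). norm (Tsum neg x n))
   <= 28 * L * real N / L powr a0 * (x * (1 + L))"
proof -
 define g where "g = (%n. norm (Tsum neg x n))"
 define J where "J = {j. j0 <= j \<and> 2 ^ j <= N}"
 define B where "B = (%j. {r. rough (L powr 20) r \<and> 2 ^ j < r \<and> r <= 2 * 2 ^ j})"
 define T where "T = (SIGMA j:J. {1..N div 2 ^ j} \<times> B j)"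
 have Jsub: "J \<subseteq> {..N}"
 proof
  fix j assume "j \<in> J"
  then have "2 ^ j <= N" by (simp add: J_def)
  moreover have "j < (2::nat) ^ j" by (rule less_exp)
  ultimately show "j \<in> {..N}" unfolding atMost_iff by linarith
 qed
 have finB: "finite (B j)" for j unfolding B_def by (rule finite_subset[of _ "{..2 * 2 ^ j}"]) auto
 have finJ: "finite J" using Jsub finite_subset by blast
 have finT: "finite T" unfolding T_def using finJ finB by auto
 have x0: "x > 0" using x by simp
 have Lp: "L powr a0 > 0" using L by simp
 have "(\<Sum>n | n \<in> {1..N} \<and> (\<exists>s r. n = s * r \<and> rough (L powr 20) r \<and> 2 ^ j0 < r). g n) <= (\<Sum>n\<in>(%(j,s,r). s * r) ` T. g n)"
 proof (rule sum_mono2)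
  show "{n \<in> {1..N}. \<exists>s r. n = s * r \<and> rough (L powr 20) r \<and> 2 ^ j0 < r} \<subseteq> (%(j,s,r). s * r) ` T"
  proof
   fix n assume "n \<in> {n \<in> {1..N}. \<exists>s r. n = s * r \<and> rough (L powr 20) r \<and> 2 ^ j0 < r}"
   then obtain s r where sr: "1 <= s * r" "s * r <= N" "n = s * r" "rough (L powr 20) r" "2 ^ j0 < r" by auto
   obtain j where j: "j >= j0" "2 ^ j < r" "r <= 2 * 2 ^ j" using sr(5) by (rule dyadic_position)
   have s1: "s >= 1" using sr(1) by (cases s) auto
   have "s * 2 ^ j <= s * r" using j(2) by (intro mult_left_mono) auto
   then have sj: "s * 2 ^ j <= N" using sr(2) by linarith
   have "1 * 2 ^ j <= s * 2 ^ j" using s1 by (rule mult_le_mono1)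
   then have "2 ^ j <= N" using sj by linarith
   moreover have "s <= N div 2 ^ j" using sj by (simp add: less_eq_div_iff_mult_less_eq)
   ultimately have "(j,s,r) \<in> T" using j s1 sr by (simp add: T_def J_def B_def)
   then show "n \<in> (%(j,s,r). s * r) ` T" unfolding sr(3) by (intro image_eqI[of _ _ "(j,s,r)"]) auto
  qed
 qed (use finT in \<open>auto simp: g_def\<close>)
 also have "... <= sum (g \<circ> (%(j,s,r). s * r)) T" by (rule sum_image_le[OF finT]) (simp add: g_def)
 also have "... = (\<Sum>(j,w)\<in>T. case w of (s,r) => g (s * r))" by (rule sum.cong) auto
 also have "... = (\<Sum>j\<in>J. \<Sum>(s,r)\<in>{1..N div 2 ^ j} \<times> B j. g (s * r))"
  unfolding T_def by (rule sum.Sigma[symmetric]) (use finJ finB in auto)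
 also have "... = (\<Sum>j\<in>J. \<Sum>s=1..N div 2 ^ j. \<Sum>r\<in>B j. g (s * r))"
  by (simp add: sum.cartesian_product)
 also have "... <= (\<Sum>j\<in>J. 4 * real N / L powr a0 * (x * (1 + L)))"
 proof (rule sum_mono)
  fix j assume j: "j \<in> J"
  have c: "0 <= x * (1 + L)" using x0 L by simp
  have "(\<Sum>s=1..N div 2 ^ j. \<Sum>r\<in>B j. g (s * r)) <= (\<Sum>s=1..N div 2 ^ j. 4 * real (2 ^ j) / L powr a0 * (x * (1 + L)))"
  proof (rule sum_mono)
   fix s
   have "(2::real) ^ j0 <= 2 ^ j" using j by (intro power_increasing) (auto simp: J_def)
   then have "L powr (64 * a0) <= 2 ^ j" using j0 by linarith
   then have "L powr (64 * a0) <= real (2 ^ j)" by simp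
   moreover have "real (2 ^ j) <= real N" using j unfolding J_def by (intro of_nat_mono) simp
   then have "real (2 ^ j) <= x ^ 4" using N by linarith
   ultimately show "(\<Sum>r\<in>B j. g (s * r)) <= 4 * real (2 ^ j) / L powr a0 * (x * (1 + L))"
    unfolding B_def g_def by (rule Tsum_rough_block[OF a0 L cond x])
  qed
  also have "... = real (N div 2 ^ j) * real (2 ^ j) * (4 / L powr a0 * (x * (1 + L)))" by simp
  also have "... <= real N * (4 / L powr a0 * (x * (1 + L)))"
  proof (rule mult_right_mono)
   have "N div 2 ^ j * 2 ^ j <= N" by (rule div_times_less_eq_dividend)
   then show "real (N div 2 ^ j) * real (2 ^ j) <= real N" unfolding of_nat_mult[symmetric] by (rule of_nat_mono)
  qed (use Lp c in simp)
  finally show "(\<Sum>s=1..N div 2 ^ j. \<Sum>r\<in>B j. g (s * r)) <= 4 * real N / L powr a0 * (x * (1 + L))" by (simp add: mult_ac)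
 qed
 also have "... = real (card J) * (4 * real N / L powr a0 * (x * (1 + L)))" by simp
 also have "... <= (7 * L) * (4 * real N / L powr a0 * (x * (1 + L)))"
 proof (rule mult_right_mono)
  have "J \<subseteq> {..nat \<lfloor>6 * L\<rfloor>}"
  proof
   fix j assume "j \<in> J"
   then have "real (2 ^ j) <= real N" unfolding J_def by (intro of_nat_mono) simp
   then have "real (2 ^ j) <= x ^ 4" using N by linarith
   then have "(2::real) ^ j <= x ^ 4" by simp
   then have "ln ((2::real) ^ j) <= ln (x ^ 4)" by (intro ln_mono) auto
   then have "real j * ln 2 <= 4 * L" using x0 by (simp add: ln_realpow L)
   moreover have "real j * (2/3) <= real j * ln 2" using ln2_ge_two_thirds by (intro mult_left_mono) auto
   ultimately have "real j <= 6 * L" by simp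
   then show "j \<in> {..nat \<lfloor>6 * L\<rfloor>}" by (simp add: le_nat_floor)
  qed
  then have "card J <= card {..nat \<lfloor>6 * L\<rfloor>}" by (rule card_mono[rotated]) simp
  then have "real (card J) <= real (nat \<lfloor>6 * L\<rfloor>) + 1" by simp
  also have "real (nat \<lfloor>6 * L\<rfloor>) <= 6 * L" using L by (intro of_nat_floor) auto
  finally show "real (card J) <= 7 * L" using L(2) by simp
 qed (use Lp x0 L in simp)
 finally show ?thesis by (simp add: g_def)
qed

text \<open>Once N >= x^4 the sums over n are themselves long enough: k = 1 suffices, and every
  integer has at most one representation, so R = 1.\<close>

lemma Tsum_total_large:
 fixes a0 :: real
 assumes a0: "a0 >= 1" and L: "L = ln x" "L >= 2" "ln L >= 1" and cond: "1 + 2 * a0 * ln L <= 2/5 * L"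
  and x: "x >= 3" and N: "(nat \<lfloor>x\<rfloor>) ^ 4 <= N"
 shows "(\<Sum>n=1..N. norm (Tsum neg x n)) <= 28 * L * real N / L powr a0 * (x * (1 + L))"
proof -
 have "nat \<lfloor>x\<rfloor> >= 1" using x by (simp add: le_nat_iff)
 then have "1 ^ 4 <= (nat \<lfloor>x\<rfloor>) ^ 4" by (intro power_mono) auto
 then have N1: "N >= 1" using N by simp
 have lam: "(L powr a0) ^ (2 * 1) = exp (2 * (a0 * ln L))" using L by (simp add: powr_def power2_eq_square exp_add[symmetric])
 have "2 * 1 * (L powr a0) ^ (2 * 1) <= exp 1 * (L powr a0) ^ (2 * 1)"
  using exp_ge_add_one_self[of 1] by (intro mult_right_mono) auto
 also have "... = exp (1 + 2 * (a0 * ln L))" unfolding lam by (simp only: exp_add)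
 also have "... <= exp L" using cond L(2) by simp
 also have "... = x" using x L by simp
 finally have cnd: "2 * 1 * (L powr a0) ^ (2 * 1) <= x" .
 have R: "real (reps {1..N} 1 m) <= 1" for m
 proof -
  have "{xs \<in> tuples {1..N} 1. prod_list xs = m} \<subseteq> {[m]}" by (auto simp: tuples_def length_Suc_conv)
  then have "reps {1..N} 1 m <= card {[m]}" unfolding reps_def by (intro card_mono) auto
  then show ?thesis by simp
 qed
 have "(\<Sum>n=1..N. norm (Tsum neg x (1 * n))) <= 2 * (real N / L powr a0) * (x * (1 + ln x))"
  by (rule Tsum_block[OF _ subset_refl N1 _ _ R _ cnd]) (use x N L in auto)
 also have "... <= (28 * L) * (real N / L powr a0) * (x * (1 + ln x))"
  using L x by (intro mult_right_mono) auto
 finally show ?thesis using L(1) by simp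
qed

text \<open>t^(2/5) from Rankin's weight and sqrt t from the sum of 1/p give an exponent of order
  t^(9/10), which e^t beats together with any fixed power of t.\<close>

lemma rankin_decay:
 fixes c :: real
 assumes "c > 0"
 shows "eventually (%t::real. exp (c * ln t) * (1 + 50 * c * t) * exp (4 * (exp (2/5 * ln t) * (1 + 3 * sqrt (20 * t)))) <= exp t) at_top"
 using assms by real_asymp

lemma power_of_two_above:
 assumes v: "v > (1::real)"
 obtains j where "v <= 2 ^ j" "2 ^ j <= 2 * v"
proof -
 define B where "B = nat \<lceil>v\<rceil>"
 have B: "B > 1" unfolding B_def using v by linarith
 obtain k where k: "k >= 1" "B <= 2 ^ k" "2 ^ (k - 1) < B" using least_power_exceeding[OF B, of 2] by auto
 have "v <= real B" unfolding B_def by linarith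
 also have "... <= real (2 ^ k)" using k(2) by (rule of_nat_mono)
 finally have 1: "v <= 2 ^ k" by simp
 have "real (2 ^ (k - 1)) < v" using k(3) unfolding B_def by linarith
 moreover have "real (2 ^ k) = 2 * real (2 ^ (k - 1))" using k(1) by (cases k) auto
 ultimately have "2 ^ k <= 2 * v" by simp
 then show ?thesis using that[of k] 1 by blast
qed

abbreviation rankin_cond :: "real => real => bool" where
 "rankin_cond E t \<equiv> exp ((E + 1) / 50 * ln t) * (1 + (E + 1) * t) * exp (4 * (exp (2/5 * ln t) * (1 + 3 * sqrt (20 * t)))) <= exp t"

text \<open>For z = L^20 and l = ln L, Rankin's exponent \<theta> = ln l / (50 l) is chosen so that
  z^\<theta> = l^(2/5) keeps the Euler product below e^l. The lower bound on y then gives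
  y^(-\<theta>) <= L^(-(D+1)), and the one factor L beyond L^(-D) absorbs everything else by
  \<open>rankin_cond\<close>.\<close>

lemma exceptional_smooth:
 fixes D :: real
 assumes D: "D >= 10" and L: "L >= 30" "ln L >= 2" and E: "E > 0"
  and rank: "rankin_cond E (ln L)"
  and y: "y >= 1" "ln y >= 60 * (D + 1) / ln 2 * ((ln L)\<^sup>2 / ln (ln L))" and j0: "2 ^ j0 <= 2 * L powr E"
 shows "real (card {n\<in>{1..nat \<lfloor>y\<rfloor>}. \<exists>s r. n = s * r \<and> smooth_nat (L powr 20) s \<and> 1 <= r \<and> r <= 2 ^ j0}) <= y / L powr D"
proof -
 define l where "l = ln L"
 define \<theta> where "\<theta> = ln l / (50 * l)"
 define V where "V = (2::nat) ^ j0"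
 have l: "l >= 2" using L by (simp add: l_def)
 have ll: "ln l > 0" "ln l <= l" using l ln_le_minus_one[of l] by auto
 have \<theta>: "0 <= \<theta>" "\<theta> <= 1/2" using l ll by (auto simp: \<theta>_def divide_le_eq)
 have \<theta>l: "\<theta> * l = ln l / 50" using l by (simp add: \<theta>_def)
 have z: "ln (L powr 20) = 20 * l" unfolding l_def by (rule ln_powr)
 have V1: "V >= 1" "real V >= 1" by (auto simp: V_def)
 have lnV: "ln (real V) <= (E + 1) * l"
 proof -
  have "2 * L powr E <= L * L powr E" using L by (intro mult_right_mono) auto
  then have "real V <= L * L powr E" using j0 by (simp add: V_def)
  also have "... = L powr (E + 1)" using L by (simp add: powr_add)
  finally have "ln (real V) <= ln (L powr (E + 1))" using V1 by (intro ln_mono) auto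
  also have "... = (E + 1) * l" unfolding l_def by (rule ln_powr)
  finally show ?thesis .
 qed
 have lnV0: "0 <= ln (real V)" using V1 by simp
 have Vth: "real V powr \<theta> <= exp ((E + 1) / 50 * ln l)"
 proof -
  have "\<theta> * ln (real V) <= \<theta> * ((E + 1) * l)" using lnV \<theta> by (intro mult_left_mono) auto
  also have "... = (E + 1) * (\<theta> * l)" by simp
  also have "... = (E + 1) / 50 * ln l" unfolding \<theta>l by simp
  finally show ?thesis using V1 by (simp add: powr_def)
 qed
 have zth: "(L powr 20) powr \<theta> = exp (2/5 * ln l)"
 proof -
  have "(L powr 20) powr \<theta> = exp (\<theta> * ln (L powr 20))" using L by (simp add: powr_def)
  also have "\<theta> * ln (L powr 20) = 20 * (\<theta> * l)" unfolding z by simp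
  finally show ?thesis unfolding \<theta>l by simp
 qed
 define H where "H = exp (4 * (exp (2/5 * ln l) * (1 + 3 * sqrt (20 * l))))"
 have "real (card {n\<in>{1..nat \<lfloor>y\<rfloor>}. \<exists>s r. n = s * r \<and> smooth_nat (L powr 20) s \<and> 1 <= r \<and> r <= V})
   <= real (nat \<lfloor>y\<rfloor>) powr (1 - \<theta>) * (real V powr \<theta> * (1 + ln (real V))) * exp (4 * ((L powr 20) powr \<theta> * (1 + 3 * sqrt (ln (L powr 20)))))"
  by (rule smooth_part_count[OF _ _ \<theta> V1(1)]) (use L l in \<open>simp_all add: z del: powr_numeral\<close>)
 also have "... = real (nat \<lfloor>y\<rfloor>) powr (1 - \<theta>) * (real V powr \<theta> * (1 + ln (real V))) * H" unfolding zth z H_def ..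
 also have "... <= (y * exp (- ((D + 1) * l))) * (exp ((E + 1) / 50 * ln l) * (1 + (E + 1) * l)) * H"
 proof (rule mult_right_mono[OF mult_mono[OF _ mult_mono[OF Vth]]])
  show "1 + ln (real V) <= 1 + (E + 1) * l" using lnV by simp
  have "real (nat \<lfloor>y\<rfloor>) powr (1 - \<theta>) <= y powr (1 - \<theta>)" using y \<theta> by (intro powr_mono2 of_nat_floor) auto
  also have "... = exp (ln y + - (\<theta> * ln y))" using y by (simp add: powr_def left_diff_distrib)
  also have "... = y * exp (- (\<theta> * ln y))" unfolding exp_add using y by simp
  also have "... <= y * exp (- ((D + 1) * l))"
  proof -
   have "(D + 1) * l <= (60 / 50 / ln 2) * ((D + 1) * l)"
   proof -
    \<comment> \<open>The 60 and the ln 2 < 1 in the hypothesis on y outweigh the 50 in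
      \<theta>.\<close>
    have "1 <= 60 / 50 / ln (2::real)" using ln_2_less_1 by (simp add: le_divide_eq)
    then have "1 * ((D + 1) * l) <= (60 / 50 / ln 2) * ((D + 1) * l)" using D l by (intro mult_right_mono) auto
    then show ?thesis by simp
   qed
   also have "... = \<theta> * (60 * (D + 1) / ln 2 * (l\<^sup>2 / ln l))" using l ll by (simp add: \<theta>_def power2_eq_square field_simps)
   also have "... <= \<theta> * ln y" using y(2) \<theta> by (intro mult_left_mono) (auto simp: l_def)
   finally show ?thesis using y(1) by simp
  qed
  finally show "real (nat \<lfloor>y\<rfloor>) powr (1 - \<theta>) <= y * exp (- ((D + 1) * l))" .
 qed (use y lnV0 V1 l E in \<open>auto simp: H_def\<close>)
 also have "... = y * exp (- ((D + 1) * l)) * (exp ((E + 1) / 50 * ln l) * (1 + (E + 1) * l) * H)" by (simp only: mult.assoc)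
 also have "... <= y * exp (- ((D + 1) * l)) * exp l"
  using rank y(1) unfolding l_def[symmetric] H_def by (intro mult_left_mono) auto
 also have "... = y * exp (- (D * l))" by (simp add: mult.assoc exp_add[symmetric] distrib_right)
 also have "... = y / L powr D" using L by (simp add: powr_def l_def exp_minus divide_inverse)
 finally show ?thesis by (simp add: V_def)
qed

text \<open>Markov's inequality on a set G where a mean value bound is available: all n if y >= x^4,
  otherwise those divisible by a rough r > 2^j0, the rest being counted by
  \<open>exceptional_smooth\<close>. The threshold v and the target y / L^D each cost L^D, which
  explains 2D in a0. The extra L^5 beats the factor L (1 + L) in the mean value and the prime
  density 1/L in v, with two powers of L left for the constants.\<close>

lemma exceptional_count:
 fixes D a0 E :: real
 assumes D: "D >= 10" and a0: "a0 = 2 * D + 5" and E: "E = 64 * a0"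
  and L: "L = ln x" "L >= 30" "ln L >= 2" and cond: "1 + 2 * a0 * ln L <= 2/5 * L"
  and rank: "rankin_cond E (ln L)"
  and x: "x >= 3" and y: "y >= 1" "ln y >= 60 * (D + 1) / ln 2 * ((ln L)\<^sup>2 / ln (ln L))"
  and pil: "real (prime_pi x) >= x / (4 * L)"
 shows "real (card {n\<in>{1..nat \<lfloor>y\<rfloor>}. real (prime_pi x) / (2 * L powr D) < real (card {p\<in>(primes_le x). p dvd n}) + norm (Tsum neg x n)})
   <= 2 * y / L powr D"
proof -
 define N where "N = nat \<lfloor>y\<rfloor>"
 have Ny: "real N <= y" unfolding N_def using y by (intro of_nat_floor) auto
 define v where "v = real (prime_pi x) / (2 * L powr D)"
 define P where "P = (primes_le x)"
 have fP: "finite P" unfolding P_def by (rule finite_primes_le)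
 define h where "h = (%n. real (card {p\<in>P. p dvd n}) + norm (Tsum neg x n))"
 have a1: "a0 >= 1" using D a0 by simp
 have LL: "L = ln x" "L >= 2" "ln L >= 1" using L by auto
 define X where "X = 28 * L * real N / L powr a0 * (x * (1 + L))"
 have u1: "L powr D >= 1" using L D by (intro ge_one_powr_ge_zero) auto
 obtain G where G: "G \<subseteq> {1..N}" "(\<Sum>n\<in>G. norm (Tsum neg x n)) <= X" "real (card ({1..N} - G)) <= y / L powr D"
 proof (cases "y >= x ^ 4")
  case True
  have "real ((nat \<lfloor>x\<rfloor>) ^ 4) <= y"
  proof -
   have "real (nat \<lfloor>x\<rfloor>) <= x" using x by (intro of_nat_floor) auto
   then have "real (nat \<lfloor>x\<rfloor>) ^ 4 <= x ^ 4" by (intro power_mono) auto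
   then show ?thesis using True by simp
  qed
  then have "(nat \<lfloor>x\<rfloor>) ^ 4 <= N" unfolding N_def by (rule le_nat_floor)
  then have "(\<Sum>n=1..N. norm (Tsum neg x n)) <= X" unfolding X_def by (rule Tsum_total_large[OF a1 LL cond x])
  then show ?thesis using that[of "{1..N}"] y u1 by simp
 next
  case False
  have "L powr (64 * a0) > 1" using L a1 by (intro gr_one_powr) auto
  then obtain j0 where j0: "L powr (64 * a0) <= 2 ^ j0" "2 ^ j0 <= 2 * L powr (64 * a0)" by (rule power_of_two_above)
  define G where "G = {n. n \<in> {1..N} \<and> (\<exists>s r. n = s * r \<and> rough (L powr 20) r \<and> 2 ^ j0 < r)}"
  have "real N <= x ^ 4" using Ny False by simp
  then have 1: "(\<Sum>n\<in>G. norm (Tsum neg x n)) <= X" unfolding X_def G_def by (rule Tsum_rough_total[OF a1 LL cond x j0(1)])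
  have "{1..N} - G \<subseteq> {n\<in>{1..N}. \<exists>s r. n = s * r \<and> smooth_nat (L powr 20) s \<and> 1 <= r \<and> r <= 2 ^ j0}"
  proof
   fix n assume n: "n \<in> {1..N} - G"
   then obtain s r where sr: "n = s * r" "smooth_nat (L powr 20) s" "rough (L powr 20) r"
    using smooth_rough_split[of n "L powr 20"] by auto
   then have "r <= 2 ^ j0" using n unfolding G_def by (metis (mono_tags, lifting) DiffE mem_Collect_eq not_le)
   moreover have "1 <= r" using sr(3) by (simp add: rough_def)
   ultimately show "n \<in> {n\<in>{1..N}. \<exists>s r. n = s * r \<and> smooth_nat (L powr 20) s \<and> 1 <= r \<and> r <= 2 ^ j0}"
    using n sr by blast
  qed
  then have "card ({1..N} - G) <= card {n\<in>{1..N}. \<exists>s r. n = s * r \<and> smooth_nat (L powr 20) s \<and> 1 <= r \<and> r <= 2 ^ j0}"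
   by (rule card_mono[rotated]) simp
  then have "real (card ({1..N} - G)) <= real (card {n\<in>{1..N}. \<exists>s r. n = s * r \<and> smooth_nat (L powr 20) s \<and> 1 <= r \<and> r <= 2 ^ j0})"
   by (rule of_nat_mono)
  also have "... <= y / L powr D" unfolding N_def
   by (rule exceptional_smooth[OF D L(2,3) _ rank y]) (use j0(2) E a1 in auto)
  finally have 2: "real (card ({1..N} - G)) <= y / L powr D" .
  show ?thesis by (rule that[OF _ 1 2]) (auto simp: G_def)
 qed
 have finG: "finite G" using G(1) finite_subset by blast
 have h0: "0 <= h n" for n by (simp add: h_def)
 have x0: "x > 0" using x by simp
 have cs: "(\<Sum>n\<in>G. real (card {p\<in>P. p dvd n})) <= real N * (1 + L)"
 proof -
  have "(\<Sum>n\<in>G. real (card {p\<in>P. p dvd n})) <= (\<Sum>n=1..N. real (card {p\<in>P. p dvd n}))" by (rule sum_mono2) (use G(1) in auto)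
  also have "... <= real N * (\<Sum>p\<in>P. 1 / real p)" by (rule sum_card_dvd_le[OF fP]) (auto simp: P_def prime_gt_0_nat)
  also have "(\<Sum>p\<in>P. 1 / real p) <= (\<Sum>n=1..nat \<lfloor>x\<rfloor>. 1 / real n)"
   by (rule sum_mono2) (auto simp: P_def Suc_le_eq prime_gt_0_nat intro: le_nat_floor)
  also have "... <= 1 + ln (real (nat \<lfloor>x\<rfloor>))" using x by (intro harmonic_le) (simp add: le_nat_iff)
  also have "... <= 1 + L" unfolding L(1) using x by (intro add_left_mono ln_mono of_nat_floor) (auto simp: le_floor_iff)
  finally show ?thesis by (simp add: mult_left_mono)
 qed
 have hs: "(\<Sum>n\<in>G. h n) <= real N * (1 + L) + X" unfolding h_def sum.distrib using cs G(2) by linarith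
 have num: "real N * (1 + L) + X <= v * (y / L powr D)"
 proof -
  define u where "u = L powr D"
  have u: "u >= 1" using u1 by (simp add: u_def)
  have La: "L powr a0 = u * u * L ^ 5"
  proof -
   have "L powr a0 = L powr (D + D + 5)" by (simp add: a0)
   also have "... = u * u * L powr 5" by (simp only: u_def powr_add)
   also have "L powr 5 = L ^ 5" using L by simp
   finally show ?thesis .
  qed
  \<comment> \<open>\<open>cond\<close> in multiplicative form. It puts the mean number of primes
    dividing n, at most 1 + L, below half of v / L^D.\<close>
  have sq: "2 * (L powr a0)\<^sup>2 <= x"
  proof -
   have e: "(L powr a0)\<^sup>2 = exp (2 * (a0 * ln L))" using L by (simp add: powr_def power2_eq_square exp_add[symmetric])
   have "2 * (L powr a0)\<^sup>2 <= exp 1 * (L powr a0)\<^sup>2"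
    using exp_ge_add_one_self[of 1] by (intro mult_right_mono) auto
   also have "... = exp (1 + 2 * (a0 * ln L))" unfolding e by (simp only: exp_add)
   also have "... <= exp L" using cond L(2) by simp
   also have "... = x" using x L by simp
   finally show ?thesis .
  qed
  have L2: "L ^ 2 >= 30 ^ 2" using L by (intro power_mono) auto
  have L5: "L ^ 5 = L ^ 2 * L ^ 3" by (simp add: power_add[symmetric])
  have t1: "2 * L <= x / (16 * L * (u * u))"
  proof -
   have "2 * L * (16 * L * (u * u)) = (u * u) * (32 * L ^ 2)" by (simp add: power2_eq_square)
   also have "... <= (u * u) * (2 * ((u * u) * (L ^ 5 * L ^ 5)))"
   proof (rule mult_left_mono)
    have f1: "1 <= u * u" using mult_mono[of 1 u 1 u] u by simp
    have f2: "16 * L ^ 2 <= L ^ 5 * L ^ 5"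
    proof -
     have "L ^ 3 >= 1" "L ^ 5 >= 1" using L by (auto intro: one_le_power)
     have "16 * L ^ 2 <= L ^ 2 * L ^ 2" using L2 by (intro mult_right_mono) auto
     also have "... <= L ^ 5 * L ^ 5" using L by (intro mult_mono power_increasing) auto
     finally show ?thesis .
    qed
    have "1 * (16 * L ^ 2) <= (u * u) * (L ^ 5 * L ^ 5)" by (rule mult_mono[OF f1 f2]) auto
    then show "32 * L ^ 2 <= 2 * ((u * u) * (L ^ 5 * L ^ 5))" by simp
   qed simp
   also have "... = 2 * (L powr a0)\<^sup>2" unfolding La by (simp add: power2_eq_square mult_ac)
   also have "... <= x" by (rule sq)
   finally show ?thesis using u L by (subst pos_le_divide_eq) auto
  qed
  have t2: "28 * L / L powr a0 * (x * (2 * L)) <= x / (16 * L * (u * u))"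
  proof -
   have "28 * L / L powr a0 * (x * (2 * L)) = x * (56 * L ^ 2 / (L ^ 2 * L ^ 3)) / (u * u)"
    unfolding La L5 by (simp add: power2_eq_square mult_ac)
   also have "56 * L ^ 2 / (L ^ 2 * L ^ 3) = 56 / (L ^ 2 * L)" using L by (simp add: power2_eq_square power3_eq_cube)
   also have "... <= 56 / (900 * L)" using L2 L by (intro divide_left_mono mult_right_mono mult_pos_pos) auto
   also have "... <= 1 / (16 * L)" using L by (simp add: field_simps)
   finally show ?thesis using x0 u by (simp add: divide_right_mono mult_left_mono mult_ac)
  qed
  have "real N * (1 + L) + X <= real N * (2 * L) + 28 * L * real N / L powr a0 * (x * (2 * L))"
   unfolding X_def using L(2) x0 by (intro add_mono mult_left_mono) auto
  also have "... = real N * (2 * L + 28 * L / L powr a0 * (x * (2 * L)))" by (simp add: algebra_simps)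
  also have "... <= y * (x / (16 * L * (u * u)) + x / (16 * L * (u * u)))"
   using Ny t1 t2 L(2) x0 by (intro mult_mono add_mono) auto
  also have "... = (x / (4 * L)) / (2 * u) * (y / u)" using L u by (simp add: field_simps)
  also have "... <= v * (y / u)" unfolding v_def u_def using pil y L by (intro mult_right_mono divide_right_mono) auto
  finally show ?thesis by (simp add: u_def)
 qed
 have v0: "v > 0"
 proof -
  have "x / (4 * L) > 0" using x L by simp
  then have "real (prime_pi x) > 0" using pil by linarith
  moreover have "2 * L powr D > 0" using u1 by linarith
  ultimately show ?thesis unfolding v_def by (rule divide_pos_pos)
 qed
 have "real (card {n\<in>G. v < h n}) * v = (\<Sum>n\<in>{n\<in>G. v < h n}. v)" by simp
 also have "... <= (\<Sum>n\<in>{n\<in>G. v < h n}. h n)" by (rule sum_mono) auto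
 also have "... <= (\<Sum>n\<in>G. h n)" by (rule sum_mono2) (use finG h0 in auto)
 also have "... <= v * (y / L powr D)" using hs num by linarith
 finally have "v * real (card {n\<in>G. v < h n}) <= v * (y / L powr D)" by (simp only: mult.commute)
 then have c: "real (card {n\<in>G. v < h n}) <= y / L powr D" by (rule mult_left_le_imp_le[OF _ v0])
 have "{n\<in>{1..N}. v < h n} \<subseteq> ({1..N} - G) \<union> {n\<in>G. v < h n}" by auto
 then have "card {n\<in>{1..N}. v < h n} <= card (({1..N} - G) \<union> {n\<in>G. v < h n})" using finG by (intro card_mono) auto
 also have "... <= card ({1..N} - G) + card {n\<in>G. v < h n}" by (rule card_Un_le)
 finally have "real (card {n\<in>{1..N}. v < h n}) <= real (card ({1..N} - G)) + real (card {n\<in>G. v < h n})" by linarith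
 then have "real (card {n\<in>{1..N}. v < h n}) <= 2 * y / L powr D" using c G(3) by simp
 then show ?thesis unfolding v_def h_def P_def N_def .
qed

theorem theorem1p1:
  fixes D :: real
  assumes "D \<ge> 10"
  shows "\<exists>C>0. \<forall>x y :: real. x \<ge> 100 \<longrightarrow> y \<ge> 100 \<longrightarrow>
           y \<ge> exp (60 * (D + 1) / ln 2 * ((ln (ln x))\<^sup>2 / ln (ln (ln x)))) \<longrightarrow>
           real (card {a::int. \<bar>real_of_int a\<bar> \<le> y \<and>
                 \<bar>real (N_artin a x) - artin_const * real (prime_pi x)\<bar> > real (prime_pi x) / (ln x) powr D})
             \<le> C * y / (ln x) powr D"
proof -
 define a0 where "a0 = 2 * D + 5"
 define E where "E = 64 * a0"
 \<comment> \<open>One additional power of L pays for the density of the primes, the other beats the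
   constant C0.\<close>
 have B: "D + 2 >= 1" using assms by simp
 obtain C0 where C0: "C0 > 0" "\<And>x. x >= 3 ==> \<bar>totient_sum x - artin_const * real (prime_pi x)\<bar>
   <= C0 * x / ln x powr (D + 2)"
  using main_term[OF B] by blast
 obtain x1 where x1: "\<And>x. x >= x1 ==> real (prime_pi x) >= x / (4 * ln x)" using prime_pi_lower by blast
 have Epos: "(E + 1) / 50 > 0" using assms by (simp add: E_def a0_def)
 have evL: "eventually (%L::real. L >= 30 \<and> ln L >= 2 \<and> 1 + 2 * a0 * ln L <= 2/5 * L \<and> 8 * C0 <= L \<and>
   rankin_cond E (ln L)) at_top"
 proof (intro eventually_conj)
  show "eventually (%L::real. 30 <= L) at_top" "eventually (%L::real. 8 * C0 <= L) at_top" by (rule eventually_ge_at_top)+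
  show "eventually (%L::real. 2 <= ln L) at_top" by real_asymp
  have "a0 > 0" using assms by (simp add: a0_def)
  then show "eventually (%L::real. 1 + 2 * a0 * ln L <= 2/5 * L) at_top" by real_asymp
  show "eventually (%L::real. rankin_cond E (ln L)) at_top"
  proof -
   have "50 * ((E + 1) / 50) = E + 1" by simp
   then show ?thesis using eventually_compose_filterlim[OF rankin_decay[OF Epos] ln_at_top] by (simp only:)
  qed
 qed
 have "eventually (%x::real. ln x >= 30 \<and> ln (ln x) >= 2 \<and> 1 + 2 * a0 * ln (ln x) <= 2/5 * ln x \<and> 8 * C0 <= ln x \<and>
   rankin_cond E (ln (ln x))) at_top"
  using eventually_compose_filterlim[OF evL ln_at_top] .
 then obtain x2 where x2: "\<And>x. x >= x2 ==> ln x >= 30 \<and> ln (ln x) >= 2 \<and> 1 + 2 * a0 * ln (ln x) <= 2/5 * ln x \<and> 8 * C0 <= ln x \<and>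
   rankin_cond E (ln (ln x))"
  unfolding eventually_at_top_linorder by blast
 define x0 where "x0 = max 100 (max x1 x2)"
 \<comment> \<open>The summand 5 is 2 + 2 for the two signs of a and 1 for a = 0. The other summand
   covers x < x0, where all of at most 3y integers in [-y, y] are counted.\<close>
 define C where "C = 5 + 3 * ln x0 powr D"
 have Cpos: "C > 0" unfolding C_def by (intro add_pos_nonneg) auto
 have main: "real (card {a::int. \<bar>real_of_int a\<bar> <= y \<and>
         \<bar>real (N_artin a x) - artin_const * real (prime_pi x)\<bar> > real (prime_pi x) / (ln x) powr D})
       <= C * y / (ln x) powr D" (is "real (card ?Bad) <= _")
  if x: "x >= 100" and y: "y >= 100" and yx: "y >= exp (60 * (D + 1) / ln 2 * ((ln (ln x))\<^sup>2 / ln (ln (ln x))))" for x y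
 proof (cases "x >= x0")
  case False
  define L where "L = ln x"
  have L0: "L > 0" "L <= ln x0" using x False by (auto simp: L_def x0_def)
  have Lx: "L powr D <= ln x0 powr D" using L0 assms by (intro powr_mono2) auto
  have "?Bad \<subseteq> {-\<lfloor>y\<rfloor>..\<lfloor>y\<rfloor>}" by (auto simp: le_floor_iff abs_le_iff) linarith
  then have "card ?Bad <= card {-\<lfloor>y\<rfloor>..\<lfloor>y\<rfloor>}" by (intro card_mono) auto
  then have "real (card ?Bad) <= real (nat (2 * \<lfloor>y\<rfloor> + 1))" by simp
  also have "... <= 3 * y" using y by linarith
  also have "... <= 3 * y * (ln x0 powr D / L powr D)"
   using Lx L0 y mult_left_mono[of 1 "ln x0 powr D / L powr D" "3 * y"] by simp
  also have "... = (3 * ln x0 powr D) * y / L powr D" by simp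
  also have "... <= C * y / L powr D" unfolding C_def using y by (intro divide_right_mono mult_right_mono) auto
  finally show ?thesis by (simp add: L_def)
 next
  case True
  define L where "L = ln x"
  define pp where "pp = real (prime_pi x)"
  have xx: "x >= x1" "x >= x2" "x >= 3" using True x by (auto simp: x0_def)
  have L: "L >= 30" "ln L >= 2" "1 + 2 * a0 * ln L <= 2/5 * L" "8 * C0 <= L"
   and rank: "rankin_cond E (ln L)"
   using x2[OF xx(2)] unfolding L_def by blast+
  have lny: "ln y >= 60 * (D + 1) / ln 2 * ((ln L)\<^sup>2 / ln (ln L))"
   using yx y unfolding L_def by (subst ln_ge_iff) auto
  have pil: "real (prime_pi x) >= x / (4 * L)" using x1[OF xx(1)] by (simp add: L_def)
  define bad where "bad = (%neg. {n\<in>{1..nat \<lfloor>y\<rfloor>}. pp / (2 * L powr D) < real (card {p\<in>(primes_le x). p dvd n}) + norm (Tsum neg x n)})"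
  have cb: "real (card (bad neg)) <= 2 * y / L powr D" for neg
   unfolding bad_def pp_def
   by (rule exceptional_count[OF assms a0_def E_def L_def L(1,2,3) rank xx(3) _ lny pil]) (use y in simp)
  have u0: "L powr D > 0" using L by simp
  have me: "\<bar>totient_sum x - artin_const * pp\<bar> <= pp / (2 * L powr D)"
  proof -
   have "\<bar>totient_sum x - artin_const * pp\<bar> <= C0 * x / L powr (D + 2)"
    using C0(2)[OF xx(3)] by (simp add: L_def pp_def)
   also have "... = C0 / L * (x / L) / L powr D" using L by (simp add: powr_add power2_eq_square)
   also have "... <= 1 / 8 * (x / L) / L powr D"
    using L xx u0 by (intro divide_right_mono mult_right_mono) (auto simp: divide_le_eq)
   also have "... = x / (4 * L) / (2 * L powr D)" by simp
   also have "... <= pp / (2 * L powr D)" unfolding pp_def using pil u0 by (intro divide_right_mono) auto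
   finally show ?thesis .
  qed
  have sub: "?Bad \<subseteq> {0} \<union> (signed False ` bad False \<union> signed True ` bad True)"
  proof
   fix a assume "a \<in> ?Bad"
   then have a: "\<bar>real_of_int a\<bar> <= y" "\<bar>real (N_artin a x) - artin_const * pp\<bar> > pp / L powr D" by (auto simp: pp_def L_def)
   show "a \<in> {0} \<union> (signed False ` bad False \<union> signed True ` bad True)"
   proof (cases "a = 0")
    case False
    define n where "n = nat \<bar>a\<bar>"
    define neg where "neg = (a < 0)"
    have an: "a = signed neg n" by (auto simp: signed_def neg_def n_def)
    have "real n = \<bar>real_of_int a\<bar>" by (simp add: n_def)
    then have n: "n \<in> {1..nat \<lfloor>y\<rfloor>}" using a(1) False by (auto simp: n_def intro: le_nat_floor)
    have "pp / L powr D < \<bar>totient_sum x - artin_const * pp\<bar>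
     + (real (card {p\<in>(primes_le x). p dvd n}) + norm (Tsum neg x n))"
     using N_artin_diff[of neg n x] a(2) unfolding an pp_def by linarith
    moreover have "pp / L powr D = pp / (2 * L powr D) + pp / (2 * L powr D)" by simp
    ultimately have "pp / (2 * L powr D) < real (card {p\<in>(primes_le x). p dvd n}) + norm (Tsum neg x n)"
     using me by linarith
    then have "n \<in> bad neg" using n by (simp add: bad_def)
    then show ?thesis unfolding an by (cases neg) auto
   qed simp
  qed
  have finb: "finite (bad neg)" for neg by (simp add: bad_def)
  have "card ?Bad <= card ({0} \<union> (signed False ` bad False \<union> signed True ` bad True))" using finb by (intro card_mono sub) auto
  also have "... <= card {0::int} + card (signed False ` bad False \<union> signed True ` bad True)" by (rule card_Un_le)
  also have "... <= card {0::int} + (card (signed False ` bad False) + card (signed True ` bad True))" by (intro add_left_mono card_Un_le)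
  also have "... <= 1 + (card (bad False) + card (bad True))" using finb by (intro add_mono card_image_le) auto
  finally have "real (card ?Bad) <= real (1 + (card (bad False) + card (bad True)))" by (rule of_nat_mono)
  also have "... <= 1 + (2 * y / L powr D + 2 * y / L powr D)" using cb[of False] cb[of True] by simp
  \<comment> \<open>The single integer a = 0 is charged to y / L^D; that L^D <= y follows from the
    lower bound on y, since ln l <= l.\<close>
  also have "1 <= y / L powr D"
  proof -
   define l where "l = ln L"
   have l: "l >= 2" using L by (simp add: l_def)
   have ll: "ln l > 0" "ln l <= l" using l ln_le_minus_one[of l] by auto
   have "D * l <= 60 * (D + 1) / ln 2 * l"
   proof (rule mult_right_mono)
    have "D <= 1 * (D + 1) * 1" by simp
    also have "... <= 60 * (D + 1) * 1" using assms by (intro mult_right_mono) auto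
    also have "... <= 60 * (D + 1) / ln 2" using ln_2_less_1 assms by (simp add: le_divide_eq)
    finally show "D <= 60 * (D + 1) / ln 2" .
   qed (use l in simp)
   also have "... <= 60 * (D + 1) / ln 2 * (l\<^sup>2 / ln l)"
   proof (rule mult_left_mono)
    have "l * ln l <= l * l" using ll l by (intro mult_left_mono) auto
    then show "l <= l\<^sup>2 / ln l" using ll by (simp add: le_divide_eq power2_eq_square)
   qed (use assms in simp)
   also have "... <= ln y" using lny by (simp add: l_def)
   finally have "exp (D * l) <= exp (ln y)" by simp
   then have "L powr D <= y" using L y by (simp add: powr_def l_def)
   then show ?thesis using u0 by simp
  qed
  also have "y / L powr D + (2 * y / L powr D + 2 * y / L powr D) = 5 * y / L powr D" by simp
  also have "... <= C * y / L powr D" unfolding C_def using y u0 by (intro divide_right_mono mult_right_mono) auto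
  finally show ?thesis by (simp add: L_def)
 qed
 show ?thesis using Cpos main by (intro exI[of _ C]) blast
qed

end
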